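(* Let $d=2$. Assume $W=\frac12w^2$ where $w\in\mathcal{C}^2(\mathbb{R}^2,\mathbb{R})$ solves either $\Delta w=\partial_{11}w+\partial_{22}w=0$ in $\mathbb{R}^2$, or $\partial_{11}w-\partial_{22}w=0$ in $\mathbb{R}^2$. Let $u^\pm=(a,u_2^\pm)\in\mathbb{R}^2$ satisfy $W(u^\pm)=0$ and suppose $w>0$ on the open segment $(u^-,u^+)$. Let $u$ be a global minimizer of problem $(\mathcal P)$ and assume that either $u\in L^\infty$ or there exist $C,\beta>0$ with $W(z)\le Ce^{\beta|z|^2}$ for all $z\in\mathbb{R}^2$. Then $u$ is one-dimensional: $u(x)=g(x_1)$, where $g$ is the minimizer (unique up to translation) of $$\inf\Big\{\int_\mathbb{R}\tfrac12|\dot\gamma|^2+W(\gamma)\,dt:\ \gamma\in\dot H^1(\mathbb{R},\mathbb{R}^2_a),\ \gamma(\pm\infty)=u^\pm\Big\}.$$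
   Context: $\mathbb{T}=\mathbb{R}/\mathbb{Z}$, $\Omega=\mathbb{R}\times\mathbb{T}$, $x=(x_1,x_2)$. $\dot H^1_{div}(\Omega,\mathbb{R}^2)=\{u\in H^1_{loc}(\Omega,\mathbb{R}^2):\nabla u\in L^2,\ \nabla\cdot u=0\}$, $E(u)=\int_\Omega\frac12|\nabla u|^2+W(u)\,dx$, $\overline{u}(x_1)=\int_{\mathbb{T}}u(x_1,x_2)dx_2$. Problem $(\mathcal P)$: minimize $E(u)$ over $u\in\dot H^1_{div}(\Omega,\mathbb{R}^2)$ with $\lim_{x_1\to\pm\infty}\overline{u}(x_1)=u^\pm$; a global minimizer is an admissible $u$ attaining this infimum. $\mathbb{R}^2_a=\{z\in\mathbb{R}^2:z_1=a\}$, and $\dot H^1(\mathbb{R},\mathbb{R}^2_a)$ denotes locally $H^1$ curves with values in $\mathbb{R}^2_a$ and square-integrable derivative. *)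

theory Defs
  imports "HOL-Analysis.Analysis"
begin

text \<open>Points of the plane (and of the cylinder, via 1-periodicity in the second
coordinate) are modelled as pairs of reals; the Euclidean norm on real \<times> real is
the norm of the library.\<close>

definition test_fun :: "(real \<times> real \<Rightarrow> real) \<Rightarrow> (real \<times> real \<Rightarrow> real) \<Rightarrow> (real \<times> real \<Rightarrow> real) \<Rightarrow> bool" where
  "test_fun \<phi> \<phi>1 \<phi>2 \<longleftrightarrow>
     continuous_on UNIV \<phi>1 \<and> continuous_on UNIV \<phi>2 \<and>
     (\<forall>x. (\<phi> has_derivative (\<lambda>h. fst h * \<phi>1 x + snd h * \<phi>2 x)) (at x)) \<and>
     compact (closure {x. \<phi> x \<noteq> 0})"

definition C2_partials :: "(real \<times> real \<Rightarrow> real) \<Rightarrow> (real \<times> real \<Rightarrow> real) \<Rightarrow> (real \<times> real \<Rightarrow> real)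
   \<Rightarrow> (real \<times> real \<Rightarrow> real) \<Rightarrow> (real \<times> real \<Rightarrow> real) \<Rightarrow> (real \<times> real \<Rightarrow> real) \<Rightarrow> (real \<times> real \<Rightarrow> real) \<Rightarrow> bool" where
  "C2_partials w w1 w2 w11 w12 w21 w22 \<longleftrightarrow>
     (\<forall>x. (w has_derivative (\<lambda>h. fst h * w1 x + snd h * w2 x)) (at x)) \<and>
     (\<forall>x. (w1 has_derivative (\<lambda>h. fst h * w11 x + snd h * w12 x)) (at x)) \<and>
     (\<forall>x. (w2 has_derivative (\<lambda>h. fst h * w21 x + snd h * w22 x)) (at x)) \<and>
     continuous_on UNIV w11 \<and> continuous_on UNIV w12 \<and>
     continuous_on UNIV w21 \<and> continuous_on UNIV w22"

text \<open>The cylinder Omega = R \<times> T, represented by the fundamental domain R \<times> [0,1].\<close>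
definition strip :: "(real \<times> real) set" where
  "strip = UNIV \<times> {0..1}"

text \<open>u lies in L^2_loc(R^2) (u periodic, so this is L^2_loc(Omega)).\<close>
definition L2_loc :: "(real \<times> real \<Rightarrow> real \<times> real) \<Rightarrow> bool" where
  "L2_loc u \<longleftrightarrow> u \<in> borel_measurable lborel \<and>
     (\<forall>K. compact K \<longrightarrow> (\<integral>\<^sup>+ x. indicator K x * ennreal ((norm (u x))\<^sup>2) \<partial>lborel) < \<infinity>)"

definition weak_partials :: "(real \<times> real \<Rightarrow> real \<times> real) \<Rightarrow> (real \<times> real \<Rightarrow> real \<times> real)
   \<Rightarrow> (real \<times> real \<Rightarrow> real \<times> real) \<Rightarrow> bool" where
  "weak_partials u D1 D2 \<longleftrightarrow> L2_loc D1 \<and> L2_loc D2 \<and>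
     (\<forall>\<phi> \<phi>1 \<phi>2. test_fun \<phi> \<phi>1 \<phi>2 \<longrightarrow>
        (\<integral>x. \<phi>1 x *\<^sub>R u x \<partial>lborel) = - (\<integral>x. \<phi> x *\<^sub>R D1 x \<partial>lborel) \<and>
        (\<integral>x. \<phi>2 x *\<^sub>R u x \<partial>lborel) = - (\<integral>x. \<phi> x *\<^sub>R D2 x \<partial>lborel))"

definition H1div :: "(real \<times> real \<Rightarrow> real \<times> real) \<Rightarrow> (real \<times> real \<Rightarrow> real \<times> real)
   \<Rightarrow> (real \<times> real \<Rightarrow> real \<times> real) \<Rightarrow> bool" where
  "H1div u D1 D2 \<longleftrightarrow>
     (\<forall>x1 x2. u (x1, x2 + 1) = u (x1, x2)) \<and>
     L2_loc u \<and> weak_partials u D1 D2 \<and>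
     (\<integral>\<^sup>+ x. indicator strip x * ennreal ((norm (D1 x))\<^sup>2 + (norm (D2 x))\<^sup>2) \<partial>lborel) < \<infinity> \<and>
     (AE x in lborel. fst (D1 x) + snd (D2 x) = 0)"

definition ubar :: "(real \<times> real \<Rightarrow> real \<times> real) \<Rightarrow> real \<Rightarrow> real \<times> real" where
  "ubar u x1 = (\<integral>x2. indicator {0..1} x2 *\<^sub>R u (x1, x2) \<partial>lborel)"

definition bc2 :: "real \<times> real \<Rightarrow> real \<times> real \<Rightarrow> (real \<times> real \<Rightarrow> real \<times> real) \<Rightarrow> bool" where
  "bc2 um up u \<longleftrightarrow> (\<exists>v. continuous_on UNIV v \<and> (AE x1 in lborel. v x1 = ubar u x1) \<and>
       (v \<longlongrightarrow> up) at_top \<and> (v \<longlongrightarrow> um) at_bot)"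

definition energy2 :: "(real \<times> real \<Rightarrow> real) \<Rightarrow> (real \<times> real \<Rightarrow> real \<times> real) \<Rightarrow> (real \<times> real \<Rightarrow> real \<times> real)
   \<Rightarrow> (real \<times> real \<Rightarrow> real \<times> real) \<Rightarrow> ennreal" where
  "energy2 W u D1 D2 = (\<integral>\<^sup>+ x. indicator strip x *
       ennreal ((norm (D1 x))\<^sup>2 / 2 + (norm (D2 x))\<^sup>2 / 2 + W (u x)) \<partial>lborel)"

definition admissible2 where
  "admissible2 um up u D1 D2 \<longleftrightarrow> H1div u D1 D2 \<and> bc2 um up u"

definition global_minimizer :: "(real \<times> real \<Rightarrow> real) \<Rightarrow> real \<times> real \<Rightarrow> real \<times> real
   \<Rightarrow> (real \<times> real \<Rightarrow> real \<times> real) \<Rightarrow> bool" where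
  "global_minimizer W um up u \<longleftrightarrow> (\<exists>D1 D2. admissible2 um up u D1 D2 \<and>
     (\<forall>v V1 V2. admissible2 um up v V1 V2 \<longrightarrow> energy2 W u D1 D2 \<le> energy2 W v V1 V2))"

text \<open>gamma in dot-H^1(R,R^2_a) (continuous representative) with derivative gamma'.\<close>
definition H1_line :: "real \<Rightarrow> (real \<Rightarrow> real \<times> real) \<Rightarrow> (real \<Rightarrow> real \<times> real) \<Rightarrow> bool" where
  "H1_line a \<gamma> \<gamma>' \<longleftrightarrow> (\<forall>t. fst (\<gamma> t) = a) \<and> \<gamma>' \<in> borel_measurable lborel \<and>
     (\<integral>\<^sup>+ t. ennreal ((norm (\<gamma>' t))\<^sup>2) \<partial>lborel) < \<infinity> \<and>
     (\<forall>s t. s \<le> t \<longrightarrow> set_integrable lborel {s..t} \<gamma>' \<and>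
        \<gamma> t - \<gamma> s = set_lebesgue_integral lborel {s..t} \<gamma>')"

definition admissible1 where
  "admissible1 a um up \<gamma> \<gamma>' \<longleftrightarrow> H1_line a \<gamma> \<gamma>' \<and> (\<gamma> \<longlongrightarrow> up) at_top \<and> (\<gamma> \<longlongrightarrow> um) at_bot"

definition energy1 :: "(real \<times> real \<Rightarrow> real) \<Rightarrow> (real \<Rightarrow> real \<times> real) \<Rightarrow> (real \<Rightarrow> real \<times> real) \<Rightarrow> ennreal" where
  "energy1 W \<gamma> \<gamma>' = (\<integral>\<^sup>+ t. ennreal ((norm (\<gamma>' t))\<^sup>2 / 2 + W (\<gamma> t)) \<partial>lborel)"

definition minimizer1 :: "(real \<times> real \<Rightarrow> real) \<Rightarrow> real \<Rightarrow> real \<times> real \<Rightarrow> real \<times> real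
   \<Rightarrow> (real \<Rightarrow> real \<times> real) \<Rightarrow> bool" where
  "minimizer1 W a um up g \<longleftrightarrow> (\<exists>g'. admissible1 a um up g g' \<and>
     (\<forall>\<gamma> \<gamma>'. admissible1 a um up \<gamma> \<gamma>' \<longrightarrow> energy1 W g g' \<le> energy1 W \<gamma> \<gamma>'))"

end

theory Submission
  imports Defs "HOL-Complex_Analysis.Complex_Analysis"
begin

text \<open>
  Let \<open>\<epsilon> = -1\<close> for the Laplace equation and \<open>\<epsilon> = 1\<close> for the wave equation. The equation makes
  \<open>(\<epsilon> \<partial>\<^sub>2w, \<partial>\<^sub>1w)\<close> a gradient \<open>\<nabla>A\<close>, and then \<open>(A, w)\<close> and \<open>(\<epsilon> w, A)\<close> are gradients as well. Hence, for
  divergence-free \<open>u\<close>, the integral of \<open>w(u) (\<partial>\<^sub>1u\<^sub>2 + \<epsilon> \<partial>\<^sub>2u\<^sub>1)\<close> depends on the boundary values only and is the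
  integral \<open>c\<close> of \<open>w\<close> over the segment. As \<open>(\<partial>\<^sub>1u\<^sub>1)\<^sup>2 + \<partial>\<^sub>1u\<^sub>2 \<partial>\<^sub>2u\<^sub>1\<close> has integral zero, completing the square
  gives \<open>E(u) \<ge> c\<close>, and the heteroclinic solution of \<open>\<gamma>' = w(a, \<gamma>)\<close> attains \<open>c\<close>. A minimizer therefore satisfies
  \<open>\<partial>\<^sub>1u\<^sub>2 + \<epsilon> \<partial>\<^sub>2u\<^sub>1 = w(u)\<close>, and \<open>\<partial>\<^sub>1u\<^sub>1 = 0\<close> if \<open>\<epsilon> = 1\<close>, in which case \<open>u\<^sub>1 = a\<close> because \<open>u\<^sub>1 - a\<close> is square
  integrable. If \<open>\<epsilon> = -1\<close>, the curl of \<open>u\<close> is \<open>w(u)\<close>, and \<open>u\<^sub>1 = a\<close> follows from a maximum principle whose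
  coefficients are controlled by the growth of \<open>w\<close> and the Moser--Trudinger inequality. Finally \<open>u\<^sub>1 = a\<close> and
  \<open>div u = 0\<close> leave \<open>u\<^sub>2\<close> a function of \<open>x\<^sub>1\<close>.
\<close>

text \<open>The obstacle is low regularity against fast growth: \<open>u\<close> is only locally
  \<open>H^1\<close>, hence possibly unbounded, while \<open>w\<close> may grow like the exponential
  of \<open>(norm z)^2\<close>. Neither density of smooth maps nor a weak chain rule applies
  directly to \<open>w(u)\<close> and its potentials. The proof therefore works with restrictions to
  lines: they are absolutely continuous, the chain rule holds there for every \<open>C^1\<close>
  outer function, and integrability is settled afterwards. For the calibration it suffices that
  \<open>A(u)\<close> be square integrable over bounded pieces of the cylinder. This takes
  exponential integrability of \<open>u\<close> and a growth bound for \<open>A\<close>, got from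
  \<open>w\<close> by constancy along characteristics (wave) or by Cauchy's estimate (Laplace). For
  \<epsilon> = -1 the completed square carries no separate information on \<open>p\<close>, so
  \<open>u1 = a\<close> has to come from the equation for \<open>u1\<close>. Its coefficient is not
  bounded but only fourth-power integrable on sets of finite measure; hence the supremum is lowered
  by a smallness argument on superlevel sets, not by pointwise comparison.\<close>

lemma AE_zero_if_box_integrals_zero:
  fixes f :: "'a::euclidean_space \<Rightarrow> real"
  assumes int: "\<And>a b. set_integrable lborel (cbox a b) f"
    and zero: "\<And>a b. (LINT x:cbox a b|lborel. f x) = 0"
  shows "AE x in lborel. f x = 0"
proof -
  have "f integrable_on cbox a b" for a b
    using int by (rule set_borel_integral_eq_integral)
  then obtain N where N: "negligible N"
    and lim: "\<And>x e. \<lbrakk>x \<notin> N; 0 < e\<rbrakk> \<Longrightarrow> \<exists>d>0. \<forall>h. 0 < h \<and> h < d \<longrightarrow>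
       norm (integral (cbox x (x + h *\<^sub>R One)) f /\<^sub>R h ^ DIM('a) - f x) < e"
    using integrable_ccontinuous_explicit by blast
  have z: "integral (cbox a b) f = 0" for a b
    using set_borel_integral_eq_integral(2)[OF int, of a b] zero[of a b] by simp
  have "f x = 0" if xN: "x \<notin> N" for x
  proof (rule ccontr)
    assume "f x \<noteq> 0"
    \<comment> \<open>Lebesgue differentiation over boxes: all averages are zero, so the estimate
      with error \<open>\<bar>f x\<bar>\<close> reads
      \<open>\<bar>f x\<bar> < \<bar>f x\<bar>\<close> for every small \<open>h\<close>.\<close>
    then obtain d :: real where "d > 0" "\<forall>h. 0 < h \<and> h < d \<longrightarrow> \<bar>f x\<bar> < \<bar>f x\<bar>"
      using lim[OF xN, of "\<bar>f x\<bar>"] by (auto simp: z)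
    then show False by (meson dense less_irrefl)
  qed
  then have "AE x in lebesgue. f x = 0"
    using N by (auto simp: negligible_iff_null_sets intro!: AE_I'[of N])
  then show ?thesis
    by (simp add: AE_completion_iff)
qed

section \<open>Absolute continuity and the chain rule\<close>

text \<open>Local absolute continuity, stated through the fundamental theorem of calculus. Only
  integrals of \<open>d\<close> enter, so \<open>d\<close> may be changed on a null set
  (\<open>ac_cong_AE\<close>), and no differentiability almost everywhere is used.\<close>

definition ac :: "(real \<Rightarrow> real) \<Rightarrow> (real \<Rightarrow> real) \<Rightarrow> bool" where
  "ac \<gamma> d \<longleftrightarrow> (\<forall>s t. s \<le> t \<longrightarrow> set_integrable lborel {s..t} d \<and>
     \<gamma> t - \<gamma> s = (LINT x:{s..t}|lborel. d x))"

lemma acD: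
  assumes "ac \<gamma> d" "s \<le> t"
  shows "set_integrable lborel {s..t} d" "\<gamma> t - \<gamma> s = (LINT x:{s..t}|lborel. d x)"
  using assms by (auto simp: ac_def)

lemma ac_continuous: assumes "ac \<gamma> d" shows "continuous_on UNIV \<gamma>"
proof -
  have "isCont \<gamma> x" for x
  proof -
    have i: "d integrable_on {x-1..x+1}"
      using acD(1)[OF assms, of "x-1" "x+1"] by (auto intro: set_borel_integral_eq_integral)
    have "continuous_on {x-1..x+1} (\<lambda>t. integral {x-1..t} d)"
      by (rule indefinite_integral_continuous_1[OF i])
    then have "continuous_on {x-1..x+1} (\<lambda>t. \<gamma> (x-1) + integral {x-1..t} d)"
      by (intro continuous_intros)
    moreover have "\<gamma> (x-1) + integral {x-1..t} d = \<gamma> t" if "t \<in> {x-1..x+1}" for t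
      using acD[OF assms, of "x-1" t] that by (auto simp: set_borel_integral_eq_integral(2))
    ultimately have "continuous_on {x-1..x+1} \<gamma>"
      by (rule continuous_on_eq)
    then show ?thesis
      by (simp add: continuous_on_interior interior_atLeastAtMost_real)
  qed
  then show ?thesis by (simp add: continuous_at_imp_continuous_on)
qed

lemma ac_borel_measurable: assumes "ac \<gamma> d" shows "\<gamma> \<in> borel_measurable borel"
  using ac_continuous[OF assms] by (rule borel_measurable_continuous_onI)

lemma set_integral_combine:
  fixes f :: "real \<Rightarrow> real"
  assumes "set_integrable lborel {a..c} f" "a \<le> b" "b \<le> c"
  shows "(LINT x:{a..b}|lborel. f x) + (LINT x:{b..c}|lborel. f x) = (LINT x:{a..c}|lborel. f x)"
proof -
  have 1: "set_integrable lborel {a..b} f" "set_integrable lborel {b..c} f"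
    using assms by (auto intro: set_integrable_subset)
  show ?thesis
    using Henstock_Kurzweil_Integration.integral_combine[OF assms(2,3), of f]
      set_borel_integral_eq_integral[OF assms(1)] set_borel_integral_eq_integral(2)[OF 1(1)]
      set_borel_integral_eq_integral(2)[OF 1(2)] by auto
qed

lemma set_integral_abs_bound:
  fixes f g :: "real \<Rightarrow> real"
  assumes "set_integrable lborel A f" "set_integrable lborel A g" "A \<in> sets borel"
    and "\<And>x. x \<in> A \<Longrightarrow> \<bar>f x\<bar> \<le> g x"
  shows "\<bar>LINT x:A|lborel. f x\<bar> \<le> (LINT x:A|lborel. g x)"
proof -
  have "norm (LINT x|lborel. indicator A x *\<^sub>R f x) \<le> (LINT x|lborel. indicator A x *\<^sub>R g x)"
    using assms unfolding set_integrable_def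
    by (intro Bochner_Integration.integral_norm_bound_integral) (auto simp: indicator_def)
  then show ?thesis by (simp add: set_lebesgue_integral_def)
qed

lemma set_integrable_bounded_mult:
  fixes f d :: "real \<Rightarrow> real"
  assumes d: "set_integrable lborel {s..t} d" and f: "continuous_on {s..t} f"
  shows "set_integrable lborel {s..t} (\<lambda>x. f x * d x)"
proof -
  have "compact (f ` {s..t})" using f by (intro compact_continuous_image) auto
  then obtain B where B: "\<And>x. x \<in> {s..t} \<Longrightarrow> \<bar>f x\<bar> \<le> B"
    by (force dest!: compact_imp_bounded simp: bounded_iff)
  have m: "(\<lambda>x. indicator {s..t} x *\<^sub>R f x) \<in> borel_measurable borel"
    using f by (intro borel_measurable_continuous_on_indicator) auto
  have "integrable lborel (\<lambda>x. B * (indicator {s..t} x *\<^sub>R d x))"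
    using d by (auto simp: set_integrable_def)
  moreover have "(\<lambda>x. indicator {s..t} x *\<^sub>R (f x * d x)) \<in> borel_measurable lborel"
  proof -
    have "(\<lambda>x. (indicator {s..t} x *\<^sub>R f x) * (indicator {s..t} x *\<^sub>R d x)) \<in> borel_measurable lborel"
      using m d by (intro borel_measurable_times) (auto simp: set_integrable_def)
    also have "(\<lambda>x. (indicator {s..t} x *\<^sub>R f x) * (indicator {s..t} x *\<^sub>R d x)) = (\<lambda>x. indicator {s..t} x *\<^sub>R (f x * d x))"
      by (auto simp: indicator_def)
    finally show ?thesis .
  qed
  ultimately show ?thesis unfolding set_integrable_def
    by (rule Bochner_Integration.integrable_bound)
      (auto simp: indicator_def abs_mult intro!: AE_I2 mult_right_mono order_trans[OF B] )
qed

text \<open>The mean value theorem for \<open>\<Phi>\<close> restricted to the segment. It controls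
  the error in \<open>ac_chain\<close> and later the growth of the conjugate function.\<close>

lemma has_derivative_segment_sum:
  fixes \<Phi> \<Phi>1 \<Phi>2 :: "real \<times> real \<Rightarrow> real"
  assumes der: "\<And>z. (\<Phi> has_derivative (\<lambda>h. fst h * \<Phi>1 z + snd h * \<Phi>2 z)) (at z)"
  shows "\<exists>\<xi>\<in>closed_segment x y. \<Phi> y - \<Phi> x = \<Phi>1 \<xi> * (fst y - fst x) + \<Phi>2 \<xi> * (snd y - snd x)"
proof -
  obtain \<xi> where "\<xi> \<in> closed_segment x y" "\<Phi> y - \<Phi> x = fst (y - x) * \<Phi>1 \<xi> + snd (y - x) * \<Phi>2 \<xi>"
  proof (cases "x = y")
    case False
    define g where "g t = \<Phi> (x + t *\<^sub>R (y - x))" for t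
    have gd: "(g has_derivative (\<lambda>s. fst (s *\<^sub>R (y - x)) * \<Phi>1 (x + t *\<^sub>R (y - x)) + snd (s *\<^sub>R (y - x)) * \<Phi>2 (x + t *\<^sub>R (y - x)))) (at t)" for t
      unfolding g_def
      by (rule has_derivative_compose[where g=\<Phi>, OF _ der]) (auto intro!: derivative_eq_intros)
    have "(g has_real_derivative (fst (y - x) * \<Phi>1 (x + t *\<^sub>R (y - x)) + snd (y - x) * \<Phi>2 (x + t *\<^sub>R (y - x)))) (at t)" for t
      using gd[of t] unfolding has_field_derivative_def
      by (rule has_derivative_eq_rhs) (auto simp: algebra_simps)
    then obtain t where t: "0 < t" "t < 1" "g 1 - g 0 = (1 - 0) * (fst (y - x) * \<Phi>1 (x + t *\<^sub>R (y - x)) + snd (y - x) * \<Phi>2 (x + t *\<^sub>R (y - x)))"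
      using MVT2[of 0 1 g "\<lambda>t. fst (y - x) * \<Phi>1 (x + t *\<^sub>R (y - x)) + snd (y - x) * \<Phi>2 (x + t *\<^sub>R (y - x))"] by auto
    have "x + t *\<^sub>R (y - x) \<in> open_segment x y"
      using t False by (auto simp: in_segment algebra_simps intro!: exI[of _ t])
    then show ?thesis using t(3) by (intro that[of "x + t *\<^sub>R (y - x)"]) (auto simp: g_def open_closed_segment)
  qed (use that[of x] in auto)
  then show ?thesis
    by (auto simp: mult.commute intro!: bexI[of _ \<xi>])
qed

text \<open>On a fine subdivision the mean value theorem replaces \<open>\<Phi>1\<close>, \<open>\<Phi>2\<close> by their values at one point
  of the interval; the error is the oscillation of the partials times the total variation.\<close>

lemma ac_chain:
  fixes \<Phi> \<Phi>1 \<Phi>2 :: "real \<times> real \<Rightarrow> real"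
  assumes a1: "ac \<gamma>1 d1" and a2: "ac \<gamma>2 d2"
    and der: "\<And>z. (\<Phi> has_derivative (\<lambda>h. fst h * \<Phi>1 z + snd h * \<Phi>2 z)) (at z)"
    and cont: "continuous_on UNIV \<Phi>1" "continuous_on UNIV \<Phi>2"
  shows "ac (\<lambda>t. \<Phi> (\<gamma>1 t, \<gamma>2 t)) (\<lambda>t. \<Phi>1 (\<gamma>1 t, \<gamma>2 t) * d1 t + \<Phi>2 (\<gamma>1 t, \<gamma>2 t) * d2 t)"
  unfolding ac_def
proof (intro allI impI conjI)
  fix s t :: real assume st: "s \<le> t"
  note c1 = ac_continuous[OF a1] and c2 = ac_continuous[OF a2]
  have cp: "continuous_on A (\<lambda>t. (\<gamma>1 t, \<gamma>2 t))" for A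
    by (intro continuous_on_Pair continuous_on_subset[OF c1] continuous_on_subset[OF c2]) auto
  have cP: "continuous_on A (\<lambda>t. \<Phi>1 (\<gamma>1 t, \<gamma>2 t))" "continuous_on A (\<lambda>t. \<Phi>2 (\<gamma>1 t, \<gamma>2 t))" for A
    by (rule continuous_on_compose2[OF cont(1) cp] continuous_on_compose2[OF cont(2) cp], simp)+
  let ?D = "\<lambda>t. \<Phi>1 (\<gamma>1 t, \<gamma>2 t) * d1 t + \<Phi>2 (\<gamma>1 t, \<gamma>2 t) * d2 t"
  have Di: "set_integrable lborel {s'..t'} ?D" if "s' \<le> t'" for s' t'
    using acD(1)[OF a1 that] acD(1)[OF a2 that] by (intro set_integral_add set_integrable_bounded_mult cP)
  show "set_integrable lborel {s..t} ?D" using Di[OF st] .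
  define V where "V s' t' = (LINT x:{s'..t'}|lborel. \<bar>d1 x\<bar> + \<bar>d2 x\<bar>)" for s' t'
  have Vi: "set_integrable lborel {s'..t'} (\<lambda>x. \<bar>d1 x\<bar> + \<bar>d2 x\<bar>)" if "s' \<le> t'" for s' t'
    using acD(1)[OF a1 that] acD(1)[OF a2 that] by (intro set_integral_add set_integrable_abs)
  \<comment> \<open>\<open>R\<close> is the error of the chain rule over an interval. It is additive
    over adjacent intervals, as is the variation \<open>V\<close>, so a bound of \<open>R\<close> by
    \<open>e * V\<close> on short intervals adds up.\<close>
  define R where "R s' t' = \<Phi> (\<gamma>1 t', \<gamma>2 t') - \<Phi> (\<gamma>1 s', \<gamma>2 s') - (LINT x:{s'..t'}|lborel. ?D x)" for s' t'
  have "\<bar>R s t\<bar> \<le> e * V s t" if e: "e > 0" for e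
  proof -
    have "compact ((\<lambda>t. (\<gamma>1 t, \<gamma>2 t)) ` {s..t})"
      by (intro compact_continuous_image cp) auto
    \<comment> \<open>The convex hull is taken because the mean value point lies on the chord
      between two points of the curve, not on the curve.\<close>
    then have K: "compact (convex hull ((\<lambda>t. (\<gamma>1 t, \<gamma>2 t)) ` {s..t}))" (is "compact ?K")
      by (rule compact_convex_hull)
    have u: "uniformly_continuous_on ?K \<Phi>1" "uniformly_continuous_on ?K \<Phi>2"
      using K by (auto intro!: compact_uniformly_continuous continuous_on_subset[OF cont(1)] continuous_on_subset[OF cont(2)])
    obtain \<delta>1 where \<delta>1: "\<delta>1 > 0"
      "\<And>x y. x \<in> ?K \<Longrightarrow> y \<in> ?K \<Longrightarrow> dist y x < \<delta>1 \<Longrightarrow> dist (\<Phi>1 y) (\<Phi>1 x) < e"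
      using u(1)[unfolded uniformly_continuous_on_def, rule_format, OF e] by blast
    obtain \<delta>2 where \<delta>2: "\<delta>2 > 0"
      "\<And>x y. x \<in> ?K \<Longrightarrow> y \<in> ?K \<Longrightarrow> dist y x < \<delta>2 \<Longrightarrow> dist (\<Phi>2 y) (\<Phi>2 x) < e"
      using u(2)[unfolded uniformly_continuous_on_def, rule_format, OF e] by blast
    note \<delta> = \<delta>1(1) \<delta>2(1) \<delta>1(2) \<delta>2(2)
    \<comment> \<open>Half, since the mean value point and the points of the curve are each within
      \<open>\<delta>\<close> of \<open>?x\<close> and are then compared with each other.\<close>
    define \<delta> where "\<delta> = min \<delta>1 \<delta>2 / 2"
    have uc: "uniformly_continuous_on {s..t} (\<lambda>t. (\<gamma>1 t, \<gamma>2 t))"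
      by (intro compact_uniformly_continuous cp) auto
    have \<delta>0: "\<delta> > 0" using \<delta>(1,2) by (auto simp: \<delta>_def)
    obtain \<eta> where \<eta>: "\<eta> > 0"
      "\<And>x y. x \<in> {s..t} \<Longrightarrow> y \<in> {s..t} \<Longrightarrow> dist y x < \<eta> \<Longrightarrow> dist (\<gamma>1 y, \<gamma>2 y) (\<gamma>1 x, \<gamma>2 x) < \<delta>"
      using uc[unfolded uniformly_continuous_on_def, rule_format, OF \<delta>0] by blast
    have small: "\<bar>R s' t'\<bar> \<le> e * V s' t'" if "s \<le> s'" "s' \<le> t'" "t' \<le> t" "t' - s' < \<eta>" for s' t'
    proof -
      let ?x = "(\<gamma>1 s', \<gamma>2 s')" and ?y = "(\<gamma>1 t', \<gamma>2 t')"
      obtain \<xi> where \<xi>: "\<xi> \<in> closed_segment ?x ?y"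
        and eq: "\<Phi> ?y - \<Phi> ?x = \<Phi>1 \<xi> * (\<gamma>1 t' - \<gamma>1 s') + \<Phi>2 \<xi> * (\<gamma>2 t' - \<gamma>2 s')"
        using has_derivative_segment_sum[OF der, of ?x ?y] by auto
      have xin: "(\<gamma>1 r, \<gamma>2 r) \<in> ?K" if "r \<in> {s'..t'}" for r
        using that \<open>s \<le> s'\<close> \<open>t' \<le> t\<close> by (intro hull_inc) auto
      have \<xi>K: "\<xi> \<in> ?K"
        using xin[of s'] xin[of t'] \<open>s' \<le> t'\<close> \<xi> closed_segment_subset[of ?x ?K ?y] by auto
      have d\<xi>: "dist (\<gamma>1 r, \<gamma>2 r) \<xi> < min \<delta>1 \<delta>2" if "r \<in> {s'..t'}" for r
      proof -
        have "dist \<xi> ?x \<le> dist ?x ?y" using \<xi> by (metis dist_commute dist_in_closed_segment(1))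
        also have "\<dots> < \<delta>" using \<eta>(2)[of t' s'] that \<open>s \<le> s'\<close> \<open>t' \<le> t\<close> \<open>t' - s' < \<eta>\<close> by (auto simp: dist_real_def)
        finally have "dist \<xi> ?x < \<delta>" .
        moreover have "dist (\<gamma>1 r, \<gamma>2 r) ?x < \<delta>"
          using \<eta>(2)[of s' r] that \<open>s \<le> s'\<close> \<open>t' \<le> t\<close> \<open>t' - s' < \<eta>\<close> by (auto simp: dist_real_def)
        ultimately show ?thesis
          using dist_triangle3[of "(\<gamma>1 r, \<gamma>2 r)" \<xi> ?x] by (simp add: \<delta>_def dist_commute)
      qed
      have b1: "set_integrable lborel {s'..t'} (\<lambda>x. \<Phi>1 \<xi> * d1 x + \<Phi>2 \<xi> * d2 x)"
        using acD(1)[OF a1 \<open>s' \<le> t'\<close>] acD(1)[OF a2 \<open>s' \<le> t'\<close>] by (intro set_integral_add) auto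
      have "\<Phi> ?y - \<Phi> ?x = (LINT x:{s'..t'}|lborel. \<Phi>1 \<xi> * d1 x + \<Phi>2 \<xi> * d2 x)"
        unfolding eq acD(2)[OF a1 \<open>s' \<le> t'\<close>] acD(2)[OF a2 \<open>s' \<le> t'\<close>]
        using acD(1)[OF a1 \<open>s' \<le> t'\<close>] acD(1)[OF a2 \<open>s' \<le> t'\<close>] by simp
      then have Req: "R s' t' = (LINT x:{s'..t'}|lborel. (\<Phi>1 \<xi> * d1 x + \<Phi>2 \<xi> * d2 x) - ?D x)"
        unfolding R_def using b1 Di[OF \<open>s' \<le> t'\<close>] by (subst set_integral_diff) auto
      have "\<bar>R s' t'\<bar> \<le> (LINT x:{s'..t'}|lborel. e * (\<bar>d1 x\<bar> + \<bar>d2 x\<bar>))"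
        unfolding Req
      proof (rule set_integral_abs_bound)
        show "set_integrable lborel {s'..t'} (\<lambda>x. (\<Phi>1 \<xi> * d1 x + \<Phi>2 \<xi> * d2 x) - ?D x)"
          using b1 Di[OF \<open>s' \<le> t'\<close>] by (rule set_integral_diff)
        show "set_integrable lborel {s'..t'} (\<lambda>x. e * (\<bar>d1 x\<bar> + \<bar>d2 x\<bar>))"
          using Vi[OF \<open>s' \<le> t'\<close>] by simp
        fix x assume x: "x \<in> {s'..t'}"
        let ?z = "(\<gamma>1 x, \<gamma>2 x)"
        have k: "\<bar>\<Phi>1 \<xi> - \<Phi>1 ?z\<bar> \<le> e" "\<bar>\<Phi>2 \<xi> - \<Phi>2 ?z\<bar> \<le> e"
          using \<delta>(3)[OF xin[OF x] \<xi>K] \<delta>(4)[OF xin[OF x] \<xi>K] d\<xi>[OF x] by (auto simp: dist_real_def dist_commute)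
        have "(\<Phi>1 \<xi> * d1 x + \<Phi>2 \<xi> * d2 x) - ?D x = (\<Phi>1 \<xi> - \<Phi>1 ?z) * d1 x + (\<Phi>2 \<xi> - \<Phi>2 ?z) * d2 x"
          by (simp add: algebra_simps)
        also have "\<bar>\<dots>\<bar> \<le> \<bar>\<Phi>1 \<xi> - \<Phi>1 ?z\<bar> * \<bar>d1 x\<bar> + \<bar>\<Phi>2 \<xi> - \<Phi>2 ?z\<bar> * \<bar>d2 x\<bar>"
          by (metis abs_mult abs_triangle_ineq)
        also have "\<dots> \<le> e * (\<bar>d1 x\<bar> + \<bar>d2 x\<bar>)"
          using k by (simp add: distrib_left add_mono mult_right_mono)
        finally show "\<bar>(\<Phi>1 \<xi> * d1 x + \<Phi>2 \<xi> * d2 x) - ?D x\<bar> \<le> e * (\<bar>d1 x\<bar> + \<bar>d2 x\<bar>)" .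
      qed auto
      also have "\<dots> = e * V s' t'" by (simp add: V_def)
      finally show ?thesis .
    qed
    \<comment> \<open>Steps of length \<open>\<eta> / 2\<close> stay below \<open>\<eta>\<close>,
      and the minimum with \<open>t\<close> lets the last one end exactly at
      \<open>t\<close>.\<close>
    have step: "\<bar>R s (min t (s + real n * (\<eta> / 2)))\<bar> \<le> e * V s (min t (s + real n * (\<eta> / 2)))" for n
    proof (induction n)
      case 0
      then show ?case using st small[of s s] \<eta>(1) by simp
    next
      case (Suc n)
      let ?m = "min t (s + real n * (\<eta> / 2))" and ?M = "min t (s + real (Suc n) * (\<eta> / 2))"
      have o: "s \<le> ?m" "?m \<le> ?M" "?M \<le> t" "?M - ?m < \<eta>" using st \<eta>(1) by (auto simp: field_simps min_def)
      have "R s ?M = R s ?m + R ?m ?M"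
        unfolding R_def using set_integral_combine[OF Di o(1,2), of ] o by (simp add: )
      moreover have "V s ?M = V s ?m + V ?m ?M"
        unfolding V_def using set_integral_combine[OF Vi o(1,2)] o by simp
      moreover have "\<bar>R s ?m + R ?m ?M\<bar> \<le> e * (V s ?m + V ?m ?M)"
        unfolding distrib_left by (rule order_trans[OF abs_triangle_ineq add_mono[OF Suc small[OF o]]])
      ultimately show ?case by (simp only:)
    qed
    obtain n where "t - s < real n * (\<eta> / 2)"
      using reals_Archimedean3[of "\<eta> / 2"] \<eta>(1) half_gt_zero by blast
    then show ?thesis using step[of n] by (simp add: min_def)
  qed
  then have "\<bar>R s t\<bar> \<le> 0"
  proof -
    assume *: "\<And>e. e > 0 \<Longrightarrow> \<bar>R s t\<bar> \<le> e * V s t"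
    have "V s t \<ge> 0" unfolding V_def set_lebesgue_integral_def by (intro Bochner_Integration.integral_nonneg) auto
    show ?thesis
    proof (rule field_le_epsilon)
      fix e :: real assume "e > 0"
      have "\<bar>R s t\<bar> \<le> e / (V s t + 1) * V s t" using \<open>e > 0\<close> \<open>V s t \<ge> 0\<close> by (intro *) simp
      also have "\<dots> \<le> e" using \<open>e > 0\<close> \<open>V s t \<ge> 0\<close> by (simp add: field_simps)
      finally show "\<bar>R s t\<bar> \<le> 0 + e" by simp
    qed
  qed
  then show "\<Phi> (\<gamma>1 t, \<gamma>2 t) - \<Phi> (\<gamma>1 s, \<gamma>2 s) = (LINT x:{s..t}|lborel. ?D x)"
    by (simp add: R_def)
qed

text \<open>Slices of a Sobolev function are absolutely continuous only after a change on a null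
  set. The given representative is kept, and the continuous one is merely asked to exist.\<close>

definition wac :: "(real \<Rightarrow> real) \<Rightarrow> (real \<Rightarrow> real) \<Rightarrow> bool" where
  "wac v d \<longleftrightarrow> v \<in> borel_measurable borel \<and> d \<in> borel_measurable borel \<and>
     (\<exists>\<gamma>. ac \<gamma> d \<and> (AE x in lborel. v x = \<gamma> x))"

lemma set_integral_cong_AE':
  fixes f g :: "real \<Rightarrow> real"
  assumes "set_integrable lborel A f" "AE x in lborel. f x = g x" "g \<in> borel_measurable borel" "A \<in> sets borel"
  shows "set_integrable lborel A g" "(LINT x:A|lborel. f x) = (LINT x:A|lborel. g x)"
proof -
  have m: "(\<lambda>x. indicator A x *\<^sub>R g x) \<in> borel_measurable lborel" using assms by simp
  have f: "(\<lambda>x. indicator A x *\<^sub>R f x) \<in> borel_measurable lborel"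
    using assms(1) by (auto simp: set_integrable_def)
  have ae: "AE x in lborel. indicator A x *\<^sub>R f x = indicator A x *\<^sub>R g x" using assms(2) by auto
  show "set_integrable lborel A g" using assms(1) unfolding set_integrable_def
    by (rule integrable_cong_AE_imp[OF _ m]) (use ae in auto)
  show "(LINT x:A|lborel. f x) = (LINT x:A|lborel. g x)" unfolding set_lebesgue_integral_def
    by (rule integral_cong_AE[OF f m ae])
qed

lemma ac_cong_AE:
  assumes "ac \<gamma> d" "AE x in lborel. d x = d' x" "d' \<in> borel_measurable borel"
  shows "ac \<gamma> d'"
  using set_integral_cong_AE'[OF _ assms(2,3)] assms(1) unfolding ac_def by auto

lemma has_derivative_pair_continuous:
  assumes "\<And>z. (\<Phi> has_derivative (\<lambda>h. fst h * \<Phi>1 z + snd h * \<Phi>2 z)) (at z)"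
  shows "continuous_on UNIV (\<Phi> :: real \<times> real \<Rightarrow> real)"
  using assms by (meson has_derivative_continuous continuous_at_imp_continuous_on)

lemma wac_chain:
  fixes \<Phi> \<Phi>1 \<Phi>2 :: "real \<times> real \<Rightarrow> real"
  assumes a1: "wac v1 d1" and a2: "wac v2 d2"
    and der: "\<And>z. (\<Phi> has_derivative (\<lambda>h. fst h * \<Phi>1 z + snd h * \<Phi>2 z)) (at z)"
    and cont: "continuous_on UNIV \<Phi>1" "continuous_on UNIV \<Phi>2"
  shows "wac (\<lambda>t. \<Phi> (v1 t, v2 t)) (\<lambda>t. \<Phi>1 (v1 t, v2 t) * d1 t + \<Phi>2 (v1 t, v2 t) * d2 t)"
proof -
  obtain \<gamma>1 \<gamma>2 where g: "ac \<gamma>1 d1" "AE x in lborel. v1 x = \<gamma>1 x" "ac \<gamma>2 d2" "AE x in lborel. v2 x = \<gamma>2 x"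
    using a1 a2 by (auto simp: wac_def)
  have [measurable]: "\<Phi> \<in> borel_measurable borel" "\<Phi>1 \<in> borel_measurable borel" "\<Phi>2 \<in> borel_measurable borel"
    using cont has_derivative_pair_continuous[OF der] by (auto intro: borel_measurable_continuous_onI)
  have [measurable]: "v1 \<in> borel_measurable borel" "v2 \<in> borel_measurable borel" "d1 \<in> borel_measurable borel" "d2 \<in> borel_measurable borel"
    using a1 a2 by (auto simp: wac_def)
  let ?D = "\<lambda>t. \<Phi>1 (v1 t, v2 t) * d1 t + \<Phi>2 (v1 t, v2 t) * d2 t"
  have "ac (\<lambda>t. \<Phi> (\<gamma>1 t, \<gamma>2 t)) ?D"
    by (rule ac_cong_AE[OF ac_chain[OF g(1,3) der cont]]) (use g(2,4) in \<open>auto\<close>)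
  moreover have "AE x in lborel. \<Phi> (v1 x, v2 x) = \<Phi> (\<gamma>1 x, \<gamma>2 x)" using g(2,4) by auto
  ultimately show ?thesis unfolding wac_def by (intro conjI exI) auto
qed

lemma wac_compose:
  fixes \<theta> \<theta>' :: "real \<Rightarrow> real"
  assumes "wac v d" "\<And>y. (\<theta> has_real_derivative \<theta>' y) (at y)" "continuous_on UNIV \<theta>'"
  shows "wac (\<lambda>t. \<theta> (v t)) (\<lambda>t. \<theta>' (v t) * d t)"
proof -
  have "((\<lambda>z. \<theta> (fst z)) has_derivative (\<lambda>h. fst h * \<theta>' (fst z) + snd h * 0)) (at z)" for z :: "real \<times> real"
    using has_derivative_compose[OF has_derivative_fst[OF has_derivative_ident] assms(2)[unfolded has_field_derivative_def], of z UNIV]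
    by (simp add: mult.commute)
  from wac_chain[OF assms(1) assms(1) this] show ?thesis
    using continuous_on_compose2[OF assms(3) continuous_on_fst[OF continuous_on_id], of UNIV] by simp
qed

text \<open>The set where the two differ is open and null, hence empty.\<close>

lemma continuous_AE_eq:
  fixes f g :: "real \<Rightarrow> 'b::{real_normed_vector}"
  assumes "continuous_on UNIV f" "continuous_on UNIV g" "AE x in lborel. f x = g x"
  shows "f x = g x"
proof (rule ccontr)
  assume "f x \<noteq> g x"
  have "open {x. f x \<noteq> g x}"
    using assms(1,2) by (intro open_Collect_neq) auto
  then obtain e where e: "e > 0" "{x-e<..<x+e} \<subseteq> {x. f x \<noteq> g x}"
    using \<open>f x \<noteq> g x\<close> by (auto simp: open_real_greaterThanLessThan open_contains_ball ball_eq_greaterThanLessThan)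
  have "AE y in lborel. y \<notin> {x-e<..<x+e}" using assms(3) by eventually_elim (use e(2) in blast)
  then have "{x-e<..<x+e} \<in> null_sets lborel" by (subst (asm) AE_iff_null_sets[symmetric]) auto
  then show False using e(1) by (auto dest!: null_setsD1)
qed

lemma ac_diff_measure_zero:
  assumes "ac \<gamma> d" "ac \<gamma>' d'" "\<And>x. \<gamma> x = \<gamma>' x + c"
  shows "AE x in lborel. d x = d' x"
proof -
  have i: "set_integrable lborel {a..b} d" "set_integrable lborel {a..b} d'" for a b
    using acD(1)[OF assms(1), of a b] acD(1)[OF assms(2), of a b] by (cases "a \<le> b"; auto simp: set_integrable_def)+
  have "AE x in lborel. d x - d' x = 0"
  proof (rule AE_zero_if_box_integrals_zero)
    show "set_integrable lborel (cbox a b) (\<lambda>x. d x - d' x)" for a b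
      using i by (auto intro: set_integral_diff)
    show "(LINT x:cbox a b|lborel. d x - d' x) = 0" for a b
    proof (cases "a \<le> b")
      case True
      then show ?thesis using acD(2)[OF assms(1), of a b] acD(2)[OF assms(2), of a b] assms(3) i
        by (simp add: set_integral_diff(2))
    qed (auto simp: set_lebesgue_integral_def)
  qed
  then show ?thesis by auto
qed

lemma wac_unique:
  assumes "wac v d" "wac v' d'" "AE x in lborel. v x = v' x"
  shows "AE x in lborel. d x = d' x"
proof -
  obtain \<gamma>1 \<gamma>2 where g: "ac \<gamma>1 d" "AE x in lborel. v x = \<gamma>1 x" "ac \<gamma>2 d'" "AE x in lborel. v' x = \<gamma>2 x"
    using assms by (auto simp: wac_def)
  have "AE x in lborel. \<gamma>1 x = \<gamma>2 x" using g(2,4) assms(3) by auto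
  then have "\<gamma>1 x = \<gamma>2 x" for x
    by (rule continuous_AE_eq[OF ac_continuous[OF g(1)] ac_continuous[OF g(3)]])
  then show ?thesis using ac_diff_measure_zero[OF g(1,3), of 0] by auto
qed

section \<open>The cylinder\<close>

text \<open>The circle is Lebesgue measure weighted by the indicator of the unit interval. The space
  stays all of \<open>real\<close>, so periodic functions need no quotient and no restriction; the
  total mass one makes integrals over it means.\<close>

definition T1 :: "real measure" where "T1 = density lborel (indicator {0..1})"

lemma sets_T1[measurable_cong, simp]: "sets T1 = sets borel" and space_T1[simp]: "space T1 = UNIV"
  by (auto simp: T1_def)

lemma AE_T1: "(AE x in T1. P x) \<longleftrightarrow> (AE x in lborel. 0 \<le> x \<and> x \<le> 1 \<longrightarrow> P x)"
  unfolding T1_def by (subst AE_density) (auto simp: indicator_def)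

lemma AE_T1_I: "(AE x in lborel. P x) \<Longrightarrow> (AE x in T1. P x)"
  by (auto simp: AE_T1 elim: AE_mp)

lemma emeasure_T1_UNIV[simp]: "emeasure T1 UNIV = 1"
  unfolding T1_def by (subst emeasure_density) auto

interpretation T1: finite_measure T1
  by (rule finite_measureI) simp

lemma integrable_T1:
  fixes f :: "real \<Rightarrow> real"
  assumes "f \<in> borel_measurable borel"
  shows "integrable T1 f \<longleftrightarrow> set_integrable lborel {0..1} f"
    "integral\<^sup>L T1 f = (LINT x:{0..1}|lborel. f x)"
  unfolding T1_def set_integrable_def set_lebesgue_integral_def
  using integrable_density[of f lborel "indicator {0..1}"] integral_density[of f lborel "indicator {0..1}"] assms
  by (auto simp: ennreal_indicator)

definition cyl :: "(real \<times> real) measure" where "cyl = lborel \<Otimes>\<^sub>M T1"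

interpretation cyl: pair_sigma_finite lborel T1 ..

lemma strip_borel[measurable]: "strip \<in> sets borel"
  unfolding strip_def by (intro borel_closed closed_Times) auto

text \<open>The link between the integrals over \<open>strip\<close> in the definitions of energy
  and admissibility and the product measure, for which Fubini is available.\<close>

lemma cyl_eq_density: "cyl = density lborel (indicator strip)"
proof -
  have "cyl = density lborel (\<lambda>_. 1) \<Otimes>\<^sub>M density lborel (indicator {0..1})"
    by (simp add: cyl_def T1_def density_1)
  also have "\<dots> = density (lborel \<Otimes>\<^sub>M lborel) (\<lambda>(x,y). 1 * indicator {0..1} y)"
    using T1.sigma_finite_measure_axioms by (intro pair_measure_density) (auto simp: T1_def sigma_finite_lborel)
  also have "\<dots> = density lborel (indicator strip)"
  proof -
    have "(\<lambda>(x, y). 1 * indicator {0..1} y) = (indicator strip :: real \<times> real \<Rightarrow> ennreal)"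
      by (auto simp: strip_def indicator_def)
    then show ?thesis by (simp only: lborel_prod)
  qed
  finally show ?thesis .
qed

lemma sets_cyl[measurable_cong, simp]: "sets cyl = sets borel" and space_cyl[simp]: "space cyl = UNIV"
  by (auto simp: cyl_eq_density)

lemma measurable_cyl_pair:
  fixes f :: "real \<times> real \<Rightarrow> 'b::topological_space"
  shows "f \<in> borel_measurable borel \<Longrightarrow> f \<in> borel_measurable (lborel \<Otimes>\<^sub>M T1)"
  unfolding cyl_def[symmetric] by simp

lemma nn_integral_cyl:
  "f \<in> borel_measurable borel \<Longrightarrow> (\<integral>\<^sup>+x. f x \<partial>cyl) = (\<integral>\<^sup>+x. indicator strip x * f x \<partial>lborel)"
  unfolding cyl_eq_density by (subst nn_integral_density) auto

lemma AE_cyl_I: "(AE x in lborel. P x) \<Longrightarrow> (AE x in cyl. P x)"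
  unfolding cyl_eq_density by (subst AE_density) (auto elim: AE_mp)

lemma nn_integral_cyl_fst:
  assumes "f \<in> borel_measurable borel"
  shows "(\<integral>\<^sup>+x. f x \<partial>cyl) = (\<integral>\<^sup>+x. \<integral>\<^sup>+y. f (x, y) \<partial>T1 \<partial>lborel)"
  unfolding cyl_def by (rule T1.nn_integral_fst[symmetric]) (rule measurable_cyl_pair[OF assms])

lemma nn_integral_cyl_snd:
  assumes "f \<in> borel_measurable borel"
  shows "(\<integral>\<^sup>+x. f x \<partial>cyl) = (\<integral>\<^sup>+y. \<integral>\<^sup>+x. f (x, y) \<partial>lborel \<partial>T1)"
  unfolding cyl_def by (rule cyl.nn_integral_snd[symmetric]) (rule measurable_cyl_pair[OF assms])

lemma AE_cyl_fst: "(AE x in cyl. P x) \<Longrightarrow> AE x in lborel. AE y in T1. P (x, y)"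
  unfolding cyl_def by (rule cyl.AE_pair)

lemma AE_cyl_swap:
  assumes "{x. P x} \<in> sets borel"
  shows "(AE x in cyl. P x) \<longleftrightarrow> (AE x in lborel. AE y in T1. P (x, y))"
    "(AE x in cyl. P x) \<longleftrightarrow> (AE y in T1. AE x in lborel. P (x, y))"
proof -
  have s: "{x\<in>space (lborel \<Otimes>\<^sub>M T1). P x} \<in> sets (lborel \<Otimes>\<^sub>M T1)"
    using assms unfolding cyl_def[symmetric] by simp
  show 1: "(AE x in cyl. P x) \<longleftrightarrow> (AE x in lborel. AE y in T1. P (x, y))"
    unfolding cyl_def using cyl.AE_pair_iff[of "\<lambda>x y. P (x, y)"] s by simp
  show "(AE x in cyl. P x) \<longleftrightarrow> (AE y in T1. AE x in lborel. P (x, y))"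
    unfolding 1 by (rule cyl.AE_commute) (use s in simp)
qed

lemma integral_cyl:
  fixes f :: "real \<times> real \<Rightarrow> real"
  assumes "integrable cyl f"
  shows "AE x in lborel. integrable T1 (\<lambda>y. f (x, y))"
    "integrable lborel (\<lambda>x. \<integral>y. f (x, y) \<partial>T1)"
    "(\<integral>x. \<integral>y. f (x, y) \<partial>T1 \<partial>lborel) = (\<integral>x. f x \<partial>cyl)"
    "AE y in T1. integrable lborel (\<lambda>x. f (x, y))"
    "integrable T1 (\<lambda>y. \<integral>x. f (x, y) \<partial>lborel)"
    "(\<integral>y. \<integral>x. f (x, y) \<partial>lborel \<partial>T1) = (\<integral>x. f x \<partial>cyl)"
  using cyl.AE_integrable_fst'[of f] cyl.integrable_fst'[of f] cyl.integral_fst'[of f] assms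
    cyl.AE_integrable_snd[of "\<lambda>x y. f (x, y)"] cyl.integrable_snd[of "\<lambda>x y. f (x, y)"] cyl.integral_snd[of "\<lambda>x y. f (x, y)"]
  by (auto simp: cyl_def)

text \<open>Absolute continuity on almost every line parallel to an axis, with the partial
  derivatives carried along. This replaces weak derivatives: it is stable under composition whether
  or not the resulting derivatives are integrable.\<close>

definition acl :: "(real \<times> real \<Rightarrow> real) \<Rightarrow> (real \<times> real \<Rightarrow> real) \<Rightarrow> (real \<times> real \<Rightarrow> real) \<Rightarrow> bool" where
  "acl v d1 d2 \<longleftrightarrow> v \<in> borel_measurable borel \<and> d1 \<in> borel_measurable borel \<and> d2 \<in> borel_measurable borel \<and>
     (\<forall>x1 x2. v (x1, x2 + 1) = v (x1, x2)) \<and>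
     (AE x2 in lborel. wac (\<lambda>x1. v (x1, x2)) (\<lambda>x1. d1 (x1, x2))) \<and>
     (AE x1 in lborel. wac (\<lambda>x2. v (x1, x2)) (\<lambda>x2. d2 (x1, x2)))"

lemma aclD:
  assumes "acl v d1 d2"
  shows "v \<in> borel_measurable borel" "d1 \<in> borel_measurable borel" "d2 \<in> borel_measurable borel"
    "v (x1, x2 + 1) = v (x1, x2)"
    "AE x2 in T1. wac (\<lambda>x1. v (x1, x2)) (\<lambda>x1. d1 (x1, x2))"
    "AE x1 in lborel. wac (\<lambda>x2. v (x1, x2)) (\<lambda>x2. d2 (x1, x2))"
  using assms by (auto simp: acl_def intro: AE_T1_I)

text \<open>The chain rule is applied slice by slice, so the outer function may grow arbitrarily;
  integrability of the new derivatives is a separate question.\<close>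

lemma acl_chain:
  fixes \<Phi> \<Phi>1 \<Phi>2 :: "real \<times> real \<Rightarrow> real"
  assumes a1: "acl v c1 c2" and a2: "acl u d1 d2"
    and der: "\<And>z. (\<Phi> has_derivative (\<lambda>h. fst h * \<Phi>1 z + snd h * \<Phi>2 z)) (at z)"
    and cont: "continuous_on UNIV \<Phi>1" "continuous_on UNIV \<Phi>2"
  shows "acl (\<lambda>x. \<Phi> (v x, u x)) (\<lambda>x. \<Phi>1 (v x, u x) * c1 x + \<Phi>2 (v x, u x) * d1 x)
     (\<lambda>x. \<Phi>1 (v x, u x) * c2 x + \<Phi>2 (v x, u x) * d2 x)"
proof -
  have [measurable]: "\<Phi> \<in> borel_measurable borel" "\<Phi>1 \<in> borel_measurable borel" "\<Phi>2 \<in> borel_measurable borel"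
    using cont has_derivative_pair_continuous[OF der] by (auto intro: borel_measurable_continuous_onI)
  note [measurable] = aclD(1-3)[OF a1] aclD(1-3)[OF a2]
  have A: "AE x2 in lborel. wac (\<lambda>x1. \<Phi> (v (x1, x2), u (x1, x2)))
      (\<lambda>x1. \<Phi>1 (v (x1, x2), u (x1, x2)) * c1 (x1, x2) + \<Phi>2 (v (x1, x2), u (x1, x2)) * d1 (x1, x2))"
  proof -
    have "AE x2 in lborel. wac (\<lambda>x1. v (x1, x2)) (\<lambda>x1. c1 (x1, x2))"
      "AE x2 in lborel. wac (\<lambda>x1. u (x1, x2)) (\<lambda>x1. d1 (x1, x2))"
      using a1 a2 by (auto simp: acl_def)
    then show ?thesis by eventually_elim (rule wac_chain[OF _ _ der cont])
  qed
  have B: "AE x1 in lborel. wac (\<lambda>x2. \<Phi> (v (x1, x2), u (x1, x2)))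
      (\<lambda>x2. \<Phi>1 (v (x1, x2), u (x1, x2)) * c2 (x1, x2) + \<Phi>2 (v (x1, x2), u (x1, x2)) * d2 (x1, x2))"
    using aclD(6)[OF a1] aclD(6)[OF a2] by eventually_elim (rule wac_chain[OF _ _ der cont])
  show ?thesis
    unfolding acl_def using A B aclD(4)[OF a1] aclD(4)[OF a2] by (intro conjI) auto
qed

lemma acl_compose:
  fixes \<theta> \<theta>' :: "real \<Rightarrow> real"
  assumes a: "acl v c1 c2" and der: "\<And>y. (\<theta> has_real_derivative \<theta>' y) (at y)" and cont: "continuous_on UNIV \<theta>'"
  shows "acl (\<lambda>x. \<theta> (v x)) (\<lambda>x. \<theta>' (v x) * c1 x) (\<lambda>x. \<theta>' (v x) * c2 x)"
proof -
  have "((\<lambda>z. \<theta> (fst z)) has_derivative (\<lambda>h. fst h * \<theta>' (fst z) + snd h * 0)) (at z)" for z :: "real \<times> real"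
    using has_derivative_compose[OF has_derivative_fst[OF has_derivative_ident] der[unfolded has_field_derivative_def], of z UNIV]
    by (simp add: mult.commute)
  from acl_chain[OF a a this] show ?thesis
    using continuous_on_compose2[OF cont continuous_on_fst[OF continuous_on_id], of UNIV] by simp
qed

lemma ac_bound:
  assumes "ac \<gamma> d" "x \<in> {s..t}" "y \<in> {s..t}"
  shows "\<bar>\<gamma> x - \<gamma> y\<bar> \<le> (LINT x:{s..t}|lborel. \<bar>d x\<bar>)"
proof -
  have *: "\<bar>\<gamma> x - \<gamma> y\<bar> \<le> (LINT x:{s..t}|lborel. \<bar>d x\<bar>)" if "y \<le> x" "x \<in> {s..t}" "y \<in> {s..t}" for x y
  proof -
    have i: "set_integrable lborel {s..t} (\<lambda>x. \<bar>d x\<bar>)" "set_integrable lborel {y..x} (\<lambda>x. \<bar>d x\<bar>)"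
      using acD(1)[OF assms(1), of s t] acD(1)[OF assms(1) \<open>y \<le> x\<close>] that by (auto intro: set_integrable_abs)
    have "\<bar>\<gamma> x - \<gamma> y\<bar> \<le> (LINT x:{y..x}|lborel. \<bar>d x\<bar>)"
      unfolding acD(2)[OF assms(1) \<open>y \<le> x\<close>] using acD(1)[OF assms(1) \<open>y \<le> x\<close>] i
      by (intro set_integral_abs_bound) auto
    also have "\<dots> \<le> (LINT x:{s..t}|lborel. \<bar>d x\<bar>)"
      using i that unfolding set_lebesgue_integral_def set_integrable_def
      by (intro integral_mono) (auto simp: indicator_def)
    finally show ?thesis .
  qed
  show ?thesis
    using *[of y x] *[of x y] assms(2,3) by (cases "y \<le> x") (auto simp: abs_minus_commute)
qed

lemma wac_periodic_integral:
  assumes "wac v d" "\<And>x. v (x + 1) = v x"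
  shows "integrable T1 d" "(\<integral>x. d x \<partial>T1) = 0"
proof -
  obtain \<gamma> where g: "ac \<gamma> d" "AE x in lborel. v x = \<gamma> x" using assms by (auto simp: wac_def)
  have d: "d \<in> borel_measurable borel" using assms by (auto simp: wac_def)
  show "integrable T1 d" using acD(1)[OF g(1), of 0 1] d by (simp add: integrable_T1)
  \<comment> \<open>Only \<open>v\<close> is periodic by assumption. Its continuous representative
    inherits periodicity first almost everywhere and then, by continuity, at
    \<open>0\<close>.\<close>
  have "AE x in lborel. v (x + 1) = \<gamma> (x + 1)"
    using g(2) ac_borel_measurable[OF g(1)] assms(1)
      AE_borel_affine[of 1 "\<lambda>x. v x = \<gamma> x" 1] by (auto simp: wac_def add.commute)
  then have "AE x in lborel. \<gamma> (x + 1) = \<gamma> x" using g(2) assms(2) by auto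
  moreover have "continuous_on UNIV (\<lambda>x. \<gamma> (x + 1))"
    by (rule continuous_on_compose2[OF ac_continuous[OF g(1)]]) (auto intro: continuous_intros)
  ultimately have "\<gamma> (0 + 1) = \<gamma> 0"
    using continuous_AE_eq[OF _ ac_continuous[OF g(1)]] by blast
  then show "(\<integral>x. d x \<partial>T1) = 0"
    using acD(2)[OF g(1), of 0 1] d by (simp add: integrable_T1)
qed

lemma wac_integrable_T1:
  assumes "wac v d"
  shows "integrable T1 v" "integrable T1 d"
proof -
  obtain \<gamma> where g: "ac \<gamma> d" "AE x in lborel. v x = \<gamma> x" using assms by (auto simp: wac_def)
  have m: "v \<in> borel_measurable borel" "d \<in> borel_measurable borel" using assms by (auto simp: wac_def)
  show "integrable T1 d" using acD(1)[OF g(1), of 0 1] m by (simp add: integrable_T1)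
  have "set_integrable lborel {0..1} \<gamma>"
    using ac_continuous[OF g(1)] by (intro borel_integrable_atLeastAtMost') (auto intro: continuous_on_subset)
  then have "set_integrable lborel {0..1} v"
    by (rule set_integral_cong_AE') (use g(2) m in auto)
  then show "integrable T1 v" using m by (simp add: integrable_T1)
qed

text \<open>The mean lies between the extreme values. It provides the base point in
  \<open>wac_slice_bound\<close>.\<close>

lemma ac_mean_attained:
  fixes \<gamma> :: "real \<Rightarrow> real"
  assumes "continuous_on UNIV \<gamma>"
  shows "\<exists>y\<in>{0..1}. \<gamma> y = (LINT x:{0..1}|lborel. \<gamma> x)"
proof -
  have c: "continuous_on {0..1} \<gamma>" using assms by (rule continuous_on_subset) auto
  have i: "set_integrable lborel {0..1} \<gamma>" using c by (rule borel_integrable_atLeastAtMost')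
  have ne: "{0..1::real} \<noteq> {}" by auto
  obtain a where a: "a \<in> {0..1}" "\<And>x. x \<in> {0..1} \<Longrightarrow> \<gamma> a \<le> \<gamma> x"
    using continuous_attains_inf[OF compact_Icc ne c] by blast
  obtain b where b: "b \<in> {0..1}" "\<And>x. x \<in> {0..1} \<Longrightarrow> \<gamma> x \<le> \<gamma> b"
    using continuous_attains_sup[OF compact_Icc ne c] by blast
  note ab = a(1) b(1) a(2) b(2)
  have "\<gamma> a = (LINT x:{0..1::real}|lborel. \<gamma> a)" "\<gamma> b = (LINT x:{0..1::real}|lborel. \<gamma> b)"
    by (simp_all add: set_lebesgue_integral_def)
  moreover have "(LINT x:{0..1::real}|lborel. \<gamma> a) \<le> (LINT x:{0..1}|lborel. \<gamma> x)" "(LINT x:{0..1}|lborel. \<gamma> x) \<le> (LINT x:{0..1::real}|lborel. \<gamma> b)"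
    using i ab by (auto intro!: set_integral_mono simp: set_integrable_def)
  ultimately have "\<gamma> a \<le> (LINT x:{0..1}|lborel. \<gamma> x)" "(LINT x:{0..1}|lborel. \<gamma> x) \<le> \<gamma> b" by auto
  moreover have "connected (\<gamma> ` {0..1})" using c by (intro connected_continuous_image) auto
  ultimately have "(LINT x:{0..1}|lborel. \<gamma> x) \<in> \<gamma> ` {0..1}"
    using ab(1,2) unfolding connected_iff_interval by blast
  then show ?thesis by force
qed

text \<open>The continuous representative attains its mean somewhere on the circle, and there
  \<open>\<theta>\<close> vanishes; elsewhere \<open>\<theta>\<close> is at most the variation of
  the composition over the circle. With truncations for \<open>\<theta>\<close> this yields
  inequalities on superlevel sets.\<close>

lemma wac_slice_bound:
  assumes "wac v d" and der: "\<And>y. (\<theta> has_real_derivative \<theta>' y) (at y)" and cont: "continuous_on UNIV \<theta>'"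
    and z: "\<theta> (\<integral>x. v x \<partial>T1) = 0"
  shows "AE x in T1. ennreal \<bar>\<theta> (v x)\<bar> \<le> (\<integral>\<^sup>+x. ennreal \<bar>\<theta>' (v x) * d x\<bar> \<partial>T1)"
proof -
  obtain \<gamma> where g: "ac \<gamma> d" "AE x in lborel. v x = \<gamma> x" using assms by (auto simp: wac_def)
  have m[measurable]: "v \<in> borel_measurable borel" "d \<in> borel_measurable borel" using assms by (auto simp: wac_def)
  have [measurable]: "\<theta>' \<in> borel_measurable borel" using cont by (rule borel_measurable_continuous_onI)
  obtain y where y: "y \<in> {0..1}" "\<gamma> y = (LINT x:{0..1}|lborel. \<gamma> x)"
    using ac_mean_attained[OF ac_continuous[OF g(1)]] by blast
  have "set_integrable lborel {0..1} \<gamma>"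
    using ac_continuous[OF g(1)] by (intro borel_integrable_atLeastAtMost') (auto intro: continuous_on_subset)
  then have "\<gamma> y = (\<integral>x. v x \<partial>T1)"
    using set_integral_cong_AE'(2)[of "{0..1}" \<gamma> v] g(2) m y(2) by (simp add: integrable_T1 eq_commute)
  then have \<theta>y: "\<theta> (\<gamma> y) = 0" using z by simp
  have der': "((\<lambda>z. \<theta> (fst z)) has_derivative (\<lambda>h. fst h * \<theta>' (fst z) + snd h * 0)) (at z)" for z :: "real \<times> real"
    using has_derivative_compose[OF has_derivative_fst[OF has_derivative_ident] der[unfolded has_field_derivative_def], of z UNIV]
    by (simp add: mult.commute)
  have "ac (\<lambda>t. \<theta> (\<gamma> t)) (\<lambda>t. \<theta>' (\<gamma> t) * d t)"
    using ac_chain[OF g(1) g(1) der'] continuous_on_compose2[OF cont continuous_on_fst[OF continuous_on_id], of UNIV] by simp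
  then have a: "ac (\<lambda>t. \<theta> (\<gamma> t)) (\<lambda>t. \<theta>' (v t) * d t)"
    by (rule ac_cong_AE) (use g(2) in auto)
  have "\<bar>\<theta> (\<gamma> x)\<bar> \<le> (LINT x:{0..1}|lborel. \<bar>\<theta>' (v x) * d x\<bar>)" if "x \<in> {0..1}" for x
    using ac_bound[OF a that y(1)] \<theta>y by simp
  then have bd: "ennreal \<bar>\<theta> (\<gamma> x)\<bar> \<le> ennreal (LINT x:{0..1}|lborel. \<bar>\<theta>' (v x) * d x\<bar>)" if "x \<in> {0..1}" for x
    using that by (intro ennreal_leI)
  have "ennreal (LINT x:{0..1}|lborel. \<bar>\<theta>' (v x) * d x\<bar>) = (\<integral>\<^sup>+x. ennreal \<bar>\<theta>' (v x) * d x\<bar> \<partial>T1)"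
  proof -
    have "set_integrable lborel {0..1} (\<lambda>x. \<bar>\<theta>' (v x) * d x\<bar>)"
      using acD(1)[OF a, of 0 1] by (auto intro: set_integrable_abs)
    then show ?thesis
      by (subst nn_integral_eq_integral) (auto simp: integrable_T1)
  qed
  with bd have "ennreal \<bar>\<theta> (\<gamma> x)\<bar> \<le> (\<integral>\<^sup>+x. ennreal \<bar>\<theta>' (v x) * d x\<bar> \<partial>T1)" if "x \<in> {0..1}" for x
    using that by simp
  then show ?thesis unfolding AE_T1 using g(2) by (auto elim!: eventually_mono)
qed

lemma borel_measurable_fst_snd[measurable]:
  "(fst :: real \<times> real \<Rightarrow> real) \<in> borel_measurable borel" "(snd :: real \<times> real \<Rightarrow> real) \<in> borel_measurable borel"
  by (auto intro!: borel_measurable_continuous_onI continuous_intros)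

section \<open>Weak derivatives and absolute continuity on lines\<close>

text \<open>\<open>R\<close> bounds the support. Products of two such functions of one variable are
  the only test functions needed for passing from weak derivatives to lines.\<close>

definition C1c :: "(real \<Rightarrow> real) \<Rightarrow> (real \<Rightarrow> real) \<Rightarrow> real \<Rightarrow> bool" where
  "C1c \<alpha> \<alpha>' R \<longleftrightarrow> (\<forall>x. (\<alpha> has_real_derivative \<alpha>' x) (at x)) \<and> continuous_on UNIV \<alpha>' \<and>
     (\<forall>x. \<bar>x\<bar> \<ge> R \<longrightarrow> \<alpha> x = 0 \<and> \<alpha>' x = 0)"

lemma C1cD:
  assumes "C1c \<alpha> \<alpha>' R"
  shows "(\<alpha> has_real_derivative \<alpha>' x) (at x)" "continuous_on A \<alpha>'" "continuous_on A \<alpha>"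
    "R \<le> \<bar>x\<bar> \<Longrightarrow> \<alpha> x = 0" "R \<le> \<bar>x\<bar> \<Longrightarrow> \<alpha>' x = 0"
proof -
  show d: "(\<alpha> has_real_derivative \<alpha>' x) (at x)" for x using assms by (auto simp: C1c_def)
  show "continuous_on A \<alpha>'" using assms by (auto simp: C1c_def intro: continuous_on_subset)
  show "continuous_on A \<alpha>" using d by (meson DERIV_isCont continuous_at_imp_continuous_on)
qed (use assms in \<open>auto simp: C1c_def\<close>)

lemma C1c_mono: "C1c \<alpha> \<alpha>' R \<Longrightarrow> R \<le> R' \<Longrightarrow> C1c \<alpha> \<alpha>' R'"
  by (auto simp: C1c_def)

lemma test_fun_product:
  assumes a: "C1c \<alpha> \<alpha>' R" and b: "C1c \<beta> \<beta>' R"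
  shows "test_fun (\<lambda>x. \<alpha> (fst x) * \<beta> (snd x)) (\<lambda>x. \<alpha>' (fst x) * \<beta> (snd x)) (\<lambda>x. \<alpha> (fst x) * \<beta>' (snd x))"
  unfolding test_fun_def
proof (intro conjI allI)
  have c: "continuous_on UNIV (\<lambda>x::real\<times>real. \<alpha> (fst x))" "continuous_on UNIV (\<lambda>x::real\<times>real. \<alpha>' (fst x))"
    "continuous_on UNIV (\<lambda>x::real\<times>real. \<beta> (snd x))" "continuous_on UNIV (\<lambda>x::real\<times>real. \<beta>' (snd x))"
    by (rule continuous_on_compose2[OF C1cD(3)[OF a, of UNIV]] continuous_on_compose2[OF C1cD(2)[OF a, of UNIV]]
      continuous_on_compose2[OF C1cD(3)[OF b, of UNIV]] continuous_on_compose2[OF C1cD(2)[OF b, of UNIV]]; auto intro: continuous_intros)+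
  show "continuous_on UNIV (\<lambda>x::real\<times>real. \<alpha>' (fst x) * \<beta> (snd x))" "continuous_on UNIV (\<lambda>x::real\<times>real. \<alpha> (fst x) * \<beta>' (snd x))"
    using c by (auto intro: continuous_intros)
  fix x :: "real \<times> real"
  have A: "((\<lambda>x. \<alpha> (fst x)) has_derivative (\<lambda>h. \<alpha>' (fst x) * fst h)) (at x)"
    using has_derivative_compose[OF has_derivative_fst[OF has_derivative_ident] C1cD(1)[OF a, unfolded has_field_derivative_def], of x UNIV] by simp
  have B: "((\<lambda>x. \<beta> (snd x)) has_derivative (\<lambda>h. \<beta>' (snd x) * snd h)) (at x)"
    using has_derivative_compose[OF has_derivative_snd[OF has_derivative_ident] C1cD(1)[OF b, unfolded has_field_derivative_def], of x UNIV] by simp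
  show "((\<lambda>x. \<alpha> (fst x) * \<beta> (snd x)) has_derivative
      (\<lambda>h. fst h * (\<alpha>' (fst x) * \<beta> (snd x)) + snd h * (\<alpha> (fst x) * \<beta>' (snd x)))) (at x)"
    by (rule has_derivative_eq_rhs[OF has_derivative_mult[OF A B]]) (auto simp: algebra_simps)
next
  have "{x::real\<times>real. \<alpha> (fst x) * \<beta> (snd x) \<noteq> 0} \<subseteq> cbox (-R, -R) (R, R)"
  proof
    fix x :: "real \<times> real" assume "x \<in> {x. \<alpha> (fst x) * \<beta> (snd x) \<noteq> 0}"
    then have "\<not> R \<le> \<bar>fst x\<bar>" "\<not> R \<le> \<bar>snd x\<bar>" using C1cD(4)[OF a] C1cD(4)[OF b] by auto
    then show "x \<in> cbox (-R, -R) (R, R)" by (cases x) (auto simp: cbox_Pair_eq)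
  qed
  then show "compact (closure {x::real\<times>real. \<alpha> (fst x) * \<beta> (snd x) \<noteq> 0})"
    using bounded_subset[OF bounded_cbox] by (simp add: compact_closure)
qed

lemma integrable_mult_compact_support:
  fixes f g :: "'a::euclidean_space \<Rightarrow> real"
  assumes g: "continuous_on UNIV g" "\<And>x. x \<notin> cbox a b \<Longrightarrow> g x = 0"
    and f: "set_integrable lborel (cbox a b) f" "f \<in> borel_measurable borel"
  shows "integrable lborel (\<lambda>x. g x * f x)"
proof -
  have "compact (g ` cbox a b)" using g by (intro compact_continuous_image) (auto intro: continuous_on_subset)
  then obtain B where B: "\<And>x. x \<in> cbox a b \<Longrightarrow> \<bar>g x\<bar> \<le> B"
    by (force dest!: compact_imp_bounded simp: bounded_iff)
  have [measurable]: "g \<in> borel_measurable borel" "f \<in> borel_measurable borel" using g f by (auto intro: borel_measurable_continuous_onI)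
  have "integrable lborel (\<lambda>x. B * (indicator (cbox a b) x *\<^sub>R f x))" using f by (auto simp: set_integrable_def)
  then show ?thesis
  proof (rule Bochner_Integration.integrable_bound)
    have "norm (g x * f x) \<le> norm (B * (indicator (cbox a b) x *\<^sub>R f x))" for x
    proof (cases "x \<in> cbox a b")
      case True
      then show ?thesis using B[OF True] by (auto simp: abs_mult intro!: mult_right_mono)
    qed (simp add: g)
    then show "AE x in lborel. norm (g x * f x) \<le> norm (B * (indicator (cbox a b) x *\<^sub>R f x))" by simp
  qed simp
qed

text \<open>A \<open>C^1\<close> approximation of the indicator of the open interval from
  \<open>l\<close> to \<open>r\<close>: the squares make it flat at the end points, and the factor
  \<open>n\<close> in the exponent drives the value to one wherever the product of squares is
  positive. All values lie between zero and one.\<close>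

definition bump :: "real \<Rightarrow> real \<Rightarrow> nat \<Rightarrow> real \<Rightarrow> real" where
  "bump l r n x = 1 - exp (- real n * ((max 0 (x - l))\<^sup>2 * (max 0 (r - x))\<^sup>2))"

lemma max_square_has_derivative: "((\<lambda>t::real. (max 0 t)\<^sup>2) has_real_derivative 2 * max 0 t) (at t)"
proof -
  consider "t < 0" | "t = 0" | "t > 0" by linarith
  then show ?thesis
  proof cases
    case 1
    have "((\<lambda>t::real. 0) has_real_derivative 2 * max 0 t) (at t)" using 1 by (auto intro!: derivative_eq_intros)
    then show ?thesis
      by (rule DERIV_cong_ev[OF refl _ refl, THEN iffD1, rotated])
        (use eventually_nhds_in_open[of "{..<0}" t] 1 in \<open>auto elim: eventually_mono\<close>)
  next
    case 3
    have "((\<lambda>t::real. t\<^sup>2) has_real_derivative 2 * max 0 t) (at t)" using 3 by (auto intro!: derivative_eq_intros)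
    then show ?thesis
      by (rule DERIV_cong_ev[OF refl _ refl, THEN iffD1, rotated])
        (use eventually_nhds_in_open[of "{0<..}" t] 3 in \<open>auto elim: eventually_mono\<close>)
  next
    case 2
    have "((\<lambda>h. ((max 0 (0 + h))\<^sup>2 - (max 0 0)\<^sup>2) / h) \<longlongrightarrow> (0::real)) (at 0)"
    proof (rule Lim_null_comparison[where g="\<lambda>h. \<bar>h\<bar>"])
      show "\<forall>\<^sub>F h in at 0. norm (((max 0 (0 + h))\<^sup>2 - (max 0 0)\<^sup>2) / h) \<le> \<bar>h::real\<bar>"
        by (intro always_eventually allI) (auto simp: max_def power2_eq_square)
      show "((\<lambda>h::real. \<bar>h\<bar>) \<longlongrightarrow> 0) (at 0)" by (rule tendsto_eq_intros | simp)+
    qed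
    then show ?thesis using 2 by (simp add: DERIV_def)
  qed
qed

lemma bump_C1c:
  obtains b' where "C1c (bump l r n) b' (max \<bar>l\<bar> \<bar>r\<bar>)"
proof -
  let ?b = "\<lambda>x. (max 0 (x - l))\<^sup>2 * (max 0 (r - x))\<^sup>2"
  let ?b' = "\<lambda>x. 2 * max 0 (x - l) * (max 0 (r - x))\<^sup>2 - (max 0 (x - l))\<^sup>2 * (2 * max 0 (r - x))"
  have d1: "((\<lambda>x. (max 0 (x - l))\<^sup>2) has_real_derivative 2 * max 0 (x - l)) (at x)" for x
    by (rule DERIV_chain2[OF max_square_has_derivative, of "\<lambda>x. x - l" 1 x UNIV, simplified]) (auto intro!: derivative_eq_intros)
  have d2: "((\<lambda>x. (max 0 (r - x))\<^sup>2) has_real_derivative - (2 * max 0 (r - x))) (at x)" for x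
    by (rule DERIV_chain2[OF max_square_has_derivative, of "\<lambda>x. r - x" "-1" x UNIV, simplified]) (auto intro!: derivative_eq_intros)
  have d: "(?b has_real_derivative ?b' x) (at x)" for x
    using DERIV_mult[OF d1[of x] d2[of x]] by (simp add: algebra_simps)
  have e: "(bump l r n has_real_derivative real n * ?b' x * exp (- real n * ?b x)) (at x)" for x
    unfolding bump_def by (rule derivative_eq_intros d refl | simp)+
  have "?b x = 0 \<and> ?b' x = 0" if "max \<bar>l\<bar> \<bar>r\<bar> \<le> \<bar>x\<bar>" for x
  proof -
    have "x \<le> l \<or> r \<le> x" using that by linarith
    then show ?thesis by auto
  qed
  then have "C1c (bump l r n) (\<lambda>x. real n * ?b' x * exp (- real n * ?b x)) (max \<bar>l\<bar> \<bar>r\<bar>)"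
    unfolding C1c_def using e by (auto simp: bump_def intro!: continuous_intros)
  then show ?thesis by (rule that)
qed

lemma bump_bounds: "0 \<le> bump l r n x" "bump l r n x \<le> 1" "x \<notin> {l<..<r} \<Longrightarrow> bump l r n x = 0"
  by (auto simp: bump_def max_def not_less)

lemma bump_tendsto: "(\<lambda>n. bump l r n x) \<longlonglongrightarrow> indicator {l<..<r} x"
proof (cases "x \<in> {l<..<r}")
  case True
  let ?b = "(max 0 (x - l))\<^sup>2 * (max 0 (r - x))\<^sup>2"
  have b: "?b > 0" using True by auto
  have "(\<lambda>n. (exp (- ?b)) ^ n) \<longlonglongrightarrow> 0" using b by (intro LIMSEQ_realpow_zero) auto
  then have "(\<lambda>n. exp (- real n * ?b)) \<longlonglongrightarrow> 0" by (simp add: exp_of_nat_mult[symmetric])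
  then have "(\<lambda>n. 1 - exp (- real n * ?b)) \<longlonglongrightarrow> 1 - 0" by (intro tendsto_intros)
  then show ?thesis using True by (simp add: bump_def)
qed (auto simp: bump_bounds)

text \<open>Dominated convergence turns products of bumps into indicators of open boxes, which
  differ from closed ones by null sets; then \<open>AE_zero_if_box_integrals_zero\<close>
  applies.\<close>

lemma AE_zero_if_bump_integrals_zero:
  fixes z :: "real \<times> real \<Rightarrow> real"
  assumes li: "\<And>a b. set_integrable lborel (cbox a b) z" and m: "z \<in> borel_measurable borel"
    and zero: "\<And>l r l' r' n. (\<integral>x. bump l r n (fst x) * bump l' r' n (snd x) * z x \<partial>lborel) = 0"
  shows "AE x in lborel. z x = 0"
proof (rule AE_zero_if_box_integrals_zero[OF li])
  fix a b :: "real \<times> real"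
  obtain l l' r r' where ab: "a = (l, l')" "b = (r, r')" by (cases a, cases b)
  note [measurable] = m
  have bm[measurable]: "bump l r n \<in> borel_measurable borel" for l r n
    using bump_C1c C1cD(3) by (metis borel_measurable_continuous_onI)
  let ?f = "\<lambda>n x. bump l r n (fst x) * bump l' r' n (snd x) * z x"
  let ?g = "\<lambda>x. indicator {l<..<r} (fst x) * indicator {l'<..<r'} (snd x) * z x"
  have "(\<lambda>n. \<integral>x. ?f n x \<partial>lborel) \<longlonglongrightarrow> (\<integral>x. ?g x \<partial>lborel)"
  proof (rule integral_dominated_convergence[where w="\<lambda>x. norm (indicator (cbox a b) x *\<^sub>R z x)"])
    show "integrable lborel (\<lambda>x. norm (indicator (cbox a b) x *\<^sub>R z x))"
      using li[of a b] by (intro integrable_norm) (simp add: set_integrable_def)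
    show "AE x in lborel. (\<lambda>n. ?f n x) \<longlonglongrightarrow> ?g x"
      by (intro AE_I2 tendsto_mult bump_tendsto tendsto_const)
    fix n
    have "norm (?f n x) \<le> norm (indicator (cbox a b) x *\<^sub>R z x)" for x
    proof (cases "x \<in> cbox a b")
      case True
      have "\<bar>bump l r n (fst x) * bump l' r' n (snd x)\<bar> \<le> 1"
        using bump_bounds(1,2)[of l r n "fst x"] bump_bounds(1,2)[of l' r' n "snd x"] by (auto simp: abs_mult mult_le_one)
      then show ?thesis using True mult_right_mono[of _ 1 "\<bar>z x\<bar>"] by (simp add: abs_mult)
    next
      case False
      then have "fst x \<notin> {l<..<r} \<or> snd x \<notin> {l'<..<r'}" by (cases x) (auto simp: ab cbox_Pair_eq)
      then show ?thesis by (auto simp: bump_bounds)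
    qed
    then show "AE x in lborel. norm (?f n x) \<le> norm (indicator (cbox a b) x *\<^sub>R z x)" by simp
  qed simp_all
  then have "(\<integral>x. ?g x \<partial>lborel) = 0" using zero by (simp add: LIMSEQ_const_iff)
  moreover have "(\<integral>x. ?g x \<partial>lborel) = (\<integral>x. indicator (cbox a b) x *\<^sub>R z x \<partial>lborel)"
  proof (rule integral_cong_AE)
    have "AE x in lborel. x \<notin> cbox a b - box a b"
      by (intro AE_not_in) (auto simp: null_sets_def emeasure_Diff content_eq_0 emeasure_lborel_box_eq emeasure_lborel_cbox_eq box_subset_cbox)
    then show "AE x in lborel. ?g x = indicator (cbox a b) x *\<^sub>R z x"
      by eventually_elim (auto simp: ab mem_box Basis_prod_def indicator_def)
  qed simp_all
  ultimately show "(LINT x:cbox a b|lborel. z x) = 0" by (simp add: set_lebesgue_integral_def)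
qed

lemma lborel_pair_nn_integral:
  fixes f :: "real \<times> real \<Rightarrow> ennreal"
  assumes "f \<in> borel_measurable borel"
  shows "(\<integral>\<^sup>+x. f x \<partial>lborel) = (\<integral>\<^sup>+y. \<integral>\<^sup>+x. f (x, y) \<partial>lborel \<partial>lborel)"
  using lborel_pair.nn_integral_snd[of f] assms by (simp add: lborel_prod)

lemma lborel_pair_integral:
  fixes f :: "real \<times> real \<Rightarrow> real"
  assumes "integrable lborel f"
  shows "AE y in lborel. integrable lborel (\<lambda>x. f (x, y))"
    "integrable lborel (\<lambda>y. \<integral>x. f (x, y) \<partial>lborel)"
    "(\<integral>y. \<integral>x. f (x, y) \<partial>lborel \<partial>lborel) = (\<integral>x. f x \<partial>lborel)"
  using lborel_pair.AE_integrable_snd[of "\<lambda>x y. f (x, y)"] lborel_pair.integrable_snd[of "\<lambda>x y. f (x, y)"]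
    lborel_pair.integral_snd[of "\<lambda>x y. f (x, y)"] assms
  by (auto simp: lborel_prod)

lemma ac_C1c: assumes "C1c \<alpha> \<alpha>' R" shows "ac \<alpha> \<alpha>'"
  unfolding ac_def
proof (intro allI impI conjI)
  fix s t :: real assume st: "s \<le> t"
  show "set_integrable lborel {s..t} \<alpha>'" using C1cD(2)[OF assms] by (rule borel_integrable_atLeastAtMost')
  have "(\<integral>x. indicator {s..t} x *\<^sub>R \<alpha>' x \<partial>lborel) = \<alpha> t - \<alpha> s"
  proof (rule integral_FTC_atLeastAtMost[OF st])
    show "(\<alpha> has_vector_derivative \<alpha>' x) (at x within {s..t})" for x
      using C1cD(1)[OF assms, of x] by (simp add: has_real_derivative_iff_has_vector_derivative[symmetric] has_field_derivative_at_within)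
  qed (rule C1cD(2)[OF assms])
  then show "\<alpha> t - \<alpha> s = (LINT x:{s..t}|lborel. \<alpha>' x)" by (simp add: set_lebesgue_integral_def)
qed

lemma ac_mult:
  assumes "ac f f'" "ac g g'"
  shows "ac (\<lambda>t. f t * g t) (\<lambda>t. g t * f' t + f t * g' t)"
proof -
  have "((\<lambda>z. fst z * snd z) has_derivative (\<lambda>h. fst h * snd z + snd h * fst z)) (at z)" for z :: "real \<times> real"
    by (auto intro!: derivative_eq_intros simp: algebra_simps)
  from ac_chain[OF assms this continuous_on_snd[OF continuous_on_id] continuous_on_fst[OF continuous_on_id]] show ?thesis by simp
qed

text \<open>The kernel of the primitive: the integral of \<open>primK x t * d t\<close> over \<open>t\<close> is that of \<open>d\<close> from \<open>0\<close> to \<open>x\<close>.\<close>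

definition primK :: "real \<Rightarrow> real \<Rightarrow> real" where
  "primK x t = indicator {0..x} t - indicator {x..0} t"

lemma primK_alt: "primK x t = (if 0 \<le> t \<and> t \<le> x then 1 else 0) - (if x \<le> t \<and> t \<le> 0 then 1 else 0)"
  by (auto simp: primK_def indicator_def)

lemma set_integrable_all_intervals:
  fixes f :: "real \<Rightarrow> real"
  assumes "\<forall>n::nat. set_integrable lborel {-real n..real n} f"
  shows "set_integrable lborel {s..t} f"
proof -
  obtain n :: nat where "max \<bar>s\<bar> \<bar>t\<bar> \<le> real n" using real_arch_simple by blast
  then show ?thesis by (intro set_integrable_subset[OF assms[rule_format, of n]]) auto
qed

lemma ac_primitive:
  fixes d :: "real \<Rightarrow> real"
  assumes "\<forall>n::nat. set_integrable lborel {-real n..real n} d"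
  shows "ac (\<lambda>x. \<integral>t. primK x t * d t \<partial>lborel) d"
proof -
  note i = set_integrable_all_intervals[OF assms]
  have eq: "(\<integral>t. primK x t * d t \<partial>lborel) = (LINT t:{0..x}|lborel. d t) - (LINT t:{x..0}|lborel. d t)" for x
    unfolding primK_def set_lebesgue_integral_def left_diff_distrib
    using i by (subst Bochner_Integration.integral_diff) (auto simp: set_integrable_def)
  have e: "(LINT t:{x..x}|lborel. d t) = 0" for x
    using set_borel_integral_eq_integral(2)[OF i[of x x]] by simp
  have emp: "x < x' \<Longrightarrow> (LINT t:{x'..x}|lborel. d t) = 0" for x x' by (simp add: set_lebesgue_integral_def)
  show ?thesis unfolding ac_def eq
  proof (intro allI impI conjI i)
    fix s t :: real assume st: "s \<le> t"
    consider "0 \<le> s" | "t \<le> 0" "s < 0" | "s < 0" "0 < t" using st by linarith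
    then show "(LINT r:{0..t}|lborel. d r) - (LINT r:{t..0}|lborel. d r) -
       ((LINT r:{0..s}|lborel. d r) - (LINT r:{s..0}|lborel. d r)) = (LINT r:{s..t}|lborel. d r)"
    proof cases
      case 1
      then show ?thesis using set_integral_combine[OF i 1 st] e[of 0] emp[of 0 s] emp[of 0 t] st
        by (cases "s = 0"; cases "t = 0") auto
    next
      case 2
      then show ?thesis using set_integral_combine[OF i st 2(1)] e[of 0] emp[of s 0] emp[of t 0]
        by (cases "t = 0") auto
    next
      case 3
      then show ?thesis using set_integral_combine[OF i, of s 0 t] emp[of s 0] emp[of 0 t] by auto
    qed
  qed
qed

text \<open>Subtracting the primitive of \<open>D\<close> in the first variable leaves a function whose integrals against
  products \<open>\<alpha>'(x\<^sub>1) \<beta>(x\<^sub>2)\<close> vanish; by du Bois-Reymond it depends on \<open>x\<^sub>2\<close> only.\<close>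

lemma weak_derivative_imp_wac:
  fixes u D :: "real \<times> real \<Rightarrow> real"
  assumes m[measurable]: "u \<in> borel_measurable borel" "D \<in> borel_measurable borel"
    and li: "\<And>a b. set_integrable lborel (cbox a b) u" "\<And>a b. set_integrable lborel (cbox a b) D"
    and weak: "\<And>\<alpha> \<alpha>' \<beta> \<beta>' R. C1c \<alpha> \<alpha>' R \<Longrightarrow> C1c \<beta> \<beta>' R \<Longrightarrow>
      (\<integral>x. \<alpha>' (fst x) * \<beta> (snd x) * u x \<partial>lborel) = - (\<integral>x. \<alpha> (fst x) * \<beta> (snd x) * D x \<partial>lborel)"
  shows "AE x2 in lborel. wac (\<lambda>x1. u (x1, x2)) (\<lambda>x1. D (x1, x2))"
proof -
  \<comment> \<open>The primitive of \<open>D\<close> along the first variable that vanishes at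
    \<open>0\<close>. Written with the kernel \<open>primK\<close> it is a parameter integral, hence
    jointly measurable.\<close>
  define \<gamma> where "\<gamma> x = (\<integral>t. primK (fst x) t * D (t, snd x) \<partial>lborel)" for x :: "real \<times> real"
  have [measurable]: "(\<lambda>(x, t). primK (fst x) t * D (t, snd x)) \<in> borel_measurable ((borel :: (real \<times> real) measure) \<Otimes>\<^sub>M borel)"
    unfolding primK_alt by measurable
  have \<gamma>m[measurable]: "\<gamma> \<in> borel_measurable borel"
    unfolding \<gamma>_def by (intro lborel.borel_measurable_lebesgue_integral) (simp add: case_prod_beta')
  have good: "AE x2 in lborel. \<forall>n::nat. set_integrable lborel {-real n..real n} (\<lambda>x1. D (x1, x2))"
    unfolding AE_all_countable
  proof
    fix n :: nat
    have "AE x2 in lborel. \<forall>k::nat. integrable lborel (\<lambda>x1. indicator (cbox (-real n, -real k) (real n, real k)) (x1, x2) *\<^sub>R D (x1, x2))"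
      unfolding AE_all_countable
      using lborel_pair_integral(1)[OF li(2)[unfolded set_integrable_def]] by blast
    then show "AE x2 in lborel. set_integrable lborel {-real n..real n} (\<lambda>x1. D (x1, x2))"
    proof eventually_elim
      case (elim x2)
      obtain k :: nat where "\<bar>x2\<bar> \<le> real k" using real_arch_simple by blast
      then have "indicator (cbox (-real n, -real k) (real n, real k)) (x1, x2) = (indicator {-real n..real n} x1 :: real)" for x1
        by (auto simp: indicator_def cbox_Pair_eq)
      then show ?case using elim[rule_format, of k] by (simp add: set_integrable_def)
    qed
  qed
  note sub = set_integrable_all_intervals
  have \<gamma>ac: "AE x2 in lborel. ac (\<lambda>x1. \<gamma> (x1, x2)) (\<lambda>x1. D (x1, x2))"
    using good by eventually_elim (unfold \<gamma>_def fst_conv snd_conv, rule ac_primitive)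
  \<comment> \<open>Within the square \<open>?Q\<close> the primitive is at most the integral of the
    absolute value of \<open>D\<close> along the whole chord, which Fubini makes integrable.\<close>
  have \<gamma>li: "set_integrable lborel (cbox a b) \<gamma>" for a b
  proof -
    obtain n :: nat where n: "norm a \<le> real n" "norm b \<le> real n"
      using real_arch_simple[of "max (norm a) (norm b)"] by auto
    let ?Q = "cbox (-real n, -real n) (real n, real n)"
    have "cbox a b \<subseteq> ?Q"
    proof -
      have "\<bar>fst a\<bar> \<le> real n" "\<bar>snd a\<bar> \<le> real n" "\<bar>fst b\<bar> \<le> real n" "\<bar>snd b\<bar> \<le> real n"
        using n norm_fst_le[of "fst a" "snd a"] norm_snd_le[of "snd a" "fst a"] norm_fst_le[of "fst b" "snd b"] norm_snd_le[of "snd b" "fst b"] by auto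
      then show ?thesis by (cases a, cases b) (auto simp: cbox_Pair_eq)
    qed
    moreover have "set_integrable lborel ?Q \<gamma>"
      unfolding set_integrable_def
    proof (rule integrableI_bounded)
      define G where "G t y = ennreal \<bar>indicator ?Q (t, y) *\<^sub>R D (t, y)\<bar>" for t y
      have [measurable]: "(\<lambda>(t, y). G t y) \<in> borel_measurable (borel \<Otimes>\<^sub>M borel)" unfolding G_def borel_prod by measurable
      have "integrable lborel (\<lambda>x. indicator ?Q x *\<^sub>R D x)" using li(2) by (simp add: set_integrable_def)
      then have "(\<integral>\<^sup>+x. ennreal (norm (indicator ?Q x *\<^sub>R D x)) \<partial>(lborel \<Otimes>\<^sub>M lborel)) < \<infinity>"
        by (simp add: integrable_iff_bounded lborel_prod)
      then have fin: "(\<integral>\<^sup>+y. \<integral>\<^sup>+t. G t y \<partial>lborel \<partial>lborel) < \<infinity>"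
        by (subst lborel_pair.nn_integral_snd[of "\<lambda>(t,y). G t y", simplified]) (simp_all add: G_def case_prod_beta')
      have "(\<integral>\<^sup>+x. ennreal (norm (indicator ?Q x *\<^sub>R \<gamma> x)) \<partial>lborel) = (\<integral>\<^sup>+y. \<integral>\<^sup>+x. ennreal (norm (indicator ?Q (x,y) *\<^sub>R \<gamma> (x,y))) \<partial>lborel \<partial>lborel)"
        by (rule lborel_pair_nn_integral) simp
      also have "\<dots> \<le> (\<integral>\<^sup>+y. \<integral>\<^sup>+x. indicator {-real n..real n} x * (\<integral>\<^sup>+t. G t y \<partial>lborel) \<partial>lborel \<partial>lborel)"
      proof (intro nn_integral_mono)
        fix x y :: real
        show "ennreal (norm (indicator ?Q (x,y) *\<^sub>R \<gamma> (x,y))) \<le> indicator {-real n..real n} x * (\<integral>\<^sup>+t. G t y \<partial>lborel)"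
        proof (cases "(x, y) \<in> ?Q")
          case True
          then have xy: "x \<in> {-real n..real n}" "y \<in> {-real n..real n}" by (auto simp: cbox_Pair_eq)
          have "ennreal (norm (\<gamma> (x, y))) \<le> (\<integral>\<^sup>+t. norm (primK x t * D (t, y)) \<partial>lborel)"
            unfolding \<gamma>_def fst_conv snd_conv
            using integral_norm_bound_ennreal[of lborel "\<lambda>t. primK x t * D (t, y)"]
            by (cases "integrable lborel (\<lambda>t. primK x t * D (t, y))") (auto simp: not_integrable_integral_eq)
          also have "\<dots> \<le> (\<integral>\<^sup>+t. G t y \<partial>lborel)"
            using xy by (intro nn_integral_mono) (auto simp: G_def primK_alt indicator_def cbox_Pair_eq)
          finally show ?thesis using True xy by simp
        qed simp
      qed
      also have "\<dots> = ennreal (2 * real n) * (\<integral>\<^sup>+y. \<integral>\<^sup>+t. G t y \<partial>lborel \<partial>lborel)"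
        by (simp add: nn_integral_multc nn_integral_cmult)
      also have "\<dots> < \<infinity>" using fin by (simp add: ennreal_mult_less_top)
      finally show "(\<integral>\<^sup>+x. ennreal (norm (indicator ?Q x *\<^sub>R \<gamma> x)) \<partial>lborel) < \<infinity>" .
    qed simp
    ultimately show ?thesis by (rule set_integrable_subset[rotated 2]) simp
  qed
  \<comment> \<open>The weak derivative of this difference in the first variable is zero; the rest
    of the proof shows that it depends on the second variable only.\<close>
  define v where "v x = u x - \<gamma> x" for x
  have vm[measurable]: "v \<in> borel_measurable borel" unfolding v_def by simp
  have vli: "set_integrable lborel (cbox a b) v" for a b
    unfolding v_def using li(1) \<gamma>li by (rule set_integral_diff)
  have Cint: "integrable lborel (\<lambda>x. \<alpha> (fst x) * \<beta> (snd x) * f x)"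
    if "continuous_on UNIV \<alpha>" "continuous_on UNIV \<beta>" "\<And>x. R \<le> \<bar>x\<bar> \<Longrightarrow> \<alpha> x = 0" "\<And>x. R \<le> \<bar>x\<bar> \<Longrightarrow> \<beta> x = 0"
      "\<And>a b. set_integrable lborel (cbox a b) f" "f \<in> borel_measurable borel" for \<alpha> \<beta> :: "real \<Rightarrow> real" and R and f :: "real \<times> real \<Rightarrow> real"
  proof (rule integrable_mult_compact_support[where a="(-R,-R)" and b="(R,R)"])
    show "continuous_on UNIV (\<lambda>x::real\<times>real. \<alpha> (fst x) * \<beta> (snd x))"
      by (intro continuous_on_mult continuous_on_compose2[OF that(1)] continuous_on_compose2[OF that(2)]) (auto intro: continuous_intros)
    fix x :: "real \<times> real" assume "x \<notin> cbox (-R,-R) (R,R)"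
    then have "R \<le> \<bar>fst x\<bar> \<or> R \<le> \<bar>snd x\<bar>" by (cases x) (auto simp: cbox_Pair_eq)
    then show "\<alpha> (fst x) * \<beta> (snd x) = 0" using that(3,4) by auto
  qed (use that in auto)
  have CA: "integrable lborel (\<lambda>x. \<alpha>' (fst x) * \<beta> (snd x) * f x)"
    and CB: "integrable lborel (\<lambda>x. \<alpha> (fst x) * \<beta> (snd x) * f x)"
    if a: "C1c \<alpha> \<alpha>' R" and b: "C1c \<beta> \<beta>' R" and f: "\<And>a b. set_integrable lborel (cbox a b) f" "f \<in> borel_measurable borel"
    for \<alpha> \<alpha>' \<beta> \<beta>' R f
    using C1cD(2,3)[OF a, of UNIV] C1cD(3)[OF b, of UNIV] C1cD(4,5)[OF a] C1cD(4)[OF b] f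
    by (auto intro!: Cint[where R=R])
  have vweak: "(\<integral>x. \<alpha>' (fst x) * \<beta> (snd x) * v x \<partial>lborel) = 0" if a: "C1c \<alpha> \<alpha>' R" and b: "C1c \<beta> \<beta>' R" for \<alpha> \<alpha>' \<beta> \<beta>' R
  proof -
    note ia = CA[OF a b] and ib = CB[OF a b]
    have i: "integrable lborel (\<lambda>x. \<alpha>' (fst x) * \<beta> (snd x) * \<gamma> x + \<alpha> (fst x) * \<beta> (snd x) * D x)"
      using ia[OF \<gamma>li \<gamma>m] ib[OF li(2) m(2)] by simp
    have "(\<integral>x. \<alpha>' (fst x) * \<beta> (snd x) * \<gamma> x + \<alpha> (fst x) * \<beta> (snd x) * D x \<partial>lborel) =
      (\<integral>y. \<integral>x. \<alpha>' x * \<beta> y * \<gamma> (x, y) + \<alpha> x * \<beta> y * D (x, y) \<partial>lborel \<partial>lborel)"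
      using lborel_pair_integral(3)[OF i] by simp
    also have "\<dots> = (\<integral>y. 0 \<partial>(lborel :: real measure))"
    proof (rule integral_cong_AE)
      show "AE y in lborel. (\<integral>x. \<alpha>' x * \<beta> y * \<gamma> (x, y) + \<alpha> x * \<beta> y * D (x, y) \<partial>lborel) = 0"
        using \<gamma>ac
      proof eventually_elim
        case (elim y)
        have p: "ac (\<lambda>x. \<alpha> x * \<gamma> (x, y)) (\<lambda>x. \<gamma> (x, y) * \<alpha>' x + \<alpha> x * D (x, y))"
          by (rule ac_mult[OF ac_C1c[OF a] elim])
        have "\<alpha>' x * \<beta> y * \<gamma> (x, y) + \<alpha> x * \<beta> y * D (x, y) = \<beta> y * (indicator {-\<bar>R\<bar>..\<bar>R\<bar>} x *\<^sub>R (\<gamma> (x, y) * \<alpha>' x + \<alpha> x * D (x, y)))" for x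
          using C1cD(4)[OF a, of x] C1cD(5)[OF a, of x] by (auto simp: indicator_def algebra_simps)
        then have "(\<integral>x. \<alpha>' x * \<beta> y * \<gamma> (x, y) + \<alpha> x * \<beta> y * D (x, y) \<partial>lborel) = \<beta> y * (LINT x:{-\<bar>R\<bar>..\<bar>R\<bar>}|lborel. \<gamma> (x, y) * \<alpha>' x + \<alpha> x * D (x, y))"
          by (simp add: set_lebesgue_integral_def)
        also have "\<dots> = 0"
          using acD(2)[OF p, of "-\<bar>R\<bar>" "\<bar>R\<bar>"] C1cD(4)[OF a, of "\<bar>R\<bar>"] C1cD(4)[OF a, of "-\<bar>R\<bar>"] by simp
        finally show ?case .
      qed
      show "(\<lambda>y. \<integral>x. \<alpha>' x * \<beta> y * \<gamma> (x, y) + \<alpha> x * \<beta> y * D (x, y) \<partial>lborel) \<in> borel_measurable lborel"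
        using lborel_pair_integral(2)[OF i] by (simp add: borel_measurable_integrable)
    qed simp
    finally have "(\<integral>x. \<alpha>' (fst x) * \<beta> (snd x) * \<gamma> x \<partial>lborel) = - (\<integral>x. \<alpha> (fst x) * \<beta> (snd x) * D x \<partial>lborel)"
      using ia[OF \<gamma>li \<gamma>m] ib[OF li(2) m(2)] by simp
    then show ?thesis
      unfolding v_def right_diff_distrib using weak[OF a b] ia[OF li(1) m(1)] ia[OF \<gamma>li \<gamma>m] by simp
  qed
  obtain b1 where b1: "C1c (bump 0 1 1) b1 1" using bump_C1c[of 0 1 1] by auto
  define m0 where "m0 = (LINT x:{-1..1}|lborel. bump 0 1 1 x)"
  have bi: "set_integrable lborel {-1..1} (bump 0 1 1)" using C1cD(3)[OF b1] by (rule borel_integrable_atLeastAtMost')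
  have m0: "m0 > 0"
  proof -
    have "m0 \<noteq> 0"
    proof
      assume "m0 = 0"
      then have "AE x in lborel. indicator {-1..1} x *\<^sub>R bump 0 1 1 x = 0"
        using bi unfolding m0_def set_lebesgue_integral_def set_integrable_def
        by (subst (asm) integral_nonneg_eq_0_iff_AE) (auto simp: bump_bounds)
      then have "AE x in lborel. x \<notin> {0<..<1::real}"
        by eventually_elim (auto simp: bump_def indicator_def)
      then have "{0<..<1::real} \<in> null_sets lborel" by (subst (asm) AE_iff_null_sets[symmetric]) auto
      then show False by (auto dest!: null_setsD1)
    qed
    moreover have "m0 \<ge> 0" unfolding m0_def set_lebesgue_integral_def
      by (intro Bochner_Integration.integral_nonneg) (auto simp: bump_bounds)
    ultimately show ?thesis by simp
  qed
  \<comment> \<open>A fixed weight of integral one. The candidate for the value of \<open>v\<close>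
    on a line is its weighted mean \<open>c\<close> along that line.\<close>
  define \<alpha>0 where "\<alpha>0 x = bump 0 1 1 x / m0" for x
  have a0: "C1c \<alpha>0 (\<lambda>x. b1 x / m0) 1"
    using b1 m0 unfolding C1c_def \<alpha>0_def by (auto intro!: DERIV_cdivide continuous_intros)
  have a0R: "\<alpha>0 x = 0" if "\<bar>x\<bar> \<ge> 1" for x using C1cD(4)[OF a0 that] .
  have [measurable]: "\<alpha>0 \<in> borel_measurable borel" using C1cD(3)[OF a0] by (rule borel_measurable_continuous_onI)
  define c where "c y = (\<integral>x. \<alpha>0 x * v (x, y) \<partial>lborel)" for y
  have cm[measurable]: "c \<in> borel_measurable borel"
    unfolding c_def by (intro lborel.borel_measurable_lebesgue_integral) simp
  have key: "(\<integral>x. \<alpha> (fst x) * \<beta> (snd x) * v x \<partial>lborel) = (\<integral>x. \<alpha> x \<partial>lborel) * (\<integral>x. \<alpha>0 (fst x) * \<beta> (snd x) * v x \<partial>lborel)"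
    if a: "C1c \<alpha> \<alpha>' R" and b: "C1c \<beta> \<beta>' R" and R: "R \<ge> 1" for \<alpha> \<alpha>' \<beta> \<beta>' R
  proof -
    define I where "I = (\<integral>x. \<alpha> x \<partial>lborel)"
    have Ieq: "I = (LINT x:{-R..R}|lborel. \<alpha> x)" unfolding I_def set_lebesgue_integral_def
      by (rule Bochner_Integration.integral_cong) (use C1cD(4)[OF a] in \<open>force simp: indicator_def\<close>)+
    \<comment> \<open>Subtracting \<open>I * \<alpha>0\<close> makes the integral vanish, so
      \<open>g\<close> is the derivative of a compactly supported function and \<open>vweak\<close>
      applies to it.\<close>
    define g where "g x = \<alpha> x - I * \<alpha>0 x" for x
    have cg: "continuous_on A g" for A unfolding g_def by (intro continuous_intros C1cD(3)[OF a] C1cD(3)[OF a0])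
    have gR: "g x = 0" if "R \<le> \<bar>x\<bar>" for x using C1cD(4)[OF a that] a0R[of x] that R by (auto simp: g_def)
    have gi: "set_integrable lborel {s..t} g" for s t using cg by (rule borel_integrable_atLeastAtMost')
    have ai: "set_integrable lborel {s..t} \<alpha>" "set_integrable lborel {s..t} \<alpha>0" for s t
      using C1cD(3)[OF a] C1cD(3)[OF a0] by (auto intro: borel_integrable_atLeastAtMost')
    have "(LINT x:{-R..R}|lborel. \<alpha>0 x) = 1"
    proof -
      have "(LINT x:{-R..R}|lborel. \<alpha>0 x) = (LINT x:{-1..1}|lborel. \<alpha>0 x)" unfolding set_lebesgue_integral_def
        by (rule Bochner_Integration.integral_cong) (use a0R R in \<open>force simp: indicator_def\<close>)+
      also have "\<dots> = 1" using m0 by (simp add: \<alpha>0_def m0_def)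
      finally show ?thesis .
    qed
    then have g0: "(LINT x:{-R..R}|lborel. g x) = 0"
      unfolding g_def using ai Ieq by (subst set_integral_diff) auto
    define B where "B x = integral {-R..x} g" for x
    have BC: "C1c B g R" unfolding C1c_def
    proof (intro conjI allI impI cg)
      fix x
      show "(B has_real_derivative g x) (at x)"
      proof (cases "x \<le> -R")
        case True
        \<comment> \<open>\<open>B\<close> is an integral starting at \<open>-R\<close>, which shows
          nothing about points to the left of it. Near such a point it is rewritten with a base
          point further left, where \<open>g\<close> vanishes.\<close>
        let ?l = "x - 1" let ?r = "x + 1"
        have Beq: "integral {?l..t} g = B t" if "t \<in> {?l..?r}" for t
        proof (cases "t \<le> -R")
          case True
          have "integral {?l..t} g = integral {?l..t} (\<lambda>_. 0)"
            using True gR R by (intro Henstock_Kurzweil_Integration.integral_cong) auto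
          moreover have "B t = 0" using True by (cases "t = -R") (auto simp: B_def)
          ultimately show ?thesis by simp
        next
          case False
          have "integral {?l..-R} g = integral {?l..-R} (\<lambda>_. 0)"
            using gR R by (intro Henstock_Kurzweil_Integration.integral_cong) auto
          then show ?thesis unfolding B_def
            using Henstock_Kurzweil_Integration.integral_combine[of ?l "-R" t g] False \<open>x \<le> -R\<close> integrable_continuous_real[OF cg] by auto
        qed
        have "((\<lambda>t. integral {?l..t} g) has_real_derivative g x) (at x within {?l..?r})"
          by (rule integral_has_real_derivative[OF cg]) auto
        then have "(B has_real_derivative g x) (at x within {?l..?r})"
          by (rule has_field_derivative_transform_within[where d=1]) (auto simp: Beq)
        moreover have "x \<in> interior {?l..?r}" by (auto simp: interior_atLeastAtMost_real)
        ultimately show ?thesis by (simp only: at_within_interior)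
      next
        case False
        have xR: "x \<in> {-R..x+1}" "x \<in> interior {-R..x+1}" using False by (auto simp: interior_atLeastAtMost_real)
        have "((\<lambda>t. integral {-R..t} g) has_real_derivative g x) (at x within {-R..x+1})"
          by (rule integral_has_real_derivative[OF cg xR(1)])
        then show ?thesis unfolding at_within_interior[OF xR(2)] B_def[abs_def] .
      qed
    next
      fix x :: real assume x: "R \<le> \<bar>x\<bar>"
      show "g x = 0" using gR[OF x] .
      show "B x = 0"
      proof (cases "x \<le> -R")
        case True
        then show ?thesis by (cases "x = -R") (auto simp: B_def)
      next
        case False
        then have "R \<le> x" using x by linarith
        have "integral {R..x} g = integral {R..x} (\<lambda>_. 0)"
          using gR R by (intro Henstock_Kurzweil_Integration.integral_cong) auto
        then show ?thesis unfolding B_def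
          using Henstock_Kurzweil_Integration.integral_combine[of "-R" R x g] \<open>R \<le> x\<close> R integrable_continuous_real[OF cg]
            g0 set_borel_integral_eq_integral(2)[OF gi[of "-R" R]] by auto
      qed
    qed
    have "(\<integral>x. g (fst x) * \<beta> (snd x) * v x \<partial>lborel) = 0" by (rule vweak[OF BC b])
    moreover have "(\<lambda>x. g (fst x) * \<beta> (snd x) * v x) = (\<lambda>x. \<alpha> (fst x) * \<beta> (snd x) * v x - I * (\<alpha>0 (fst x) * \<beta> (snd x) * v x))"
      by (auto simp: g_def algebra_simps)
    moreover have "integrable lborel (\<lambda>x. \<alpha> (fst x) * \<beta> (snd x) * v x)"
      by (rule CB[OF a b vli vm])
    moreover have "integrable lborel (\<lambda>x. \<alpha>0 (fst x) * \<beta> (snd x) * v x)"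
      by (rule CB[OF C1c_mono[OF a0 R] b vli vm])
    ultimately show ?thesis by (simp add: I_def)
  qed
  have ci: "set_integrable lborel {-real n..real n} c" for n :: nat
  proof -
    let ?Q = "cbox (-1, -real n) (1, real n)"
    obtain B where B: "\<And>x. \<bar>\<alpha>0 x\<bar> \<le> B"
    proof -
      have "\<bar>\<alpha>0 x\<bar> \<le> 1 / m0" for x
        using bump_bounds(1,2)[of 0 1 1 x] m0 by (simp add: \<alpha>0_def divide_right_mono)
      then show ?thesis by (rule that)
    qed
    have "integrable lborel (\<lambda>x. B * (indicator ?Q x *\<^sub>R v x))" using vli by (auto simp: set_integrable_def)
    then have i: "integrable lborel (\<lambda>x. \<alpha>0 (fst x) * indicator {-real n..real n} (snd x) * v x)"
    proof (rule Bochner_Integration.integrable_bound)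
      have "norm (\<alpha>0 (fst x) * indicator {-real n..real n} (snd x) * v x) \<le> norm (B * (indicator ?Q x *\<^sub>R v x))" for x
        using B[of "fst x"] a0R[of "fst x"] by (cases x) (auto simp: indicator_def abs_mult cbox_Pair_eq intro!: mult_right_mono)
      then show "AE x in lborel. norm (\<alpha>0 (fst x) * indicator {-real n..real n} (snd x) * v x) \<le> norm (B * (indicator ?Q x *\<^sub>R v x))" by simp
    qed simp
    have "(\<lambda>y. \<integral>x. \<alpha>0 (fst (x,y)) * indicator {-real n..real n} (snd (x,y)) * v (x,y) \<partial>lborel) = (\<lambda>y. indicator {-real n..real n} y *\<^sub>R c y)"
      by (auto simp: c_def indicator_def)
    then show ?thesis using lborel_pair_integral(2)[OF i] by (simp add: set_integrable_def)
  qed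
  define z where "z x = v x - c (snd x)" for x
  have csnd: "set_integrable lborel (cbox a b) (\<lambda>x. c (snd x))" for a b :: "real \<times> real"
    unfolding set_integrable_def
  proof (rule integrableI_bounded)
    obtain a1 a2 b1 b2 where ab: "a = (a1, a2)" "b = (b1, b2)" by (cases a, cases b)
    have "set_integrable lborel {a2..b2} c" using sub ci by blast
    then have fin: "(\<integral>\<^sup>+y. ennreal (norm (indicator {a2..b2} y *\<^sub>R c y)) \<partial>lborel) < \<infinity>"
      by (simp add: set_integrable_def integrable_iff_bounded)
    have "(\<integral>\<^sup>+x. ennreal (norm (indicator (cbox a b) x *\<^sub>R c (snd x))) \<partial>lborel) =
      (\<integral>\<^sup>+y. \<integral>\<^sup>+x. ennreal (norm (indicator (cbox a b) (x,y) *\<^sub>R c y)) \<partial>lborel \<partial>lborel)"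
      by (subst lborel_pair_nn_integral) auto
    also have "\<dots> = (\<integral>\<^sup>+y. \<integral>\<^sup>+x. indicator {a1..b1} x * ennreal (norm (indicator {a2..b2} y *\<^sub>R c y)) \<partial>lborel \<partial>lborel)"
      by (intro nn_integral_cong) (auto simp: ab cbox_Pair_eq indicator_def)
    also have "\<dots> = emeasure lborel {a1..b1} * (\<integral>\<^sup>+y. ennreal (norm (indicator {a2..b2} y *\<^sub>R c y)) \<partial>lborel)"
      by (simp add: nn_integral_multc nn_integral_cmult)
    also have "\<dots> < \<infinity>" using fin by (simp add: ennreal_mult_less_top emeasure_lborel_Icc_eq)
    finally show "(\<integral>\<^sup>+x. ennreal (norm (indicator (cbox a b) x *\<^sub>R c (snd x))) \<partial>lborel) < \<infinity>" .
  qed simp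
  have csm: "(\<lambda>x::real\<times>real. c (snd x)) \<in> borel_measurable borel" by simp
  have "AE x in lborel. z x = 0"
  proof (rule AE_zero_if_bump_integrals_zero)
    show "set_integrable lborel (cbox a b) z" for a b
      unfolding z_def using vli csnd by (rule set_integral_diff)
    show "z \<in> borel_measurable borel" unfolding z_def by simp
    fix l r l' r' :: real and n :: nat
    define R where "R = 1 + \<bar>l\<bar> + \<bar>r\<bar> + \<bar>l'\<bar> + \<bar>r'\<bar>"
    obtain p where "C1c (bump l r n) p (max \<bar>l\<bar> \<bar>r\<bar>)" by (rule bump_C1c)
    then have a: "C1c (bump l r n) p R" by (rule C1c_mono) (auto simp: R_def)
    obtain q where "C1c (bump l' r' n) q (max \<bar>l'\<bar> \<bar>r'\<bar>)" by (rule bump_C1c)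
    then have b: "C1c (bump l' r' n) q R" by (rule C1c_mono) (auto simp: R_def)
    have R: "R \<ge> 1" by (auto simp: R_def)
    let ?\<alpha> = "bump l r n" and ?\<beta> = "bump l' r' n"
    have i1: "integrable lborel (\<lambda>x. ?\<alpha> (fst x) * ?\<beta> (snd x) * v x)"
      by (rule CB[OF a b vli vm])
    have i2: "integrable lborel (\<lambda>x. ?\<alpha> (fst x) * ?\<beta> (snd x) * c (snd x))"
      by (rule CB[OF a b csnd csm])
    have i3: "integrable lborel (\<lambda>x. \<alpha>0 (fst x) * ?\<beta> (snd x) * v x)"
      by (rule CB[OF C1c_mono[OF a0 R] b vli vm])
    have e: "(\<integral>x. \<alpha>0 x * ?\<beta> y * v (x, y) \<partial>lborel) = ?\<beta> y * c y" for y
    proof -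
      have "(\<lambda>x. \<alpha>0 x * ?\<beta> y * v (x, y)) = (\<lambda>x. ?\<beta> y * (\<alpha>0 x * v (x, y)))" by (auto simp: ac_simps)
      then show ?thesis by (simp add: c_def)
    qed
    have "(\<integral>x. ?\<alpha> (fst x) * ?\<beta> (snd x) * c (snd x) \<partial>lborel) = (\<integral>y. (\<integral>x. ?\<alpha> x \<partial>lborel) * (?\<beta> y * c y) \<partial>lborel)"
      unfolding lborel_pair_integral(3)[OF i2, symmetric] by (simp add: mult.assoc)
    also have "\<dots> = (\<integral>x. ?\<alpha> x \<partial>lborel) * (\<integral>x. \<alpha>0 (fst x) * ?\<beta> (snd x) * v x \<partial>lborel)"
      unfolding lborel_pair_integral(3)[OF i3, symmetric] by (simp add: e)
    also have "\<dots> = (\<integral>x. ?\<alpha> (fst x) * ?\<beta> (snd x) * v x \<partial>lborel)"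
      by (rule key[OF a b R, symmetric])
    finally show "(\<integral>x. ?\<alpha> (fst x) * ?\<beta> (snd x) * z x \<partial>lborel) = 0"
      unfolding z_def right_diff_distrib using i1 i2 by simp
  qed
  then have "AE x in lborel \<Otimes>\<^sub>M lborel. u x = \<gamma> x + c (snd x)"
    unfolding lborel_prod by eventually_elim (simp add: z_def v_def)
  then have "AE x in lborel. AE y in lborel. u (x, y) = \<gamma> (x, y) + c y"
    using lborel_pair.AE_pair by fastforce
  then have "AE y in lborel. AE x in lborel. u (x, y) = \<gamma> (x, y) + c y"
  proof (subst lborel_pair.AE_commute[symmetric])
    have "{x \<in> space lborel. u (fst x, snd x) = \<gamma> (fst x, snd x) + c (snd x)} \<in> sets lborel" by measurable
    then show "{x \<in> space (lborel \<Otimes>\<^sub>M lborel). u (fst x, snd x) = \<gamma> (fst x, snd x) + c (snd x)} \<in> sets (lborel \<Otimes>\<^sub>M lborel)"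
      unfolding lborel_prod .
  qed
  then show ?thesis using \<gamma>ac
  proof eventually_elim
    case (elim y)
    have "ac (\<lambda>x. \<gamma> (x, y) + c y) (\<lambda>x. D (x, y))" using elim(2) by (auto simp: ac_def)
    then show ?case using elim(1) unfolding wac_def by (intro conjI exI) auto
  qed
qed

lemma lborel_swap:
  fixes F :: "real \<times> real \<Rightarrow> real"
  assumes "F \<in> borel_measurable borel"
  shows "(\<integral>x. F (snd x, fst x) \<partial>lborel) = (\<integral>x. F x \<partial>lborel)"
proof -
  have "F \<in> borel_measurable (lborel \<Otimes>\<^sub>M lborel)" using assms by (simp add: lborel_prod)
  from lborel_pair.integral_product_swap[OF this] show ?thesis
    by (simp add: lborel_prod case_prod_beta')
qed

lemma set_integrable_swap:
  fixes f :: "real \<times> real \<Rightarrow> real"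
  assumes "\<And>a b. set_integrable lborel (cbox a b) f"
  shows "set_integrable lborel (cbox a b) (\<lambda>x. f (snd x, fst x))"
proof -
  let ?a = "(snd a, fst a)" and ?b = "(snd b, fst b)"
  have "integrable (lborel \<Otimes>\<^sub>M lborel) (\<lambda>x. indicator (cbox ?a ?b) x *\<^sub>R f x)"
    using assms by (simp add: set_integrable_def lborel_prod)
  from lborel_pair.integrable_product_swap[OF this]
  have "integrable lborel (\<lambda>x. indicator (cbox ?a ?b) (snd x, fst x) *\<^sub>R f (snd x, fst x))"
    by (simp add: lborel_prod case_prod_beta')
  moreover have "indicator (cbox ?a ?b) (snd x, fst x) = (indicator (cbox a b) x :: real)" for x
    by (cases x, cases a, cases b) (auto simp: cbox_Pair_eq indicator_def)
  ultimately show ?thesis by (simp add: set_integrable_def)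
qed

lemma L2_loc_imp:
  assumes "L2_loc u"
  shows "(\<lambda>x. fst (u x)) \<in> borel_measurable borel" "(\<lambda>x. snd (u x)) \<in> borel_measurable borel"
    "\<And>a b. set_integrable lborel (cbox a b) (\<lambda>x. fst (u x))" "\<And>a b. set_integrable lborel (cbox a b) (\<lambda>x. snd (u x))"
proof -
  have [measurable]: "u \<in> borel_measurable borel" using assms by (simp add: L2_loc_def)
  show m[measurable]: "(\<lambda>x. fst (u x)) \<in> borel_measurable borel" "(\<lambda>x. snd (u x)) \<in> borel_measurable borel" by auto
  fix a b :: "real \<times> real"
  have "(\<integral>\<^sup>+ x. indicator (cbox a b) x * ennreal ((norm (u x))\<^sup>2) \<partial>lborel) < \<infinity>"
    using assms by (auto simp: L2_loc_def)
  then have fin: "(\<integral>\<^sup>+ x. indicator (cbox a b) x + indicator (cbox a b) x * ennreal ((norm (u x))\<^sup>2) \<partial>lborel) < \<infinity>"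
    by (subst nn_integral_add) (auto simp: emeasure_lborel_cbox_eq)
  have *: "set_integrable lborel (cbox a b) f" if [measurable]: "f \<in> borel_measurable borel" and le: "\<And>x. \<bar>f x\<bar> \<le> norm (u x)" for f :: "real \<times> real \<Rightarrow> real"
    unfolding set_integrable_def
  proof (rule integrableI_bounded)
    have "(\<integral>\<^sup>+ x. ennreal (norm (indicator (cbox a b) x *\<^sub>R f x)) \<partial>lborel) \<le> (\<integral>\<^sup>+ x. indicator (cbox a b) x + indicator (cbox a b) x * ennreal ((norm (u x))\<^sup>2) \<partial>lborel)"
    proof (rule nn_integral_mono)
      fix x
      have "\<bar>f x\<bar> \<le> 1 + (norm (u x))\<^sup>2"
        using le[of x] zero_le_power2[of "norm (u x) - 1"] norm_ge_zero[of "u x"] by (auto simp: power2_eq_square algebra_simps)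
      then have "ennreal \<bar>f x\<bar> \<le> 1 + ennreal ((norm (u x))\<^sup>2)"
        by (metis ennreal_1 ennreal_leI ennreal_plus zero_le_one zero_le_power2)
      then show "ennreal (norm (indicator (cbox a b) x *\<^sub>R f x)) \<le> indicator (cbox a b) x + indicator (cbox a b) x * ennreal ((norm (u x))\<^sup>2)"
        by (auto simp: indicator_def)
    qed
    then show "(\<integral>\<^sup>+ x. ennreal (norm (indicator (cbox a b) x *\<^sub>R f x)) \<partial>lborel) < \<infinity>"
      using fin by (rule le_less_trans)
  qed simp
  show "set_integrable lborel (cbox a b) (\<lambda>x. fst (u x))" "set_integrable lborel (cbox a b) (\<lambda>x. snd (u x))"
    using norm_fst_le[of "fst (u x)" "snd (u x)" for x] norm_snd_le[of "snd (u x)" "fst (u x)" for x] by (auto intro!: *)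
qed

lemma C1c_test_integrable:
  fixes u :: "real \<times> real \<Rightarrow> real \<times> real"
  assumes u: "L2_loc u" and a: "C1c \<alpha> \<alpha>' R" and b: "C1c \<beta> \<beta>' R"
    and f: "f \<in> {\<alpha>, \<alpha>'}" and g: "g \<in> {\<beta>, \<beta>'}"
  shows "integrable lborel (\<lambda>x. (f (fst x) * g (snd x)) *\<^sub>R u x)"
proof -
  note L = L2_loc_imp[OF u]
  have m[measurable]: "u \<in> borel_measurable borel" using u by (simp add: L2_loc_def)
  have c: "continuous_on UNIV f" "continuous_on UNIV g" and z: "\<And>x. R \<le> \<bar>x\<bar> \<Longrightarrow> f x = 0" "\<And>x. R \<le> \<bar>x\<bar> \<Longrightarrow> g x = 0"
    using f g C1cD[OF a] C1cD[OF b] by auto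
  have [measurable]: "f \<in> borel_measurable borel" "g \<in> borel_measurable borel" using c by (auto intro: borel_measurable_continuous_onI)
  have cc: "continuous_on UNIV (\<lambda>x::real\<times>real. f (fst x) * g (snd x))"
    by (intro continuous_on_mult continuous_on_compose2[OF c(1)] continuous_on_compose2[OF c(2)]) (auto intro: continuous_intros)
  have zz: "f (fst x) * g (snd x) = 0" if "x \<notin> cbox (-R,-R) (R,R)" for x :: "real \<times> real"
  proof -
    have "R \<le> \<bar>fst x\<bar> \<or> R \<le> \<bar>snd x\<bar>" using that by (cases x) (auto simp: cbox_Pair_eq)
    then show ?thesis using z by auto
  qed
  note i = integrable_mult_compact_support[OF cc zz L(3) L(1)] integrable_mult_compact_support[OF cc zz L(4) L(2)]
  have "integrable lborel (\<lambda>x. \<bar>f (fst x) * g (snd x) * fst (u x)\<bar> + \<bar>f (fst x) * g (snd x) * snd (u x)\<bar>)"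
    using i by (intro Bochner_Integration.integrable_add integrable_abs)
  then show ?thesis
  proof (rule Bochner_Integration.integrable_bound)
    have "norm ((f (fst x) * g (snd x)) *\<^sub>R u x) \<le> norm (\<bar>f (fst x) * g (snd x) * fst (u x)\<bar> + \<bar>f (fst x) * g (snd x) * snd (u x)\<bar>)" for x
      using norm_Pair_le[of "fst (u x)" "snd (u x)"]
      by (simp add: abs_mult distrib_left[symmetric] mult.assoc[symmetric]) (simp add: mult_left_mono mult.assoc)
    then show "AE x in lborel. norm ((f (fst x) * g (snd x)) *\<^sub>R u x) \<le> norm (\<bar>f (fst x) * g (snd x) * fst (u x)\<bar> + \<bar>f (fst x) * g (snd x) * snd (u x)\<bar>)"
      by simp
  qed simp
qed

text \<open>One component at a time, so that scalar results apply; the second direction follows from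
  the first after exchanging the coordinates.\<close>

lemma weak_partials_acl:
  assumes u: "L2_loc u" and w: "weak_partials u D1 D2" and per: "\<And>x1 x2. u (x1, x2 + 1) = u (x1, x2)"
    and pr: "pr = fst \<or> pr = snd"
  shows "acl (\<lambda>x. pr (u x)) (\<lambda>x. pr (D1 x)) (\<lambda>x. pr (D2 x))"
proof -
  have D: "L2_loc D1" "L2_loc D2" using w by (auto simp: weak_partials_def)
  have bl: "bounded_linear (pr :: real \<times> real \<Rightarrow> real)" using pr by (auto intro: bounded_linear_fst bounded_linear_snd)
  have prs: "pr (c *\<^sub>R z) = c * pr z" "pr (- z) = - pr z" for c and z :: "real \<times> real" using pr by auto
  have L: "(\<lambda>x. pr (v x)) \<in> borel_measurable borel" "\<And>a b. set_integrable lborel (cbox a b) (\<lambda>x. pr (v x))" if "L2_loc v" for v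
    using L2_loc_imp[OF that] pr by auto
  have t: "(\<integral>x. \<alpha>' (fst x) * \<beta> (snd x) * pr (u x) \<partial>lborel) = - (\<integral>x. \<alpha> (fst x) * \<beta> (snd x) * pr (D1 x) \<partial>lborel)"
    "(\<integral>x. \<alpha> (fst x) * \<beta>' (snd x) * pr (u x) \<partial>lborel) = - (\<integral>x. \<alpha> (fst x) * \<beta> (snd x) * pr (D2 x) \<partial>lborel)"
    if a: "C1c \<alpha> \<alpha>' R" and b: "C1c \<beta> \<beta>' R" for \<alpha> \<alpha>' \<beta> \<beta>' R
  proof -
    have e: "(\<integral>x. f (fst x) * g (snd x) * pr (v x) \<partial>lborel) = pr (\<integral>x. (f (fst x) * g (snd x)) *\<^sub>R v x \<partial>lborel)"
      if "L2_loc v" "f \<in> {\<alpha>, \<alpha>'}" "g \<in> {\<beta>, \<beta>'}" for v f g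
      using integral_bounded_linear[OF bl C1c_test_integrable[OF that(1) a b that(2,3)]] by (simp add: prs)
    show "(\<integral>x. \<alpha>' (fst x) * \<beta> (snd x) * pr (u x) \<partial>lborel) = - (\<integral>x. \<alpha> (fst x) * \<beta> (snd x) * pr (D1 x) \<partial>lborel)"
      "(\<integral>x. \<alpha> (fst x) * \<beta>' (snd x) * pr (u x) \<partial>lborel) = - (\<integral>x. \<alpha> (fst x) * \<beta> (snd x) * pr (D2 x) \<partial>lborel)"
      using w test_fun_product[OF a b] by (auto simp: e u D weak_partials_def prs)
  qed
  have 1: "AE x2 in lborel. wac (\<lambda>x1. pr (u (x1, x2))) (\<lambda>x1. pr (D1 (x1, x2)))"
    by (rule weak_derivative_imp_wac) (use L[OF u] L[OF D(1)] t(1) in auto)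
  have 2: "AE x1 in lborel. wac (\<lambda>x2. pr (u (snd (x2, x1), fst (x2, x1)))) (\<lambda>x2. pr (D2 (snd (x2, x1), fst (x2, x1))))"
  proof (rule weak_derivative_imp_wac[where u="\<lambda>x. pr (u (snd x, fst x))" and D="\<lambda>x. pr (D2 (snd x, fst x))"])
    note [measurable] = L(1)[OF u] L(1)[OF D(2)]
    show "(\<lambda>x. pr (u (snd x, fst x))) \<in> borel_measurable borel" "(\<lambda>x. pr (D2 (snd x, fst x))) \<in> borel_measurable borel"
      by measurable
    show "set_integrable lborel (cbox a b) (\<lambda>x. pr (u (snd x, fst x)))" "set_integrable lborel (cbox a b) (\<lambda>x. pr (D2 (snd x, fst x)))" for a b
      using set_integrable_swap[OF L(2)[OF u]] set_integrable_swap[OF L(2)[OF D(2)]] by auto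
    fix \<alpha> \<alpha>' \<beta> \<beta>' R assume a: "C1c \<alpha> \<alpha>' R" and b: "C1c \<beta> \<beta>' R"
    have [measurable]: "\<alpha> \<in> borel_measurable borel" "\<alpha>' \<in> borel_measurable borel" "\<beta> \<in> borel_measurable borel"
      using C1cD(2,3)[OF a] C1cD(3)[OF b] by (auto intro: borel_measurable_continuous_onI)
    show "(\<integral>x. \<alpha>' (fst x) * \<beta> (snd x) * pr (u (snd x, fst x)) \<partial>lborel) = - (\<integral>x. \<alpha> (fst x) * \<beta> (snd x) * pr (D2 (snd x, fst x)) \<partial>lborel)"
      using t(2)[OF b a] lborel_swap[of "\<lambda>x. \<beta> (fst x) * \<alpha>' (snd x) * pr (u x)"] lborel_swap[of "\<lambda>x. \<beta> (fst x) * \<alpha> (snd x) * pr (D2 x)"]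
      by (simp add: ac_simps)
  qed
  show ?thesis unfolding acl_def using 1 2 L(1)[OF u] L(1)[OF D(1)] L(1)[OF D(2)] per by simp
qed

lemma T1_integral_measurable:
  fixes f :: "real \<times> real \<Rightarrow> real"
  assumes "f \<in> borel_measurable borel"
  shows "(\<lambda>x. \<integral>y. f (x, y) \<partial>T1) \<in> borel_measurable borel"
  using T1.borel_measurable_lebesgue_integral[of "\<lambda>x y. f (x, y)" lborel] measurable_cyl_pair[OF assms] by simp

section \<open>Null Lagrangians\<close>

lemma L2_mult_integrable:
  fixes f g :: "'a \<Rightarrow> real"
  assumes [measurable]: "f \<in> borel_measurable M" "g \<in> borel_measurable M"
    and i: "integrable M (\<lambda>x. (f x)\<^sup>2)" "integrable M (\<lambda>x. (g x)\<^sup>2)"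
  shows "integrable M (\<lambda>x. f x * g x)"
proof -
  have "integrable M (\<lambda>x. (f x)\<^sup>2 + (g x)\<^sup>2)" using i by simp
  then show ?thesis
  proof (rule Bochner_Integration.integrable_bound)
    have "norm (f x * g x) \<le> norm ((f x)\<^sup>2 + (g x)\<^sup>2)" for x
    proof -
      have "2 * (\<bar>f x\<bar> * \<bar>g x\<bar>) \<le> (f x)\<^sup>2 + (g x)\<^sup>2"
        using sum_squares_bound[of "\<bar>f x\<bar>" "\<bar>g x\<bar>"] by (simp add: algebra_simps)
      moreover have "\<bar>f x\<bar> * \<bar>g x\<bar> \<ge> 0" by simp
      ultimately have "\<bar>f x\<bar> * \<bar>g x\<bar> \<le> (f x)\<^sup>2 + (g x)\<^sup>2" by linarith
      then show ?thesis by (simp add: abs_mult)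
    qed
    then show "AE x in M. norm (f x * g x) \<le> norm ((f x)\<^sup>2 + (g x)\<^sup>2)" by simp
  qed simp
qed

lemma L2_Cauchy_Schwarz:
  fixes f g :: "'a \<Rightarrow> real"
  assumes [measurable]: "f \<in> borel_measurable M" "g \<in> borel_measurable M"
    and i: "integrable M (\<lambda>x. (f x)\<^sup>2)" "integrable M (\<lambda>x. (g x)\<^sup>2)"
  shows "(\<integral>x. \<bar>f x * g x\<bar> \<partial>M)\<^sup>2 \<le> (\<integral>x. (f x)\<^sup>2 \<partial>M) * (\<integral>x. (g x)\<^sup>2 \<partial>M)"
proof -
  have fg: "integrable M (\<lambda>x. \<bar>f x * g x\<bar>)" using L2_mult_integrable[OF assms] by simp
  have "(\<integral>\<^sup>+x. ennreal \<bar>f x\<bar> * ennreal \<bar>g x\<bar> \<partial>M)\<^sup>2 \<le> (\<integral>\<^sup>+x. (ennreal \<bar>f x\<bar>)\<^sup>2 \<partial>M) * (\<integral>\<^sup>+x. (ennreal \<bar>g x\<bar>)\<^sup>2 \<partial>M)"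
    by (rule Cauchy_Schwarz_nn_integral) auto
  also have "(\<lambda>x. ennreal \<bar>f x\<bar> * ennreal \<bar>g x\<bar>) = (\<lambda>x. ennreal \<bar>f x * g x\<bar>)"
    by (auto simp: ennreal_mult[symmetric] abs_mult)
  also have "(\<lambda>x. (ennreal \<bar>f x\<bar>)\<^sup>2) = (\<lambda>x. ennreal ((f x)\<^sup>2))" by (auto simp: ennreal_power)
  also have "(\<lambda>x. (ennreal \<bar>g x\<bar>)\<^sup>2) = (\<lambda>x. ennreal ((g x)\<^sup>2))" by (auto simp: ennreal_power)
  finally show ?thesis
    using fg i by (simp add: nn_integral_eq_integral ennreal_mult[symmetric] ennreal_power)
qed

lemma L2_tendsto_mult:
  fixes f g :: "'a \<Rightarrow> real"
  assumes [measurable]: "f \<in> borel_measurable M" "g \<in> borel_measurable M" "\<And>n. G n \<in> borel_measurable M"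
    and i: "integrable M (\<lambda>x. (f x)\<^sup>2)" "integrable M (\<lambda>x. (g x)\<^sup>2)" "\<And>n. integrable M (\<lambda>x. (G n x)\<^sup>2)"
    and lim: "(\<lambda>n. \<integral>x. (G n x - g x)\<^sup>2 \<partial>M) \<longlonglongrightarrow> 0"
  shows "(\<lambda>n::nat. \<integral>x. G n x * f x \<partial>M) \<longlonglongrightarrow> (\<integral>x. g x * f x \<partial>M)"
proof -
  have d: "integrable M (\<lambda>x. (G n x - g x)\<^sup>2)" for n
  proof -
    have "integrable M (\<lambda>x. (G n x)\<^sup>2 + (g x)\<^sup>2 - 2 * (G n x * g x))"
      using i L2_mult_integrable[of "G n" M g] by simp
    then show ?thesis by (simp add: power2_diff algebra_simps)
  qed
  have "(\<lambda>n. sqrt ((\<integral>x. (G n x - g x)\<^sup>2 \<partial>M) * (\<integral>x. (f x)\<^sup>2 \<partial>M))) \<longlonglongrightarrow> sqrt (0 * (\<integral>x. (f x)\<^sup>2 \<partial>M))"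
    by (intro tendsto_intros lim)
  then have s0: "(\<lambda>n. sqrt ((\<integral>x. (G n x - g x)\<^sup>2 \<partial>M) * (\<integral>x. (f x)\<^sup>2 \<partial>M))) \<longlonglongrightarrow> 0" by simp
  have b: "norm ((\<integral>x. G n x * f x \<partial>M) - (\<integral>x. g x * f x \<partial>M)) \<le> sqrt ((\<integral>x. (G n x - g x)\<^sup>2 \<partial>M) * (\<integral>x. (f x)\<^sup>2 \<partial>M))" for n
  proof -
    have "(\<integral>x. G n x * f x \<partial>M) - (\<integral>x. g x * f x \<partial>M) = (\<integral>x. (G n x - g x) * f x \<partial>M)"
      using L2_mult_integrable[of "G n" M f] L2_mult_integrable[of g M f] i by (simp add: left_diff_distrib)
    also have "\<bar>\<dots>\<bar> \<le> (\<integral>x. \<bar>(G n x - g x) * f x\<bar> \<partial>M)" by (rule integral_abs_bound)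
    also have "\<dots> \<le> sqrt ((\<integral>x. (G n x - g x)\<^sup>2 \<partial>M) * (\<integral>x. (f x)\<^sup>2 \<partial>M))"
      using L2_Cauchy_Schwarz[of "\<lambda>x. G n x - g x" M f] d i by (intro real_le_rsqrt) auto
    finally show ?thesis by simp
  qed
  have "(\<lambda>n. (\<integral>x. G n x * f x \<partial>M) - (\<integral>x. g x * f x \<partial>M)) \<longlonglongrightarrow> 0"
    by (rule Lim_null_comparison[OF _ s0]) (use b in auto)
  then show ?thesis by (simp add: LIM_zero_iff)
qed

text \<open>Fatou applied to \<open>2 (G n)\<^sup>2 + 2 g\<^sup>2 - (G n - g)\<^sup>2\<close>.\<close>

lemma L2_tendsto_if_norm_le:
  fixes g :: "'a \<Rightarrow> real"
  assumes [measurable]: "g \<in> borel_measurable M" "\<And>n. G n \<in> borel_measurable M"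
    and gi: "integrable M (\<lambda>x. (g x)\<^sup>2)"
    and le: "\<And>n::nat. (\<integral>\<^sup>+x. ennreal ((G n x)\<^sup>2) \<partial>M) \<le> (\<integral>\<^sup>+x. ennreal ((g x)\<^sup>2) \<partial>M)"
    and lim: "AE x in M. (\<lambda>n. G n x) \<longlonglongrightarrow> g x"
  shows "integrable M (\<lambda>x. (G n x)\<^sup>2)" "(\<lambda>n. \<integral>x. (G n x - g x)\<^sup>2 \<partial>M) \<longlonglongrightarrow> 0"
proof -
  have fin: "(\<integral>\<^sup>+x. ennreal ((g x)\<^sup>2) \<partial>M) < \<infinity>" using gi by (simp add: integrable_iff_bounded)
  show Gi: "integrable M (\<lambda>x. (G n x)\<^sup>2)" for n
    using le_less_trans[OF le fin, of n] by (auto simp: integrable_iff_bounded)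
  have d: "integrable M (\<lambda>x. (G n x - g x)\<^sup>2)" for n
  proof -
    have "integrable M (\<lambda>x. (G n x)\<^sup>2 + (g x)\<^sup>2 - 2 * (G n x * g x))"
      using Gi gi L2_mult_integrable[of "G n" M g] by simp
    then show ?thesis by (simp add: power2_diff algebra_simps)
  qed
  define A where "A = (\<integral>x. (g x)\<^sup>2 \<partial>M)"
  define e where "e n = (\<integral>x. (G n x - g x)\<^sup>2 \<partial>M)" for n
  have leA: "(\<integral>x. (G n x)\<^sup>2 \<partial>M) \<le> A" for n
  proof -
    have "ennreal (\<integral>x. (G n x)\<^sup>2 \<partial>M) \<le> ennreal A"
      using le[of n] Gi gi by (simp add: nn_integral_eq_integral A_def)
    then show ?thesis by (subst (asm) ennreal_le_iff) (auto simp: A_def)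
  qed
  have e0: "e n \<ge> 0" for n by (simp add: e_def)
  let ?h = "\<lambda>n x. 2 * (G n x)\<^sup>2 + 2 * (g x)\<^sup>2 - (G n x - g x)\<^sup>2"
  have h0: "?h n x \<ge> 0" for n x
    using zero_le_power2[of "G n x + g x"] by (simp add: power2_sum power2_diff)
  have hi: "integrable M (?h n)" for n using Gi gi d by simp
  have hI: "(\<integral>x. ?h n x \<partial>M) \<le> 4 * A - e n" for n
    using Gi gi d leA[of n] by (simp add: e_def A_def)
  have "ennreal (4 * A) = (\<integral>\<^sup>+x. ennreal (4 * (g x)\<^sup>2) \<partial>M)"
    using gi by (simp add: nn_integral_eq_integral A_def)
  also have "\<dots> \<le> (\<integral>\<^sup>+x. liminf (\<lambda>n. ennreal (?h n x)) \<partial>M)"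
  proof (rule nn_integral_mono_AE)
    show "AE x in M. ennreal (4 * (g x)\<^sup>2) \<le> liminf (\<lambda>n. ennreal (?h n x))"
      using lim
    proof eventually_elim
      case (elim x)
      have "(\<lambda>n. ?h n x) \<longlonglongrightarrow> 2 * (g x)\<^sup>2 + 2 * (g x)\<^sup>2 - (g x - g x)\<^sup>2"
        by (intro tendsto_intros elim)
      then have "(\<lambda>n. ennreal (?h n x)) \<longlonglongrightarrow> ennreal (4 * (g x)\<^sup>2)" by (intro tendsto_ennrealI) simp
      then show ?case by (simp add: lim_imp_Liminf)
    qed
  qed
  also have "\<dots> \<le> liminf (\<lambda>n. \<integral>\<^sup>+x. ennreal (?h n x) \<partial>M)"
    by (rule nn_integral_liminf) simp
  also have "\<dots> \<le> liminf (\<lambda>n. ennreal (4 * A - e n))"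
  proof (rule Liminf_mono, rule always_eventually, rule allI)
    fix n
    have "(\<integral>\<^sup>+x. ennreal (?h n x) \<partial>M) = ennreal (\<integral>x. ?h n x \<partial>M)" using hi h0 by (intro nn_integral_eq_integral) auto
    also have "\<dots> \<le> ennreal (4 * A - e n)" using hI by (rule ennreal_leI)
    finally show "(\<integral>\<^sup>+x. ennreal (?h n x) \<partial>M) \<le> ennreal (4 * A - e n)" .
  qed
  finally have L: "ennreal (4 * A) \<le> liminf (\<lambda>n. ennreal (4 * A - e n))" .
  have "e \<longlonglongrightarrow> 0"
  proof (rule LIMSEQ_I)
    fix r :: real assume r: "r > 0"
    have A0: "A \<ge> 0" by (simp add: A_def)
    show "\<exists>no. \<forall>n\<ge>no. norm (e n - 0) < r"
    proof (cases "r \<le> 4 * A")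
      \<comment> \<open>\<open>ennreal\<close> truncates at zero, so the liminf bound is informative
        only while \<open>4 * A - r\<close> is nonnegative. A larger \<open>r\<close> is covered by
        \<open>e n \<le> 4 * A\<close>.\<close>
      case True
      then have "ennreal (4 * A - r) < ennreal (4 * A)" using r A0 by (intro ennreal_lessI) auto
      also note L
      finally have "\<forall>\<^sub>F n in sequentially. ennreal (4 * A - r) < ennreal (4 * A - e n)"
        by (simp add: less_LiminfD)
      then have "\<forall>\<^sub>F n in sequentially. e n < r"
        by eventually_elim (use True in \<open>auto simp: ennreal_less_iff\<close>)
      then show ?thesis using e0 by (auto simp: eventually_sequentially)
    next
      case False
      have "e n \<le> 4 * A" for n
      proof -
        have "0 \<le> (\<integral>x. ?h n x \<partial>M)" using h0 by simp
        then show ?thesis using hI[of n] by linarith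
      qed
      then have "e n < r" for n using False by (metis le_less_trans not_le)
      then show ?thesis using e0 by auto
    qed
  qed
  then show "(\<lambda>n. \<integral>x. (G n x - g x)\<^sup>2 \<partial>M) \<longlonglongrightarrow> 0" unfolding e_def[abs_def] .
qed

section \<open>Translations and averages along the axis of the cylinder\<close>

lemma indicator_vimage: "indicator (f -` A) x = indicator A (f x)"
  by (auto simp: indicator_def)

lemma cyl_shift: "distr cyl borel (\<lambda>x. (fst x + s, snd x)) = cyl"
proof (rule measure_eqI)
  fix A assume "A \<in> sets (distr cyl borel (\<lambda>x. (fst x + s, snd x)))"
  then have A[measurable]: "A \<in> sets borel" by simp
  have B: "(\<lambda>x::real\<times>real. (fst x + s, snd x)) -` A \<in> sets borel"
    using measurable_sets[of "\<lambda>x::real\<times>real. (fst x + s, snd x)" borel borel A] by simp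
  have "emeasure (distr cyl borel (\<lambda>x. (fst x + s, snd x))) A = emeasure cyl ((\<lambda>x. (fst x + s, snd x)) -` A)"
    by (subst emeasure_distr) auto
  also have "\<dots> = (\<integral>\<^sup>+x. indicator A (fst x + s, snd x) \<partial>cyl)"
    using nn_integral_indicator[of "(\<lambda>x. (fst x + s, snd x)) -` A" cyl] B by (simp add: indicator_vimage)
  also have "\<dots> = (\<integral>\<^sup>+y. \<integral>\<^sup>+x. indicator A (x + s, y) \<partial>lborel \<partial>T1)"
    by (subst nn_integral_cyl_snd) auto
  also have "\<dots> = (\<integral>\<^sup>+y. \<integral>\<^sup>+x. indicator A (x, y) \<partial>lborel \<partial>T1)"
  proof (rule nn_integral_cong)
    fix y
    show "(\<integral>\<^sup>+x. indicator A (x + s, y) \<partial>lborel) = (\<integral>\<^sup>+x. indicator A (x, y) \<partial>lborel)"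
      using nn_integral_real_affine[of "\<lambda>x. indicator A (x, y)" 1 s] by (simp add: add.commute)
  qed
  also have "\<dots> = (\<integral>\<^sup>+x. indicator A x \<partial>cyl)" by (subst nn_integral_cyl_snd) auto
  finally show "emeasure (distr cyl borel (\<lambda>x. (fst x + s, snd x))) A = emeasure cyl A" by simp
qed simp

lemma cyl_shift_integral:
  fixes f :: "real \<times> real \<Rightarrow> real"
  assumes [measurable]: "f \<in> borel_measurable borel"
  shows "(\<integral>x. f (fst x + s, snd x) \<partial>cyl) = (\<integral>x. f x \<partial>cyl)"
    "integrable cyl (\<lambda>x. f (fst x + s, snd x)) \<longleftrightarrow> integrable cyl f"
proof -
  have m: "(\<lambda>x. (fst x + s, snd x)) \<in> measurable cyl borel" by simp
  show "(\<integral>x. f (fst x + s, snd x) \<partial>cyl) = (\<integral>x. f x \<partial>cyl)"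
    using integral_distr[OF m, of f] by (simp add: cyl_shift)
  show "integrable cyl (\<lambda>x. f (fst x + s, snd x)) \<longleftrightarrow> integrable cyl f"
    using integrable_distr_eq[OF m, of f] by (simp add: cyl_shift)
qed

text \<open>As \<open>P\<close> may fail to be measurable, the exceptional set is first enlarged to
  a Borel null set.\<close>

lemma AE_lborel_shift:
  assumes "AE x in lborel. P x"
  shows "AE x in lborel. P (x + s :: real)"
proof -
  obtain N where N: "{x. \<not> P x} \<subseteq> N" "emeasure lborel N = 0" "N \<in> sets lborel"
    using assms by (auto elim!: AE_E)
  then have "AE x in lborel. x \<notin> N" by (intro AE_not_in) (auto simp: null_sets_def)
  then have "AE x in lborel. x + s \<notin> N"
    using AE_borel_affine[of 1 "\<lambda>x. x \<notin> N" s] N(3) by (simp add: add.commute)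
  then show ?thesis by eventually_elim (use N in auto)
qed

lemma AE_lborel_uminus:
  assumes "AE x in lborel. P x"
  shows "AE x in lborel. P (- x :: real)"
proof -
  obtain N where N: "{x. \<not> P x} \<subseteq> N" "emeasure lborel N = 0" "N \<in> sets lborel"
    using assms by (auto elim!: AE_E)
  then have "AE x in lborel. x \<notin> N" by (intro AE_not_in) (auto simp: null_sets_def)
  then have "AE x in lborel. - x \<notin> N"
    using AE_borel_affine[of "-1" "\<lambda>x. x \<notin> N" 0] N(3) by simp
  then show ?thesis by eventually_elim (use N in auto)
qed

lemma AE_lborel_ex:
  fixes a b :: real
  assumes "AE x in lborel. P x" "a < b"
  shows "\<exists>x. a < x \<and> x < b \<and> P x"
proof (rule ccontr)
  assume c: "\<not> ?thesis"
  have "AE x in lborel. x \<notin> {a<..<b}" using assms(1) by eventually_elim (use c in auto)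
  then have "{a<..<b} \<in> null_sets lborel" by (subst (asm) AE_iff_null_sets[symmetric]) auto
  then show False using assms(2) by (auto dest!: null_setsD1)
qed

lemma integral_T1_affine:
  fixes d :: "real \<Rightarrow> real"
  assumes [measurable]: "d \<in> borel_measurable borel" and h: "h > 0"
  shows "(\<integral>s. d (x + s * h) \<partial>T1) * h = (LINT t:{x..x+h}|lborel. d t)"
    "(\<integral>s. d (x - s * h) \<partial>T1) * h = (LINT t:{x-h..x}|lborel. d t)"
proof -
  have "(\<integral>s. d (x + s * h) \<partial>T1) = (\<integral>s. indicator {0..1} s *\<^sub>R d (x + s * h) \<partial>lborel)"
    by (simp add: integrable_T1(2) set_lebesgue_integral_def)
  also have "\<dots> = (\<integral>s. indicator {x..x+h} (x + h * s) *\<^sub>R d (x + h * s) \<partial>lborel)"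
    using h by (intro Bochner_Integration.integral_cong) (auto simp: indicator_def mult.commute zero_le_mult_iff)
  also have "\<dots> * h = (\<integral>t. indicator {x..x+h} t *\<^sub>R d t \<partial>lborel)"
    using lborel_integral_real_affine[of h "\<lambda>t. indicator {x..x+h} t *\<^sub>R d t" x] h by simp
  finally show "(\<integral>s. d (x + s * h) \<partial>T1) * h = (LINT t:{x..x+h}|lborel. d t)"
    by (simp add: set_lebesgue_integral_def)
  have "(\<integral>s. d (x - s * h) \<partial>T1) = (\<integral>s. indicator {0..1} s *\<^sub>R d (x - s * h) \<partial>lborel)"
    by (simp add: integrable_T1(2) set_lebesgue_integral_def)
  also have "\<dots> = (\<integral>s. indicator {x-h..x} (x + (-h) * s) *\<^sub>R d (x + (-h) * s) \<partial>lborel)"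
    using h by (intro Bochner_Integration.integral_cong) (auto simp: indicator_def mult.commute zero_le_mult_iff)
  also have "\<dots> * h = (\<integral>t. indicator {x-h..x} t *\<^sub>R d t \<partial>lborel)"
    using lborel_integral_real_affine[of "-h" "\<lambda>t. indicator {x-h..x} t *\<^sub>R d t" x] h by simp
  finally show "(\<integral>s. d (x - s * h) \<partial>T1) * h = (LINT t:{x-h..x}|lborel. d t)"
    by (simp add: set_lebesgue_integral_def)
qed

text \<open>The increment as \<open>y\<close> times an average of the derivative. Averaging over the
  unit interval gives one formula for both signs of \<open>y\<close>.\<close>

lemma wac_difference:
  assumes "wac v d"
  shows "AE x in lborel. v (x + y) - v x = y * (\<integral>s. d (x + s * y) \<partial>T1)"
proof -
  obtain \<gamma> where g: "ac \<gamma> d" "AE x in lborel. v x = \<gamma> x" using assms by (auto simp: wac_def)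
  have d[measurable]: "d \<in> borel_measurable borel" using assms by (auto simp: wac_def)
  have "\<gamma> (x + y) - \<gamma> x = y * (\<integral>s. d (x + s * y) \<partial>T1)" for x
  proof -
    consider "y = 0" | "y > 0" | "y < 0" by linarith
    then show ?thesis
    proof cases
      case 2
      then show ?thesis using acD(2)[OF g(1), of x "x + y"] integral_T1_affine(1)[OF d 2, of x] by (simp add: mult.commute)
    next
      case 3
      then show ?thesis using acD(2)[OF g(1), of "x + y" x] integral_T1_affine(2)[OF d, of "-y" x] by (simp add: mult.commute)
    qed simp
  qed
  then show ?thesis using g(2) AE_lborel_shift[OF g(2), of y] by auto
qed

lemma AE_average_tendsto:
  fixes d :: "real \<Rightarrow> real"
  assumes [measurable]: "d \<in> borel_measurable borel" and i: "\<And>s t. set_integrable lborel {s..t} d"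
  shows "AE x in lborel. (\<lambda>n. \<integral>s. d (x + s * (1 / real (Suc n))) \<partial>T1) \<longlonglongrightarrow> d x"
proof -
  have "d integrable_on cbox a b" for a b
    using i by (auto intro: set_borel_integral_eq_integral)
  then obtain N where N: "negligible N"
    and lim: "\<And>x e. \<lbrakk>x \<notin> N; 0 < e\<rbrakk> \<Longrightarrow> \<exists>\<delta>>0. \<forall>h. 0 < h \<and> h < \<delta> \<longrightarrow>
       norm (integral (cbox x (x + h *\<^sub>R One)) d /\<^sub>R h ^ DIM(real) - d x) < e"
    using integrable_ccontinuous_explicit by blast
  have "(\<lambda>n. \<integral>s. d (x + s * (1 / real (Suc n))) \<partial>T1) \<longlonglongrightarrow> d x" if xN: "x \<notin> N" for x
  proof (rule LIMSEQ_I)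
    fix e :: real assume "e > 0"
    then obtain \<delta> where \<delta>: "\<delta> > 0" "\<forall>h. 0 < h \<and> h < \<delta> \<longrightarrow> norm (integral (cbox x (x + h *\<^sub>R One)) d /\<^sub>R h ^ DIM(real) - d x) < e"
      using lim[OF xN] by blast
    obtain m where m: "1 / real (Suc m) < \<delta>" using \<delta>(1) nat_approx_posE by blast
    show "\<exists>no. \<forall>n\<ge>no. norm ((\<integral>s. d (x + s * (1 / real (Suc n))) \<partial>T1) - d x) < e"
    proof (intro exI allI impI)
      fix n assume "m \<le> n"
      define h where "h = 1 / real (Suc n)"
      have h: "0 < h" "h < \<delta>" using m \<open>m \<le> n\<close> using le_less_trans[OF frac_le[of 1 1 "real (Suc m)" "real (Suc n)"] m] by (auto simp: h_def)
      have "(\<integral>s. d (x + s * h) \<partial>T1) = integral {x..x+h} d / h"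
        using integral_T1_affine(1)[of d h x] h set_borel_integral_eq_integral(2)[OF i[of x "x+h"]] by (simp add: field_simps)
      then show "norm ((\<integral>s. d (x + s * (1 / real (Suc n))) \<partial>T1) - d x) < e"
        using \<delta>(2)[rule_format, of h] h unfolding h_def[symmetric] by (simp add: divide_inverse mult.commute)
    qed
  qed
  then have "AE x in lebesgue. (\<lambda>n. \<integral>s. d (x + s * (1 / real (Suc n))) \<partial>T1) \<longlonglongrightarrow> d x"
    using N by (auto simp: negligible_iff_null_sets intro!: AE_I'[of N])
  then show ?thesis by (simp only: AE_completion_iff)
qed

text \<open>The one-sided Steklov average in the axial direction. If \<open>g\<close> is an axial
  derivative, this is the difference quotient with step \<open>h\<close>; a negative
  \<open>h\<close> averages to the left.\<close>

definition avg :: "real \<Rightarrow> (real \<times> real \<Rightarrow> real) \<Rightarrow> real \<times> real \<Rightarrow> real" where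
  "avg h g x = (\<integral>s. g (fst x + s * h, snd x) \<partial>T1)"

lemma avg_measurable[measurable]:
  assumes [measurable]: "g \<in> borel_measurable borel"
  shows "avg h g \<in> borel_measurable borel"
  unfolding avg_def[abs_def]
  by (rule T1.borel_measurable_lebesgue_integral) simp

lemma nn_integral_T1_square_le:
  fixes f :: "real \<Rightarrow> real"
  assumes [measurable]: "f \<in> borel_measurable borel"
  shows "ennreal ((\<integral>s. f s \<partial>T1)\<^sup>2) \<le> (\<integral>\<^sup>+s. ennreal ((f s)\<^sup>2) \<partial>T1)"
proof (cases "integrable T1 f")
  case True
  have "ennreal \<bar>\<integral>s. f s \<partial>T1\<bar> \<le> (\<integral>\<^sup>+s. ennreal \<bar>f s\<bar> * 1 \<partial>T1)"
    using integral_norm_bound_ennreal[OF True] by simp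
  then have "(ennreal \<bar>\<integral>s. f s \<partial>T1\<bar>)\<^sup>2 \<le> (\<integral>\<^sup>+s. ennreal \<bar>f s\<bar> * 1 \<partial>T1)\<^sup>2"
    by (rule power_mono) simp
  also have "\<dots> \<le> (\<integral>\<^sup>+s. (ennreal \<bar>f s\<bar>)\<^sup>2 \<partial>T1) * (\<integral>\<^sup>+s. 1\<^sup>2 \<partial>T1)"
    by (rule Cauchy_Schwarz_nn_integral) auto
  finally show ?thesis by (simp add: ennreal_power)
qed (simp add: not_integrable_integral_eq)

text \<open>Jensen's inequality and translation invariance. The bound by the norm of
  \<open>g\<close> itself, without a constant, is what \<open>L2_tendsto_if_norm_le\<close> asks
  for.\<close>

lemma avg_L2_le:
  assumes [measurable]: "g \<in> borel_measurable borel"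
  shows "(\<integral>\<^sup>+x. ennreal ((avg h g x)\<^sup>2) \<partial>cyl) \<le> (\<integral>\<^sup>+x. ennreal ((g x)\<^sup>2) \<partial>cyl)"
proof -
  have "(\<integral>\<^sup>+x. ennreal ((avg h g x)\<^sup>2) \<partial>cyl) \<le> (\<integral>\<^sup>+x. \<integral>\<^sup>+s. ennreal ((g (fst x + s * h, snd x))\<^sup>2) \<partial>T1 \<partial>cyl)"
    unfolding avg_def by (intro nn_integral_mono nn_integral_T1_square_le) simp
  also have "\<dots> = (\<integral>\<^sup>+y. \<integral>\<^sup>+x. \<integral>\<^sup>+s. ennreal ((g (x + s * h, y))\<^sup>2) \<partial>T1 \<partial>lborel \<partial>T1)"
    by (subst nn_integral_cyl_snd) (auto intro!: T1.borel_measurable_nn_integral)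
  also have "\<dots> = (\<integral>\<^sup>+y. \<integral>\<^sup>+s. \<integral>\<^sup>+x. ennreal ((g (x + s * h, y))\<^sup>2) \<partial>lborel \<partial>T1 \<partial>T1)"
    by (intro nn_integral_cong cyl.Fubini'[symmetric]) measurable
  also have "\<dots> = (\<integral>\<^sup>+y. \<integral>\<^sup>+s. \<integral>\<^sup>+x. ennreal ((g (x, y))\<^sup>2) \<partial>lborel \<partial>T1 \<partial>T1)"
  proof (rule nn_integral_cong, rule nn_integral_cong)
    fix s y
    show "(\<integral>\<^sup>+x. ennreal ((g (x + s * h, y))\<^sup>2) \<partial>lborel) = (\<integral>\<^sup>+x. ennreal ((g (x, y))\<^sup>2) \<partial>lborel)"
      using nn_integral_real_affine[of "\<lambda>x. ennreal ((g (x, y))\<^sup>2)" 1 "s * h"] by (simp add: add.commute)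
  qed
  also have "\<dots> = (\<integral>\<^sup>+x. ennreal ((g x)\<^sup>2) \<partial>cyl)"
    by (subst nn_integral_cyl_snd) auto
  finally show ?thesis .
qed

lemma L2_slice_integrable:
  fixes g :: "real \<times> real \<Rightarrow> real"
  assumes [measurable]: "g \<in> borel_measurable borel" and i: "integrable cyl (\<lambda>x. (g x)\<^sup>2)"
  shows "AE y in T1. \<forall>s t. set_integrable lborel {s..t} (\<lambda>x. g (x, y))"
  using integral_cyl(4)[OF i]
proof eventually_elim
  case (elim y)
  have "set_integrable lborel {s..t} (\<lambda>x. g (x, y))" for s t
  proof -
    have "integrable lborel (\<lambda>x. indicator {s..t} x * g (x, y))"
      by (rule L2_mult_integrable) (use elim in \<open>auto simp: power2_eq_square[of "indicator _ _"] indicator_inter_arith[symmetric] intro!: integrable_real_indicator simp: emeasure_lborel_Icc_eq\<close>)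
    then show ?thesis by (simp add: set_integrable_def)
  qed
  then show ?case by blast
qed

lemma avg_tendsto:
  fixes g :: "real \<times> real \<Rightarrow> real"
  assumes g[measurable]: "g \<in> borel_measurable borel" and i: "integrable cyl (\<lambda>x. (g x)\<^sup>2)"
  shows "AE x in cyl. (\<lambda>n. avg (1 / real (Suc n)) g x) \<longlonglongrightarrow> g x"
    "AE x in cyl. (\<lambda>n. avg (- 1 / real (Suc n)) g x) \<longlonglongrightarrow> g x"
proof -
  show "AE x in cyl. (\<lambda>n. avg (1 / real (Suc n)) g x) \<longlonglongrightarrow> g x"
  proof (subst AE_cyl_swap(2))
    show "AE y in T1. AE x in lborel. (\<lambda>n. avg (1 / real (Suc n)) g (x, y)) \<longlonglongrightarrow> g (x, y)"
      using L2_slice_integrable[OF g i]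
      by eventually_elim (unfold avg_def fst_conv snd_conv, rule AE_average_tendsto, auto)
  qed measurable
  show "AE x in cyl. (\<lambda>n. avg (- 1 / real (Suc n)) g x) \<longlonglongrightarrow> g x"
  proof (subst AE_cyl_swap(2))
    show "AE y in T1. AE x in lborel. (\<lambda>n. avg (- 1 / real (Suc n)) g (x, y)) \<longlonglongrightarrow> g (x, y)"
      using L2_slice_integrable[OF g i]
    proof eventually_elim
      case (elim y)
      have "set_integrable lborel {s..t} (\<lambda>x. g (- x, y))" for s t
      proof -
        have "integrable lborel (\<lambda>x. indicator {-t..-s} x *\<^sub>R g (x, y))" using elim by (simp add: set_integrable_def)
        then have "integrable lborel (\<lambda>x. indicator {-t..-s} (0 + -1 * x) *\<^sub>R g (0 + -1 * x, y))"
          by (rule lborel_integrable_real_affine) simp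
        moreover have "indicator {-t..-s} (- x) = (indicator {s..t} x :: real)" for x by (auto simp: indicator_def)
        ultimately show ?thesis by (simp add: set_integrable_def)
      qed
      \<comment> \<open>Averages to the left are averages to the right of the reflected
        function.\<close>
      then have "AE x in lborel. (\<lambda>n. \<integral>s. g (- (x + s * (1 / real (Suc n))), y) \<partial>T1) \<longlonglongrightarrow> g (- x, y)"
        by (intro AE_average_tendsto) auto
      from AE_lborel_uminus[OF this] show ?case
        unfolding avg_def by (simp add: algebra_simps)
    qed
  qed measurable
qed

lemma wac_mult:
  assumes "wac f f'" "wac g g'"
  shows "wac (\<lambda>t. f t * g t) (\<lambda>t. g t * f' t + f t * g' t)"
proof -
  have "((\<lambda>z. fst z * snd z) has_derivative (\<lambda>h. fst h * snd z + snd h * fst z)) (at z)" for z :: "real \<times> real"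
    by (auto intro!: derivative_eq_intros simp: algebra_simps)
  from wac_chain[OF assms this continuous_on_snd[OF continuous_on_id] continuous_on_fst[OF continuous_on_id]] show ?thesis by simp
qed

lemma wac_diff:
  assumes "wac f f'" "wac g g'"
  shows "wac (\<lambda>t. f t - g t) (\<lambda>t. f' t - g' t)"
proof -
  have "((\<lambda>z. fst z - snd z) has_derivative (\<lambda>h. fst h * 1 + snd h * -1)) (at z)" for z :: "real \<times> real"
    by (auto intro!: derivative_eq_intros simp: algebra_simps)
  from wac_chain[OF assms this continuous_on_const continuous_on_const] show ?thesis by simp
qed

text \<open>Difference quotients in the first variable replace one of the two derivatives falling on \<open>V\<close>, so
  that no second derivatives are needed.\<close>

lemma null_lagrangian:
  assumes U: "acl U U1 U2" and V: "acl V V1 V2"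
    and L2: "integrable cyl (\<lambda>x. (U x)\<^sup>2)" "integrable cyl (\<lambda>x. (U1 x)\<^sup>2)" "integrable cyl (\<lambda>x. (U2 x)\<^sup>2)"
      "integrable cyl (\<lambda>x. (V1 x)\<^sup>2)" "integrable cyl (\<lambda>x. (V2 x)\<^sup>2)"
  shows "(\<integral>x. U1 x * V2 x \<partial>cyl) = (\<integral>x. V1 x * U2 x \<partial>cyl)"
proof -
  note [measurable] = aclD(1-3)[OF U] aclD(1-3)[OF V]
  have avi: "integrable cyl (\<lambda>x. (avg h g x)\<^sup>2)" if [measurable]: "g \<in> borel_measurable borel" and i: "integrable cyl (\<lambda>x. (g x)\<^sup>2)" for h g
    using le_less_trans[OF avg_L2_le[OF that(1), of h]] i by (auto simp: integrable_iff_bounded)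
  have diff: "AE x in cyl. W (fst x + y, snd x) - W x = y * avg y W1 x" if W: "acl W W1 W2" for W W1 W2 y
  proof (subst AE_cyl_swap(2))
    note [measurable] = aclD(1-3)[OF W]
    show "{x. W (fst x + y, snd x) - W x = y * avg y W1 x} \<in> sets borel" by measurable
    show "AE x2 in T1. AE x1 in lborel. W (fst (x1, x2) + y, snd (x1, x2)) - W (x1, x2) = y * avg y W1 (x1, x2)"
      using aclD(5)[OF W] by eventually_elim (unfold avg_def fst_conv snd_conv, rule wac_difference)
  qed
  \<comment> \<open>The discrete identity: the forward quotient of \<open>V\<close> against
    \<open>U2\<close> is integrated by parts around the circle, and the shift left on
    \<open>V2\<close> is then moved to \<open>U\<close>, which turns it into the backward quotient
    of \<open>U\<close> against \<open>V2\<close>.\<close>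
  have main: "(\<integral>x. avg h V1 x * U2 x \<partial>cyl) = (\<integral>x. avg (-h) U1 x * V2 x \<partial>cyl)" if h: "h > 0" for h
  proof -
    \<comment> \<open>\<open>V\<close> itself may fail to be square integrable, as \<open>u2\<close>
      does; its increment is \<open>h\<close> times an average of \<open>V1\<close>.\<close>
    let ?dV = "\<lambda>x. V (fst x + h, snd x) - V x"
    have sq: "integrable cyl (\<lambda>x. (V2 (fst x + h, snd x))\<^sup>2)" using L2(5) by (subst cyl_shift_integral(2)[of "\<lambda>x. (V2 x)\<^sup>2"]) auto
    have i1: "integrable cyl (\<lambda>x. (h * avg h V1 x) * U2 x)"
      using L2_mult_integrable[of "avg h V1" cyl U2] avi L2 by (simp add: mult.assoc)
    have i1': "integrable cyl (\<lambda>x. ?dV x * U2 x)"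
      by (rule integrable_cong_AE_imp[OF i1]) (use diff[OF V, of h] in auto)
    have i2: "integrable cyl (\<lambda>x. U x * V2 (fst x + h, snd x))" "integrable cyl (\<lambda>x. U x * V2 x)"
      using L2 sq by (auto intro!: L2_mult_integrable)
    have "(\<integral>x. ?dV x * U2 x + U x * (V2 (fst x + h, snd x) - V2 x) \<partial>cyl) =
      (\<integral>x1. \<integral>x2. ?dV (x1, x2) * U2 (x1, x2) + U (x1, x2) * (V2 (x1 + h, x2) - V2 (x1, x2)) \<partial>T1 \<partial>lborel)"
      by (subst integral_cyl(3)[symmetric]) (use i1' i2 in \<open>auto simp: right_diff_distrib\<close>)
    also have "\<dots> = (\<integral>x1. 0 \<partial>(lborel :: real measure))"
    proof (rule integral_cong_AE)
      show "AE x1 in lborel. (\<integral>x2. ?dV (x1, x2) * U2 (x1, x2) + U (x1, x2) * (V2 (x1 + h, x2) - V2 (x1, x2)) \<partial>T1) = 0"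
        using aclD(6)[OF U] aclD(6)[OF V] AE_lborel_shift[OF aclD(6)[OF V], of h]
      proof eventually_elim
        case (elim x1)
        have "wac (\<lambda>x2. U (x1, x2) * (V (x1 + h, x2) - V (x1, x2)))
          (\<lambda>x2. (V (x1 + h, x2) - V (x1, x2)) * U2 (x1, x2) + U (x1, x2) * (V2 (x1 + h, x2) - V2 (x1, x2)))"
          by (rule wac_mult[OF elim(1) wac_diff[OF elim(3,2)]])
        from wac_periodic_integral(2)[OF this] show ?case
          by (simp add: aclD(4)[OF U] aclD(4)[OF V])
      qed
    qed (auto intro!: T1.borel_measurable_lebesgue_integral)
    finally have e1: "(\<integral>x. ?dV x * U2 x \<partial>cyl) = (\<integral>x. U x * V2 x \<partial>cyl) - (\<integral>x. U x * V2 (fst x + h, snd x) \<partial>cyl)"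
      using i1' i2 by (simp add: right_diff_distrib)
    have e2: "(\<integral>x. U x * V2 (fst x + h, snd x) \<partial>cyl) = (\<integral>x. U (fst x + - h, snd x) * V2 x \<partial>cyl)"
      using cyl_shift_integral(1)[of "\<lambda>x. U (fst x + - h, snd x) * V2 x" h] by simp
    have i3: "integrable cyl (\<lambda>x. U (fst x + - h, snd x) * V2 x)"
      using cyl_shift_integral(2)[of "\<lambda>x. U (fst x + - h, snd x) * V2 x" h] i2(1) by simp
    have "(\<integral>x. (h * avg h V1 x) * U2 x \<partial>cyl) = (\<integral>x. ?dV x * U2 x \<partial>cyl)"
      by (rule integral_cong_AE) (use diff[OF V, of h] in auto)
    also have "\<dots> = (\<integral>x. (U x - U (fst x + - h, snd x)) * V2 x \<partial>cyl)"
      unfolding e1 e2 using i2 i3 by (simp add: left_diff_distrib)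
    also have "\<dots> = (\<integral>x. h * (avg (-h) U1 x * V2 x) \<partial>cyl)"
    proof (rule integral_cong_AE)
      show "AE x in cyl. (U x - U (fst x + - h, snd x)) * V2 x = h * (avg (-h) U1 x * V2 x)"
        using diff[OF U, of "-h"]
      proof eventually_elim
        case (elim x)
        then have "U x - U (fst x + - h, snd x) = h * avg (-h) U1 x" by simp
        then show ?case by (simp only: mult.assoc)
      qed
    qed auto
    finally show ?thesis using h by (simp add: mult.assoc)
  qed
  \<comment> \<open>As the step tends to zero both averages converge strongly in \<open>L^2\<close>,
    so each side of \<open>main\<close> has its expected limit.\<close>
  have l1: "(\<lambda>n. \<integral>x. avg (1 / real (Suc n)) V1 x * U2 x \<partial>cyl) \<longlonglongrightarrow> (\<integral>x. V1 x * U2 x \<partial>cyl)"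
    using L2 avi by (intro L2_tendsto_mult L2_tendsto_if_norm_le(2) avg_L2_le avg_tendsto(1)) auto
  have l2: "(\<lambda>n. \<integral>x. avg (- 1 / real (Suc n)) U1 x * V2 x \<partial>cyl) \<longlonglongrightarrow> (\<integral>x. U1 x * V2 x \<partial>cyl)"
    using L2 avi by (intro L2_tendsto_mult L2_tendsto_if_norm_le(2) avg_L2_le avg_tendsto(2)) auto
  have "(\<lambda>n. \<integral>x. avg (1 / real (Suc n)) V1 x * U2 x \<partial>cyl) \<longlonglongrightarrow> (\<integral>x. U1 x * V2 x \<partial>cyl)"
    using l2 main[of "1 / real (Suc n)" for n] by simp
  then show ?thesis using l1 LIMSEQ_unique by blast
qed

text \<open>On almost every line \<open>v\<close> is a constant of integration plus a primitive of
  \<open>d\<close>. By Fubini, averaging over the circle commutes with forming the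
  primitive.\<close>

lemma wac_mean:
  fixes v d :: "real \<times> real \<Rightarrow> real"
  assumes [measurable]: "v \<in> borel_measurable borel" "d \<in> borel_measurable borel"
    and w: "AE y in T1. wac (\<lambda>x. v (x, y)) (\<lambda>x. d (x, y))"
    and di: "\<And>n::nat. integrable cyl (\<lambda>x. indicator {-real n..real n} (fst x) * d x)"
    and vi: "AE x in lborel. integrable T1 (\<lambda>y. v (x, y))"
  shows "wac (\<lambda>x. \<integral>y. v (x, y) \<partial>T1) (\<lambda>x. \<integral>y. d (x, y) \<partial>T1)"
proof -
  define \<Gamma> where "\<Gamma> x = (\<integral>t. primK (fst x) t * d (t, snd x) \<partial>lborel)" for x :: "real \<times> real"
  have [measurable]: "(\<lambda>(x, t). primK (fst x) t * d (t, snd x)) \<in> borel_measurable ((borel :: (real \<times> real) measure) \<Otimes>\<^sub>M borel)"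
    unfolding primK_alt by measurable
  have \<Gamma>m[measurable]: "\<Gamma> \<in> borel_measurable borel"
    unfolding \<Gamma>_def by (intro lborel.borel_measurable_lebesgue_integral) (simp add: case_prod_beta')
  \<comment> \<open>The constant of integration, recovered as a mean over the line variable: in this
    form it is visibly a measurable function of \<open>y\<close>, unlike the value of a chosen
    representative at a point.\<close>
  define c where "c y = (\<integral>t. v (t, y) - \<Gamma> (t, y) \<partial>T1)" for y
  have [measurable]: "c \<in> borel_measurable borel"
    unfolding c_def by (intro T1.borel_measurable_lebesgue_integral) simp
  have "AE y in T1. AE x in lborel. v (x, y) = c y + \<Gamma> (x, y)"
    using w
  proof eventually_elim
    case (elim y)
    obtain \<gamma> where g: "ac \<gamma> (\<lambda>x. d (x, y))" "AE x in lborel. v (x, y) = \<gamma> x" using elim by (auto simp: wac_def)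
    have "ac (\<lambda>x. \<Gamma> (x, y)) (\<lambda>x. d (x, y))"
      unfolding \<Gamma>_def fst_conv snd_conv by (rule ac_primitive) (use acD(1)[OF g(1)] in auto)
    note G = this
    have eq: "\<gamma> x - \<Gamma> (x, y) = \<gamma> 0 - \<Gamma> (0, y)" for x
      using acD(2)[OF g(1), of 0 x] acD(2)[OF g(1), of x 0] acD(2)[OF G, of 0 x] acD(2)[OF G, of x 0]
      by (cases "0 \<le> x") auto
    have "AE t in T1. v (t, y) - \<Gamma> (t, y) = \<gamma> 0 - \<Gamma> (0, y)"
      by (rule AE_T1_I) (use g(2) eq in \<open>auto elim!: eventually_mono\<close>)
    then have "c y = (\<integral>t. \<gamma> 0 - \<Gamma> (0, y) \<partial>T1)"
      unfolding c_def by (intro integral_cong_AE) auto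
    also have "\<dots> = \<gamma> 0 - \<Gamma> (0, y)" by (simp add: measure_def)
    finally have cy: "c y = \<gamma> 0 - \<Gamma> (0, y)" .
    show ?case using g(2) by eventually_elim (use cy eq in \<open>metis diff_add_cancel\<close>)
  qed
  then have ae: "AE x in lborel. AE y in T1. v (x, y) = c y + \<Gamma> (x, y)"
    using AE_cyl_swap[of "\<lambda>x. v x = c (snd x) + \<Gamma> x"] by simp
  define D where "D x = (\<integral>y. d (x, y) \<partial>T1)" for x
  have [measurable]: "D \<in> borel_measurable borel" unfolding D_def by (intro T1_integral_measurable) simp
  have Di: "\<forall>n::nat. set_integrable lborel {-real n..real n} D"
    using integral_cyl(2)[OF di] by (simp add: set_integrable_def D_def)
  have Ki: "integrable cyl (\<lambda>z. primK x (fst z) * d z)" for x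
  proof -
    obtain n :: nat where n: "\<bar>x\<bar> \<le> real n" using real_arch_simple by blast
    have [measurable]: "(\<lambda>z::real\<times>real. primK x (fst z)) \<in> borel_measurable borel" unfolding primK_alt by measurable
    show ?thesis
    proof (rule Bochner_Integration.integrable_bound[OF di[of n]])
      have "norm (primK x (fst z) * d z) \<le> norm (indicator {-real n..real n} (fst z) * d z)" for z
        using n by (auto simp: primK_alt indicator_def)
      then show "AE z in cyl. norm (primK x (fst z) * d z) \<le> norm (indicator {-real n..real n} (fst z) * d z)" by simp
    qed simp
  qed
  have \<Gamma>i: "integrable T1 (\<lambda>y. \<Gamma> (x, y))" "(\<integral>y. \<Gamma> (x, y) \<partial>T1) = (\<integral>t. primK x t * D t \<partial>lborel)" for x
    using integral_cyl(3,5,6)[OF Ki[of x]] by (simp_all add: \<Gamma>_def D_def)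
  \<comment> \<open>A single good value of \<open>x\<close>, at which \<open>v\<close> and
    \<open>\<Gamma>\<close> are both integrable over the circle, shows that \<open>c\<close> is
    integrable.\<close>
  have ci: "integrable T1 c"
  proof -
    have "\<exists>x. integrable T1 (\<lambda>y. v (x, y)) \<and> (AE y in T1. v (x, y) = c y + \<Gamma> (x, y))"
    proof -
      have "AE x in lborel. integrable T1 (\<lambda>y. v (x, y)) \<and> (AE y in T1. v (x, y) = c y + \<Gamma> (x, y))"
        using vi ae by eventually_elim simp
      from AE_lborel_ex[OF this zero_less_one] show ?thesis by blast
    qed
    then obtain x where x: "integrable T1 (\<lambda>y. v (x, y))" "AE y in T1. v (x, y) = c y + \<Gamma> (x, y)" by blast
    have "integrable T1 (\<lambda>y. v (x, y) - \<Gamma> (x, y))" using x(1) \<Gamma>i by simp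
    then show ?thesis by (rule integrable_cong_AE_imp) (use x(2) in auto)
  qed
  have "ac (\<lambda>x. (\<integral>y. c y \<partial>T1) + (\<integral>t. primK x t * D t \<partial>lborel)) D"
    using ac_primitive[OF Di] by (auto simp: ac_def)
  moreover have "AE x in lborel. (\<integral>y. v (x, y) \<partial>T1) = (\<integral>y. c y \<partial>T1) + (\<integral>t. primK x t * D t \<partial>lborel)"
    using ae
  proof eventually_elim
    case (elim x)
    then have "(\<integral>y. v (x, y) \<partial>T1) = (\<integral>y. c y + \<Gamma> (x, y) \<partial>T1)" by (intro integral_cong_AE) auto
    then show ?case using ci \<Gamma>i[of x] by simp
  qed
  moreover have "(\<lambda>x. \<integral>y. v (x, y) \<partial>T1) \<in> borel_measurable borel" by (intro T1_integral_measurable) simp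
  ultimately show ?thesis unfolding wac_def D_def[symmetric] by (intro conjI exI) auto
qed

section \<open>Poincare, Sobolev and Moser--Trudinger inequalities\<close>

lemma acl_slice_bound:
  assumes v: "acl v d1 d2" and der: "\<And>y. (\<theta> has_real_derivative \<theta>' y) (at y)" and cont: "continuous_on UNIV \<theta>'"
    and z: "AE x1 in lborel. \<theta> (\<integral>y. v (x1, y) \<partial>T1) = 0"
  shows "AE x1 in lborel. AE x2 in T1. ennreal \<bar>\<theta> (v (x1, x2))\<bar> \<le> (\<integral>\<^sup>+y. ennreal \<bar>\<theta>' (v (x1, y)) * d2 (x1, y)\<bar> \<partial>T1)"
  using aclD(6)[OF v] z by eventually_elim (rule wac_slice_bound[OF _ der cont])

text \<open>The slice bound integrated along the axis; the circle has mass one, so no constant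
  appears.\<close>

lemma acl_Poincare:
  assumes v: "acl v d1 d2" and der: "\<And>y. (\<theta> has_real_derivative \<theta>' y) (at y)" and cont: "continuous_on UNIV \<theta>'"
    and z: "AE x1 in lborel. \<theta> (\<integral>y. v (x1, y) \<partial>T1) = 0"
  shows "(\<integral>\<^sup>+x. ennreal \<bar>\<theta> (v x)\<bar> \<partial>cyl) \<le> (\<integral>\<^sup>+x. ennreal \<bar>\<theta>' (v x) * d2 x\<bar> \<partial>cyl)"
proof -
  note [measurable] = aclD(1-3)[OF v]
  have [measurable]: "\<theta> \<in> borel_measurable borel" "\<theta>' \<in> borel_measurable borel"
    using cont der by (auto intro!: borel_measurable_continuous_onI continuous_at_imp_continuous_on DERIV_isCont)
  have "(\<integral>\<^sup>+x. ennreal \<bar>\<theta> (v x)\<bar> \<partial>cyl) = (\<integral>\<^sup>+x. \<integral>\<^sup>+y. ennreal \<bar>\<theta> (v (x, y))\<bar> \<partial>T1 \<partial>lborel)"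
    by (rule nn_integral_cyl_fst) simp
  also have "\<dots> \<le> (\<integral>\<^sup>+x. \<integral>\<^sup>+y. ennreal \<bar>\<theta>' (v (x, y)) * d2 (x, y)\<bar> \<partial>T1 \<partial>lborel)"
  proof (rule nn_integral_mono_AE)
    show "AE x in lborel. (\<integral>\<^sup>+y. ennreal \<bar>\<theta> (v (x, y))\<bar> \<partial>T1) \<le> (\<integral>\<^sup>+y. ennreal \<bar>\<theta>' (v (x, y)) * d2 (x, y)\<bar> \<partial>T1)"
      using acl_slice_bound[OF assms]
    proof eventually_elim
      case (elim x)
      then have "(\<integral>\<^sup>+y. ennreal \<bar>\<theta> (v (x, y))\<bar> \<partial>T1) \<le> (\<integral>\<^sup>+z. (\<integral>\<^sup>+y. ennreal \<bar>\<theta>' (v (x, y)) * d2 (x, y)\<bar> \<partial>T1) \<partial>T1)"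
        by (rule nn_integral_mono_AE)
      then show ?case by simp
    qed
  qed
  also have "\<dots> = (\<integral>\<^sup>+x. ennreal \<bar>\<theta>' (v x) * d2 x\<bar> \<partial>cyl)"
    by (rule nn_integral_cyl_fst[symmetric]) simp
  finally show ?thesis .
qed

text \<open>The line has infinite measure, so finiteness of the set where
  \<open>\<theta> (v x)\<close> is nonzero forces a zero of the continuous representative; from
  there the variation bounds it.\<close>

lemma wac_line_bound:
  assumes "wac v d" and der: "\<And>y. (\<theta> has_real_derivative \<theta>' y) (at y)" and cont: "continuous_on UNIV \<theta>'"
    and fin: "emeasure lborel {x. \<theta> (v x) \<noteq> 0} < \<infinity>"
  shows "AE x in lborel. ennreal \<bar>\<theta> (v x)\<bar> \<le> (\<integral>\<^sup>+x. ennreal \<bar>\<theta>' (v x) * d x\<bar> \<partial>lborel)"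
proof -
  obtain \<gamma> where g: "ac \<gamma> (\<lambda>t. \<theta>' (v t) * d t)" "AE x in lborel. \<theta> (v x) = \<gamma> x"
    using wac_compose[OF assms(1) der cont] by (auto simp: wac_def)
  have m[measurable]: "v \<in> borel_measurable borel" "d \<in> borel_measurable borel" using assms by (auto simp: wac_def)
  have [measurable]: "\<theta> \<in> borel_measurable borel" "\<theta>' \<in> borel_measurable borel"
    using cont der by (auto intro!: borel_measurable_continuous_onI continuous_at_imp_continuous_on DERIV_isCont)
  have "\<exists>x0. \<gamma> x0 = 0"
  proof (rule ccontr)
    assume "\<nexists>x0. \<gamma> x0 = 0"
    then have "AE x in lborel. x \<in> {x. \<theta> (v x) \<noteq> 0}" using g(2) by (auto elim!: eventually_mono)
    then have "emeasure lborel {x. \<theta> (v x) \<noteq> 0} = emeasure lborel (UNIV :: real set)"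
      by (intro emeasure_eq_AE) auto
    then show False using fin by simp
  qed
  then obtain x0 where x0: "\<gamma> x0 = 0" by blast
  have "ennreal \<bar>\<gamma> x\<bar> \<le> (\<integral>\<^sup>+x. ennreal \<bar>\<theta>' (v x) * d x\<bar> \<partial>lborel)" for x
  proof -
    let ?I = "{min x x0..max x x0}"
    have i: "integrable lborel (\<lambda>x. indicator ?I x *\<^sub>R \<bar>\<theta>' (v x) * d x\<bar>)"
      using set_integrable_abs[OF acD(1)[OF g(1), of "min x x0" "max x x0"]] by (auto simp: set_integrable_def)
    have "\<bar>\<gamma> x\<bar> \<le> (LINT x:?I|lborel. \<bar>\<theta>' (v x) * d x\<bar>)"
      using ac_bound[OF g(1), of x "min x x0" "max x x0" x0] x0 by auto
    then have "ennreal \<bar>\<gamma> x\<bar> \<le> ennreal (\<integral>x. indicator ?I x *\<^sub>R \<bar>\<theta>' (v x) * d x\<bar> \<partial>lborel)"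
      unfolding set_lebesgue_integral_def by (rule ennreal_leI)
    also have "\<dots> = (\<integral>\<^sup>+x. ennreal (indicator ?I x *\<^sub>R \<bar>\<theta>' (v x) * d x\<bar>) \<partial>lborel)"
      using i by (subst nn_integral_eq_integral) auto
    also have "\<dots> \<le> (\<integral>\<^sup>+x. ennreal \<bar>\<theta>' (v x) * d x\<bar> \<partial>lborel)"
      by (intro nn_integral_mono ennreal_leI) (auto simp: indicator_def)
    finally show ?thesis .
  qed
  then show ?thesis using g(2) by (auto elim!: eventually_mono)
qed

text \<open>Gagliardo's argument in dimension two: the function is bounded by some \<open>H\<close>
  of the first variable alone (circle slices) and by some \<open>G\<close> of the second alone
  (lines), and the integral of the product factorizes.\<close>

lemma acl_Sobolev:
  assumes v: "acl v d1 d2" and der: "\<And>y. (\<theta> has_real_derivative \<theta>' y) (at y)" and cont: "continuous_on UNIV \<theta>'"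
    and z: "AE x1 in lborel. \<theta> (\<integral>y. v (x1, y) \<partial>T1) = 0"
    and fin: "emeasure cyl {x. \<theta> (v x) \<noteq> 0} < \<infinity>"
  shows "(\<integral>\<^sup>+x. (ennreal \<bar>\<theta> (v x)\<bar>)\<^sup>2 \<partial>cyl) \<le>
    (\<integral>\<^sup>+x. ennreal \<bar>\<theta>' (v x) * d1 x\<bar> \<partial>cyl) * (\<integral>\<^sup>+x. ennreal \<bar>\<theta>' (v x) * d2 x\<bar> \<partial>cyl)"
proof -
  note [measurable] = aclD(1-3)[OF v]
  have [measurable]: "\<theta> \<in> borel_measurable borel" "\<theta>' \<in> borel_measurable borel"
    using cont der by (auto intro!: borel_measurable_continuous_onI continuous_at_imp_continuous_on DERIV_isCont)
  define H where "H x = (\<integral>\<^sup>+y. ennreal \<bar>\<theta>' (v (x, y)) * d2 (x, y)\<bar> \<partial>T1)" for x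
  define G where "G y = (\<integral>\<^sup>+x. ennreal \<bar>\<theta>' (v (x, y)) * d1 (x, y)\<bar> \<partial>lborel)" for y
  have Hm[measurable]: "H \<in> borel_measurable borel"
  proof -
    have "(\<lambda>z. ennreal \<bar>\<theta>' (v z) * d2 z\<bar>) \<in> borel_measurable (lborel \<Otimes>\<^sub>M T1)" by (rule measurable_cyl_pair) simp
    from T1.borel_measurable_nn_integral_fst[OF this] have "H \<in> borel_measurable lborel" unfolding H_def .
    then show ?thesis by simp
  qed
  have Gm[measurable]: "G \<in> borel_measurable borel"
    unfolding G_def by (rule lborel.borel_measurable_nn_integral) simp
  have h: "AE x in lborel. AE y in T1. ennreal \<bar>\<theta> (v (x, y))\<bar> \<le> H x"
    unfolding H_def by (rule acl_slice_bound[OF v der cont z])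
  have "(\<integral>\<^sup>+x. indicator {x. \<theta> (v x) \<noteq> 0} x \<partial>cyl) \<noteq> \<infinity>" using fin by simp
  then have "AE y in T1. (\<integral>\<^sup>+x. indicator {x. \<theta> (v x) \<noteq> 0} (x, y) \<partial>lborel) \<noteq> \<infinity>"
    by (subst (asm) nn_integral_cyl_snd, simp)
      (rule nn_integral_PInf_AE[rotated], assumption, rule lborel.borel_measurable_nn_integral, simp)
  then have "AE y in T1. AE x in lborel. ennreal \<bar>\<theta> (v (x, y))\<bar> \<le> G y"
    using aclD(5)[OF v]
  proof eventually_elim
    case (elim y)
    have "(\<integral>\<^sup>+x. indicator {x. \<theta> (v x) \<noteq> 0} (x, y) \<partial>lborel) = (\<integral>\<^sup>+x. indicator {x. \<theta> (v (x, y)) \<noteq> 0} x \<partial>lborel)"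
      by (intro nn_integral_cong) (auto simp: indicator_def)
    then have "emeasure lborel {x. \<theta> (v (x, y)) \<noteq> 0} < \<infinity>" using elim(1) by (simp add: less_top)
    then show ?case unfolding G_def by (rule wac_line_bound[OF elim(2) der cont])
  qed
  then have g: "AE x in lborel. AE y in T1. ennreal \<bar>\<theta> (v (x, y))\<bar> \<le> G y"
    using AE_cyl_swap[of "\<lambda>x. ennreal \<bar>\<theta> (v x)\<bar> \<le> G (snd x)"] by simp
  have "(\<integral>\<^sup>+x. (ennreal \<bar>\<theta> (v x)\<bar>)\<^sup>2 \<partial>cyl) = (\<integral>\<^sup>+x. \<integral>\<^sup>+y. (ennreal \<bar>\<theta> (v (x, y))\<bar>)\<^sup>2 \<partial>T1 \<partial>lborel)"
    by (rule nn_integral_cyl_fst) simp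
  also have "\<dots> \<le> (\<integral>\<^sup>+x. \<integral>\<^sup>+y. H x * G y \<partial>T1 \<partial>lborel)"
  proof (rule nn_integral_mono_AE)
    show "AE x in lborel. (\<integral>\<^sup>+y. (ennreal \<bar>\<theta> (v (x, y))\<bar>)\<^sup>2 \<partial>T1) \<le> (\<integral>\<^sup>+y. H x * G y \<partial>T1)"
      using h g
    proof eventually_elim
      case (elim x)
      have "AE y in T1. (ennreal \<bar>\<theta> (v (x, y))\<bar>)\<^sup>2 \<le> H x * G y"
        using elim by eventually_elim (simp add: power2_eq_square mult_mono)
      then show ?case by (rule nn_integral_mono_AE)
    qed
  qed
  also have "\<dots> = (\<integral>\<^sup>+x. H x \<partial>lborel) * (\<integral>\<^sup>+y. G y \<partial>T1)"
    by (simp add: nn_integral_cmult nn_integral_multc)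
  also have "(\<integral>\<^sup>+x. H x \<partial>lborel) = (\<integral>\<^sup>+x. ennreal \<bar>\<theta>' (v x) * d2 x\<bar> \<partial>cyl)"
    unfolding H_def by (rule nn_integral_cyl_fst[symmetric]) simp
  also have "(\<integral>\<^sup>+y. G y \<partial>T1) = (\<integral>\<^sup>+x. ennreal \<bar>\<theta>' (v x) * d1 x\<bar> \<partial>cyl)"
    unfolding G_def by (rule nn_integral_cyl_snd[symmetric]) simp
  finally show ?thesis by (simp add: mult.commute)
qed

text \<open>The slice bound with \<open>\<theta> t = t - ?m\<close>, squared by Cauchy-Schwarz on a
  space of mass one.\<close>

lemma acl_Poincare_mean:
  assumes v: "acl v d1 d2"
  shows "(\<integral>\<^sup>+x. ennreal ((v x - (\<integral>y. v (fst x, y) \<partial>T1))\<^sup>2) \<partial>cyl) \<le> (\<integral>\<^sup>+x. ennreal ((d2 x)\<^sup>2) \<partial>cyl)"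
    "AE x1 in lborel. AE x2 in T1. ennreal ((v (x1, x2) - (\<integral>y. v (x1, y) \<partial>T1))\<^sup>2) \<le> (\<integral>\<^sup>+y. ennreal ((d2 (x1, y))\<^sup>2) \<partial>T1)"
proof -
  note [measurable] = aclD(1-3)[OF v]
  have [measurable]: "(\<lambda>x. \<integral>y. v (x, y) \<partial>T1) \<in> borel_measurable borel" by (rule T1_integral_measurable) simp
  show *: "AE x1 in lborel. AE x2 in T1. ennreal ((v (x1, x2) - (\<integral>y. v (x1, y) \<partial>T1))\<^sup>2) \<le> (\<integral>\<^sup>+y. ennreal ((d2 (x1, y))\<^sup>2) \<partial>T1)"
    using aclD(6)[OF v]
  proof eventually_elim
    case (elim x1)
    let ?m = "\<integral>y. v (x1, y) \<partial>T1"
    have "AE x2 in T1. ennreal \<bar>v (x1, x2) - ?m\<bar> \<le> (\<integral>\<^sup>+y. ennreal \<bar>1 * d2 (x1, y)\<bar> \<partial>T1)"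
      by (rule wac_slice_bound[OF elim, where \<theta>="\<lambda>t. t - ?m" and \<theta>'="\<lambda>_. 1"]) (auto intro!: derivative_eq_intros)
    have "(\<integral>\<^sup>+y. ennreal \<bar>d2 (x1, y)\<bar> * 1 \<partial>T1)\<^sup>2 \<le> (\<integral>\<^sup>+y. (ennreal \<bar>d2 (x1, y)\<bar>)\<^sup>2 \<partial>T1) * (\<integral>\<^sup>+y. 1\<^sup>2 \<partial>T1)"
      by (rule Cauchy_Schwarz_nn_integral) auto
    note CS = this
    show ?case using \<open>AE x2 in T1. ennreal \<bar>v (x1, x2) - ?m\<bar> \<le> _\<close>
    proof eventually_elim
      case (elim x2)
      have "(ennreal \<bar>v (x1, x2) - ?m\<bar>)\<^sup>2 \<le> (\<integral>\<^sup>+y. ennreal \<bar>1 * d2 (x1, y)\<bar> \<partial>T1)\<^sup>2" using elim by (rule power_mono) simp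
      also have "\<dots> \<le> (\<integral>\<^sup>+y. ennreal ((d2 (x1, y))\<^sup>2) \<partial>T1)" using CS by (simp add: ennreal_power)
      finally show ?case by (simp add: ennreal_power)
    qed
  qed
  have "(\<integral>\<^sup>+x. ennreal ((v x - (\<integral>y. v (fst x, y) \<partial>T1))\<^sup>2) \<partial>cyl) = (\<integral>\<^sup>+x1. \<integral>\<^sup>+x2. ennreal ((v (x1, x2) - (\<integral>y. v (x1, y) \<partial>T1))\<^sup>2) \<partial>T1 \<partial>lborel)"
    by (subst nn_integral_cyl_fst) auto
  also have "\<dots> \<le> (\<integral>\<^sup>+x. \<integral>\<^sup>+y. ennreal ((d2 (x, y))\<^sup>2) \<partial>T1 \<partial>lborel)"
  proof (rule nn_integral_mono_AE)
    show "AE x1 in lborel. (\<integral>\<^sup>+x2. ennreal ((v (x1, x2) - (\<integral>y. v (x1, y) \<partial>T1))\<^sup>2) \<partial>T1) \<le> (\<integral>\<^sup>+y. ennreal ((d2 (x1, y))\<^sup>2) \<partial>T1)"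
      using *
    proof eventually_elim
      case (elim x1)
      then have "(\<integral>\<^sup>+x2. ennreal ((v (x1, x2) - (\<integral>y. v (x1, y) \<partial>T1))\<^sup>2) \<partial>T1) \<le> (\<integral>\<^sup>+x2. (\<integral>\<^sup>+y. ennreal ((d2 (x1, y))\<^sup>2) \<partial>T1) \<partial>T1)"
        by (rule nn_integral_mono_AE)
      then show ?case by simp
    qed
  qed
  also have "\<dots> = (\<integral>\<^sup>+x. ennreal ((d2 x)\<^sup>2) \<partial>cyl)" by (rule nn_integral_cyl_fst[symmetric]) simp
  finally show "(\<integral>\<^sup>+x. ennreal ((v x - (\<integral>y. v (fst x, y) \<partial>T1))\<^sup>2) \<partial>cyl) \<le> (\<integral>\<^sup>+x. ennreal ((d2 x)\<^sup>2) \<partial>cyl)" .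
qed

text \<open>Chebyshev: on the superlevel set \<open>v\<close> differs from its slice mean by at
  least \<open>l - B\<close>, and this difference is square integrable.\<close>

lemma finite_superlevel:
  assumes v: "acl v d1 d2" and d: "integrable cyl (\<lambda>x. (d2 x)\<^sup>2)"
    and B: "AE x1 in lborel. \<bar>(\<integral>y. v (x1, y) \<partial>T1) - b\<bar> \<le> B" and l: "B < l"
  shows "emeasure cyl {x. l < \<bar>v x - b\<bar>} < \<infinity>"
proof -
  note [measurable] = aclD(1-3)[OF v]
  have mm[measurable]: "(\<lambda>x. \<integral>y. v (x, y) \<partial>T1) \<in> borel_measurable borel" by (rule T1_integral_measurable) simp
  have "AE x in cyl. \<bar>(\<integral>y. v (fst x, y) \<partial>T1) - b\<bar> \<le> B"
    by (subst AE_cyl_swap(1)) (use B in auto)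
  then have "(\<integral>\<^sup>+x. indicator {x. l < \<bar>v x - b\<bar>} x * ennreal ((l - B)\<^sup>2) \<partial>cyl) \<le> (\<integral>\<^sup>+x. ennreal ((v x - (\<integral>y. v (fst x, y) \<partial>T1))\<^sup>2) \<partial>cyl)"
  proof (intro nn_integral_mono_AE, eventually_elim)
    case (elim x)
    show ?case
    proof (cases "l < \<bar>v x - b\<bar>")
      case True
      then have "l - B \<le> \<bar>v x - (\<integral>y. v (fst x, y) \<partial>T1)\<bar>" using elim by linarith
      then have "(l - B)\<^sup>2 \<le> (v x - (\<integral>y. v (fst x, y) \<partial>T1))\<^sup>2" using l by (metis abs_le_square_iff abs_of_pos diff_gt_0_iff_gt)
      then show ?thesis using True by (simp add: ennreal_leI)
    qed simp
  qed
  also have "\<dots> \<le> (\<integral>\<^sup>+x. ennreal ((d2 x)\<^sup>2) \<partial>cyl)" by (rule acl_Poincare_mean(1)[OF v])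
  also have "\<dots> < \<infinity>" using d by (simp add: integrable_iff_bounded)
  finally have "emeasure cyl {x. l < \<bar>v x - b\<bar>} * ennreal ((l - B)\<^sup>2) < \<infinity>"
    by (simp add: nn_integral_multc)
  then show ?thesis using l by (auto simp: ennreal_mult_less_top)
qed

section \<open>Truncation at a level and exponential integrability\<close>

text \<open>A \<open>C^1\<close> truncation rising from \<open>0\<close> at level \<open>k\<close>
  to the constant \<open>h^2 / 2\<close> from level \<open>k + h\<close> on. Its derivative
  \<open>tent'\<close> is the hat function on that interval, with peak \<open>h\<close> in the
  middle.\<close>

definition tent :: "real \<Rightarrow> real \<Rightarrow> real \<Rightarrow> real" where
  "tent k h y = (max 0 (y - k))\<^sup>2 - 2 * (max 0 (y - (k + h / 2)))\<^sup>2 + (max 0 (y - (k + h)))\<^sup>2"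
definition tent' :: "real \<Rightarrow> real \<Rightarrow> real \<Rightarrow> real" where
  "tent' k h y = 2 * max 0 (y - k) - 4 * max 0 (y - (k + h / 2)) + 2 * max 0 (y - (k + h))"

lemma max_shift_square_has_derivative:
  "((\<lambda>x. (max 0 (x - l))\<^sup>2) has_real_derivative 2 * max 0 (x - l :: real)) (at x)"
  by (rule DERIV_chain2[OF max_square_has_derivative, of "\<lambda>x. x - l" 1 x UNIV, simplified]) (auto intro!: derivative_eq_intros)

lemma tent_derivative: "(tent k h has_real_derivative tent' k h y) (at y)"
  unfolding tent_def[abs_def] tent'_def
  by (rule derivative_eq_intros max_shift_square_has_derivative refl | simp)+

lemma tent'_bounds:
  assumes "h > 0"
  shows "0 \<le> tent' k h y" "tent' k h y \<le> h" "\<not> (k < y \<and> y < k + h) \<Longrightarrow> tent' k h y = 0"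
  using assms by (auto simp: tent'_def max_def)

lemma tent_values:
  assumes "h > 0"
  shows "y \<le> k \<Longrightarrow> tent k h y = 0" "k + h \<le> y \<Longrightarrow> tent k h y = h\<^sup>2 / 2"
  using assms by (auto simp: tent_def max_def power2_eq_square field_simps)

text \<open>\<open>acl_Sobolev\<close> for the even truncation made of two tents: it equals
  \<open>h^2 / 2\<close> above level \<open>k + h\<close>, and its slope is at most \<open>h\<close>
  and lives in the layer \<open>L\<close> between the levels. Cauchy-Schwarz splits the gradient
  integral into measure and energy of the layer, and both are differences of values at the two
  levels.\<close>

lemma level_inequality:
  assumes v: "acl v d1 d2" and L2: "integrable cyl (\<lambda>x. (d1 x)\<^sup>2)" "integrable cyl (\<lambda>x. (d2 x)\<^sup>2)"
    and B: "AE x1 in lborel. \<bar>\<integral>y. v (x1, y) \<partial>T1\<bar> \<le> B" "0 \<le> B"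
    and k: "B < k" and h: "h > 0"
  shows "h\<^sup>2 / 4 * measure cyl {x. k + h < \<bar>v x\<bar>} \<le>
    (measure cyl {x. k < \<bar>v x\<bar>} - measure cyl {x. k + h < \<bar>v x\<bar>}) *
    ((\<integral>x. indicator {x. k < \<bar>v x\<bar>} x * ((d1 x)\<^sup>2 + (d2 x)\<^sup>2) \<partial>cyl) - (\<integral>x. indicator {x. k + h < \<bar>v x\<bar>} x * ((d1 x)\<^sup>2 + (d2 x)\<^sup>2) \<partial>cyl))"
proof -
  note [measurable] = aclD(1-3)[OF v]
  define \<theta> where "\<theta> y = tent k h y + tent k h (- y)" for y
  define \<theta>' where "\<theta>' y = tent' k h y - tent' k h (- y)" for y
  have der: "(\<theta> has_real_derivative \<theta>' y) (at y)" for y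
    unfolding \<theta>_def \<theta>'_def
    using DERIV_add[OF tent_derivative[of k h y] DERIV_chain2[OF tent_derivative[of k h "- y"] DERIV_minus[OF DERIV_ident]]] by simp
  have cont: "continuous_on UNIV \<theta>'" unfolding \<theta>'_def tent'_def by (intro continuous_intros)
  have [measurable]: "\<theta> \<in> borel_measurable borel" "\<theta>' \<in> borel_measurable borel"
    using cont der by (auto intro!: borel_measurable_continuous_onI continuous_at_imp_continuous_on DERIV_isCont)
  have k0: "k > 0" using k B by simp
  define L where "L = {x. k < \<bar>v x\<bar> \<and> \<bar>v x\<bar> \<le> k + h}"
  have Lm[measurable]: "L \<in> sets borel" unfolding L_def by measurable
  have \<theta>z: "\<theta> y = 0" if "\<bar>y\<bar> \<le> k" for y using that tent_values(1)[OF h, of y k] tent_values(1)[OF h, of "-y" k] by (auto simp: \<theta>_def)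
  have "\<theta> y = h\<^sup>2 / 2" if "k + h < \<bar>y\<bar>" for y
    using that tent_values(1)[OF h, of y k] tent_values(1)[OF h, of "-y" k] tent_values(2)[OF h, of k y] tent_values(2)[OF h, of k "-y"] k0 h by (cases "y \<ge> 0") (auto simp: \<theta>_def)
  note \<theta>v1 = this
  have \<theta>v: "\<bar>\<theta> y\<bar> = h\<^sup>2 / 2" if "k + h < \<bar>y\<bar>" for y unfolding \<theta>v1[OF that] by simp
  have \<theta>'b: "\<bar>\<theta>' (v x) * d\<bar> \<le> h * (indicator L x * g)" if "\<bar>d\<bar> \<le> g" for x d g
  proof -
    have "\<bar>\<theta>' (v x)\<bar> \<le> h * indicator L x"
    proof (cases "x \<in> L")
      case True
      then show ?thesis using tent'_bounds(1,2)[OF h, of k "v x"] tent'_bounds(1,2)[OF h, of k "- v x"] by (auto simp: \<theta>'_def)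
    next
      case False
      then have "\<not> (k < v x \<and> v x < k + h)" "\<not> (k < - v x \<and> - v x < k + h)" using k0 by (auto simp: L_def)
      then have "\<theta>' (v x) = 0" using tent'_bounds(3)[OF h] by (simp add: \<theta>'_def)
      then show ?thesis using h by simp
    qed
    then have "\<bar>\<theta>' (v x)\<bar> * \<bar>d\<bar> \<le> (h * indicator L x) * g" using that h by (intro mult_mono) auto
    then show ?thesis by (simp add: abs_mult mult.assoc)
  qed
  have z: "AE x1 in lborel. \<theta> (\<integral>y. v (x1, y) \<partial>T1) = 0" using B(1) by eventually_elim (use k in \<open>auto intro!: \<theta>z\<close>)
  have fink: "emeasure cyl {x. k < \<bar>v x\<bar>} < \<infinity>" using finite_superlevel[OF v L2(2), of 0 B k] B(1) k by simp
  have fin: "emeasure cyl {x. \<theta> (v x) \<noteq> 0} < \<infinity>"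
    by (rule le_less_trans[OF emeasure_mono fink]) (use \<theta>z not_le in auto)
  define g where "g x = sqrt ((d1 x)\<^sup>2 + (d2 x)\<^sup>2)" for x
  have gm[measurable]: "g \<in> borel_measurable borel" unfolding g_def by measurable
  have g2: "(g x)\<^sup>2 = (d1 x)\<^sup>2 + (d2 x)\<^sup>2" for x by (simp add: g_def)
  have g0: "g x \<ge> 0" for x by (simp add: g_def)
  have dg: "\<bar>d1 x\<bar> \<le> g x" "\<bar>d2 x\<bar> \<le> g x" for x by (auto simp: g_def intro!: real_le_rsqrt)
  have gi: "integrable cyl (\<lambda>x. (g x)\<^sup>2)" unfolding g2 using L2 by simp
  have Li: "integrable cyl (\<lambda>x. (indicator L x)\<^sup>2 :: real)"
  proof -
    have "emeasure cyl L < \<infinity>" by (rule le_less_trans[OF emeasure_mono fink]) (auto simp: L_def)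
    then have "integrable cyl (indicator L :: _ \<Rightarrow> real)" by (intro integrable_real_indicator) auto
    then show ?thesis by (simp add: power2_eq_square indicator_inter_arith[symmetric])
  qed
  have gLi: "integrable cyl (\<lambda>x. (indicator L x * g x)\<^sup>2)"
    by (rule Bochner_Integration.integrable_bound[OF gi]) (auto simp: indicator_def)
  define I where "I = (\<integral>x. indicator L x * g x \<partial>cyl)"
  have LI: "integrable cyl (\<lambda>x. indicator L x * g x)" using Li gi by (intro L2_mult_integrable) auto
  have I0: "I \<ge> 0" unfolding I_def using g0 by simp
  have bd: "(\<integral>\<^sup>+x. ennreal \<bar>\<theta>' (v x) * d x\<bar> \<partial>cyl) \<le> ennreal (h * I)" if "\<And>x. \<bar>d x\<bar> \<le> g x" for d
  proof -
    have "(\<integral>\<^sup>+x. ennreal \<bar>\<theta>' (v x) * d x\<bar> \<partial>cyl) \<le> (\<integral>\<^sup>+x. ennreal (h * (indicator L x * g x)) \<partial>cyl)"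
      using \<theta>'b that by (intro nn_integral_mono ennreal_leI) auto
    also have "\<dots> = ennreal (h * I)" unfolding I_def using LI h g0 by (subst nn_integral_eq_integral) auto
    finally show ?thesis .
  qed
  define m where "m l = measure cyl {x. l < \<bar>v x\<bar>}" for l
  define E where "E l = (\<integral>x. indicator {x. l < \<bar>v x\<bar>} x * ((d1 x)\<^sup>2 + (d2 x)\<^sup>2) \<partial>cyl)" for l
  have finh: "emeasure cyl {x. k + h < \<bar>v x\<bar>} < \<infinity>"
    by (rule le_less_trans[OF emeasure_mono fink]) (use h in auto)
  have "ennreal ((h\<^sup>2 / 2)\<^sup>2 * m (k + h)) = (\<integral>\<^sup>+x. ennreal ((h\<^sup>2 / 2)\<^sup>2) * indicator {x. k + h < \<bar>v x\<bar>} x \<partial>cyl)"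
    using finh by (subst nn_integral_cmult_indicator) (auto simp: m_def ennreal_mult emeasure_eq_ennreal_measure less_top)
  also have "\<dots> \<le> (\<integral>\<^sup>+x. (ennreal \<bar>\<theta> (v x)\<bar>)\<^sup>2 \<partial>cyl)"
    by (intro nn_integral_mono) (auto simp: indicator_def \<theta>v1 ennreal_power)
  also have "\<dots> \<le> (\<integral>\<^sup>+x. ennreal \<bar>\<theta>' (v x) * d1 x\<bar> \<partial>cyl) * (\<integral>\<^sup>+x. ennreal \<bar>\<theta>' (v x) * d2 x\<bar> \<partial>cyl)"
    by (rule acl_Sobolev[OF v der cont z fin])
  also have "\<dots> \<le> ennreal (h * I) * ennreal (h * I)"
    using bd dg by (intro mult_mono) auto
  also have "\<dots> = ennreal (h\<^sup>2 * I\<^sup>2)" using h I0 by (simp add: ennreal_mult[symmetric] power2_eq_square ac_simps)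
  finally have 1: "(h\<^sup>2 / 2)\<^sup>2 * m (k + h) \<le> h\<^sup>2 * I\<^sup>2" by (subst (asm) ennreal_le_iff) auto
  have 2: "h\<^sup>2 / 4 * m (k + h) \<le> I\<^sup>2"
  proof -
    have "h\<^sup>2 * (h\<^sup>2 / 4 * m (k + h)) \<le> h\<^sup>2 * I\<^sup>2" using 1 by (simp add: power2_eq_square field_simps)
    then show ?thesis using h by (simp only: mult_le_cancel_left_pos zero_less_power)
  qed
  have "I\<^sup>2 \<le> (\<integral>x. (indicator L x)\<^sup>2 \<partial>cyl) * (\<integral>x. (indicator L x * g x)\<^sup>2 \<partial>cyl)"
  proof -
    have "(\<integral>x. \<bar>indicator L x * (indicator L x * g x)\<bar> \<partial>cyl)\<^sup>2 \<le> (\<integral>x. (indicator L x)\<^sup>2 \<partial>cyl) * (\<integral>x. (indicator L x * g x)\<^sup>2 \<partial>cyl)"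
      using Li gLi by (intro L2_Cauchy_Schwarz) auto
    also have "(\<lambda>x. \<bar>indicator L x * (indicator L x * g x)\<bar>) = (\<lambda>x. indicator L x * g x)"
      using g0 by (auto simp: indicator_def)
    finally show ?thesis by (simp add: I_def)
  qed
  also have "(\<integral>x. (indicator L x)\<^sup>2 \<partial>cyl) = m k - m (k + h)"
  proof -
    have "(\<lambda>x. (indicator L x)\<^sup>2 :: real) = (\<lambda>x. indicator {x. k < \<bar>v x\<bar>} x - indicator {x. k + h < \<bar>v x\<bar>} x)"
      using h by (auto simp: L_def indicator_def)
    moreover have "integrable cyl (indicator {x. k < \<bar>v x\<bar>} :: _ \<Rightarrow> real)" "integrable cyl (indicator {x. k + h < \<bar>v x\<bar>} :: _ \<Rightarrow> real)"
      using fink finh by (auto intro!: integrable_real_indicator)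
    ultimately show ?thesis by (simp add: m_def)
  qed
  also have "(\<integral>x. (indicator L x * g x)\<^sup>2 \<partial>cyl) = E k - E (k + h)"
  proof -
    have "(\<lambda>x. (indicator L x * g x)\<^sup>2) = (\<lambda>x. indicator {x. k < \<bar>v x\<bar>} x * ((d1 x)\<^sup>2 + (d2 x)\<^sup>2) - indicator {x. k + h < \<bar>v x\<bar>} x * ((d1 x)\<^sup>2 + (d2 x)\<^sup>2))"
      using h by (auto simp: L_def indicator_def g2)
    moreover have "integrable cyl (\<lambda>x. indicator {x. l < \<bar>v x\<bar>} x * ((d1 x)\<^sup>2 + (d2 x)\<^sup>2))" for l
      by (rule Bochner_Integration.integrable_bound[OF gi[unfolded g2]]) (auto simp: indicator_def)
    ultimately show ?thesis by (simp add: E_def)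
  qed
  finally show ?thesis using 2 unfolding m_def E_def by linarith
qed

text \<open>Where the energy drop over a step is at most \<open>h^2 / 4\<close>, the hypothesis
  \<open>ineq\<close> gives \<open>m (l + h) \<le> m l - m (l + h)\<close>, so \<open>m\<close> is
  halved. Steps with a larger drop are limited by the total energy available, which is
  small.\<close>

lemma exp_level_decay:
  fixes m E :: "real \<Rightarrow> real"
  assumes ineq: "\<And>l h. k \<le> l \<Longrightarrow> 0 < h \<Longrightarrow> h\<^sup>2 / 4 * m (l + h) \<le> (m l - m (l + h)) * (E l - E (l + h))"
    and mono: "\<And>l h. k \<le> l \<Longrightarrow> 0 < h \<Longrightarrow> m (l + h) \<le> m l" "\<And>l h. 0 < h \<Longrightarrow> E (l + h) \<le> E l"
    and m0: "\<And>l. 0 \<le> m l" and E0: "\<And>l. 0 \<le> E l"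
    and M: "M > 0" "E k \<le> 1 / (8 * real M)"
  shows "m (k + real J) \<le> m k * 2 powr (- (real (J^2) * real M / 2))"
proof (cases "J = 0")
  case False
  \<comment> \<open>\<open>J^2 * M\<close> steps of this length cover the distance \<open>J\<close>.
    They contribute \<open>- J^2 * M\<close> to the exponent, while the energy costs at most
    \<open>4 * (1 / (8 * M)) * (J * M)^2\<close>, that is half of it.\<close>
  define h where "h = 1 / (real J * real M)"
  have h: "h > 0" using False M by (simp add: h_def)
  \<comment> \<open>The power is at least \<open>1\<close> if the drop exceeds
    \<open>h^2 / 4\<close> and at least \<open>1 / 2\<close> in any case. Hence one formula covers
    both kinds of steps, and its exponents telescope in \<open>E\<close>.\<close>
  have step: "m (l + h) \<le> m l * 2 powr (- 1 + 4 * (E l - E (l + h)) / h\<^sup>2)" if "k \<le> l" for l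
  proof (cases "4 * (E l - E (l + h)) / h\<^sup>2 \<ge> 1")
    case True
    then have "(1::real) \<le> 2 powr (- 1 + 4 * (E l - E (l + h)) / h\<^sup>2)" by (intro ge_one_powr_ge_zero) auto
    then show ?thesis using mono(1)[OF that h] m0[of l] mult_left_mono[of 1 _ "m l"] by fastforce
  next
    case False
    then have e: "E l - E (l + h) \<le> h\<^sup>2 / 4" using h by (simp add: field_simps)
    have "h\<^sup>2 / 4 * m (l + h) \<le> (m l - m (l + h)) * (h\<^sup>2 / 4)"
      using ineq[OF that h] mult_left_mono[OF e, of "m l - m (l + h)"] mono(1)[OF that h] by linarith
    then have "h\<^sup>2 / 4 * m (l + h) \<le> h\<^sup>2 / 4 * (m l - m (l + h))" by (simp add: mult.commute)
    then have "m (l + h) \<le> m l * (1 / 2)" using h by simp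
    also have "\<dots> \<le> m l * 2 powr (- 1 + 4 * (E l - E (l + h)) / h\<^sup>2)"
    proof (rule mult_left_mono[OF _ m0])
      have "(1 / 2 :: real) = 2 powr (-1)" by (simp add: powr_minus_divide)
      also have "\<dots> \<le> 2 powr (- 1 + 4 * (E l - E (l + h)) / h\<^sup>2)" using mono(2)[OF h, of l] by (intro powr_mono) auto
      finally show "1 / 2 \<le> 2 powr (- 1 + 4 * (E l - E (l + h)) / h\<^sup>2)" .
    qed
    finally show ?thesis .
  qed
  have it: "m (k + real n * h) \<le> m k * 2 powr (- real n + 4 * (E k - E (k + real n * h)) / h\<^sup>2)" for n
  proof (induction n)
    case (Suc n)
    let ?l = "k + real n * h"
    have l: "k \<le> ?l" "k + real (Suc n) * h = ?l + h" using h by (auto simp: algebra_simps)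
    have "m (?l + h) \<le> m ?l * 2 powr (- 1 + 4 * (E ?l - E (?l + h)) / h\<^sup>2)" by (rule step[OF l(1)])
    also have "\<dots> \<le> (m k * 2 powr (- real n + 4 * (E k - E ?l) / h\<^sup>2)) * 2 powr (- 1 + 4 * (E ?l - E (?l + h)) / h\<^sup>2)"
      by (rule mult_right_mono[OF Suc]) simp
    also have "\<dots> = m k * 2 powr (- real (Suc n) + 4 * (E k - E (?l + h)) / h\<^sup>2)"
      by (simp add: mult.assoc powr_add[symmetric]) (simp add: field_simps diff_divide_distrib)
    finally show ?case unfolding l(2) .
  qed simp
  have "real (J^2 * M) * h = real J" using False M by (simp add: h_def power2_eq_square)
  then have "m (k + real J) \<le> m k * 2 powr (- real (J^2 * M) + 4 * (E k - E (k + real J)) / h\<^sup>2)"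
    using it[of "J^2 * M"] by simp
  also have "\<dots> \<le> m k * 2 powr (- (real (J^2) * real M / 2))"
  proof (intro mult_left_mono powr_mono m0)
    have "4 * (E k - E (k + real J)) / h\<^sup>2 \<le> 4 * (1 / (8 * real M)) / h\<^sup>2"
      using M E0[of "k + real J"] by (intro divide_right_mono) auto
    also have "4 * (1 / (8 * real M)) / h\<^sup>2 = real (J^2) * real M / 2" using False M by (simp add: h_def field_simps power2_eq_square)
    finally have "4 * (E k - E (k + real J)) / h\<^sup>2 \<le> real (J^2) * real M / 2" .
    moreover have "real (J^2 * M) = real (J^2) * real M" by simp
    ultimately show "- real (J^2 * M) + 4 * (E k - E (k + real J)) / h\<^sup>2 \<le> - (real (J^2) * real M / 2)" by linarith
  qed simp
  finally show ?thesis .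
qed simp

text \<open>Moser--Trudinger: the small parameter is the Dirichlet energy of \<open>v\<close> on a high superlevel set, hence
  every exponent \<open>\<beta>\<close> is allowed.\<close>

lemma exp_square_integrable:
  assumes v: "acl v d1 d2" and L2: "integrable cyl (\<lambda>x. (d1 x)\<^sup>2)" "integrable cyl (\<lambda>x. (d2 x)\<^sup>2)"
    and B: "AE x1 in lborel. \<bar>\<integral>y. v (x1, y) \<partial>T1\<bar> \<le> B"
    and \<beta>: "\<beta> > 0"
  shows "\<exists>k>0. (\<integral>\<^sup>+x. indicator {x. k < \<bar>v x\<bar>} x * ennreal (exp (\<beta> * (v x)\<^sup>2)) \<partial>cyl) < \<infinity>"
proof -
  note [measurable] = aclD(1-3)[OF v]
  define B' where "B' = max 0 B"
  have B': "AE x1 in lborel. \<bar>\<integral>y. v (x1, y) \<partial>T1\<bar> \<le> B'" "0 \<le> B'"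
    using B by (auto simp: B'_def elim!: eventually_mono)
  define m where "m l = measure cyl {x. l < \<bar>v x\<bar>}" for l
  define E where "E l = (\<integral>x. indicator {x. l < \<bar>v x\<bar>} x * ((d1 x)\<^sup>2 + (d2 x)\<^sup>2) \<partial>cyl)" for l
  have fin: "emeasure cyl {x. l < \<bar>v x\<bar>} < \<infinity>" if "B' < l" for l
    using finite_superlevel[OF v L2(2), of 0 B' l] B'(1) that by simp
  have Ei: "integrable cyl (\<lambda>x. indicator {x. l < \<bar>v x\<bar>} x * ((d1 x)\<^sup>2 + (d2 x)\<^sup>2))" for l
    by (rule Bochner_Integration.integrable_bound[of _ "\<lambda>x. (d1 x)\<^sup>2 + (d2 x)\<^sup>2"]) (use L2 in \<open>auto simp: indicator_def\<close>)
  have Elim: "(\<lambda>n. E (real n)) \<longlonglongrightarrow> (\<integral>x. 0 \<partial>cyl)"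
    unfolding E_def
  proof (rule integral_dominated_convergence[where w="\<lambda>x. (d1 x)\<^sup>2 + (d2 x)\<^sup>2"])
    show "integrable cyl (\<lambda>x. (d1 x)\<^sup>2 + (d2 x)\<^sup>2)" using L2 by simp
    show "AE x in cyl. (\<lambda>n. indicator {x. real n < \<bar>v x\<bar>} x * ((d1 x)\<^sup>2 + (d2 x)\<^sup>2)) \<longlonglongrightarrow> 0"
    proof (rule AE_I2, rule tendsto_eventually)
      fix x
      obtain N :: nat where "\<bar>v x\<bar> \<le> real N" using real_arch_simple by blast
      then show "\<forall>\<^sub>F n in sequentially. indicator {x. real n < \<bar>v x\<bar>} x * ((d1 x)\<^sup>2 + (d2 x)\<^sup>2) = 0"
        by (intro eventually_sequentiallyI[of N]) (auto simp: indicator_def)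
    qed
  qed (auto simp: indicator_def)
  \<comment> \<open>The decay rate \<open>M * ln 2 / 2\<close> is then at least
    \<open>2 * \<beta> + 1\<close>: the part \<open>2 * \<beta>\<close> absorbs the weight in
    \<open>trm\<close>, the remaining \<open>1\<close> leaves a geometric series.\<close>
  obtain M :: nat where M: "(4 * \<beta> + 2) / ln 2 \<le> real M" using real_arch_simple by blast
  have M0: "M > 0"
  proof -
    have "0 < (4 * \<beta> + 2) / ln 2" using \<beta> by (intro divide_pos_pos) auto
    then have "0 < real M" using M by linarith
    then show ?thesis by simp
  qed
  have "\<forall>\<^sub>F n in sequentially. E (real n) < 1 / (8 * real M)"
    using Elim M0 by (intro order_tendstoD) auto
  moreover have "\<forall>\<^sub>F n in sequentially. B' < real n"
    using filterlim_real_sequentially by (auto simp: filterlim_at_top_dense)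
  moreover have "\<forall>\<^sub>F n in sequentially. 0 < real n"
    using filterlim_real_sequentially by (auto simp: filterlim_at_top_dense)
  ultimately have "\<forall>\<^sub>F n in sequentially. E (real n) < 1 / (8 * real M) \<and> B' < real n \<and> 0 < real n"
    by eventually_elim auto
  then obtain n where n: "E (real n) < 1 / (8 * real M)" "B' < real n" "0 < real n"
    using eventually_happens'[OF sequentially_bot] by blast
  define k where "k = real n"
  have decay: "m (k + real J) \<le> m k * 2 powr (- (real (J^2) * real M / 2))" for J
  proof (rule exp_level_decay[where E=E])
    fix l h :: real assume "k \<le> l" "0 < h"
    then show "h\<^sup>2 / 4 * m (l + h) \<le> (m l - m (l + h)) * (E l - E (l + h))"
      unfolding m_def E_def using n(2) by (intro level_inequality[OF v L2 B']) (auto simp: k_def)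
  next
    fix l h :: real assume h: "0 < h"
    show "E (l + h) \<le> E l" unfolding E_def
      using h by (intro integral_mono Ei) (auto simp: indicator_def)
  next
    fix l h :: real assume "k \<le> l" "0 < h"
    then show "m (l + h) \<le> m l" unfolding m_def
      using fin[of l] n(2) by (intro measure_mono_fmeasurable) (auto simp: fmeasurable_def k_def)
  next
    show "0 \<le> E l" for l unfolding E_def by (intro Bochner_Integration.integral_nonneg) (auto simp: indicator_def)
  qed (use n M0 in \<open>auto simp: k_def m_def\<close>)
  define C where "C = m k * exp (2 * \<beta> * (k + 1)\<^sup>2)"
  have m0: "m l \<ge> 0" for l by (simp add: m_def)
  have trm: "exp (\<beta> * (k + real J + 1)\<^sup>2) * m (k + real J) \<le> C * exp (-1) ^ J" for J
  proof -
    have a: "2 powr (- (real (J^2) * real M / 2)) = exp (- (real (J^2) * (real M * ln 2 / 2)))"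
      by (simp add: powr_def algebra_simps)
    have b: "2 * \<beta> + 1 \<le> real M * ln 2 / 2"
    proof -
      have "0 < ln (2::real)" by simp
      then show ?thesis using M by (simp add: field_simps)
    qed
    have "(k + real J + 1)\<^sup>2 \<le> 2 * (k + 1)\<^sup>2 + 2 * (real J)\<^sup>2"
      using zero_le_power2[of "k + 1 - real J"] by (simp add: power2_eq_square algebra_simps)
    then have "\<beta> * (k + real J + 1)\<^sup>2 \<le> 2 * \<beta> * (k + 1)\<^sup>2 + 2 * \<beta> * (real J)\<^sup>2"
      using mult_left_mono[of _ _ \<beta>] \<beta> by (fastforce simp: algebra_simps)
    moreover have "real (J^2) * (2 * \<beta> + 1) \<le> real (J^2) * (real M * ln 2 / 2)" by (rule mult_left_mono[OF b]) simp
    moreover have "real J \<le> (real J)\<^sup>2"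
    proof -
      have "J \<le> J^2" by (simp add: power2_eq_square)
      then show ?thesis by (metis of_nat_le_iff of_nat_power)
    qed
    moreover have "real (J^2) * (2 * \<beta> + 1) = 2 * \<beta> * (real J)\<^sup>2 + (real J)\<^sup>2" by (simp add: algebra_simps)
    ultimately have e: "\<beta> * (k + real J + 1)\<^sup>2 + - (real (J^2) * (real M * ln 2 / 2)) \<le> 2 * \<beta> * (k + 1)\<^sup>2 + real J * (-1)"
      by linarith
    have "exp (\<beta> * (k + real J + 1)\<^sup>2) * m (k + real J) \<le> exp (\<beta> * (k + real J + 1)\<^sup>2) * (m k * exp (- (real (J^2) * (real M * ln 2 / 2))))"
      using decay[of J] unfolding a by (intro mult_left_mono) auto
    also have "\<dots> = m k * exp (\<beta> * (k + real J + 1)\<^sup>2 + - (real (J^2) * (real M * ln 2 / 2)))" by (simp only: exp_add ac_simps)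
    also have "\<dots> \<le> m k * exp (2 * \<beta> * (k + 1)\<^sup>2 + real J * (-1))" using e m0 by (intro mult_left_mono) auto
    also have "\<dots> = C * exp (-1) ^ J" unfolding C_def exp_add exp_of_nat_mult by simp
    finally show ?thesis .
  qed
  have "(\<integral>\<^sup>+x. indicator {x. k < \<bar>v x\<bar>} x * ennreal (exp (\<beta> * (v x)\<^sup>2)) \<partial>cyl) \<le>
    (\<integral>\<^sup>+x. (\<Sum>J. ennreal (exp (\<beta> * (k + real J + 1)\<^sup>2)) * indicator {x. k + real J < \<bar>v x\<bar>} x) \<partial>cyl)"
  proof (rule nn_integral_mono)
    fix x
    let ?f = "\<lambda>J. ennreal (exp (\<beta> * (k + real J + 1)\<^sup>2)) * indicator {x. k + real J < \<bar>v x\<bar>} x"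
    show "indicator {x. k < \<bar>v x\<bar>} x * ennreal (exp (\<beta> * (v x)\<^sup>2)) \<le> (\<Sum>J. ?f J)"
    proof (cases "k < \<bar>v x\<bar>")
      case True
      \<comment> \<open>The layer with \<open>k + J < \<bar>v x\<bar> \<le> k + J + 1\<close>;
        ceiling minus one makes the lower inequality strict.\<close>
      define J where "J = nat (\<lceil>\<bar>v x\<bar> - k\<rceil> - 1)"
      have J: "k + real J < \<bar>v x\<bar>" "\<bar>v x\<bar> \<le> k + real J + 1" using True unfolding J_def by linarith+
      have "(v x)\<^sup>2 \<le> (k + real J + 1)\<^sup>2" using J n(3) by (intro abs_le_square_iff[THEN iffD1]) (auto simp: k_def)
      then have "ennreal (exp (\<beta> * (v x)\<^sup>2)) \<le> ennreal (exp (\<beta> * (k + real J + 1)\<^sup>2))" using \<beta> by (intro ennreal_leI) simp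
      also have "\<dots> = ?f J" using J by simp
      also have "?f J \<le> (\<Sum>J. ?f J)"
      proof -
        have "sum ?f {J} \<le> suminf ?f" by (rule sum_le_suminf) auto
        then show ?thesis by (simp only: sum.insert finite.emptyI empty_iff not_False_eq_True sum.empty add_0_right)
      qed
      finally show ?thesis using True by simp
    qed simp
  qed
  also have "\<dots> = (\<Sum>J. \<integral>\<^sup>+x. ennreal (exp (\<beta> * (k + real J + 1)\<^sup>2)) * indicator {x. k + real J < \<bar>v x\<bar>} x \<partial>cyl)"
    by (rule nn_integral_suminf) simp
  also have "\<dots> = (\<Sum>J. ennreal (exp (\<beta> * (k + real J + 1)\<^sup>2) * m (k + real J)))"
  proof (rule suminf_cong)
    fix J
    have "emeasure cyl {x. k + real J < \<bar>v x\<bar>} = ennreal (m (k + real J))"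
      unfolding m_def using fin[of "k + real J"] n(2) by (intro emeasure_eq_ennreal_measure) (auto simp: k_def less_top)
    then show "(\<integral>\<^sup>+x. ennreal (exp (\<beta> * (k + real J + 1)\<^sup>2)) * indicator {x. k + real J < \<bar>v x\<bar>} x \<partial>cyl) = ennreal (exp (\<beta> * (k + real J + 1)\<^sup>2) * m (k + real J))"
      by (subst nn_integral_cmult_indicator) (auto simp: ennreal_mult m0)
  qed
  also have "\<dots> \<le> (\<Sum>J. ennreal (C * exp (-1) ^ J))"
    using trm by (intro suminf_le ennreal_leI) auto
  also have "\<dots> = ennreal (\<Sum>J. C * exp (-1) ^ J)"
    by (rule suminf_ennreal2) (auto simp: C_def m0 intro!: summable_mult summable_geometric)
  also have "\<dots> < \<infinity>" by simp
  finally show ?thesis using n(3) unfolding k_def by blast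
qed

lemma exp_square_integrable_finite_measure:
  assumes v: "acl v d1 d2" and L2: "integrable cyl (\<lambda>x. (d1 x)\<^sup>2)" "integrable cyl (\<lambda>x. (d2 x)\<^sup>2)"
    and B: "AE x1 in lborel. \<bar>\<integral>y. v (x1, y) \<partial>T1\<bar> \<le> B"
    and \<beta>: "\<beta> > 0" and S[measurable]: "S \<in> sets borel" "emeasure cyl S < \<infinity>"
  shows "(\<integral>\<^sup>+x. indicator S x * ennreal (exp (\<beta> * (v x)\<^sup>2)) \<partial>cyl) < \<infinity>"
proof -
  note [measurable] = aclD(1-3)[OF v]
  obtain k where k: "k > 0" "(\<integral>\<^sup>+x. indicator {x. k < \<bar>v x\<bar>} x * ennreal (exp (\<beta> * (v x)\<^sup>2)) \<partial>cyl) < \<infinity>"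
    using exp_square_integrable[OF v L2 B \<beta>] by blast
  have "(\<integral>\<^sup>+x. indicator S x * ennreal (exp (\<beta> * (v x)\<^sup>2)) \<partial>cyl) \<le>
    (\<integral>\<^sup>+x. ennreal (exp (\<beta> * k\<^sup>2)) * indicator S x + indicator {x. k < \<bar>v x\<bar>} x * ennreal (exp (\<beta> * (v x)\<^sup>2)) \<partial>cyl)"
  proof (rule nn_integral_mono)
    fix x
    show "indicator S x * ennreal (exp (\<beta> * (v x)\<^sup>2)) \<le> ennreal (exp (\<beta> * k\<^sup>2)) * indicator S x + indicator {x. k < \<bar>v x\<bar>} x * ennreal (exp (\<beta> * (v x)\<^sup>2))"
    proof (cases "k < \<bar>v x\<bar>")
      case False
      then have "(v x)\<^sup>2 \<le> k\<^sup>2" using k(1) by (intro abs_le_square_iff[THEN iffD1]) auto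
      then have "ennreal (exp (\<beta> * (v x)\<^sup>2)) \<le> ennreal (exp (\<beta> * k\<^sup>2))" using \<beta> by (intro ennreal_leI) simp
      then show ?thesis using False by (auto simp: indicator_def)
    qed (auto simp: indicator_def)
  qed
  also have "\<dots> = ennreal (exp (\<beta> * k\<^sup>2)) * emeasure cyl S + (\<integral>\<^sup>+x. indicator {x. k < \<bar>v x\<bar>} x * ennreal (exp (\<beta> * (v x)\<^sup>2)) \<partial>cyl)"
    by (subst nn_integral_add) (auto simp: nn_integral_cmult_indicator)
  also have "\<dots> < \<infinity>" using k(2) S(2) by (simp add: ennreal_mult_less_top)
  finally show ?thesis .
qed

lemma box_cyl_integrable: "integrable cyl (\<lambda>x. (indicator {c..d} (fst x) :: real)\<^sup>2)"
proof -
  have "(\<integral>\<^sup>+x. indicator {c..d} (fst x) \<partial>cyl) = (\<integral>\<^sup>+x. \<integral>\<^sup>+y. indicator {c..d} x \<partial>T1 \<partial>lborel)"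
    by (subst nn_integral_cyl_fst) auto
  also have "\<dots> < \<infinity>" by (simp add: emeasure_lborel_Icc_eq)
  finally have "integrable cyl (\<lambda>x. indicator {c..d} (fst x) :: real)"
    by (intro integrableI_bounded) (auto simp: ennreal_indicator)
  then show ?thesis by (simp add: power2_eq_square indicator_inter_arith[symmetric])
qed

text \<open>A half-line has infinite measure, so an integrable function cannot stay above
  \<open>e\<close> on it, not even outside a null set.\<close>

lemma integrable_small_values:
  fixes f :: "real \<Rightarrow> real"
  assumes f: "integrable lborel f" and P: "AE x in lborel. P x" and e: "e > 0"
  shows "\<exists>x>R. P x \<and> \<bar>f x\<bar> < e" "\<exists>x<R. P x \<and> \<bar>f x\<bar> < e"
proof -
  have fin: "(\<integral>\<^sup>+x. ennreal \<bar>f x\<bar> \<partial>lborel) < \<infinity>" using f by (simp add: integrable_iff_bounded)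
  have *: "\<exists>x\<in>A. P x \<and> \<bar>f x\<bar> < e" if A: "A \<in> sets borel" "emeasure lborel A = \<infinity>" for A
  proof (rule ccontr)
    assume c: "\<not> ?thesis"
    have "(\<integral>\<^sup>+x. ennreal e * indicator A x \<partial>lborel) \<le> (\<integral>\<^sup>+x. ennreal \<bar>f x\<bar> \<partial>lborel)"
      by (rule nn_integral_mono_AE, use P in eventually_elim) (use c in \<open>force simp: indicator_def intro!: ennreal_leI\<close>)
    moreover have "(\<integral>\<^sup>+x. ennreal e * indicator A x \<partial>lborel) = \<infinity>"
      using A e by (simp add: nn_integral_cmult_indicator ennreal_mult_eq_top_iff)
    ultimately show False using fin by simp
  qed
  have "emeasure lborel {R<..} = \<infinity>" "emeasure lborel {..<R} = \<infinity>"
  proof -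
    have "ennreal (real n) \<le> emeasure lborel {R<..}" "ennreal (real n) \<le> emeasure lborel {..<R}" for n :: nat
    proof -
      have "emeasure lborel {R<..<R + real n} \<le> emeasure lborel {R<..}" by (rule emeasure_mono) auto
      then show "ennreal (real n) \<le> emeasure lborel {R<..}" by simp
      have "emeasure lborel {R - real n<..<R} \<le> emeasure lborel {..<R}" by (rule emeasure_mono) auto
      then show "ennreal (real n) \<le> emeasure lborel {..<R}" by simp
    qed
    then show "emeasure lborel {R<..} = \<infinity>" "emeasure lborel {..<R} = \<infinity>"
      by (metis ennreal_of_nat_eq_real_of_nat ennreal_top_eq_mult_iff infinity_ennreal_def linorder_not_le top.not_eq_extremum ennreal_Ex_less_of_nat)+
  qed
  then show "\<exists>x>R. P x \<and> \<bar>f x\<bar> < e" "\<exists>x<R. P x \<and> \<bar>f x\<bar> < e"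
    using *[of "{R<..}"] *[of "{..<R}"] by auto
qed

section \<open>Calibration\<close>

text \<open>Here \<open>(p, q)\<close> and \<open>(r, s)\<close> are the derivatives of \<open>(u1, u2)\<close> along the line and along the circle.\<close>

locale cyl_field =
  fixes u1 u2 p q r s :: "real \<times> real \<Rightarrow> real" and a um up :: real
  assumes acl1: "acl u1 p r" and acl2: "acl u2 q s"
    and div: "AE x in cyl. p x + s x = 0"
    and L2: "integrable cyl (\<lambda>x. (p x)\<^sup>2)" "integrable cyl (\<lambda>x. (q x)\<^sup>2)" "integrable cyl (\<lambda>x. (r x)\<^sup>2)" "integrable cyl (\<lambda>x. (s x)\<^sup>2)"
    and mean1: "AE x in lborel. (\<integral>y. u1 (x, y) \<partial>T1) = a"
    and mean2: "\<exists>v. continuous_on UNIV v \<and> (AE x in lborel. (\<integral>y. u2 (x, y) \<partial>T1) = v x) \<and>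
      (v \<longlongrightarrow> up) at_top \<and> (v \<longlongrightarrow> um) at_bot"
begin

lemmas meas[measurable] = aclD(1-3)[OF acl1] aclD(1-3)[OF acl2]

lemma u1_L2: "integrable cyl (\<lambda>x. (u1 x - a)\<^sup>2)"
proof (rule integrableI_bounded)
  have [measurable]: "(\<lambda>x. \<integral>y. u1 (x, y) \<partial>T1) \<in> borel_measurable borel" by (rule T1_integral_measurable) simp
  have "AE x in cyl. (\<integral>y. u1 (fst x, y) \<partial>T1) = a" by (subst AE_cyl_swap(1)) (use mean1 in auto)
  then have "(\<integral>\<^sup>+x. ennreal (norm ((u1 x - a)\<^sup>2)) \<partial>cyl) = (\<integral>\<^sup>+x. ennreal ((u1 x - (\<integral>y. u1 (fst x, y) \<partial>T1))\<^sup>2) \<partial>cyl)"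
    by (intro nn_integral_cong_AE) auto
  also have "\<dots> \<le> (\<integral>\<^sup>+x. ennreal ((r x)\<^sup>2) \<partial>cyl)" by (rule acl_Poincare_mean(1)[OF acl1])
  also have "\<dots> < \<infinity>" using L2 by (simp add: integrable_iff_bounded)
  finally show "(\<integral>\<^sup>+x. ennreal (norm ((u1 x - a)\<^sup>2)) \<partial>cyl) < \<infinity>" .
qed simp

lemma acl1_shift: "acl (\<lambda>x. u1 x - a) p r"
proof -
  have "((\<lambda>t. t - a) has_real_derivative 1) (at y)" for y by (auto intro!: derivative_eq_intros)
  from acl_compose[OF acl1 this continuous_on_const] show ?thesis by simp
qed

text \<open>The null Lagrangian of \<open>u1 - a\<close> and \<open>u2\<close>. The shift by
  \<open>a\<close> makes the first function square integrable, and \<open>s = - p\<close> turns the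
  determinant into this form.\<close>

lemma det_integral: "(\<integral>x. (p x)\<^sup>2 \<partial>cyl) = - (\<integral>x. q x * r x \<partial>cyl)"
proof -
  have "(\<integral>x. p x * s x \<partial>cyl) = (\<integral>x. q x * r x \<partial>cyl)"
    using u1_L2 L2 by (intro null_lagrangian[OF acl1_shift acl2]) auto
  moreover have "(\<integral>x. p x * s x \<partial>cyl) = (\<integral>x. - (p x)\<^sup>2 \<partial>cyl)"
  proof (rule integral_cong_AE)
    show "AE x in cyl. p x * s x = - (p x)\<^sup>2"
      using div
    proof eventually_elim
      case (elim x)
      then have "s x = - p x" by simp
      then show ?case by (simp add: power2_eq_square)
    qed
  qed auto
  ultimately show ?thesis by simp
qed

text \<open>The slice energy \<open>\<eta>\<close> is integrable, hence small on slices arbitrarily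
  far out. On these the Poincare inequality brings \<open>u\<close> uniformly close to its mean,
  whose limits are known. \<open>P\<close> allows further almost sure properties to be imposed on
  the slice.\<close>

lemma slices_near_limits:
  assumes e: "e > 0"
  shows "AE x in lborel. P x \<Longrightarrow> \<exists>x>R. P x \<and> (AE y in T1. dist (u1 (x, y), u2 (x, y)) (a, up) < e)"
    "AE x in lborel. P x \<Longrightarrow> \<exists>x<R. P x \<and> (AE y in T1. dist (u1 (x, y), u2 (x, y)) (a, um) < e)"
proof -
  obtain v where v: "continuous_on UNIV v" "AE x in lborel. (\<integral>y. u2 (x, y) \<partial>T1) = v x" "(v \<longlongrightarrow> up) at_top" "(v \<longlongrightarrow> um) at_bot"
    using mean2 by blast
  define \<eta> where "\<eta> x = (\<integral>y. (r (x, y))\<^sup>2 + (s (x, y))\<^sup>2 \<partial>T1)" for x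
  have i: "integrable cyl (\<lambda>x. (r x)\<^sup>2 + (s x)\<^sup>2)" using L2 by simp
  have \<eta>i: "integrable lborel \<eta>" unfolding \<eta>_def using integral_cyl(2)[OF i] by simp
  have good: "AE x in lborel. (AE y in T1. (u1 (x, y) - a)\<^sup>2 \<le> \<eta> x \<and> (u2 (x, y) - v x)\<^sup>2 \<le> \<eta> x)"
    using acl_Poincare_mean(2)[OF acl1] acl_Poincare_mean(2)[OF acl2] mean1 v(2) integral_cyl(1)[OF i]
  proof eventually_elim
    case (elim x)
    have b: "(\<integral>\<^sup>+y. ennreal ((r (x, y))\<^sup>2) \<partial>T1) \<le> ennreal (\<eta> x)" "(\<integral>\<^sup>+y. ennreal ((s (x, y))\<^sup>2) \<partial>T1) \<le> ennreal (\<eta> x)"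
      unfolding \<eta>_def using elim(5)
      by (subst nn_integral_eq_integral[symmetric]; auto intro!: nn_integral_mono ennreal_leI)+
    have \<eta>0: "\<eta> x \<ge> 0" by (simp add: \<eta>_def)
    show ?case using elim(1,2)
    proof eventually_elim
      case (elim y)
      then have "ennreal ((u1 (x, y) - a)\<^sup>2) \<le> ennreal (\<eta> x)" "ennreal ((u2 (x, y) - v x)\<^sup>2) \<le> ennreal (\<eta> x)"
        using b \<open>_ = a\<close> \<open>_ = v x\<close> by (auto intro: order_trans)
      then show ?case using \<eta>0 by (auto simp: ennreal_le_iff)
    qed
  qed
  have close: "dist (z1, z2) (a, b) < e" if "(z1 - a)\<^sup>2 \<le> h" "(z2 - v')\<^sup>2 \<le> h" "h < (e / 4)\<^sup>2" "\<bar>v' - b\<bar> < e / 4" for z1 z2 h v' b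
  proof -
    have "(z1 - a)\<^sup>2 < (e/4)\<^sup>2" "(z2 - v')\<^sup>2 < (e/4)\<^sup>2" using that by auto
    then have "\<bar>z1 - a\<bar> < e / 4" "\<bar>z2 - v'\<bar> < e / 4"
      using power2_less_imp_less[of "\<bar>z1 - a\<bar>" "e/4"] power2_less_imp_less[of "\<bar>z2 - v'\<bar>" "e/4"] e by auto
    then have "dist z1 a < e / 2" "dist z2 b < e / 2" using that(4) unfolding dist_real_def by linarith+
    moreover have "dist (z1, z2) (a, b) \<le> dist z1 a + dist z2 b"
      by (simp add: dist_prod_def sqrt_sum_squares_le_sum)
    ultimately show ?thesis by linarith
  qed
  have e4: "e / 4 > 0" "(e / 4)\<^sup>2 > 0" using e by auto
  show "\<exists>x>R. P x \<and> (AE y in T1. dist (u1 (x, y), u2 (x, y)) (a, up) < e)" if P: "AE x in lborel. P x"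
  proof -
    obtain N where N: "\<And>x. x \<ge> N \<Longrightarrow> \<bar>v x - up\<bar> < e / 4"
      using tendstoD[OF v(3) e4(1)] by (auto simp: eventually_at_top_linorder dist_real_def)
    have "AE x in lborel. P x \<and> (AE y in T1. (u1 (x, y) - a)\<^sup>2 \<le> \<eta> x \<and> (u2 (x, y) - v x)\<^sup>2 \<le> \<eta> x)" using P good by eventually_elim simp
    from integrable_small_values(1)[OF \<eta>i this e4(2), of "max R N"] obtain x where x: "x > max R N" "P x"
      "AE y in T1. (u1 (x, y) - a)\<^sup>2 \<le> \<eta> x \<and> (u2 (x, y) - v x)\<^sup>2 \<le> \<eta> x" "\<bar>\<eta> x\<bar> < (e / 4)\<^sup>2" by blast
    have "AE y in T1. dist (u1 (x, y), u2 (x, y)) (a, up) < e"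
      using x(3) by eventually_elim (use x N[of x] in \<open>auto intro!: close[of _ "\<eta> x" _ "v x"]\<close>)
    then show ?thesis using x by auto
  qed
  show "\<exists>x<R. P x \<and> (AE y in T1. dist (u1 (x, y), u2 (x, y)) (a, um) < e)" if P: "AE x in lborel. P x"
  proof -
    obtain N where N: "\<And>x. x \<le> N \<Longrightarrow> \<bar>v x - um\<bar> < e / 4"
      using tendstoD[OF v(4) e4(1)] by (auto simp: eventually_at_bot_linorder dist_real_def)
    have "AE x in lborel. P x \<and> (AE y in T1. (u1 (x, y) - a)\<^sup>2 \<le> \<eta> x \<and> (u2 (x, y) - v x)\<^sup>2 \<le> \<eta> x)" using P good by eventually_elim simp
    from integrable_small_values(2)[OF \<eta>i this e4(2), of "min R N"] obtain x where x: "x < min R N" "P x"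
      "AE y in T1. (u1 (x, y) - a)\<^sup>2 \<le> \<eta> x \<and> (u2 (x, y) - v x)\<^sup>2 \<le> \<eta> x" "\<bar>\<eta> x\<bar> < (e / 4)\<^sup>2" by blast
    have "AE y in T1. dist (u1 (x, y), u2 (x, y)) (a, um) < e"
      using x(3) by eventually_elim (use x N[of x] in \<open>auto intro!: close[of _ "\<eta> x" _ "v x"]\<close>)
    then show ?thesis using x by auto
  qed
qed

text \<open>The circle mean \<open>F\<close> of \<open>\<Phi>1 (u)\<close> has as derivative the
  mean of \<open>A p + w q\<close>. The mean of \<open>\<epsilon> w r + A s\<close>, the circle
  derivative of \<open>\<Phi>2 (u)\<close>, is zero; adding it and using \<open>s = - p\<close>
  leaves the mean of \<open>w (q + \<epsilon> r)\<close>. Its integral along the axis is the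
  difference of the limits of \<open>F\<close>. The factor \<open>A\<close> occurs only on bounded
  pieces, where \<open>F\<close> is differentiated.\<close>

lemma calibration:
  fixes \<Phi>1 \<Phi>2 A w :: "real \<times> real \<Rightarrow> real" and \<epsilon> :: real
  assumes d1: "\<And>z. (\<Phi>1 has_derivative (\<lambda>h. fst h * A z + snd h * w z)) (at z)"
    and d2: "\<And>z. (\<Phi>2 has_derivative (\<lambda>h. fst h * (\<epsilon> * w z) + snd h * A z)) (at z)"
    and c: "continuous_on UNIV A" "continuous_on UNIV w"
    and A2: "\<And>n::nat. integrable cyl (\<lambda>x. indicator {-real n..real n} (fst x) * (A (u1 x, u2 x))\<^sup>2)"
    and w2: "integrable cyl (\<lambda>x. (w (u1 x, u2 x))\<^sup>2)"
  shows "integrable cyl (\<lambda>x. w (u1 x, u2 x) * (q x + \<epsilon> * r x))"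
    "(\<integral>x. w (u1 x, u2 x) * (q x + \<epsilon> * r x) \<partial>cyl) = \<Phi>1 (a, up) - \<Phi>1 (a, um)"
proof -
  have [measurable]: "A \<in> borel_measurable borel" "w \<in> borel_measurable borel" "\<Phi>1 \<in> borel_measurable borel"
    using c has_derivative_pair_continuous[OF d1] by (auto intro: borel_measurable_continuous_onI)
  let ?A = "\<lambda>x. A (u1 x, u2 x)" and ?w = "\<lambda>x. w (u1 x, u2 x)"
  have a1: "acl (\<lambda>x. \<Phi>1 (u1 x, u2 x)) (\<lambda>x. ?A x * p x + ?w x * q x) (\<lambda>x. ?A x * r x + ?w x * s x)"
    by (rule acl_chain[OF acl1 acl2 d1 c])
  have cw: "continuous_on UNIV (\<lambda>z. \<epsilon> * w z)" using c by (intro continuous_intros)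
  have a2: "acl (\<lambda>x. \<Phi>2 (u1 x, u2 x)) (\<lambda>x. \<epsilon> * ?w x * p x + ?A x * q x) (\<lambda>x. \<epsilon> * ?w x * r x + ?A x * s x)"
    by (rule acl_chain[OF acl1 acl2 d2 cw c(1)])
  have wq: "integrable cyl (\<lambda>x. ?w x * q x)" "integrable cyl (\<lambda>x. ?w x * r x)"
    using w2 L2 by (auto intro!: L2_mult_integrable)
  show wi: "integrable cyl (\<lambda>x. ?w x * (q x + \<epsilon> * r x))"
    using wq by (simp add: distrib_left mult.left_commute[of _ \<epsilon>])
  have Ap: "integrable cyl (\<lambda>x. indicator {-real n..real n} (fst x) * (?A x * p x))" for n
  proof -
    have "integrable cyl (\<lambda>x. (indicator {-real n..real n} (fst x) * ?A x)\<^sup>2)"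
      using A2[of n] by (simp add: power_mult_distrib power2_eq_square[of "indicator _ _"] indicator_inter_arith[symmetric])
    then have "integrable cyl (\<lambda>x. (indicator {-real n..real n} (fst x) * ?A x) * p x)"
      using L2 by (intro L2_mult_integrable) auto
    then show ?thesis by (simp add: mult.assoc)
  qed
  have wql: "integrable cyl (\<lambda>x. indicator {-real n..real n} (fst x) * (?w x * q x))" for n
    by (rule Bochner_Integration.integrable_bound[OF wq(1)]) (auto simp: indicator_def)
  define F where "F x = (\<integral>y. \<Phi>1 (u1 (x, y), u2 (x, y)) \<partial>T1)" for x
  define f where "f x = (\<integral>y. ?w (x, y) * (q (x, y) + \<epsilon> * r (x, y)) \<partial>T1)" for x
  have fi: "integrable lborel f" unfolding f_def using integral_cyl(2)[OF wi] by simp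
  have Fint: "AE x in lborel. integrable T1 (\<lambda>y. \<Phi>1 (u1 (x, y), u2 (x, y)))"
    using aclD(6)[OF a1] by eventually_elim (rule wac_integrable_T1(1))
  have "wac F (\<lambda>x. \<integral>y. ?A (x, y) * p (x, y) + ?w (x, y) * q (x, y) \<partial>T1)"
    unfolding F_def
  proof (rule wac_mean)
    show "integrable cyl (\<lambda>x. indicator {- real n..real n} (fst x) * (?A x * p x + ?w x * q x))" for n
      using Ap[of n] wql[of n] by (simp add: distrib_left)
  qed (use aclD(5)[OF a1] Fint in auto)
  then obtain \<gamma> where g: "ac \<gamma> (\<lambda>x. \<integral>y. ?A (x, y) * p (x, y) + ?w (x, y) * q (x, y) \<partial>T1)" "AE x in lborel. F x = \<gamma> x"
    by (auto simp: wac_def)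
  have "AE x in lborel. (\<integral>y. ?A (x, y) * p (x, y) + ?w (x, y) * q (x, y) \<partial>T1) = f x"
    using aclD(6)[OF a1] aclD(6)[OF a2] AE_cyl_fst[OF div] integral_cyl(1)[OF wi] integral_cyl(1)[OF wq(1)]
  proof eventually_elim
    case (elim x)
    have per: "\<And>y. \<Phi>2 (u1 (x, y + 1), u2 (x, y + 1)) = \<Phi>2 (u1 (x, y), u2 (x, y))"
      using aclD(4)[OF acl1] aclD(4)[OF acl2] by simp
    have e0: "integrable T1 (\<lambda>y. \<epsilon> * ?w (x, y) * r (x, y) + ?A (x, y) * s (x, y))" "(\<integral>y. \<epsilon> * ?w (x, y) * r (x, y) + ?A (x, y) * s (x, y) \<partial>T1) = 0"
      using wac_periodic_integral[OF elim(2) per] by auto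
    have ae: "AE y in T1. ?A (x, y) * p (x, y) + ?w (x, y) * q (x, y) = ?w (x, y) * (q (x, y) + \<epsilon> * r (x, y)) - (\<epsilon> * ?w (x, y) * r (x, y) + ?A (x, y) * s (x, y))"
      using elim(3)
    proof eventually_elim
      case (elim y)
      then have "p (x, y) = - s (x, y)" by simp
      then show ?case by (simp add: algebra_simps)
    qed
    have "(\<integral>y. ?A (x, y) * p (x, y) + ?w (x, y) * q (x, y) \<partial>T1) = (\<integral>y. ?w (x, y) * (q (x, y) + \<epsilon> * r (x, y)) - (\<epsilon> * ?w (x, y) * r (x, y) + ?A (x, y) * s (x, y)) \<partial>T1)"
      by (rule integral_cong_AE[OF _ _ ae]) auto
    also have "\<dots> = f x" using elim(4) e0 unfolding f_def by simp
    finally show ?case .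
  qed
  moreover have "f \<in> borel_measurable borel" using fi by (auto dest: borel_measurable_integrable)
  ultimately have gf: "ac \<gamma> f" using ac_cong_AE[OF g(1)] by blast
  have cl: "\<exists>e>0. \<forall>x. (AE y in T1. dist (u1 (x, y), u2 (x, y)) z < e) \<longrightarrow> integrable T1 (\<lambda>y. \<Phi>1 (u1 (x, y), u2 (x, y))) \<longrightarrow> \<bar>F x - \<Phi>1 z\<bar> \<le> \<delta>" if \<delta>0: "\<delta> > 0" for \<delta> z
  proof -
    have "isCont \<Phi>1 z" using has_derivative_continuous[OF d1] by (simp add: continuous_at)
    then obtain e where e: "e > 0" "\<And>z'. dist z' z < e \<Longrightarrow> dist (\<Phi>1 z') (\<Phi>1 z) < \<delta>"
      using \<delta>0 unfolding continuous_at_eps_delta by blast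
    have "\<bar>F x - \<Phi>1 z\<bar> \<le> \<delta>" if ae: "AE y in T1. dist (u1 (x, y), u2 (x, y)) z < e" and i: "integrable T1 (\<lambda>y. \<Phi>1 (u1 (x, y), u2 (x, y)))" for x
    proof -
      have "F x - \<Phi>1 z = (\<integral>y. \<Phi>1 (u1 (x, y), u2 (x, y)) - \<Phi>1 z \<partial>T1)"
        unfolding F_def using i by (simp add: measure_def)
      also have "\<bar>\<dots>\<bar> \<le> (\<integral>y. \<bar>\<Phi>1 (u1 (x, y), u2 (x, y)) - \<Phi>1 z\<bar> \<partial>T1)" by (rule integral_abs_bound)
      also have "\<dots> \<le> (\<integral>y. \<delta> \<partial>T1)"
        by (rule integral_mono_AE) (use i ae e(2) in \<open>force simp: dist_real_def elim!: eventually_mono\<close>)+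
      finally show ?thesis by (simp add: measure_def)
    qed
    then show ?thesis using e(1) by blast
  qed
  \<comment> \<open>Limits along one sequence in each direction suffice, because the derivative
    \<open>f\<close> of \<open>\<gamma>\<close> is integrable over the whole line.\<close>
  have "\<exists>x>real n. \<bar>\<gamma> x - \<Phi>1 (a, up)\<bar> \<le> 1 / real (Suc n)" for n
  proof -
    obtain e where e: "e > 0" "\<And>x. (AE y in T1. dist (u1 (x, y), u2 (x, y)) (a, up) < e) \<Longrightarrow> integrable T1 (\<lambda>y. \<Phi>1 (u1 (x, y), u2 (x, y))) \<Longrightarrow> \<bar>F x - \<Phi>1 (a, up)\<bar> \<le> 1 / real (Suc n)"
      using cl[of "1 / real (Suc n)" "(a, up)"] by auto
    have "AE x in lborel. F x = \<gamma> x \<and> integrable T1 (\<lambda>y. \<Phi>1 (u1 (x, y), u2 (x, y)))" using g(2) Fint by eventually_elim simp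
    from slices_near_limits(1)[OF e(1) this, of "real n"] show ?thesis using e(2) by force
  qed
  then obtain X where X: "\<And>n. X n > real n" "\<And>n. \<bar>\<gamma> (X n) - \<Phi>1 (a, up)\<bar> \<le> 1 / real (Suc n)" by metis
  have "\<exists>x<(- real n). \<bar>\<gamma> x - \<Phi>1 (a, um)\<bar> \<le> 1 / real (Suc n)" for n
  proof -
    obtain e where e: "e > 0" "\<And>x. (AE y in T1. dist (u1 (x, y), u2 (x, y)) (a, um) < e) \<Longrightarrow> integrable T1 (\<lambda>y. \<Phi>1 (u1 (x, y), u2 (x, y))) \<Longrightarrow> \<bar>F x - \<Phi>1 (a, um)\<bar> \<le> 1 / real (Suc n)"
      using cl[of "1 / real (Suc n)" "(a, um)"] by auto
    have "AE x in lborel. F x = \<gamma> x \<and> integrable T1 (\<lambda>y. \<Phi>1 (u1 (x, y), u2 (x, y)))" using g(2) Fint by eventually_elim simp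
    from slices_near_limits(2)[OF e(1) this, of "- real n"] show ?thesis using e(2) by force
  qed
  then obtain Y where Y: "\<And>n. Y n < - real n" "\<And>n. \<bar>\<gamma> (Y n) - \<Phi>1 (a, um)\<bar> \<le> 1 / real (Suc n)" by metis
  have l: "(\<lambda>n. \<gamma> (X n) - \<gamma> (Y n)) \<longlonglongrightarrow> \<Phi>1 (a, up) - \<Phi>1 (a, um)"
  proof (rule tendsto_diff)
    have z: "(\<lambda>n. 1 / real (Suc n)) \<longlonglongrightarrow> 0" using LIMSEQ_inverse_real_of_nat by (simp add: inverse_eq_divide)
    have "(\<lambda>n. \<gamma> (X n) - \<Phi>1 (a, up)) \<longlonglongrightarrow> 0" "(\<lambda>n. \<gamma> (Y n) - \<Phi>1 (a, um)) \<longlonglongrightarrow> 0"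
      by (rule Lim_null_comparison[OF _ z]; use X Y in simp)+
    then show "(\<lambda>n. \<gamma> (X n)) \<longlonglongrightarrow> \<Phi>1 (a, up)" "(\<lambda>n. \<gamma> (Y n)) \<longlonglongrightarrow> \<Phi>1 (a, um)" by (simp_all add: LIM_zero_iff)
  qed
  have "(\<lambda>n. \<integral>x. indicator {Y n..X n} x *\<^sub>R f x \<partial>lborel) \<longlonglongrightarrow> (\<integral>x. f x \<partial>lborel)"
  proof (rule integral_dominated_convergence[where w="\<lambda>x. norm (f x)"])
    show "AE x in lborel. (\<lambda>n. indicator {Y n..X n} x *\<^sub>R f x) \<longlonglongrightarrow> f x"
    proof (rule AE_I2, rule tendsto_eventually)
      fix x
      obtain N :: nat where "\<bar>x\<bar> \<le> real N" using real_arch_simple by blast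
      then have "x \<in> {Y n..X n}" if "n \<ge> N" for n using X(1)[of n] Y(1)[of n] that by auto
      then show "\<forall>\<^sub>F n in sequentially. indicator {Y n..X n} x *\<^sub>R f x = f x"
        by (intro eventually_sequentiallyI[of N]) auto
    qed
  qed (use fi in \<open>auto simp: indicator_def intro: borel_measurable_integrable\<close>)
  moreover have "(\<integral>x. indicator {Y n..X n} x *\<^sub>R f x \<partial>lborel) = \<gamma> (X n) - \<gamma> (Y n)" for n
    using acD(2)[OF gf, of "Y n" "X n"] X(1)[of n] Y(1)[of n] by (simp add: set_lebesgue_integral_def)
  ultimately have "(\<lambda>n. \<gamma> (X n) - \<gamma> (Y n)) \<longlonglongrightarrow> (\<integral>x. f x \<partial>lborel)" by simp
  with l have "(\<integral>x. f x \<partial>lborel) = \<Phi>1 (a, up) - \<Phi>1 (a, um)" using LIMSEQ_unique by blast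
  then show "(\<integral>x. ?w x * (q x + \<epsilon> * r x) \<partial>cyl) = \<Phi>1 (a, up) - \<Phi>1 (a, um)"
    using integral_cyl(3)[OF wi] by (simp add: f_def)
qed

text \<open>The nonnegative \<open>?g\<close> is the energy density, plus
  \<open>2 * \<epsilon>\<close> times the determinant expression of zero integral, minus twice the
  calibrating density. Its integral is at most zero, so it vanishes. The coefficient
  \<open>2 * (1 + \<epsilon>)\<close> of \<open>(p x)^2\<close> is zero for \<epsilon> = -1, so
  \<open>p\<close> is determined here only for \<epsilon> = 1.\<close>

lemma energy_equality:
  fixes w :: "real \<times> real \<Rightarrow> real" and c :: real
  assumes [measurable]: "w \<in> borel_measurable borel" and w2: "integrable cyl (\<lambda>x. (w (u1 x, u2 x))\<^sup>2)"
    and \<epsilon>: "\<epsilon> = 1 \<or> \<epsilon> = -1"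
    and cal: "(\<integral>x. w (u1 x, u2 x) * (q x + \<epsilon> * r x) \<partial>cyl) = c"
    and E: "(\<integral>x. 2 * (p x)\<^sup>2 + (q x)\<^sup>2 + (r x)\<^sup>2 + (w (u1 x, u2 x))\<^sup>2 \<partial>cyl) \<le> 2 * c"
  shows "AE x in cyl. q x + \<epsilon> * r x = w (u1 x, u2 x)" "\<epsilon> = 1 \<Longrightarrow> AE x in cyl. p x = 0"
proof -
  let ?w = "\<lambda>x. w (u1 x, u2 x)"
  have i: "integrable cyl (\<lambda>x. ?w x * q x)" "integrable cyl (\<lambda>x. ?w x * r x)" "integrable cyl (\<lambda>x. q x * r x)"
    using w2 L2 by (auto intro!: L2_mult_integrable)
  let ?g = "\<lambda>x. (q x + \<epsilon> * r x - ?w x)\<^sup>2 + 2 * (1 + \<epsilon>) * (p x)\<^sup>2"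
  have ge: "?g x = (2 * (p x)\<^sup>2 + (q x)\<^sup>2 + (r x)\<^sup>2 + (?w x)\<^sup>2) + 2 * \<epsilon> * ((p x)\<^sup>2 + q x * r x) - 2 * (?w x * (q x + \<epsilon> * r x))" for x
    using \<epsilon> by (auto simp: power2_eq_square algebra_simps)
  have i1: "integrable cyl (\<lambda>x. 2 * (p x)\<^sup>2 + (q x)\<^sup>2 + (r x)\<^sup>2 + (?w x)\<^sup>2)" using L2 w2 by simp
  have i2: "integrable cyl (\<lambda>x. (p x)\<^sup>2 + q x * r x)" using L2 i by simp
  have i3: "integrable cyl (\<lambda>x. ?w x * (q x + \<epsilon> * r x))"
    using i by (simp add: distrib_left mult.left_commute[of _ \<epsilon>])
  have z: "(\<integral>x. (p x)\<^sup>2 + q x * r x \<partial>cyl) = 0" using det_integral L2 i by simp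
  have gi: "integrable cyl ?g" unfolding ge using i1 i2 i3 by simp
  have "(\<integral>x. ?g x \<partial>cyl) = (\<integral>x. 2 * (p x)\<^sup>2 + (q x)\<^sup>2 + (r x)\<^sup>2 + (?w x)\<^sup>2 \<partial>cyl) + 2 * \<epsilon> * (\<integral>x. (p x)\<^sup>2 + q x * r x \<partial>cyl) - 2 * c"
    unfolding ge cal[symmetric] using i1 i2 i3
    by (simp del: Bochner_Integration.integral_add Bochner_Integration.integral_diff add: Bochner_Integration.integral_add[OF i1 integrable_mult_right[OF i2]] Bochner_Integration.integral_diff[OF Bochner_Integration.integrable_add[OF i1 integrable_mult_right[OF i2]] integrable_mult_right[OF i3]])
  then have "(\<integral>x. ?g x \<partial>cyl) \<le> 0" using E z by simp
  moreover have g0: "?g x \<ge> 0" for x using \<epsilon> by auto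
  ultimately have "(\<integral>x. ?g x \<partial>cyl) = 0" by (simp add: order_antisym)
  then have ae: "AE x in cyl. ?g x = 0" using gi g0 by (subst (asm) integral_nonneg_eq_0_iff_AE) auto
  show "AE x in cyl. q x + \<epsilon> * r x = ?w x" using ae
  proof eventually_elim
    case (elim x)
    have "2 * (1 + \<epsilon>) * (p x)\<^sup>2 \<ge> 0" using \<epsilon> by auto
    then have "(q x + \<epsilon> * r x - ?w x)\<^sup>2 \<le> 0" using elim by linarith
    then show ?case by simp
  qed
  show "AE x in cyl. p x = 0" if "\<epsilon> = 1" using ae
  proof eventually_elim
    case (elim x)
    have "(q x + \<epsilon> * r x - ?w x)\<^sup>2 \<ge> 0" by simp
    then have "(p x)\<^sup>2 \<le> 0" using elim that by (simp add: add_nonneg_eq_0_iff)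
    then show ?case by simp
  qed
qed

end

section \<open>The maximum principle\<close>

lemma partials_has_derivative:
  fixes f fx fy :: "real \<times> real \<Rightarrow> real"
  assumes x: "\<And>x y. ((\<lambda>x. f (x, y)) has_real_derivative fx (x, y)) (at x)"
    and y: "\<And>x y. ((\<lambda>y. f (x, y)) has_real_derivative fy (x, y)) (at y)"
    and c: "continuous_on UNIV fy"
  shows "(f has_derivative (\<lambda>h. fst h * fx z + snd h * fy z)) (at z)"
proof -
  obtain x0 y0 where z: "z = (x0, y0)" by (cases z)
  have "((\<lambda>(x, y). f (x, y)) has_derivative (\<lambda>(tx, ty). fx (x0, y0) * tx + blinfun_apply (blinfun_mult_right (fy (x0, y0))) ty)) (at (x0, y0) within UNIV \<times> UNIV)"
  proof (rule has_derivative_partialsI[where fy="\<lambda>x y. blinfun_mult_right (fy (x, y))"])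
    show "((\<lambda>x. f (x, y0)) has_derivative (\<lambda>tx. fx (x0, y0) * tx)) (at x0 within UNIV)"
      using x[of y0 x0] by (simp add: has_field_derivative_def)
    show "((\<lambda>y. f (x, y)) has_derivative blinfun_apply (blinfun_mult_right (fy (x, y)))) (at y within UNIV)" for x y
      using y[of x y] by (simp add: has_field_derivative_def)
    have "isCont fy (x0, y0)" using c by (simp add: continuous_on_eq_continuous_at)
    then have "isCont (\<lambda>z. blinfun_mult_right (fy z)) (x0, y0)"
      by (rule bounded_linear.isCont[OF bounded_linear_blinfun_mult_right])
    then show "continuous (at (x0, y0) within UNIV \<times> UNIV) (\<lambda>(x, y). blinfun_mult_right (fy (x, y)))"
      by (simp add: case_prod_beta')
  qed auto
  then show ?thesis unfolding z by (simp add: case_prod_beta' mult.commute)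
qed

lemma antiderivative_exists:
  fixes g :: "real \<Rightarrow> real"
  assumes c: "continuous_on UNIV g"
  shows "\<exists>G. \<forall>x. (G has_real_derivative g x) (at x)"
proof -
  define G where "G x = (if 0 \<le> x then integral {0..x} g else - integral {x..0} g)" for x
  have i: "g integrable_on {c..d}" for c d :: real using continuous_on_subset[OF c] by (intro integrable_continuous_real) auto
  have "(G has_real_derivative g x) (at x)" for x
  proof -
    define l where "l = min 0 x - 1"
    have eq: "integral {l..t} g - integral {l..0} g = G t" if "t \<in> {l..x+1}" for t
    proof (cases "0 \<le> t")
      case True
      then show ?thesis using Henstock_Kurzweil_Integration.integral_combine[of l 0 t g] i[of l t] unfolding G_def by (simp add: l_def) (simp add: algebra_simps)
    next
      case False
      then show ?thesis using Henstock_Kurzweil_Integration.integral_combine[of l t 0 g] i[of l 0] that by (auto simp: G_def)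
    qed
    have "((\<lambda>t. integral {l..t} g) has_real_derivative g x) (at x within {l..x+1})"
      by (rule integral_has_real_derivative) (auto simp: l_def intro: continuous_on_subset[OF c])
    then have "((\<lambda>t. integral {l..t} g - integral {l..0} g) has_real_derivative g x) (at x within {l..x+1})"
      by (auto intro!: derivative_eq_intros)
    then have "(G has_real_derivative g x) (at x within {l..x+1})"
    proof (rule has_field_derivative_transform_within[where d=1])
      show "x \<in> {l..x+1}" by (simp add: l_def)
    qed (use eq in auto)
    moreover have "x \<in> interior {l..x+1}" by (auto simp: interior_atLeastAtMost_real l_def)
    ultimately show ?thesis by (simp only: at_within_interior)
  qed
  then show ?thesis by blast
qed

text \<open>The integral of \<open>f\<close> in the first variable from \<open>a\<close> to
  \<open>fst z\<close>, rescaled to the unit interval: orientation and the moving end point go into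
  a continuous integrand.\<close>

definition seg_int :: "real \<Rightarrow> (real \<times> real \<Rightarrow> real) \<Rightarrow> real \<times> real \<Rightarrow> real" where
  "seg_int a f z = integral {0..1} (\<lambda>t. (fst z - a) * f (a + t * (fst z - a), snd z))"

lemma seg_int_FTC:
  assumes "\<And>x. (G has_real_derivative g x) (at x)"
  shows "((\<lambda>t. (z - a) * g (a + t * (z - a))) has_integral (G z - G a)) {0..1}"
proof -
  have "((\<lambda>t. (z - a) * g (a + t * (z - a))) has_integral (G (a + 1 * (z - a)) - G (a + 0 * (z - a)))) {0..1}"
  proof (rule fundamental_theorem_of_calculus)
    fix t :: real
    have "((\<lambda>t. a + t * (z - a)) has_real_derivative (z - a)) (at t within {0..1})"
      by (auto intro!: derivative_eq_intros)
    from DERIV_chain2[OF assms this]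
    show "((\<lambda>t. G (a + t * (z - a))) has_vector_derivative (z - a) * g (a + t * (z - a))) (at t within {0..1})"
      by (simp add: has_real_derivative_iff_has_vector_derivative mult.commute)
  qed simp
  then show ?thesis by simp
qed

lemma seg_int_continuous:
  assumes c: "continuous_on UNIV f"
  shows "continuous_on UNIV (seg_int a f)"
  unfolding seg_int_def[abs_def]
proof (rule integral_continuous_on_param[where a="0::real" and b=1 and U=UNIV and f="\<lambda>z t. (fst z - a) * f (a + t * (fst z - a), snd z)", unfolded cbox_interval])
  show "continuous_on (UNIV \<times> {0..1}) (\<lambda>(z, t). (fst z - a) * f (a + t * (fst z - a), snd z))"
    unfolding case_prod_beta' by (intro continuous_intros continuous_on_compose2[OF c]) auto
qed

text \<open>In the first variable this is the fundamental theorem of calculus, in the second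
  differentiation under the integral.\<close>

lemma seg_int_has_derivative:
  fixes f f2 :: "real \<times> real \<Rightarrow> real"
  assumes c: "continuous_on UNIV f" "continuous_on UNIV f2"
    and d: "\<And>s t. ((\<lambda>t. f (s, t)) has_real_derivative f2 (s, t)) (at t)"
  shows "(seg_int a f has_derivative (\<lambda>h. fst h * f z + snd h * seg_int a f2 z)) (at z)"
proof (rule partials_has_derivative)
  fix x y :: real
  have cy: "continuous_on UNIV (\<lambda>s. f (s, y))" by (rule continuous_on_compose2[OF c(1)]) (auto intro: continuous_intros)
  obtain G where G: "\<And>x. (G has_real_derivative f (x, y)) (at x)" using antiderivative_exists[OF cy] by blast
  have "seg_int a f (x, y) = G x - G a" for x
    using integral_unique[OF seg_int_FTC[of G "\<lambda>s. f (s, y)" x a, OF G]] unfolding seg_int_def fst_conv snd_conv .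
  then show "((\<lambda>x. seg_int a f (x, y)) has_real_derivative f (x, y)) (at x)"
    using G[of x] by (auto intro!: derivative_eq_intros)
  have "((\<lambda>y. integral (cbox 0 1) (\<lambda>t. (x - a) * f (a + t * (x - a), y))) has_real_derivative
      integral (cbox 0 1) (\<lambda>t. (x - a) * f2 (a + t * (x - a), y))) (at y within UNIV)"
  proof (rule leibniz_rule_field_derivative)
    show "((\<lambda>y. (x - a) * f (a + t * (x - a), y)) has_real_derivative (x - a) * f2 (a + t * (x - a), y)) (at y within UNIV)" for y t
      using d[of "a + t * (x - a)" y] by (intro DERIV_cmult) simp
    show "(\<lambda>t. (x - a) * f (a + t * (x - a), y)) integrable_on cbox 0 1" for y
      by (intro integrable_continuous continuous_intros continuous_on_compose2[OF c(1)]) auto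
    show "continuous_on (UNIV \<times> cbox 0 1) (\<lambda>(y, t). (x - a) * f2 (a + t * (x - a), y))"
      unfolding case_prod_beta' by (intro continuous_intros continuous_on_compose2[OF c(2)]) auto
  qed auto
  then show "((\<lambda>y. seg_int a f (x, y)) has_real_derivative seg_int a f2 (x, y)) (at y)"
    by (simp add: seg_int_def)
qed (rule seg_int_continuous[OF c(2)])

text \<open>The integrand is dominated by \<open>L * n\<close>, and \<open>n\<close> integrates to
  \<open>N\<close>. Keeping \<open>N\<close> in the bound, instead of the length of the segment,
  preserves the truncation.\<close>

lemma seg_int_bound:
  fixes N n :: "real \<Rightarrow> real"
  assumes N: "\<And>x. (N has_real_derivative n x) (at x)" "N a = 0" and n0: "\<And>x. 0 \<le> n x"
    and c: "continuous_on UNIV f" and L: "0 \<le> L" and b: "\<And>s. s \<in> closed_segment a (fst z) \<Longrightarrow> \<bar>f (s, snd z)\<bar> \<le> L * n s"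
  shows "\<bar>seg_int a f z\<bar> \<le> L * \<bar>N (fst z)\<bar>"
proof -
  let ?d = "fst z - a"
  have sg: "\<bar>?d\<bar> = sgn ?d * ?d" by (simp add: abs_sgn mult.commute)
  have "((\<lambda>t. L * (sgn ?d * (?d * n (a + t * ?d)))) has_integral L * (sgn ?d * (N (fst z) - N a))) {0..1}"
    by (intro has_integral_mult_right seg_int_FTC N)
  then have I: "((\<lambda>t. \<bar>?d\<bar> * (L * n (a + t * ?d))) has_integral L * (sgn ?d * N (fst z))) {0..1}"
    unfolding sg using N(2) by (simp add: ac_simps)
  have "norm (seg_int a f z) \<le> integral {0..1} (\<lambda>t. \<bar>?d\<bar> * (L * n (a + t * ?d)))"
    unfolding seg_int_def
  proof (rule integral_norm_bound_integral)
    show "(\<lambda>t. ?d * f (a + t * ?d, snd z)) integrable_on {0..1}"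
      by (intro integrable_continuous_real continuous_intros continuous_on_compose2[OF c]) auto
    show "(\<lambda>t. \<bar>?d\<bar> * (L * n (a + t * ?d))) integrable_on {0..1}" using I by blast
    fix t :: real assume t: "t \<in> {0..1}"
    have "a + t * ?d \<in> closed_segment a (fst z)" using t by (auto simp: in_segment algebra_simps intro!: exI[of _ t])
    then show "norm (?d * f (a + t * ?d, snd z)) \<le> \<bar>?d\<bar> * (L * n (a + t * ?d))"
      using b by (auto simp: abs_mult intro!: mult_left_mono)
  qed
  also have "\<dots> = L * (sgn ?d * N (fst z))" using I by (rule integral_unique)
  also have "\<dots> \<le> L * \<bar>N (fst z)\<bar>"
    by (intro mult_left_mono[OF _ L]) (auto simp: sgn_if)
  finally show ?thesis by simp
qed

context cyl_field
begin

text \<open>Since \<open>div u = 0\<close> and \<open>curl u = w(u)\<close>, one has \<open>\<Delta> u1 = - \<partial>\<^sub>2 (w(u))\<close>, tested here with \<open>N(u1)\<close>. Up to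
  \<open>s \<cdot> \<partial>F/\<partial>z\<^sub>2 (u)\<close>, where \<open>s = - p\<close>, the right-hand side is the \<open>\<partial>\<^sub>2\<close>-derivative of \<open>F(u)\<close>, with \<open>F(z)\<close> the
  integral of \<open>N' w\<close> along the segment from \<open>(a, z\<^sub>2)\<close> to \<open>z\<close>.\<close>

lemma level_identity:
  fixes w w2 lam :: "real \<times> real \<Rightarrow> real" and N n :: "real \<Rightarrow> real"
  assumes wc: "continuous_on UNIV w" "continuous_on UNIV w2"
    and wd: "\<And>s t. ((\<lambda>t. w (s, t)) has_real_derivative w2 (s, t)) (at t)"
    and wi: "integrable cyl (\<lambda>x. (w (u1 x, u2 x))\<^sup>2)"
    and curl: "AE x in cyl. q x - r x = w (u1 x, u2 x)"
    and lam[measurable]: "lam \<in> borel_measurable borel"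
    and lamb: "AE x in cyl. \<forall>s\<in>closed_segment a (u1 x). \<bar>w2 (s, u2 x)\<bar> \<le> lam x"
    and N: "\<And>x. (N has_real_derivative n x) (at x)" "N a = 0" and n0: "\<And>x. 0 \<le> n x" and n1: "\<And>x. n x \<le> 1"
    and nc: "continuous_on UNIV n"
  shows "(\<integral>\<^sup>+x. ennreal (n (u1 x) * ((p x)\<^sup>2 + (r x)\<^sup>2)) \<partial>cyl) \<le> (\<integral>\<^sup>+x. ennreal (\<bar>N (u1 x)\<bar> * lam x * \<bar>p x\<bar>) \<partial>cyl)"
proof -
  have Nc: "continuous_on UNIV N" using N(1) by (meson DERIV_isCont continuous_at_imp_continuous_on)
  have [measurable]: "n \<in> borel_measurable borel" "N \<in> borel_measurable borel" "w \<in> borel_measurable borel" "w2 \<in> borel_measurable borel"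
    using nc Nc wc by (auto intro: borel_measurable_continuous_onI)
  let ?w = "\<lambda>x. w (u1 x, u2 x)"
  \<comment> \<open>As \<open>n \<le> 1\<close>, the function \<open>N (u1)\<close> inherits square
    integrability from \<open>u1 - a\<close>, as \<open>null_lagrangian\<close> requires.\<close>
  have Nle: "\<bar>N z\<bar> \<le> \<bar>z - a\<bar>" for z
  proof (cases "z = a")
    case False
    obtain x where "N z - N a = n x * (z - a)"
    proof (cases "a < z")
      case True
      then show ?thesis using MVT2[OF True, of N n] N(1) that by (auto simp: mult.commute)
    next
      case F: False
      then have "z < a" using False by simp
      then obtain x where "N a - N z = (a - z) * n x" using MVT2[of z a N n] N(1) by auto
      then show ?thesis using that[of x] by (simp add: algebra_simps)
    qed
    then have "\<bar>N z\<bar> = n x * \<bar>z - a\<bar>" using N(2) n0[of x] by (simp add: abs_mult)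
    also have "\<dots> \<le> 1 * \<bar>z - a\<bar>" by (rule mult_right_mono[OF n1]) simp
    finally show ?thesis by simp
  qed (simp add: N)
  have aU: "acl (\<lambda>x. N (u1 x)) (\<lambda>x. n (u1 x) * p x) (\<lambda>x. n (u1 x) * r x)"
    by (rule acl_compose[OF acl1 N(1) nc])
  have nsq: "integrable cyl (\<lambda>x. (n (u1 x) * f x)\<^sup>2)" if [measurable]: "f \<in> borel_measurable borel" and i: "integrable cyl (\<lambda>x. (f x)\<^sup>2)" for f
  proof (rule Bochner_Integration.integrable_bound[OF i])
    have "(n (u1 x) * f x)\<^sup>2 \<le> (f x)\<^sup>2" for x
      using power_mono[OF n1 n0, of "u1 x" 2] mult_right_mono[of "(n (u1 x))\<^sup>2" 1 "(f x)\<^sup>2"] by (simp add: power_mult_distrib)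
    then show "AE x in cyl. norm ((n (u1 x) * f x)\<^sup>2) \<le> norm ((f x)\<^sup>2)" by simp
  qed simp
  have UL2: "integrable cyl (\<lambda>x. (N (u1 x))\<^sup>2)"
    by (rule Bochner_Integration.integrable_bound[OF u1_L2]) (use Nle in \<open>auto simp: abs_le_square_iff[symmetric]\<close>)
  have nl: "(\<integral>x. n (u1 x) * p x * s x \<partial>cyl) = (\<integral>x. q x * (n (u1 x) * r x) \<partial>cyl)"
    using UL2 nsq L2 by (intro null_lagrangian[OF aU acl2]) auto
  have i1: "integrable cyl (\<lambda>x. n (u1 x) * ((p x)\<^sup>2 + (r x)\<^sup>2))"
  proof (rule Bochner_Integration.integrable_bound[of _ "\<lambda>x. (p x)\<^sup>2 + (r x)\<^sup>2"])
    have "n (u1 x) * ((p x)\<^sup>2 + (r x)\<^sup>2) \<le> 1 * ((p x)\<^sup>2 + (r x)\<^sup>2)" for x by (rule mult_right_mono[OF n1]) simp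
    then show "AE x in cyl. norm (n (u1 x) * ((p x)\<^sup>2 + (r x)\<^sup>2)) \<le> norm ((p x)\<^sup>2 + (r x)\<^sup>2)" using n0 by (simp add: abs_mult)
  qed (use L2 in auto)
  have i2: "integrable cyl (\<lambda>x. n (u1 x) * r x * ?w x)" using nsq[of r] L2 wi by (intro L2_mult_integrable) auto
  have i3: "integrable cyl (\<lambda>x. q x * (n (u1 x) * r x))" "integrable cyl (\<lambda>x. n (u1 x) * p x * s x)"
    using nsq[of r] nsq[of p] L2 by (auto intro!: L2_mult_integrable)
  \<comment> \<open>Inserting \<open>s = - p\<close> and \<open>q = r + w (u)\<close> into
    \<open>nl\<close> gives the tested equation; no second derivatives of \<open>u1\<close>
    occur.\<close>
  have id: "(\<integral>x. n (u1 x) * ((p x)\<^sup>2 + (r x)\<^sup>2) \<partial>cyl) = - (\<integral>x. n (u1 x) * r x * ?w x \<partial>cyl)"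
  proof -
    have "(\<integral>x. n (u1 x) * ((p x)\<^sup>2 + (r x)\<^sup>2) \<partial>cyl) = (\<integral>x. q x * (n (u1 x) * r x) - n (u1 x) * p x * s x - n (u1 x) * r x * ?w x \<partial>cyl)"
    proof (rule integral_cong_AE)
      show "AE x in cyl. n (u1 x) * ((p x)\<^sup>2 + (r x)\<^sup>2) = q x * (n (u1 x) * r x) - n (u1 x) * p x * s x - n (u1 x) * r x * ?w x"
        using div curl
      proof eventually_elim
        case (elim x)
        then have e: "s x = - p x" "q x = r x + ?w x" by auto
        show ?case unfolding e by (simp add: power2_eq_square algebra_simps)
      qed
    qed auto
    also have "\<dots> = - (\<integral>x. n (u1 x) * r x * ?w x \<partial>cyl)" using i2 i3 nl by simp
    finally show ?thesis .
  qed
  define f where "f z = n (fst z) * w z" for z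
  define f2 where "f2 z = n (fst z) * w2 z" for z
  have fc: "continuous_on UNIV f" "continuous_on UNIV f2"
    unfolding f_def f2_def by (intro continuous_on_mult continuous_on_compose2[OF nc] wc; auto intro: continuous_intros)+
  have fd: "((\<lambda>t. f (s, t)) has_real_derivative f2 (s, t)) (at t)" for s t
    unfolding f_def f2_def fst_conv by (rule DERIV_cmult[OF wd])
  have ah: "acl (\<lambda>x. seg_int a f (u1 x, u2 x)) (\<lambda>x. f (u1 x, u2 x) * p x + seg_int a f2 (u1 x, u2 x) * q x)
     (\<lambda>x. f (u1 x, u2 x) * r x + seg_int a f2 (u1 x, u2 x) * s x)"
    by (rule acl_chain[OF acl1 acl2 seg_int_has_derivative[OF fc fd] fc(1) seg_int_continuous[OF fc(2)]])
  have [measurable]: "seg_int a f2 \<in> borel_measurable borel" using seg_int_continuous[OF fc(2)] by (rule borel_measurable_continuous_onI)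
  let ?h = "\<lambda>x. seg_int a f2 (u1 x, u2 x)"
  have hb: "AE x in cyl. \<bar>?h x\<bar> \<le> \<bar>N (u1 x)\<bar> * lam x"
    using lamb
  proof eventually_elim
    case (elim x)
    have "\<bar>seg_int a f2 (u1 x, u2 x)\<bar> \<le> lam x * \<bar>N (fst (u1 x, u2 x))\<bar>"
    proof (rule seg_int_bound[OF N n0 fc(2)])
      have "\<bar>w2 (a, u2 x)\<bar> \<le> lam x" using elim by simp
      then show "0 \<le> lam x" by linarith
      fix s :: real assume "s \<in> closed_segment a (fst (u1 x, u2 x))"
      then have "\<bar>w2 (s, u2 x)\<bar> \<le> lam x" using elim by simp
      then show "\<bar>f2 (s, snd (u1 x, u2 x))\<bar> \<le> lam x * n s" using n0[of s] mult_left_mono[of "\<bar>w2 (s, u2 x)\<bar>" "lam x" "n s"] by (simp add: f2_def abs_mult mult.commute)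
    qed
    then show ?case by (simp add: mult.commute)
  qed
  \<comment> \<open>On a slice, \<open>n r w (u)\<close> is the circle derivative of
    \<open>seg_int a f (u)\<close>, which integrates to zero, minus \<open>?h * s\<close>.
    Estimating slice by slice with an extended integral avoids asking whether \<open>?h * s\<close>
    is integrable over the cylinder.\<close>
  have sl: "AE x in lborel. \<bar>\<integral>y. n (u1 (x, y)) * r (x, y) * ?w (x, y) \<partial>T1\<bar> \<le> (\<integral>\<^sup>+y. ennreal (\<bar>?h (x, y)\<bar> * \<bar>p (x, y)\<bar>) \<partial>T1)"
    using aclD(6)[OF ah] AE_cyl_fst[OF div] integral_cyl(1)[OF i2]
  proof eventually_elim
    case (elim x)
    have per: "\<And>y. seg_int a f (u1 (x, y + 1), u2 (x, y + 1)) = seg_int a f (u1 (x, y), u2 (x, y))"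
      using aclD(4)[OF acl1] aclD(4)[OF acl2] by simp
    note z = wac_periodic_integral[OF elim(1) per]
    have fe: "f (u1 (x, y), u2 (x, y)) * r (x, y) = n (u1 (x, y)) * r (x, y) * ?w (x, y)" for y by (simp add: f_def ac_simps)
    have hs: "integrable T1 (\<lambda>y. ?h (x, y) * s (x, y))"
      using Bochner_Integration.integrable_diff[OF z(1) elim(3)] by (simp add: fe)
    have "(\<integral>y. n (u1 (x, y)) * r (x, y) * ?w (x, y) \<partial>T1) = - (\<integral>y. ?h (x, y) * s (x, y) \<partial>T1)"
      using z(2) elim(3) hs unfolding fe by simp
    then have "ennreal \<bar>\<integral>y. n (u1 (x, y)) * r (x, y) * ?w (x, y) \<partial>T1\<bar> \<le> (\<integral>\<^sup>+y. ennreal \<bar>?h (x, y) * s (x, y)\<bar> \<partial>T1)"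
      using integral_norm_bound_ennreal[OF hs] by simp
    also have "\<dots> = (\<integral>\<^sup>+y. ennreal (\<bar>?h (x, y)\<bar> * \<bar>p (x, y)\<bar>) \<partial>T1)"
    proof (rule nn_integral_cong_AE)
      show "AE y in T1. ennreal \<bar>?h (x, y) * s (x, y)\<bar> = ennreal (\<bar>?h (x, y)\<bar> * \<bar>p (x, y)\<bar>)"
        using elim(2)
      proof eventually_elim
        case (elim y)
        then have "s (x, y) = - p (x, y)" by simp
        then show ?case by (simp add: abs_mult)
      qed
    qed
    finally show ?case .
  qed
  have "(\<integral>\<^sup>+x. ennreal (n (u1 x) * ((p x)\<^sup>2 + (r x)\<^sup>2)) \<partial>cyl) = ennreal (- (\<integral>x. n (u1 x) * r x * ?w x \<partial>cyl))"
    using i1 n0 id by (subst nn_integral_eq_integral) auto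
  also have "\<dots> \<le> ennreal \<bar>\<integral>x. (\<integral>y. n (u1 (x, y)) * r (x, y) * ?w (x, y) \<partial>T1) \<partial>lborel\<bar>"
    using integral_cyl(3)[OF i2] by (intro ennreal_leI) simp
  also have "\<dots> \<le> (\<integral>\<^sup>+x. ennreal \<bar>\<integral>y. n (u1 (x, y)) * r (x, y) * ?w (x, y) \<partial>T1\<bar> \<partial>lborel)"
    using integral_norm_bound_ennreal[OF integral_cyl(2)[OF i2]] by simp
  also have "\<dots> \<le> (\<integral>\<^sup>+x. \<integral>\<^sup>+y. ennreal (\<bar>?h (x, y)\<bar> * \<bar>p (x, y)\<bar>) \<partial>T1 \<partial>lborel)"
    by (rule nn_integral_mono_AE[OF sl])
  also have "\<dots> = (\<integral>\<^sup>+x. ennreal (\<bar>?h x\<bar> * \<bar>p x\<bar>) \<partial>cyl)" by (rule nn_integral_cyl_fst[symmetric]) simp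
  also have "\<dots> \<le> (\<integral>\<^sup>+x. ennreal (\<bar>N (u1 x)\<bar> * lam x * \<bar>p x\<bar>) \<partial>cyl)"
    by (rule nn_integral_mono_AE, use hb in eventually_elim) (auto intro!: ennreal_leI mult_right_mono)
  finally show ?thesis .
qed

lemma superlevel_finite: "0 < k \<Longrightarrow> emeasure cyl {x. k < \<bar>u1 x - a\<bar>} < \<infinity>"
  using finite_superlevel[OF acl1 L2(3), of a 0 k] mean1 by (auto elim!: eventually_mono)

section \<open>Truncation of the first component and its essential supremum\<close>

context
  fixes w w2 lam :: "real \<times> real \<Rightarrow> real"
  assumes wc: "continuous_on UNIV w" "continuous_on UNIV w2"
    and wd: "\<And>s t. ((\<lambda>t. w (s, t)) has_real_derivative w2 (s, t)) (at t)"
    and wi: "integrable cyl (\<lambda>x. (w (u1 x, u2 x))\<^sup>2)"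
    and curl: "AE x in cyl. q x - r x = w (u1 x, u2 x)"
    and lam[measurable]: "lam \<in> borel_measurable borel"
    and lamb: "AE x in cyl. \<forall>s\<in>closed_segment a (u1 x). \<bar>w2 (s, u2 x)\<bar> \<le> lam x"
    and lam4: "\<And>S. S \<in> sets borel \<Longrightarrow> emeasure cyl S < \<infinity> \<Longrightarrow> integrable cyl (\<lambda>x. indicator S x * (lam x)^4)"
begin

definition exc :: "real \<Rightarrow> real \<times> real \<Rightarrow> real" where
  "exc k x = max 0 (\<bar>u1 x - a\<bar> - k)"

lemma exc_measurable[measurable]: "exc k \<in> borel_measurable borel"
  unfolding exc_def by measurable

lemma exc_nonneg: "0 \<le> exc k x" by (simp add: exc_def)

lemma lam_nonneg: "AE x in cyl. 0 \<le> lam x"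
  using lamb
proof eventually_elim
  case (elim x)
  then have "\<bar>w2 (a, u2 x)\<bar> \<le> lam x" by simp
  then show ?case by linarith
qed

text \<open>\<open>level_identity\<close> asks for a continuous \<open>n\<close>, so the indicator
  of \<open>\<bar>z - a\<bar> > k\<close> is approached by the ramps \<open>n j\<close>. Their
  primitives never exceed the excess over \<open>k\<close>, so the right-hand side is uniform in
  \<open>j\<close>, and Fatou treats the left-hand side.\<close>

lemma exc_Caccioppoli:
  assumes k: "k > 0"
  shows "(\<integral>\<^sup>+x. ennreal (indicator {x. k < \<bar>u1 x - a\<bar>} x * ((p x)\<^sup>2 + (r x)\<^sup>2)) \<partial>cyl) \<le> (\<integral>\<^sup>+x. ennreal (exc k x * lam x * \<bar>p x\<bar>) \<partial>cyl)"
proof -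
  define n where "n j z = min 1 (real j * max 0 (\<bar>z - a\<bar> - k))" for j :: nat and z
  have nc: "continuous_on UNIV (n j)" for j unfolding n_def by (intro continuous_intros)
  have "\<exists>N. (\<forall>x. (N has_real_derivative n j x) (at x)) \<and> N a = 0" for j
  proof -
    obtain G where "\<And>x. (G has_real_derivative n j x) (at x)" using antiderivative_exists[OF nc[of j]] by blast
    then have "\<forall>x. ((\<lambda>x. G x - G a) has_real_derivative n j x) (at x)" by (auto intro!: derivative_eq_intros)
    then show ?thesis by (intro exI[of _ "\<lambda>x. G x - G a"]) auto
  qed
  then obtain N where N: "\<And>j x. (N j has_real_derivative n j x) (at x)" "\<And>j. N j a = 0" by metis
  have nz: "n j z = 0" if "\<bar>z - a\<bar> \<le> k" for j z using that by (simp add: n_def)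
  have n01: "0 \<le> n j z" "n j z \<le> 1" for j z by (auto simp: n_def)
  have Nz: "N j z = 0" if "\<bar>z - a\<bar> \<le> k" for j z
  proof -
    have "((\<lambda>t. (z - a) * n j (a + t * (z - a))) has_integral (N j z - N j a)) {0..1}" by (rule seg_int_FTC[OF N(1)])
    moreover have "((\<lambda>t. (z - a) * n j (a + t * (z - a))) has_integral 0) {0..1}"
    proof (rule has_integral_is_0)
      fix t :: real assume "t \<in> {0..1}"
      then have "\<bar>(a + t * (z - a)) - a\<bar> \<le> k" using that mult_left_le_one_le[of "\<bar>z - a\<bar>" t] by (simp add: abs_mult)
      then show "(z - a) * n j (a + t * (z - a)) = 0" using nz by simp
    qed
    ultimately have "N j z - N j a = 0" by (rule has_integral_unique)
    then show ?thesis by (simp add: N(2))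
  qed
  have Nb: "\<bar>N j z\<bar> \<le> max 0 (\<bar>z - a\<bar> - k)" for j z
  proof -
    consider "\<bar>z - a\<bar> \<le> k" | "z > a + k" | "z < a - k" by linarith
    then show ?thesis
    proof cases
      case 1
      then show ?thesis using Nz by simp
    next
      case 2
      obtain x where "N j z - N j (a + k) = (z - (a + k)) * n j x" using MVT2[OF 2, of "N j" "n j"] N(1) by blast
      moreover have "N j (a + k) = 0" using Nz k by simp
      ultimately have "\<bar>N j z\<bar> = (z - (a + k)) * n j x" using n01[of j x] 2 by (simp add: abs_mult)
      also have "\<dots> \<le> (z - (a + k)) * 1" using n01[of j x] 2 by (intro mult_left_mono) auto
      finally show ?thesis using 2 k by simp
    next
      case 3
      obtain x where "N j (a - k) - N j z = ((a - k) - z) * n j x" using MVT2[OF 3, of "N j" "n j"] N(1) by blast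
      moreover have "N j (a - k) = 0" using Nz k by simp
      ultimately have "- N j z = ((a - k) - z) * n j x" by simp
      moreover have "0 \<le> ((a - k) - z) * n j x" using n01[of j x] 3 by (intro mult_nonneg_nonneg) auto
      ultimately have "\<bar>N j z\<bar> = ((a - k) - z) * n j x" by linarith
      also have "\<dots> \<le> ((a - k) - z) * 1" using n01[of j x] 3 by (intro mult_left_mono) auto
      finally show ?thesis using 3 k by simp
    qed
  qed
  have [measurable]: "n j \<in> borel_measurable borel" for j using nc by (rule borel_measurable_continuous_onI)
  have "(\<integral>\<^sup>+x. ennreal (indicator {x. k < \<bar>u1 x - a\<bar>} x * ((p x)\<^sup>2 + (r x)\<^sup>2)) \<partial>cyl) \<le> (\<integral>\<^sup>+x. liminf (\<lambda>j. ennreal (n j (u1 x) * ((p x)\<^sup>2 + (r x)\<^sup>2))) \<partial>cyl)"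
  proof (rule nn_integral_mono)
    fix x
    have "(\<lambda>j. n j (u1 x)) \<longlonglongrightarrow> indicator {x. k < \<bar>u1 x - a\<bar>} x"
    proof (rule tendsto_eventually)
      show "\<forall>\<^sub>F j in sequentially. n j (u1 x) = indicator {x. k < \<bar>u1 x - a\<bar>} x"
      proof (cases "k < \<bar>u1 x - a\<bar>")
        case True
        then obtain J :: nat where J: "1 / (\<bar>u1 x - a\<bar> - k) \<le> real J" using real_arch_simple by blast
        have "n j (u1 x) = 1" if "j \<ge> J" for j
        proof -
          have "1 \<le> real J * (\<bar>u1 x - a\<bar> - k)" using J True by (simp add: divide_le_eq)
          also have "\<dots> \<le> real j * (\<bar>u1 x - a\<bar> - k)" using that True by (intro mult_right_mono) auto
          finally show ?thesis using True by (simp add: n_def)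
        qed
        then show ?thesis using True by (intro eventually_sequentiallyI[of J]) auto
      qed (simp add: nz)
    qed
    then have "(\<lambda>j. ennreal (n j (u1 x) * ((p x)\<^sup>2 + (r x)\<^sup>2))) \<longlonglongrightarrow> ennreal (indicator {x. k < \<bar>u1 x - a\<bar>} x * ((p x)\<^sup>2 + (r x)\<^sup>2))"
      by (intro tendsto_ennrealI tendsto_mult tendsto_const)
    then show "ennreal (indicator {x. k < \<bar>u1 x - a\<bar>} x * ((p x)\<^sup>2 + (r x)\<^sup>2)) \<le> liminf (\<lambda>j. ennreal (n j (u1 x) * ((p x)\<^sup>2 + (r x)\<^sup>2)))"
      by (simp add: lim_imp_Liminf)
  qed
  also have "\<dots> \<le> liminf (\<lambda>j. \<integral>\<^sup>+x. ennreal (n j (u1 x) * ((p x)\<^sup>2 + (r x)\<^sup>2)) \<partial>cyl)" by (rule nn_integral_liminf) simp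
  also have "\<dots> \<le> liminf (\<lambda>j::nat. \<integral>\<^sup>+x. ennreal (exc k x * lam x * \<bar>p x\<bar>) \<partial>cyl)"
  proof (rule Liminf_mono, rule always_eventually, rule allI)
    fix j
    have "(\<integral>\<^sup>+x. ennreal (n j (u1 x) * ((p x)\<^sup>2 + (r x)\<^sup>2)) \<partial>cyl) \<le> (\<integral>\<^sup>+x. ennreal (\<bar>N j (u1 x)\<bar> * lam x * \<bar>p x\<bar>) \<partial>cyl)"
      by (rule level_identity[OF wc wd wi curl lam lamb N n01 nc])
    also have "\<dots> \<le> (\<integral>\<^sup>+x. ennreal (exc k x * lam x * \<bar>p x\<bar>) \<partial>cyl)"
      by (rule nn_integral_mono_AE, use lam_nonneg in eventually_elim) (use Nb in \<open>auto simp: exc_def intro!: ennreal_leI mult_right_mono\<close>)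
    finally show "(\<integral>\<^sup>+x. ennreal (n j (u1 x) * ((p x)\<^sup>2 + (r x)\<^sup>2)) \<partial>cyl) \<le> (\<integral>\<^sup>+x. ennreal (exc k x * lam x * \<bar>p x\<bar>) \<partial>cyl)" .
  qed
  also have "\<dots> = (\<integral>\<^sup>+x. ennreal (exc k x * lam x * \<bar>p x\<bar>) \<partial>cyl)" by (rule Liminf_const) simp
  finally show ?thesis .
qed

lemma exc_integrable:
  assumes k: "k > 0"
  shows "integrable cyl (\<lambda>x. (exc k x)\<^sup>2)" "integrable cyl (\<lambda>x. indicator {x. k < \<bar>u1 x - a\<bar>} x * ((p x)\<^sup>2 + (r x)\<^sup>2))"
proof -
  show "integrable cyl (\<lambda>x. (exc k x)\<^sup>2)"
    by (rule Bochner_Integration.integrable_bound[OF u1_L2]) (use k in \<open>auto simp: exc_def abs_le_square_iff[symmetric]\<close>)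
  show "integrable cyl (\<lambda>x. indicator {x. k < \<bar>u1 x - a\<bar>} x * ((p x)\<^sup>2 + (r x)\<^sup>2))"
    by (rule Bochner_Integration.integrable_bound[of _ "\<lambda>x. (p x)\<^sup>2 + (r x)\<^sup>2"]) (use L2 in \<open>auto simp: indicator_def\<close>)
qed

text \<open>Both inequalities are used with \<open>\<theta> (u1) = (exc k)^2\<close>, which vanishes
  at the mean \<open>a\<close>. Writing \<open>Y\<close> for the integral of the square, Poincare
  gives \<open>Y^2 \<le> 4 * Y * X\<close>, and Sobolev bounds the fourth power by
  \<open>4 * Y * X\<close>.\<close>

lemma exc_Sobolev:
  assumes k: "k > 0"
  defines "X \<equiv> \<integral>x. indicator {x. k < \<bar>u1 x - a\<bar>} x * ((p x)\<^sup>2 + (r x)\<^sup>2) \<partial>cyl"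
  shows "(\<integral>x. (exc k x)\<^sup>2 \<partial>cyl) \<le> 4 * X" "integrable cyl (\<lambda>x. (exc k x)^4)" "(\<integral>x. (exc k x)^4 \<partial>cyl) \<le> 16 * X\<^sup>2"
proof -
  define \<theta> where "\<theta> t = (max 0 (t - (a + k)))\<^sup>2 + (max 0 (- t - (k - a)))\<^sup>2" for t
  define \<theta>' where "\<theta>' t = 2 * max 0 (t - (a + k)) - 2 * max 0 (- t - (k - a))" for t
  have der: "(\<theta> has_real_derivative \<theta>' t) (at t)" for t
    unfolding \<theta>_def \<theta>'_def
    using DERIV_add[OF max_shift_square_has_derivative[of "a + k" t] DERIV_chain2[OF max_shift_square_has_derivative[of "k - a" "- t"] DERIV_minus[OF DERIV_ident]]] by simp
  have cont: "continuous_on UNIV \<theta>'" unfolding \<theta>'_def by (intro continuous_intros)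
  have \<theta>e: "\<theta> (u1 x) = (exc k x)\<^sup>2" for x using k by (auto simp: \<theta>_def exc_def max_def abs_if)
  have \<theta>'e: "\<bar>\<theta>' (u1 x)\<bar> = 2 * exc k x" for x using k by (auto simp: \<theta>'_def exc_def max_def abs_if)
  have z: "AE x in lborel. \<theta> (\<integral>y. u1 (x, y) \<partial>T1) = 0" using mean1 by eventually_elim (use k in \<open>auto simp: \<theta>_def\<close>)
  define ch where "ch x = (indicator {x. k < \<bar>u1 x - a\<bar>} x :: real)" for x
  have chm[measurable]: "ch \<in> borel_measurable borel" unfolding ch_def by measurable
  have X0: "X \<ge> 0" unfolding X_def by (intro Bochner_Integration.integral_nonneg) (auto simp: indicator_def)
  note ei = exc_integrable[OF k]
  define Y where "Y = (\<integral>x. (exc k x)\<^sup>2 \<partial>cyl)"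
  have Y0: "Y \<ge> 0" by (simp add: Y_def)
  have half: "integrable cyl (\<lambda>x. exc k x * \<bar>d x\<bar>)" "(\<integral>x. exc k x * \<bar>d x\<bar> \<partial>cyl)\<^sup>2 \<le> Y * X"
    if [measurable]: "d \<in> borel_measurable borel" and i: "integrable cyl (\<lambda>x. (d x)\<^sup>2)" and le: "\<And>x. (d x)\<^sup>2 \<le> (p x)\<^sup>2 + (r x)\<^sup>2" for d
  proof -
    have e: "exc k x * \<bar>d x\<bar> = \<bar>exc k x * (ch x * d x)\<bar>" for x
      by (auto simp: ch_def indicator_def exc_def abs_mult)
    have sq: "integrable cyl (\<lambda>x. (ch x * d x)\<^sup>2)"
      by (rule Bochner_Integration.integrable_bound[OF i]) (auto simp: ch_def indicator_def)
    show "integrable cyl (\<lambda>x. exc k x * \<bar>d x\<bar>)" unfolding e using ei(1) sq by (intro integrable_abs L2_mult_integrable) auto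
    have "(\<integral>x. exc k x * \<bar>d x\<bar> \<partial>cyl)\<^sup>2 \<le> Y * (\<integral>x. (ch x * d x)\<^sup>2 \<partial>cyl)"
      unfolding e Y_def using ei(1) sq by (intro L2_Cauchy_Schwarz) auto
    also have "\<dots> \<le> Y * X" unfolding X_def
      by (intro mult_left_mono[OF _ Y0] integral_mono sq ei(2)) (use le in \<open>auto simp: ch_def indicator_def\<close>)
    finally show "(\<integral>x. exc k x * \<bar>d x\<bar> \<partial>cyl)\<^sup>2 \<le> Y * X" .
  qed
  have nn: "(\<integral>\<^sup>+x. ennreal \<bar>\<theta>' (u1 x) * d x\<bar> \<partial>cyl) = ennreal (2 * (\<integral>x. exc k x * \<bar>d x\<bar> \<partial>cyl))" if "integrable cyl (\<lambda>x. exc k x * \<bar>d x\<bar>)" for d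
    using that by (subst integral_mult_right_zero[symmetric], subst nn_integral_eq_integral[symmetric]) (auto simp: abs_mult \<theta>'e exc_nonneg mult.assoc)
  note hp = half[of p, simplified, OF L2(1)] and hr = half[of r, simplified, OF L2(3)]
  have "ennreal Y = (\<integral>\<^sup>+x. ennreal \<bar>\<theta> (u1 x)\<bar> \<partial>cyl)" unfolding Y_def \<theta>e using ei(1) by (subst nn_integral_eq_integral) auto
  also have "\<dots> \<le> (\<integral>\<^sup>+x. ennreal \<bar>\<theta>' (u1 x) * r x\<bar> \<partial>cyl)" by (rule acl_Poincare[OF acl1 der cont z])
  also have "\<dots> = ennreal (2 * (\<integral>x. exc k x * \<bar>r x\<bar> \<partial>cyl))" by (rule nn[OF hr(1)])
  finally have "Y \<le> 2 * (\<integral>x. exc k x * \<bar>r x\<bar> \<partial>cyl)"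
    by (subst (asm) ennreal_le_iff) (auto intro!: Bochner_Integration.integral_nonneg simp: exc_nonneg)
  then have "Y\<^sup>2 \<le> (2 * (\<integral>x. exc k x * \<bar>r x\<bar> \<partial>cyl))\<^sup>2" using Y0 by (rule power_mono)
  also have "\<dots> \<le> 4 * (Y * X)" using hr(2) by (simp add: power_mult_distrib)
  finally have "Y * Y \<le> Y * (4 * X)" by (simp add: power2_eq_square)
  then have Y4: "Y \<le> 4 * X" using Y0 X0 by (cases "Y = 0") (auto simp: mult_le_cancel_left)
  then show "(\<integral>x. (exc k x)\<^sup>2 \<partial>cyl) \<le> 4 * X" by (simp add: Y_def)
  have fin: "emeasure cyl {x. \<theta> (u1 x) \<noteq> 0} < \<infinity>"
    by (rule le_less_trans[OF emeasure_mono superlevel_finite[OF k]]) (auto simp: \<theta>e exc_def)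
  have "(\<integral>\<^sup>+x. (ennreal \<bar>\<theta> (u1 x)\<bar>)\<^sup>2 \<partial>cyl) \<le> (\<integral>\<^sup>+x. ennreal \<bar>\<theta>' (u1 x) * p x\<bar> \<partial>cyl) * (\<integral>\<^sup>+x. ennreal \<bar>\<theta>' (u1 x) * r x\<bar> \<partial>cyl)"
    by (rule acl_Sobolev[OF acl1 der cont z fin])
  also have "\<dots> = ennreal (2 * (\<integral>x. exc k x * \<bar>p x\<bar> \<partial>cyl)) * ennreal (2 * (\<integral>x. exc k x * \<bar>r x\<bar> \<partial>cyl))"
    by (simp only: nn[OF hp(1)] nn[OF hr(1)])
  also have "\<dots> \<le> ennreal (2 * sqrt (Y * X)) * ennreal (2 * sqrt (Y * X))"
    using hp(2) hr(2) by (intro mult_mono ennreal_leI mult_left_mono real_le_rsqrt) auto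
  also have "\<dots> = ennreal (4 * (Y * X))" using X0 Y0 by (subst ennreal_mult[symmetric]) auto
  also have "(\<integral>\<^sup>+x. (ennreal \<bar>\<theta> (u1 x)\<bar>)\<^sup>2 \<partial>cyl) = (\<integral>\<^sup>+x. ennreal ((exc k x)^4) \<partial>cyl)"
    by (simp add: \<theta>e ennreal_power power_mult[symmetric])
  finally have le4: "(\<integral>\<^sup>+x. ennreal ((exc k x)^4) \<partial>cyl) \<le> ennreal (4 * (Y * X))" .
  show i4: "integrable cyl (\<lambda>x. (exc k x)^4)"
    by (rule integrableI_bounded) (use le_less_trans[OF le4] in auto)
  have "(\<integral>x. (exc k x)^4 \<partial>cyl) \<le> 4 * (Y * X)"
    using le4 i4 X0 Y0 by (subst (asm) nn_integral_eq_integral) auto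
  also have "\<dots> \<le> 4 * ((4 * X) * X)" using Y4 X0 by (intro mult_left_mono mult_right_mono) auto
  finally show "(\<integral>x. (exc k x)^4 \<partial>cyl) \<le> 16 * X\<^sup>2" by (simp add: power2_eq_square)
qed

lemma lam_L2:
  assumes [measurable]: "S \<in> sets borel" and "emeasure cyl S < \<infinity>"
  shows "integrable cyl (\<lambda>x. (indicator S x * lam x)\<^sup>2)"
proof (rule Bochner_Integration.integrable_bound[of _ "\<lambda>x. indicator S x + indicator S x * (lam x)^4"])
  show "integrable cyl (\<lambda>x. indicator S x + indicator S x * (lam x)^4)"
    using assms lam4[OF assms] by (intro Bochner_Integration.integrable_add integrable_real_indicator) auto
  have "(lam x)\<^sup>2 \<le> 1 + (lam x)^4" for x
  proof -
    have "2 * (lam x)\<^sup>2 \<le> 1 + (lam x)^4"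
      using zero_le_power2[of "(lam x)\<^sup>2 - 1"] by (simp add: power2_diff power_mult[symmetric])
    then show ?thesis using zero_le_power2[of "lam x"] by linarith
  qed
  then show "AE x in cyl. norm ((indicator S x * lam x)\<^sup>2) \<le> norm (indicator S x + indicator S x * (lam x)^4)"
    by (auto simp: indicator_def)
qed simp

text \<open>\<open>level_identity\<close> with a hat of width \<open>h\<close> centred at the level:
  its value there is one, while its primitive is at most of order \<open>h\<close>, so the gradient
  on the level set has integral at most \<open>h * C\<close>. Thus even a supremum attained on a set
  of positive measure does no harm in \<open>maximum_principle\<close>.\<close>

lemma plateau:
  assumes S: "S > 0"
  shows "AE x in cyl. \<bar>u1 x - a\<bar> = S \<longrightarrow> p x = 0"
proof -
  let ?\<Sigma> = "{x. S / 2 < \<bar>u1 x - a\<bar>}"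
  have \<Sigma>[measurable]: "?\<Sigma> \<in> sets borel" by measurable
  have fin: "emeasure cyl ?\<Sigma> < \<infinity>" using superlevel_finite[of "S / 2"] S by simp
  have i: "integrable cyl (\<lambda>x. (indicator ?\<Sigma> x * lam x) * \<bar>p x\<bar>)"
    using lam_L2[OF \<Sigma> fin] L2 by (intro L2_mult_integrable) auto
  define C where "C = (\<integral>x. \<bar>(indicator ?\<Sigma> x * lam x) * \<bar>p x\<bar>\<bar> \<partial>cyl)"
  have bd: "(\<integral>\<^sup>+x. ennreal (indicator {x. \<bar>u1 x - a\<bar> = S} x * ((p x)\<^sup>2 + (r x)\<^sup>2)) \<partial>cyl) \<le> ennreal (h * C)" if h: "0 < h" "h < S" for h
  proof -
    \<comment> \<open>Places the peak of the hat at \<open>k + h / 2 = S\<close>;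
      \<open>h < S\<close> keeps its support above \<open>S / 2\<close>.\<close>
    define k where "k = S - h / 2"
    have k: "S / 2 < k" "0 < k" using h by (auto simp: k_def)
    define N where "N z = (tent k h (z - a) - tent k h (a - z)) / h" for z
    define n where "n z = (tent' k h (z - a) + tent' k h (a - z)) / h" for z
    have Nd: "(N has_real_derivative n z) (at z)" for z
    proof -
      have "((\<lambda>z. tent k h (z - a)) has_real_derivative tent' k h (z - a) * 1) (at z)"
        by (rule DERIV_chain2[OF tent_derivative]) (auto intro!: derivative_eq_intros)
      moreover have "((\<lambda>z. tent k h (a - z)) has_real_derivative tent' k h (a - z) * (-1)) (at z)"
        by (rule DERIV_chain2[OF tent_derivative]) (auto intro!: derivative_eq_intros)
      ultimately have "((\<lambda>z. (tent k h (z - a) - tent k h (a - z)) / h) has_real_derivative (tent' k h (z - a) * 1 - tent' k h (a - z) * (-1)) / h) (at z)"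
        by (intro DERIV_cdivide DERIV_diff)
      then show ?thesis by (simp add: N_def[abs_def] n_def)
    qed
    have tb: "0 \<le> tent k h y \<and> tent k h y \<le> h\<^sup>2 / 2" for y
    proof -
      have mono: "tent k h y1 \<le> tent k h y2" if "y1 \<le> y2" for y1 y2
        using that tent'_bounds(1)[OF h(1)] by (intro DERIV_nonneg_imp_nondecreasing[OF that]) (auto intro: tent_derivative)
      show ?thesis
        using mono[of "min y k" y] mono[of y "max y (k + h)"] tent_values[OF h(1)] by auto
    qed
    have nb: "0 \<le> n z" "n z \<le> 1" for z
    proof -
      have "tent' k h (z - a) = 0 \<or> tent' k h (a - z) = 0" using tent'_bounds(3)[OF h(1), of k] k by (cases "z \<ge> a") auto
      then show "0 \<le> n z" "n z \<le> 1" using tent'_bounds(1,2)[OF h(1), of k "z - a"] tent'_bounds(1,2)[OF h(1), of k "a - z"] h by (auto simp: n_def)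
    qed
    have Na: "N a = 0" using tent_values(1)[OF h(1), of 0 k] k by (simp add: N_def)
    have nc: "continuous_on UNIV n" unfolding n_def tent'_def using h by (intro continuous_intros) auto
    have nS: "n z = 1" if "\<bar>z - a\<bar> = S" for z
      using that h by (auto simp: n_def tent'_def k_def abs_if max_def split: if_splits)
    have Nb: "\<bar>N (u1 x)\<bar> \<le> h * indicator ?\<Sigma> x" for x
    proof (cases "x \<in> ?\<Sigma>")
      case True
      have "\<bar>tent k h (u1 x - a) - tent k h (a - u1 x)\<bar> \<le> h\<^sup>2 / 2" using tb[of "u1 x - a"] tb[of "a - u1 x"] unfolding abs_le_iff by linarith
      then have "\<bar>tent k h (u1 x - a) - tent k h (a - u1 x)\<bar> / h \<le> h\<^sup>2 / 2 / h" using h by (intro divide_right_mono) auto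
      also have "\<dots> \<le> h" using h by (simp add: power2_eq_square)
      finally show ?thesis using True h by (simp add: N_def)
    next
      case False
      then have "\<not> S / 2 < \<bar>u1 x - a\<bar>" by simp
      then have "u1 x - a \<le> k" "a - u1 x \<le> k" using k by linarith+
      then have "tent k h (u1 x - a) = 0" "tent k h (a - u1 x) = 0" by (auto intro!: tent_values(1)[OF h(1)])
      then show ?thesis using h by (simp add: N_def)
    qed
    have "(\<integral>\<^sup>+x. ennreal (indicator {x. \<bar>u1 x - a\<bar> = S} x * ((p x)\<^sup>2 + (r x)\<^sup>2)) \<partial>cyl) \<le> (\<integral>\<^sup>+x. ennreal (n (u1 x) * ((p x)\<^sup>2 + (r x)\<^sup>2)) \<partial>cyl)"
      using nS nb by (intro nn_integral_mono ennreal_leI mult_right_mono) (auto simp: indicator_def)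
    also have "\<dots> \<le> (\<integral>\<^sup>+x. ennreal (\<bar>N (u1 x)\<bar> * lam x * \<bar>p x\<bar>) \<partial>cyl)"
      by (rule level_identity[OF wc wd wi curl lam lamb Nd Na nb nc])
    also have "\<dots> \<le> (\<integral>\<^sup>+x. ennreal (h * \<bar>(indicator ?\<Sigma> x * lam x) * \<bar>p x\<bar>\<bar>) \<partial>cyl)"
    proof (rule nn_integral_mono_AE, use lam_nonneg in eventually_elim)
      case (elim x)
      have "\<bar>N (u1 x)\<bar> * (lam x * \<bar>p x\<bar>) \<le> (h * indicator ?\<Sigma> x) * (lam x * \<bar>p x\<bar>)" by (rule mult_right_mono[OF Nb]) (use elim in auto)
      then show ?case using elim by (intro ennreal_leI) (simp add: abs_mult ac_simps)
    qed
    also have "\<dots> = ennreal (h * C)" unfolding C_def using i h by (subst nn_integral_eq_integral) auto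
    finally show ?thesis .
  qed
  have "(\<integral>\<^sup>+x. ennreal (indicator {x. \<bar>u1 x - a\<bar> = S} x * ((p x)\<^sup>2 + (r x)\<^sup>2)) \<partial>cyl) \<le> 0"
  proof (rule ennreal_le_epsilon)
    fix e :: real assume e: "e > 0"
    have C0: "C \<ge> 0" by (simp add: C_def)
    define h where "h = min (S / 2) (e / (C + 1))"
    have h: "0 < h" "h < S" "h \<le> e / (C + 1)" using S e C0 by (auto simp: h_def)
    have "h * C \<le> e / (C + 1) * C" using h C0 by (intro mult_right_mono) auto
    also have "\<dots> \<le> e" using e C0 by (simp add: field_simps)
    finally have "ennreal (h * C) \<le> 0 + ennreal e" by (simp add: ennreal_leI)
    then show "(\<integral>\<^sup>+x. ennreal (indicator {x. \<bar>u1 x - a\<bar> = S} x * ((p x)\<^sup>2 + (r x)\<^sup>2)) \<partial>cyl) \<le> 0 + ennreal e"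
      using bd[OF h(1,2)] by (rule order_trans[rotated])
  qed
  then have "AE x in cyl. ennreal (indicator {x. \<bar>u1 x - a\<bar> = S} x * ((p x)\<^sup>2 + (r x)\<^sup>2)) = 0"
    by (simp add: nn_integral_0_iff_AE)
  then show ?thesis
  proof eventually_elim
    case (elim x)
    show ?case
    proof
      assume "\<bar>u1 x - a\<bar> = S"
      then have "(p x)\<^sup>2 + (r x)\<^sup>2 \<le> 0" using elim by (simp add: ennreal_eq_0_iff)
      then show "p x = 0" by (simp add: sum_power2_le_zero_iff)
    qed
  qed
qed

text \<open>Hoelder in \<open>exc_Caccioppoli\<close>: \<open>X\<close> is at most the product of
  the \<open>L^4\<close> norms of \<open>exc k\<close> and of \<open>lam\<close> on
  \<open>\<Sigma>\<close> with the square root of \<open>X\<close>. Since \<open>exc_Sobolev\<close>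
  bounds the integral of the fourth power of \<open>exc k\<close> by \<open>16 * X^2\<close>, the
  threshold \<open>1 / 16\<close> forces \<open>X = 0\<close>. The factor
  \<open>\<bar>p x\<bar>\<close> is what restricts \<open>\<Sigma>\<close> to points with
  \<open>p x \<noteq> 0\<close>.\<close>

lemma small_superlevel:
  assumes k: "k > 0" and small: "(\<integral>x. indicator {x. k < \<bar>u1 x - a\<bar> \<and> p x \<noteq> 0} x * (lam x)^4 \<partial>cyl) < 1 / 16"
  shows "AE x in cyl. \<bar>u1 x - a\<bar> \<le> k"
proof -
  define X where "X = (\<integral>x. indicator {x. k < \<bar>u1 x - a\<bar>} x * ((p x)\<^sup>2 + (r x)\<^sup>2) \<partial>cyl)"
  note Sb = exc_Sobolev[OF k, folded X_def] and ei = exc_integrable[OF k]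
  have X0: "X \<ge> 0" unfolding X_def by (intro Bochner_Integration.integral_nonneg) (auto simp: indicator_def)
  define \<Sigma> where "\<Sigma> = {x. k < \<bar>u1 x - a\<bar> \<and> p x \<noteq> 0}"
  have \<Sigma>m[measurable]: "\<Sigma> \<in> sets borel" unfolding \<Sigma>_def by measurable
  have fin: "emeasure cyl \<Sigma> < \<infinity>"
    by (rule le_less_trans[OF emeasure_mono superlevel_finite[OF k]]) (auto simp: \<Sigma>_def)
  have l4: "integrable cyl (\<lambda>x. (indicator \<Sigma> x * (lam x)\<^sup>2)\<^sup>2)"
    using lam4[OF \<Sigma>m fin] by (simp add: power_mult_distrib power2_eq_square[of "indicator _ _"] indicator_inter_arith[symmetric] power_mult[symmetric])
  have l4e: "(\<integral>x. (indicator \<Sigma> x * (lam x)\<^sup>2)\<^sup>2 \<partial>cyl) < 1 / 16"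
    using small by (simp add: \<Sigma>_def power_mult_distrib power2_eq_square[of "indicator _ _"] indicator_inter_arith[symmetric] power_mult[symmetric])
  have e4: "integrable cyl (\<lambda>x. ((exc k x)\<^sup>2)\<^sup>2)" "(\<integral>x. ((exc k x)\<^sup>2)\<^sup>2 \<partial>cyl) \<le> 16 * X\<^sup>2"
    using Sb(2,3) by (simp_all add: power_mult[symmetric])
  define Z where "Z = (\<integral>x. (exc k x * (indicator \<Sigma> x * lam x))\<^sup>2 \<partial>cyl)"
  have ze: "(exc k x * (indicator \<Sigma> x * lam x))\<^sup>2 = \<bar>(exc k x)\<^sup>2 * (indicator \<Sigma> x * (lam x)\<^sup>2)\<bar>" for x
    by (auto simp: power_mult_distrib indicator_def)
  have zi: "integrable cyl (\<lambda>x. (exc k x * (indicator \<Sigma> x * lam x))\<^sup>2)"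
    unfolding ze using e4 l4 by (intro integrable_abs L2_mult_integrable) auto
  have Z0: "Z \<ge> 0" by (simp add: Z_def)
  have "Z\<^sup>2 \<le> (\<integral>x. ((exc k x)\<^sup>2)\<^sup>2 \<partial>cyl) * (\<integral>x. (indicator \<Sigma> x * (lam x)\<^sup>2)\<^sup>2 \<partial>cyl)"
    unfolding Z_def ze using e4 l4 by (intro L2_Cauchy_Schwarz) auto
  also have "\<dots> \<le> (16 * X\<^sup>2) * (\<integral>x. (indicator \<Sigma> x * (lam x)\<^sup>2)\<^sup>2 \<partial>cyl)" using e4(2) by (intro mult_right_mono) auto
  finally have Z2: "Z\<^sup>2 \<le> (16 * X\<^sup>2) * (\<integral>x. (indicator \<Sigma> x * (lam x)\<^sup>2)\<^sup>2 \<partial>cyl)" .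
  define ch where "ch x = (indicator {x. k < \<bar>u1 x - a\<bar>} x * p x :: real)" for x
  have chm[measurable]: "ch \<in> borel_measurable borel" unfolding ch_def by measurable
  have chi: "integrable cyl (\<lambda>x. (ch x)\<^sup>2)"
    by (rule Bochner_Integration.integrable_bound[OF L2(1)]) (auto simp: ch_def indicator_def)
  have chX: "(\<integral>x. (ch x)\<^sup>2 \<partial>cyl) \<le> X" unfolding X_def
    by (intro integral_mono chi ei(2)) (auto simp: ch_def indicator_def)
  have "ennreal X = (\<integral>\<^sup>+x. ennreal (indicator {x. k < \<bar>u1 x - a\<bar>} x * ((p x)\<^sup>2 + (r x)\<^sup>2)) \<partial>cyl)"
    unfolding X_def using ei(2) by (subst nn_integral_eq_integral) (auto simp: indicator_def)
  also have "\<dots> \<le> (\<integral>\<^sup>+x. ennreal (exc k x * lam x * \<bar>p x\<bar>) \<partial>cyl)" by (rule exc_Caccioppoli[OF k])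
  also have "\<dots> = (\<integral>\<^sup>+x. ennreal \<bar>(exc k x * (indicator \<Sigma> x * lam x)) * ch x\<bar> \<partial>cyl)"
  proof (rule nn_integral_cong_AE, use lam_nonneg in eventually_elim)
    case (elim x)
    have "exc k x * lam x * \<bar>p x\<bar> = \<bar>(exc k x * (indicator \<Sigma> x * lam x)) * ch x\<bar>"
      using elim exc_nonneg[of k x] by (auto simp: \<Sigma>_def ch_def indicator_def abs_mult exc_def)
    then show ?case by simp
  qed
  also have "\<dots> = ennreal (\<integral>x. \<bar>(exc k x * (indicator \<Sigma> x * lam x)) * ch x\<bar> \<partial>cyl)"
    using L2_mult_integrable[OF _ _ zi chi] by (intro nn_integral_eq_integral) auto
  finally have "X \<le> (\<integral>x. \<bar>(exc k x * (indicator \<Sigma> x * lam x)) * ch x\<bar> \<partial>cyl)" by (subst (asm) ennreal_le_iff) auto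
  then have "X\<^sup>2 \<le> (\<integral>x. \<bar>(exc k x * (indicator \<Sigma> x * lam x)) * ch x\<bar> \<partial>cyl)\<^sup>2" using X0 by (rule power_mono)
  also have "\<dots> \<le> Z * (\<integral>x. (ch x)\<^sup>2 \<partial>cyl)" unfolding Z_def using zi chi by (intro L2_Cauchy_Schwarz) auto
  also have "\<dots> \<le> Z * X" by (rule mult_left_mono[OF chX Z0])
  finally have XZ: "X * X \<le> Z * X" by (simp add: power2_eq_square)
  have "X = 0"
  proof (rule ccontr)
    assume "X \<noteq> 0"
    then have X: "X > 0" using X0 by simp
    then have "X \<le> Z" using XZ by simp
    then have "X\<^sup>2 \<le> Z\<^sup>2" using X0 by (rule power_mono)
    also note Z2
    also have "(16 * X\<^sup>2) * (\<integral>x. (indicator \<Sigma> x * (lam x)\<^sup>2)\<^sup>2 \<partial>cyl) < (16 * X\<^sup>2) * (1 / 16)"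
      using X l4e by (intro mult_strict_left_mono) auto
    finally show False by simp
  qed
  then have "(\<integral>x. (exc k x)\<^sup>2 \<partial>cyl) = 0" using Sb(1) by (intro antisym) auto
  then have "AE x in cyl. (exc k x)\<^sup>2 = 0" using ei(1) by (subst (asm) integral_nonneg_eq_0_iff_AE) auto
  then show ?thesis by eventually_elim (auto simp: exc_def max_def split: if_splits)
qed

text \<open>As \<open>k\<close> increases to the essential supremum of \<open>\<bar>u1 - a\<bar>\<close>, the sets where \<open>\<bar>u1 - a\<bar> > k\<close> and
  \<open>p \<noteq> 0\<close> shrink to a null set, so that \<open>small_superlevel\<close> would lower the supremum.\<close>

lemma maximum_principle: "AE x in cyl. u1 x = a"
proof -
  \<comment> \<open>If the relevant sets shrink to a null set while the levels stay above
    \<open>c\<close>, dominated convergence pushes the integral of \<open>small_superlevel\<close>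
    below its threshold at some level.\<close>
  have sm: "\<exists>n. AE x in cyl. \<bar>u1 x - a\<bar> \<le> K n"
    if K: "\<And>n::nat. K n \<ge> c" "c > 0" and lim: "AE x in cyl. \<forall>\<^sub>F n in sequentially. \<not> (K n < \<bar>u1 x - a\<bar> \<and> p x \<noteq> 0)" for K c
  proof -
    have "(\<lambda>n. \<integral>x. indicator {x. K n < \<bar>u1 x - a\<bar> \<and> p x \<noteq> 0} x * (lam x)^4 \<partial>cyl) \<longlonglongrightarrow> (\<integral>x. 0 \<partial>cyl)"
    proof (rule integral_dominated_convergence[where w="\<lambda>x. indicator {x. c / 2 < \<bar>u1 x - a\<bar>} x * (lam x)^4"])
      show "integrable cyl (\<lambda>x. indicator {x. c / 2 < \<bar>u1 x - a\<bar>} x * (lam x)^4)"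
        using K superlevel_finite[of "c / 2"] by (intro lam4) auto
      show "AE x in cyl. (\<lambda>n. indicator {x. K n < \<bar>u1 x - a\<bar> \<and> p x \<noteq> 0} x * (lam x)^4) \<longlonglongrightarrow> 0"
        using lim by eventually_elim (rule tendsto_eventually, auto elim!: eventually_mono simp: indicator_def)
      fix n
      have "norm (indicator {x. K n < \<bar>u1 x - a\<bar> \<and> p x \<noteq> 0} x * (lam x)^4) \<le> indicator {x. c / 2 < \<bar>u1 x - a\<bar>} x * (lam x)^4" for x
      proof (cases "K n < \<bar>u1 x - a\<bar>")
        case True
        then have "c / 2 < \<bar>u1 x - a\<bar>" using K(1)[of n] K(2) by linarith
        then show ?thesis by (auto simp: indicator_def)
      qed (auto simp: indicator_def)
      then show "AE x in cyl. norm (indicator {x. K n < \<bar>u1 x - a\<bar> \<and> p x \<noteq> 0} x * (lam x)^4) \<le> indicator {x. c / 2 < \<bar>u1 x - a\<bar>} x * (lam x)^4" by simp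
    qed auto
    then have "\<forall>\<^sub>F n in sequentially. (\<integral>x. indicator {x. K n < \<bar>u1 x - a\<bar> \<and> p x \<noteq> 0} x * (lam x)^4 \<partial>cyl) < 1 / 16"
      by (intro order_tendstoD) auto
    then obtain n where "(\<integral>x. indicator {x. K n < \<bar>u1 x - a\<bar> \<and> p x \<noteq> 0} x * (lam x)^4 \<partial>cyl) < 1 / 16"
      using eventually_happens'[OF sequentially_bot] by blast
    moreover have "K n > 0" using K(1)[of n] K(2) by linarith
    ultimately show ?thesis using small_superlevel by blast
  qed
  define Q where "Q = {k. 0 < k \<and> (AE x in cyl. \<bar>u1 x - a\<bar> \<le> k)}"
  \<comment> \<open>At this point \<open>u1\<close> is not known to be bounded; levels tending to
    infinity give a first bound.\<close>
  have "\<exists>n. AE x in cyl. \<bar>u1 x - a\<bar> \<le> real n + 1"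
  proof (rule sm[of 1])
    show "AE x in cyl. \<forall>\<^sub>F n in sequentially. \<not> (real n + 1 < \<bar>u1 x - a\<bar> \<and> p x \<noteq> 0)"
    proof (rule AE_I2)
      fix x
      obtain N :: nat where "\<bar>u1 x - a\<bar> \<le> real N" using real_arch_simple by blast
      then show "\<forall>\<^sub>F n in sequentially. \<not> (real n + 1 < \<bar>u1 x - a\<bar> \<and> p x \<noteq> 0)"
        by (intro eventually_sequentiallyI[of N]) auto
    qed
  qed auto
  then obtain n0 :: nat where "AE x in cyl. \<bar>u1 x - a\<bar> \<le> real n0 + 1" by blast
  then have Qne: "Q \<noteq> {}" unfolding Q_def by (auto intro!: exI[of _ "real n0 + 1"])
  have Qbdd: "bdd_below Q" unfolding Q_def by (auto intro!: bdd_belowI[of _ 0])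
  define S where "S = Inf Q"
  have S0: "S \<ge> 0" unfolding S_def by (rule cInf_greatest[OF Qne]) (auto simp: Q_def)
  have AES: "AE x in cyl. \<bar>u1 x - a\<bar> \<le> S"
  proof -
    have "AE x in cyl. \<bar>u1 x - a\<bar> \<le> S + 1 / real (Suc n)" for n
    proof -
      obtain k where k: "k \<in> Q" "k < S + 1 / real (Suc n)" using cInf_lessD[OF Qne, of "S + 1 / real (Suc n)"] by (auto simp: S_def)
      then have "AE x in cyl. \<bar>u1 x - a\<bar> \<le> k" by (simp add: Q_def)
      then show ?thesis by eventually_elim (use k in auto)
    qed
    then have "AE x in cyl. \<forall>n. \<bar>u1 x - a\<bar> \<le> S + 1 / real (Suc n)" by (simp add: AE_all_countable)
    then show ?thesis
    proof eventually_elim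
      case (elim x)
      show ?case
      proof (rule field_le_epsilon)
        fix e :: real assume "e > 0"
        then obtain n where "1 / real (Suc n) < e" using nat_approx_posE by blast
        then show "\<bar>u1 x - a\<bar> \<le> S + e" using elim[rule_format, of n] by linarith
      qed
    qed
  qed
  have "S = 0"
  proof (rule ccontr)
    assume "S \<noteq> 0"
    then have S: "S > 0" using S0 by simp
    \<comment> \<open>The offset \<open>2\<close> keeps every level at least \<open>S / 2\<close>,
      hence away from zero.\<close>
    define K where "K n = S - S / real (n + 2)" for n
    have Kl: "K n < S" "K n \<ge> S / 2" for n using S by (auto simp: K_def field_simps)
    have Klim: "K \<longlonglongrightarrow> S"
    proof -
      have "(\<lambda>n. S / real (n + 2)) \<longlonglongrightarrow> 0"
        using LIMSEQ_ignore_initial_segment[OF lim_const_over_n[of S], of 2] by simp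
      then have "(\<lambda>n. S - S / real (n + 2)) \<longlonglongrightarrow> S - 0" by (intro tendsto_intros)
      then show ?thesis by (simp add: K_def[abs_def])
    qed
    have "\<exists>n. AE x in cyl. \<bar>u1 x - a\<bar> \<le> K n"
    proof (rule sm[of "S / 2"])
      show "AE x in cyl. \<forall>\<^sub>F n in sequentially. \<not> (K n < \<bar>u1 x - a\<bar> \<and> p x \<noteq> 0)"
        using AES plateau[OF S]
      proof eventually_elim
        case (elim x)
        show ?case
        proof (cases "\<bar>u1 x - a\<bar> = S")
          case False
          then have "\<bar>u1 x - a\<bar> < S" using elim by simp
          from order_tendstoD(1)[OF Klim this] show ?thesis by eventually_elim auto
        qed (use elim in auto)
      qed
    qed (use Kl S in auto)
    then obtain n where "AE x in cyl. \<bar>u1 x - a\<bar> \<le> K n" by blast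
    then have "K n \<in> Q" using Kl(2)[of n] S by (auto simp: Q_def)
    then have "S \<le> K n" unfolding S_def using Qbdd by (rule cInf_lower)
    then show False using Kl(1)[of n] by simp
  qed
  then show ?thesis using AES by auto
qed

end

end

section \<open>Heteroclinic connections on the line\<close>

lemma ac_if_C1:
  assumes d: "\<And>x. (G has_real_derivative g x) (at x)" and c: "continuous_on UNIV g"
  shows "ac G g"
  unfolding ac_def
proof (intro allI impI conjI)
  fix s t :: real assume st: "s \<le> t"
  have c': "continuous_on {s..t} g" using c by (rule continuous_on_subset) auto
  show "set_integrable lborel {s..t} g" using c' by (rule borel_integrable_atLeastAtMost')
  have "(\<integral>x. indicator {s..t} x *\<^sub>R g x \<partial>lborel) = G t - G s"
  proof (rule integral_FTC_atLeastAtMost[OF st _ c'])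
    show "(G has_vector_derivative g x) (at x within {s..t})" for x
      using d[of x] by (simp add: has_real_derivative_iff_has_vector_derivative[symmetric] has_field_derivative_at_within)
  qed
  then show "G t - G s = (LINT x:{s..t}|lborel. g x)" by (simp add: set_lebesgue_integral_def)
qed

text \<open>Upgrades an equation that holds almost everywhere to a classical one: its right-hand
  side is a continuous version of the derivative.\<close>

lemma ac_continuous_imp_C1:
  assumes a: "ac G g" and c: "continuous_on UNIV g"
  shows "(G has_real_derivative g x) (at x)"
proof -
  obtain H where H: "\<And>x. (H has_real_derivative g x) (at x)" using antiderivative_exists[OF c] by blast
  note aH = ac_if_C1[OF H c]
  define k where "k = G 0 - H 0"
  have "G x = H x + k" for x
    unfolding k_def using acD(2)[OF a, of 0 x] acD(2)[OF a, of x 0] acD(2)[OF aH, of 0 x] acD(2)[OF aH, of x 0] by (cases "0 \<le> x") auto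
  then have "G = (\<lambda>x. H x + k)" by (rule ext)
  then show ?thesis using H[of x] by (auto intro!: derivative_eq_intros)
qed

text \<open>Gronwall for the squared difference, forwards and backwards. The common bound
  \<open>B\<close> is there because \<open>F\<close> is Lipschitz only on bounded sets.\<close>

lemma ode_unique:
  fixes F F' y z :: "real \<Rightarrow> real"
  assumes F: "\<And>s. (F has_real_derivative F' s) (at s)" and Fc: "continuous_on UNIV F'"
    and y: "\<And>t. (y has_real_derivative F (y t)) (at t)" and z: "\<And>t. (z has_real_derivative F (z t)) (at t)"
    and b: "\<And>t. \<bar>y t\<bar> \<le> B" "\<And>t. \<bar>z t\<bar> \<le> B" and e: "y t0 = z t0"
  shows "y t = z t"
proof -
  have "compact (F' ` {-B..B})" using Fc by (intro compact_continuous_image) (auto intro: continuous_on_subset)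
  then obtain L where L: "\<And>s. s \<in> {-B..B} \<Longrightarrow> \<bar>F' s\<bar> \<le> L" by (force dest!: compact_imp_bounded simp: bounded_iff)
  have Lip: "\<bar>F s - F s'\<bar> \<le> L * \<bar>s - s'\<bar>" if "s \<in> {-B..B}" "s' \<in> {-B..B}" for s s'
    using field_differentiable_bound[of "{-B..B}" F F' L s s'] that L F by (auto simp: has_field_derivative_at_within)
  define d where "d t = (y t - z t)\<^sup>2" for t
  have dd: "(d has_real_derivative 2 * (y t - z t) * (F (y t) - F (z t))) (at t)" for t
    unfolding d_def by (rule derivative_eq_intros y z refl | simp)+
  have bd: "\<bar>2 * (y t - z t) * (F (y t) - F (z t))\<bar> \<le> 2 * L * d t" for t
  proof -
    have "\<bar>F (y t) - F (z t)\<bar> \<le> L * \<bar>y t - z t\<bar>" using b by (intro Lip) (auto simp: abs_le_iff minus_le_iff)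
    then have "2 * \<bar>y t - z t\<bar> * \<bar>F (y t) - F (z t)\<bar> \<le> 2 * \<bar>y t - z t\<bar> * (L * \<bar>y t - z t\<bar>)" by (intro mult_left_mono) auto
    also have "\<dots> = 2 * L * (\<bar>y t - z t\<bar> * \<bar>y t - z t\<bar>)" by simp
    also have "\<dots> = 2 * L * d t" by (simp add: d_def power2_eq_square)
    finally show ?thesis unfolding abs_mult by simp
  qed
  have d0: "d t0 = 0" "\<And>t. d t \<ge> 0" using e by (auto simp: d_def)
  have "d t \<le> 0"
  proof (cases "t0 \<le> t")
    case True
    have "d t * exp (- 2 * L * t) \<le> d t0 * exp (- 2 * L * t0)"
    proof (rule DERIV_nonpos_imp_nonincreasing[OF True, of "\<lambda>t. d t * exp (- 2 * L * t)"])
      fix x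
      have "((\<lambda>t. d t * exp (- 2 * L * t)) has_real_derivative (2 * (y x - z x) * (F (y x) - F (z x)) - 2 * L * d x) * exp (- 2 * L * x)) (at x)"
        by (rule derivative_eq_intros dd refl | simp add: algebra_simps)+
      moreover have "(2 * (y x - z x) * (F (y x) - F (z x)) - 2 * L * d x) * exp (- 2 * L * x) \<le> 0"
        using bd[of x] by (intro mult_nonpos_nonneg) auto
      ultimately show "\<exists>v. ((\<lambda>t. d t * exp (- 2 * L * t)) has_real_derivative v) (at x) \<and> v \<le> 0" by blast
    qed
    then show ?thesis using d0(1) by (simp add: mult_le_0_iff not_le)
  next
    case False
    have "d t * exp (2 * L * t) \<le> d t0 * exp (2 * L * t0)"
    proof (rule DERIV_nonneg_imp_nondecreasing[of t t0 "\<lambda>t. d t * exp (2 * L * t)"])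
      fix x
      have "((\<lambda>t. d t * exp (2 * L * t)) has_real_derivative (2 * (y x - z x) * (F (y x) - F (z x)) + 2 * L * d x) * exp (2 * L * x)) (at x)"
        by (rule derivative_eq_intros dd refl | simp add: algebra_simps)+
      moreover have "(2 * (y x - z x) * (F (y x) - F (z x)) + 2 * L * d x) * exp (2 * L * x) \<ge> 0"
        using bd[of x] by (intro mult_nonneg_nonneg) auto
      ultimately show "\<exists>v. ((\<lambda>t. d t * exp (2 * L * t)) has_real_derivative v) (at x) \<and> 0 \<le> v" by blast
    qed (use False in auto)
    then show ?thesis using d0(1) by (simp add: mult_le_0_iff not_le)
  qed
  then have "d t = 0" using d0(2)[of t] by simp
  then show ?thesis by (simp add: d_def)
qed

text \<open>In the logistic variable the equation becomes \<open>Y' = Q(Y)\<close> with \<open>0 < Q \<le> C\<close>: the time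
  \<open>\<integral> dy / Q(y)\<close> is a diffeomorphism of the line.\<close>

lemma heteroclinic_increasing:
  fixes F F' :: "real \<Rightarrow> real"
  assumes F: "\<And>s. (F has_real_derivative F' s) (at s)" and Fc: "continuous_on UNIV F'"
    and lr: "l < r" "F l = 0" "F r = 0" and pos: "\<And>s. l < s \<Longrightarrow> s < r \<Longrightarrow> F s > 0"
  shows "\<exists>g. (\<forall>t. (g has_real_derivative F (g t)) (at t)) \<and> (g \<longlongrightarrow> r) at_top \<and> (g \<longlongrightarrow> l) at_bot"
proof -
  have "compact (F' ` {l..r})" using Fc by (intro compact_continuous_image) (auto intro: continuous_on_subset)
  then obtain L0 where L0: "\<And>s. s \<in> {l..r} \<Longrightarrow> \<bar>F' s\<bar> \<le> L0" by (force dest!: compact_imp_bounded simp: bounded_iff)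
  define L where "L = max L0 1"
  have L: "\<And>s. s \<in> {l..r} \<Longrightarrow> \<bar>F' s\<bar> \<le> L" "L > 0" using L0 by (auto simp: L_def le_max_iff_disj)
  have Lip: "\<bar>F s - F s'\<bar> \<le> L * \<bar>s - s'\<bar>" if "s \<in> {l..r}" "s' \<in> {l..r}" for s s'
    using field_differentiable_bound[of "{l..r}" F F' L s s'] that L F by (auto simp: has_field_derivative_at_within)
  \<comment> \<open>The logistic map from the line onto the open interval between \<open>l\<close>
    and \<open>r\<close>; its derivative is the quadratic \<open>\<sigma>'\<close> of its own
    value.\<close>
  define \<sigma> where "\<sigma> y = l + (r - l) / (1 + exp (- y))" for y
  have e1: "1 + exp (- y) \<noteq> 0" "1 + exp (- y) > 0" for y :: real by (smt (verit) exp_gt_zero)+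
  have \<sigma>r: "r - \<sigma> y = (r - l) * exp (- y) / (1 + exp (- y))" for y using e1[of y] by (simp add: \<sigma>_def field_simps)
  have \<sigma>in: "l < \<sigma> y" "\<sigma> y < r" for y
  proof -
    show "l < \<sigma> y" using lr e1[of y] by (simp add: \<sigma>_def)
    have "0 < r - \<sigma> y" unfolding \<sigma>r using lr e1[of y] by simp
    then show "\<sigma> y < r" by simp
  qed
  define \<sigma>' where "\<sigma>' y = (\<sigma> y - l) * (r - \<sigma> y) / (r - l)" for y
  have \<sigma>'p: "\<sigma>' y > 0" for y using \<sigma>in[of y] lr by (simp add: \<sigma>'_def)
  have \<sigma>d: "(\<sigma> has_real_derivative \<sigma>' y) (at y)" for y
  proof -
    have "(\<sigma> has_real_derivative (r - l) * exp (- y) / (1 + exp (- y))\<^sup>2) (at y)"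
      unfolding \<sigma>_def by (rule derivative_eq_intros refl e1 | simp add: power2_eq_square)+
    moreover have "\<sigma>' y = (r - l) * exp (- y) / (1 + exp (- y))\<^sup>2"
      unfolding \<sigma>'_def \<sigma>r using lr by (simp add: \<sigma>_def power2_eq_square)
    ultimately show ?thesis by simp
  qed
  have \<sigma>c: "continuous_on UNIV \<sigma>" using \<sigma>d by (meson DERIV_isCont continuous_at_imp_continuous_on)
  have Fcc: "continuous_on UNIV F" using F by (meson DERIV_isCont continuous_at_imp_continuous_on)
  define Q where "Q y = F (\<sigma> y) / \<sigma>' y" for y
  have Qp: "Q y > 0" for y using pos[OF \<sigma>in] \<sigma>'p by (simp add: Q_def)
  \<comment> \<open>\<open>F\<close> vanishes at both ends, so it is at most \<open>L\<close> times
    the distance to either of them, just as \<open>\<sigma>'\<close> is comparable to the smaller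
    distance. This bound rules out arrival in finite time.\<close>
  have Qb: "Q y \<le> 2 * L" for y
  proof -
    have f: "F (\<sigma> y) \<le> L * (\<sigma> y - l)" "F (\<sigma> y) \<le> L * (r - \<sigma> y)"
      using Lip[of "\<sigma> y" l] Lip[of "\<sigma> y" r] \<sigma>in[of y] lr by auto
    have "F (\<sigma> y) * (r - l) = F (\<sigma> y) * (r - \<sigma> y) + F (\<sigma> y) * (\<sigma> y - l)" by (simp add: algebra_simps)
    also have "\<dots> \<le> L * (\<sigma> y - l) * (r - \<sigma> y) + L * (r - \<sigma> y) * (\<sigma> y - l)"
      using f \<sigma>in[of y] by (intro add_mono mult_right_mono) auto
    finally have "F (\<sigma> y) * (r - l) \<le> 2 * L * ((\<sigma> y - l) * (r - \<sigma> y))" by (simp add: algebra_simps)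
    then have "F (\<sigma> y) \<le> 2 * L * \<sigma>' y" unfolding \<sigma>'_def using lr by (simp add: field_simps)
    then show ?thesis unfolding Q_def using \<sigma>'p[of y] by (simp add: field_simps)
  qed
  have Qc: "continuous_on UNIV Q" unfolding Q_def \<sigma>'_def
    using lr \<sigma>in by (intro continuous_intros continuous_on_compose2[OF Fcc] \<sigma>c) (auto simp: less_imp_neq)
  have "continuous_on UNIV (\<lambda>y. 1 / Q y)" using Qp by (intro continuous_intros Qc) (auto simp: less_imp_neq[symmetric])
  then obtain T where T: "\<And>y. (T has_real_derivative 1 / Q y) (at y)" using antiderivative_exists by blast
  have Tc: "isCont T y" for y using T by (rule DERIV_isCont)
  \<comment> \<open>The time grows at least linearly, hence it is a bijection of the line.\<close>
  have Tinc: "T x + (y - x) / (2 * L) \<le> T y" if "x \<le> y" for x y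
  proof -
    have "(\<lambda>y. T y - y / (2 * L)) x \<le> (\<lambda>y. T y - y / (2 * L)) y"
    proof (rule DERIV_nonneg_imp_nondecreasing[OF that])
      fix x
      have "((\<lambda>y. T y - y / (2 * L)) has_real_derivative 1 / Q x - 1 / (2 * L)) (at x)"
        by (rule DERIV_diff[OF T DERIV_cdivide[OF DERIV_ident]])
      moreover have "1 / Q x - 1 / (2 * L) \<ge> 0" using Qb[of x] Qp[of x] L by (simp add: frac_le)
      ultimately show "\<exists>v. ((\<lambda>y. T y - y / (2 * L)) has_real_derivative v) (at x) \<and> 0 \<le> v" by blast
    qed
    then show ?thesis by (simp add: diff_divide_distrib)
  qed
  have Tstrict: "T x < T y" if "x < y" for x y
    using Tinc[of x y] that L by (smt (verit) divide_pos_pos)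
  have surj: "\<exists>y. T y = t" for t
  proof -
    define M where "M = \<bar>t - T 0\<bar> * (2 * L)"
    have M0: "M \<ge> 0" using L by (simp add: M_def)
    have "t \<le> T M" using Tinc[of 0 M] M0 L by (simp add: M_def)
    moreover have "T (- M) \<le> t" using Tinc[of "- M" 0] M0 L by (simp add: M_def)
    ultimately show ?thesis using IVT[of T "- M" t M] Tc M0 by auto
  qed
  define Y where "Y t = (SOME y. T y = t)" for t
  have TY: "T (Y t) = t" for t unfolding Y_def using someI_ex[OF surj] .
  have YT: "Y (T y) = y" for y using TY[of "T y"] Tstrict by (metis linorder_neq_iff)
  have Ymono: "Y s < Y t" if "s < t" for s t using Tstrict TY that by (metis linorder_neq_iff not_less_iff_gr_or_eq)
  have Yc: "isCont Y t" for t
  proof -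
    have "isCont Y (T (Y t))"
      by (rule isCont_inverse_function[where d=1]) (use YT Tc in auto)
    then show ?thesis by (simp add: TY)
  qed
  have Yd: "(Y has_real_derivative Q (Y t)) (at t)" for t
  proof -
    have "(Y has_real_derivative inverse (1 / Q (Y t))) (at t)"
      by (rule DERIV_inverse_function[where f=T and a="t - 1" and b="t + 1"]) (use T TY Yc Qp[of "Y t"] in auto)
    then show ?thesis by simp
  qed
  define g where "g t = \<sigma> (Y t)" for t
  have "(g has_real_derivative F (g t)) (at t)" for t
  proof -
    have "(g has_real_derivative \<sigma>' (Y t) * Q (Y t)) (at t)" unfolding g_def by (rule DERIV_chain2[OF \<sigma>d Yd])
    moreover have "\<sigma>' (Y t) * Q (Y t) = F (g t)" using \<sigma>'p[of "Y t"] by (simp add: Q_def g_def)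
    ultimately show ?thesis by simp
  qed
  moreover have Ytop: "filterlim Y at_top at_top"
    unfolding filterlim_at_top_dense
  proof
    fix Z
    show "eventually (\<lambda>t. Z < Y t) at_top"
      using eventually_gt_at_top[of "T Z"] by eventually_elim (use Ymono YT in metis)
  qed
  moreover have Ybot: "filterlim Y at_bot at_bot"
    unfolding filterlim_at_bot_dense
  proof
    fix Z
    show "eventually (\<lambda>t. Y t < Z) at_bot"
      using eventually_gt_at_bot[of "T Z"] by eventually_elim (use Ymono YT in metis)
  qed
  moreover have "(\<sigma> \<longlongrightarrow> r) at_top"
  proof -
    have "((\<lambda>y. l + (r - l) / (1 + exp (- y))) \<longlongrightarrow> l + (r - l) / (1 + 0)) at_top"
      by (intro tendsto_intros filterlim_compose[OF exp_at_bot filterlim_uminus_at_bot_at_top]) auto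
    then show ?thesis by (simp add: \<sigma>_def[abs_def])
  qed
  moreover have "(\<sigma> \<longlongrightarrow> l) at_bot"
  proof -
    have "filterlim (\<lambda>y::real. 1 + exp (- y)) at_top at_bot"
      by (intro filterlim_tendsto_add_at_top[OF tendsto_const] filterlim_compose[OF exp_at_top filterlim_uminus_at_top_at_bot])
    then have "((\<lambda>y. l + (r - l) / (1 + exp (- y))) \<longlongrightarrow> l + 0) at_bot"
      by (intro tendsto_intros real_tendsto_divide_at_top[OF tendsto_const])
    then show ?thesis by (simp add: \<sigma>_def[abs_def])
  qed
  ultimately show ?thesis unfolding g_def
    by (intro exI[of _ "\<lambda>t. \<sigma> (Y t)"]) (auto intro: filterlim_compose)
qed

text \<open>The factor \<open>up - um\<close> carries the orientation: for \<open>up < um\<close>,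
  the increasing solution for \<open>- F\<close> is run backwards in time.\<close>

lemma heteroclinic_exists:
  fixes F F' :: "real \<Rightarrow> real"
  assumes F: "\<And>s. (F has_real_derivative F' s) (at s)" and Fc: "continuous_on UNIV F'"
    and z: "F um = 0" "F up = 0" and pos: "\<And>s. s \<in> open_segment um up \<Longrightarrow> F s * (up - um) > 0"
  shows "\<exists>g. (\<forall>t. (g has_real_derivative F (g t)) (at t)) \<and> (g \<longlongrightarrow> up) at_top \<and> (g \<longlongrightarrow> um) at_bot"
proof -
  consider "um = up" | "um < up" | "up < um" by linarith
  then show ?thesis
  proof cases
    case 1
    then show ?thesis using z by (intro exI[of _ "\<lambda>_. up"]) auto
  next
    case 2
    then have "F s > 0" if "um < s" "s < up" for s
      using pos[of s] that by (simp add: open_segment_eq_real_ivl zero_less_mult_iff)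
    then show ?thesis using heteroclinic_increasing[OF F Fc 2 z] by blast
  next
    case 3
    then have "- F s > 0" if "up < s" "s < um" for s
      using pos[of s] that by (simp add: open_segment_eq_real_ivl zero_less_mult_iff)
    moreover have "((\<lambda>s. - F s) has_real_derivative - F' s) (at s)" for s using F by (rule DERIV_minus)
    moreover have "continuous_on UNIV (\<lambda>s. - F' s)" using Fc by (intro continuous_intros)
    ultimately obtain g where g: "\<And>t. (g has_real_derivative - F (g t)) (at t)" "(g \<longlongrightarrow> um) at_top" "(g \<longlongrightarrow> up) at_bot"
      using heteroclinic_increasing[of "\<lambda>s. - F s" "\<lambda>s. - F' s" up um] 3 z by auto
    have "((\<lambda>t. g (- t)) has_real_derivative F (g (- t))) (at t)" for t
      using DERIV_chain2[OF g(1)[of "- t"] DERIV_minus[OF DERIV_ident]] by simp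
    moreover have "((\<lambda>t. g (- t)) \<longlongrightarrow> up) at_top" by (rule filterlim_compose[OF g(3) filterlim_uminus_at_bot_at_top])
    moreover have "((\<lambda>t. g (- t)) \<longlongrightarrow> um) at_bot" by (rule filterlim_compose[OF g(2) filterlim_uminus_at_top_at_bot])
    ultimately show ?thesis by (intro exI[of _ "\<lambda>t. g (- t)"]) auto
  qed
qed

section \<open>Energy of curves and the one-dimensional competitor\<close>

lemma ac_compose:
  assumes a: "ac y d" and der: "\<And>t. (\<theta> has_real_derivative \<theta>' t) (at t)" and cont: "continuous_on UNIV \<theta>'"
  shows "ac (\<lambda>t. \<theta> (y t)) (\<lambda>t. \<theta>' (y t) * d t)"
proof -
  have der': "((\<lambda>z. \<theta> (fst z)) has_derivative (\<lambda>h. fst h * \<theta>' (fst z) + snd h * 0)) (at z)" for z :: "real \<times> real"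
    using has_derivative_compose[OF has_derivative_fst[OF has_derivative_ident] der[unfolded has_field_derivative_def], of z UNIV]
    by (simp add: mult.commute)
  show ?thesis
    using ac_chain[OF a a der'] continuous_on_compose2[OF cont continuous_on_fst[OF continuous_on_id], of UNIV] by simp
qed

lemma line_flux:
  fixes P F y d :: "real \<Rightarrow> real"
  assumes P: "\<And>s. (P has_real_derivative F s) (at s)" and F: "continuous_on UNIV F"
    and y: "ac y d" "(y \<longlongrightarrow> up) at_top" "(y \<longlongrightarrow> um) at_bot"
    and i: "integrable lborel (\<lambda>t. F (y t) * d t)"
  shows "(\<integral>t. F (y t) * d t \<partial>lborel) = P up - P um"
proof -
  have "(\<lambda>n. \<integral>x. indicator {-real n..real n} x *\<^sub>R (F (y x) * d x) \<partial>lborel) \<longlonglongrightarrow> (\<integral>t. F (y t) * d t \<partial>lborel)"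
  proof (rule integral_dominated_convergence[where w="\<lambda>x. norm (F (y x) * d x)"])
    show "AE x in lborel. (\<lambda>n. indicator {-real n..real n} x *\<^sub>R (F (y x) * d x)) \<longlonglongrightarrow> F (y x) * d x"
    proof (rule AE_I2, rule tendsto_eventually)
      fix x
      obtain N :: nat where "\<bar>x\<bar> \<le> real N" using real_arch_simple by blast
      then show "\<forall>\<^sub>F n in sequentially. indicator {-real n..real n} x *\<^sub>R (F (y x) * d x) = F (y x) * d x"
        by (intro eventually_sequentiallyI[of N]) (auto simp: indicator_def)
    qed
  qed (use i in \<open>auto simp: indicator_def intro: borel_measurable_integrable\<close>)
  moreover have "(\<integral>x. indicator {-real n..real n} x *\<^sub>R (F (y x) * d x) \<partial>lborel) = P (y (real n)) - P (y (- real n))" for n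
    using acD(2)[OF ac_compose[OF y(1) P F], of "- real n" "real n"] by (simp add: set_lebesgue_integral_def)
  moreover have "(\<lambda>n. P (y (real n)) - P (y (- real n))) \<longlonglongrightarrow> P up - P um"
  proof (intro tendsto_diff)
    show "(\<lambda>n. P (y (real n))) \<longlonglongrightarrow> P up"
      by (rule isCont_tendsto_compose[OF DERIV_isCont[OF P]], rule filterlim_compose[OF y(2) filterlim_real_sequentially])
    have "filterlim (\<lambda>n. - real n) at_bot sequentially"
      by (rule filterlim_compose[OF filterlim_uminus_at_bot_at_top filterlim_real_sequentially])
    then show "(\<lambda>n. P (y (- real n))) \<longlonglongrightarrow> P um"
      by (intro isCont_tendsto_compose[OF DERIV_isCont[OF P]], rule filterlim_compose[OF y(3)])
  qed
  ultimately show ?thesis using LIMSEQ_unique by fastforce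
qed

lemma H1_line_ac:
  assumes "H1_line a \<gamma> \<gamma>'"
  shows "ac (\<lambda>t. snd (\<gamma> t)) (\<lambda>t. snd (\<gamma>' t))"
  unfolding ac_def
proof (intro allI impI conjI)
  fix s t :: real assume st: "s \<le> t"
  have i: "integrable lborel (\<lambda>x. indicator {s..t} x *\<^sub>R \<gamma>' x)" and e: "\<gamma> t - \<gamma> s = (\<integral>x. indicator {s..t} x *\<^sub>R \<gamma>' x \<partial>lborel)"
    using assms st by (auto simp: H1_line_def set_integrable_def set_lebesgue_integral_def)
  show "set_integrable lborel {s..t} (\<lambda>t. snd (\<gamma>' t))"
    using integrable_bounded_linear[OF bounded_linear_snd i] by (simp add: set_integrable_def)
  have "snd (\<gamma> t) - snd (\<gamma> s) = snd (\<gamma> t - \<gamma> s)" by simp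
  also have "\<dots> = (\<integral>x. snd (indicator {s..t} x *\<^sub>R \<gamma>' x) \<partial>lborel)"
    unfolding e by (rule integral_bounded_linear[OF bounded_linear_snd i, symmetric])
  finally show "snd (\<gamma> t) - snd (\<gamma> s) = (LINT x:{s..t}|lborel. snd (\<gamma>' x))" by (simp add: set_lebesgue_integral_def)
qed

text \<open>Completing the square on the line:
  \<open>d^2 / 2 + F^2 / 2 = (d - F)^2 / 2 + F * d\<close> with \<open>F\<close> taken along the
  curve, and the last term integrates to the flux of \<open>P\<close>. In the case of equality the
  square vanishes almost everywhere.\<close>

lemma energy1_bound:
  fixes w W :: "real \<times> real \<Rightarrow> real"
  assumes W: "\<And>z. W z = (w z)\<^sup>2 / 2" and wc: "continuous_on UNIV w"
    and P: "\<And>s. (P has_real_derivative w (a, s)) (at s)"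
    and adm: "admissible1 a (a, um) (a, up) \<gamma> \<gamma>'"
  shows "ennreal (P up - P um) \<le> energy1 W \<gamma> \<gamma>'"
    "energy1 W \<gamma> \<gamma>' \<le> ennreal (P up - P um) \<Longrightarrow> 0 \<le> P up - P um \<Longrightarrow> AE t in lborel. snd (\<gamma>' t) = w (\<gamma> t)"
proof -
  have H: "H1_line a \<gamma> \<gamma>'" "(\<gamma> \<longlongrightarrow> (a, up)) at_top" "(\<gamma> \<longlongrightarrow> (a, um)) at_bot" using adm by (auto simp: admissible1_def)
  define y where "y t = snd (\<gamma> t)" for t
  define d where "d t = snd (\<gamma>' t)" for t
  have \<gamma>e: "\<gamma> t = (a, y t)" for t using H(1) by (simp add: H1_line_def y_def prod_eq_iff)
  have ay: "ac y d" using H1_line_ac[OF H(1)] by (simp add: y_def[abs_def] d_def[abs_def])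
  have ylim: "(y \<longlongrightarrow> up) at_top" "(y \<longlongrightarrow> um) at_bot" using tendsto_snd[OF H(2)] tendsto_snd[OF H(3)] by (simp_all add: y_def[abs_def])
  have [measurable]: "\<gamma>' \<in> borel_measurable borel" using H(1) by (simp add: H1_line_def)
  have [measurable]: "d \<in> borel_measurable borel" unfolding d_def by measurable
  have [measurable]: "y \<in> borel_measurable borel" using ac_borel_measurable[OF ay] .
  have [measurable]: "w \<in> borel_measurable borel" using wc by (rule borel_measurable_continuous_onI)
  define F where "F s = w (a, s)" for s
  have Fc: "continuous_on UNIV F" unfolding F_def by (intro continuous_on_compose2[OF wc]) (auto intro: continuous_intros)
  have [measurable]: "F \<in> borel_measurable borel" using Fc by (rule borel_measurable_continuous_onI)
  have PF: "(P has_real_derivative F s) (at s)" for s using P by (simp add: F_def)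
  have le: "(d t)\<^sup>2 / 2 + (F (y t))\<^sup>2 / 2 \<le> (norm (\<gamma>' t))\<^sup>2 / 2 + W (\<gamma> t)" for t
  proof -
    have "\<bar>d t\<bar> \<le> norm (\<gamma>' t)" using norm_snd_le[of "snd (\<gamma>' t)" "fst (\<gamma>' t)"] by (simp add: d_def)
    then have "(d t)\<^sup>2 \<le> (norm (\<gamma>' t))\<^sup>2" by (simp add: abs_le_square_iff[symmetric])
    then show ?thesis by (simp add: W \<gamma>e F_def)
  qed
  then have E: "(\<integral>\<^sup>+t. ennreal ((d t)\<^sup>2 / 2 + (F (y t))\<^sup>2 / 2) \<partial>lborel) \<le> energy1 W \<gamma> \<gamma>'"
    unfolding energy1_def by (intro nn_integral_mono ennreal_leI)
  have main: "ennreal (P up - P um) \<le> (\<integral>\<^sup>+t. ennreal ((d t)\<^sup>2 / 2 + (F (y t))\<^sup>2 / 2) \<partial>lborel)"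
    "(\<integral>t. (d t - F (y t))\<^sup>2 \<partial>lborel) = 2 * (\<integral>t. (d t)\<^sup>2 / 2 + (F (y t))\<^sup>2 / 2 \<partial>lborel) - 2 * (P up - P um)"
    "integrable lborel (\<lambda>t. (d t - F (y t))\<^sup>2)"
    if fin: "(\<integral>\<^sup>+t. ennreal ((d t)\<^sup>2 / 2 + (F (y t))\<^sup>2 / 2) \<partial>lborel) < \<infinity>"
  proof -
    have i: "integrable lborel (\<lambda>t. (d t)\<^sup>2 / 2 + (F (y t))\<^sup>2 / 2)" using fin by (intro integrableI_bounded) auto
    have i1: "integrable lborel (\<lambda>t. (d t)\<^sup>2)" "integrable lborel (\<lambda>t. (F (y t))\<^sup>2)"
      by (rule Bochner_Integration.integrable_bound[OF integrable_mult_right[OF i, of 2]]; auto)+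
    have i2: "integrable lborel (\<lambda>t. F (y t) * d t)" using i1 by (intro L2_mult_integrable) auto
    have fl: "(\<integral>t. F (y t) * d t \<partial>lborel) = P up - P um" by (rule line_flux[OF PF Fc ay ylim i2])
    have sq: "(d t - F (y t))\<^sup>2 = 2 * ((d t)\<^sup>2 / 2 + (F (y t))\<^sup>2 / 2) - 2 * (F (y t) * d t)" for t by (simp add: power2_eq_square algebra_simps)
    show si: "integrable lborel (\<lambda>t. (d t - F (y t))\<^sup>2)" unfolding sq
      by (rule Bochner_Integration.integrable_diff[OF integrable_mult_right[OF i] integrable_mult_right[OF i2]])
    show eq: "(\<integral>t. (d t - F (y t))\<^sup>2 \<partial>lborel) = 2 * (\<integral>t. (d t)\<^sup>2 / 2 + (F (y t))\<^sup>2 / 2 \<partial>lborel) - 2 * (P up - P um)"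
      unfolding sq fl[symmetric] Bochner_Integration.integral_diff[OF integrable_mult_right[OF i, of 2] integrable_mult_right[OF i2, of 2]]
        integral_mult_right_zero ..
    have "0 \<le> (\<integral>t. (d t - F (y t))\<^sup>2 \<partial>lborel)" by simp
    then have "P up - P um \<le> (\<integral>t. (d t)\<^sup>2 / 2 + (F (y t))\<^sup>2 / 2 \<partial>lborel)" using eq by simp
    then show "ennreal (P up - P um) \<le> (\<integral>\<^sup>+t. ennreal ((d t)\<^sup>2 / 2 + (F (y t))\<^sup>2 / 2) \<partial>lborel)"
      using i by (subst nn_integral_eq_integral) (auto intro: ennreal_leI)
  qed
  show "ennreal (P up - P um) \<le> energy1 W \<gamma> \<gamma>'"
  proof (cases "(\<integral>\<^sup>+t. ennreal ((d t)\<^sup>2 / 2 + (F (y t))\<^sup>2 / 2) \<partial>lborel) < \<infinity>")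
    case True
    then show ?thesis using main(1) E by (meson order_trans)
  next
    case False
    then have "energy1 W \<gamma> \<gamma>' = \<infinity>" using E by (simp add: top.extremum_unique less_top[symmetric])
    then show ?thesis by simp
  qed
  assume up: "energy1 W \<gamma> \<gamma>' \<le> ennreal (P up - P um)" and c0: "0 \<le> P up - P um"
  have leE: "(\<integral>\<^sup>+t. ennreal ((d t)\<^sup>2 / 2 + (F (y t))\<^sup>2 / 2) \<partial>lborel) \<le> ennreal (P up - P um)" using E up by (rule order_trans)
  then have fin: "(\<integral>\<^sup>+t. ennreal ((d t)\<^sup>2 / 2 + (F (y t))\<^sup>2 / 2) \<partial>lborel) < \<infinity>" by (rule le_less_trans) simp
  have "integrable lborel (\<lambda>t. (d t)\<^sup>2 / 2 + (F (y t))\<^sup>2 / 2)" using fin by (intro integrableI_bounded) auto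
  then have "(\<integral>t. (d t)\<^sup>2 / 2 + (F (y t))\<^sup>2 / 2 \<partial>lborel) \<le> P up - P um"
    using leE c0 by (subst (asm) nn_integral_eq_integral) auto
  then have "2 * (\<integral>t. (d t)\<^sup>2 / 2 + (F (y t))\<^sup>2 / 2 \<partial>lborel) \<le> 2 * (P up - P um)" by (rule mult_left_mono) simp
  then have "(\<integral>t. (d t - F (y t))\<^sup>2 \<partial>lborel) \<le> 0" unfolding main(2)[OF fin] by (simp only: diff_le_0_iff_le)
  then have "(\<integral>t. (d t - F (y t))\<^sup>2 \<partial>lborel) = 0" by (intro antisym) auto
  then have "AE t in lborel. (d t - F (y t))\<^sup>2 = 0" using main(3)[OF fin] by (subst (asm) integral_nonneg_eq_0_iff_AE) auto
  then show "AE t in lborel. snd (\<gamma>' t) = w (\<gamma> t)" by eventually_elim (simp add: d_def F_def \<gamma>e)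
qed

lemma L2_loc_continuous:
  assumes c: "continuous_on UNIV v"
  shows "L2_loc v"
  unfolding L2_loc_def
proof (intro conjI allI impI)
  show m: "v \<in> borel_measurable lborel" using borel_measurable_continuous_onI[OF c] by simp
  fix K :: "(real \<times> real) set" assume K: "compact K"
  have "compact (v ` K)" using K c by (intro compact_continuous_image) (auto intro: continuous_on_subset)
  then obtain B where B: "\<And>x. x \<in> K \<Longrightarrow> norm (v x) \<le> B" by (force dest!: compact_imp_bounded simp: bounded_iff)
  have "(\<integral>\<^sup>+x. indicator K x * ennreal ((norm (v x))\<^sup>2) \<partial>lborel) \<le> (\<integral>\<^sup>+x. ennreal (B\<^sup>2) * indicator K x \<partial>lborel)"
    using B by (intro nn_integral_mono) (auto simp: indicator_def intro!: ennreal_leI power_mono)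
  also have "\<dots> = ennreal (B\<^sup>2) * emeasure lborel K" using K by (intro nn_integral_cmult_indicator) (auto intro: borel_closed compact_imp_closed)
  also have "\<dots> < \<infinity>" using emeasure_compact_finite[OF K] by (simp add: ennreal_mult_less_top)
  finally show "(\<integral>\<^sup>+x. indicator K x * ennreal ((norm (v x))\<^sup>2) \<partial>lborel) < \<infinity>" .
qed

lemma test_fun_support:
  assumes t: "test_fun \<phi> \<phi>1 \<phi>2"
  obtains R where "R > 0" "\<And>x. x \<notin> cbox (-R, -R) (R, R) \<Longrightarrow> \<phi> x = 0 \<and> \<phi>1 x = 0 \<and> \<phi>2 x = 0"
proof -
  let ?S = "closure {x. \<phi> x \<noteq> 0}"
  have "bounded ?S" using t by (auto simp: test_fun_def compact_imp_bounded)
  then obtain R where R: "R > 0" "\<And>x. x \<in> ?S \<Longrightarrow> norm x \<le> R" by (auto simp: bounded_pos)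
  have "\<phi> x = 0 \<and> \<phi>1 x = 0 \<and> \<phi>2 x = 0" if x: "x \<notin> cbox (-R, -R) (R, R)" for x
  proof -
    have "x \<notin> ?S"
    proof
      assume "x \<in> ?S"
      then have "norm x \<le> R" by (rule R)
      then have "\<bar>fst x\<bar> \<le> R" "\<bar>snd x\<bar> \<le> R" using norm_fst_le[of "fst x" "snd x"] norm_snd_le[of "snd x" "fst x"] by auto
      then show False using x by (cases x) (auto simp: cbox_Pair_eq)
    qed
    then have xS: "x \<in> - ?S" by simp
    have z: "0 = \<phi> y" if "y \<in> - ?S" for y using that closure_subset[of "{x. \<phi> x \<noteq> 0}"] by auto
    have "(\<phi> has_derivative (\<lambda>h. fst h * \<phi>1 x + snd h * \<phi>2 x)) (at x)" using t unfolding test_fun_def by blast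
    moreover have "(\<phi> has_derivative (\<lambda>h. 0)) (at x)"
      by (rule has_derivative_transform_within_open[OF has_derivative_const _ xS z]) auto
    ultimately have "(\<lambda>h. fst h * \<phi>1 x + snd h * \<phi>2 x) = (\<lambda>h. 0)" by (rule has_derivative_unique)
    from fun_cong[OF this, of "(1, 0)"] fun_cong[OF this, of "(0, 1)"] show ?thesis
      using z[OF xS] by simp
  qed
  with R(1) show ?thesis by (rule that)
qed

text \<open>Integration by parts along lines. For a function of the first variable alone the other
  integral vanishes, since \<open>\<phi>2\<close> has integral zero on every vertical line.\<close>

lemma test_fun_line_parts:
  assumes t: "test_fun \<phi> \<phi>1 \<phi>2" and k: "\<And>x. (k has_real_derivative k' x) (at x)" and kc: "continuous_on UNIV k'"
  shows "integrable lborel (\<lambda>x. \<phi>1 x * k (fst x))" "integrable lborel (\<lambda>x. \<phi> x * k' (fst x))" "integrable lborel (\<lambda>x. \<phi>2 x * k (fst x))"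
    "(\<integral>x. \<phi>1 x * k (fst x) \<partial>lborel) = - (\<integral>x. \<phi> x * k' (fst x) \<partial>lborel)"
    "(\<integral>x. \<phi>2 x * k (fst x) \<partial>lborel) = 0"
proof -
  obtain R where R: "R > 0" "\<And>x. x \<notin> cbox (-R, -R) (R, R) \<Longrightarrow> \<phi> x = 0 \<and> \<phi>1 x = 0 \<and> \<phi>2 x = 0"
    using test_fun_support[OF t] by blast
  have T: "continuous_on UNIV \<phi>1" "continuous_on UNIV \<phi>2" "\<And>x. (\<phi> has_derivative (\<lambda>h. fst h * \<phi>1 x + snd h * \<phi>2 x)) (at x)"
    using t unfolding test_fun_def by blast+
  have \<phi>c: "continuous_on UNIV \<phi>" using has_derivative_pair_continuous[OF T(3)] .
  have kcc: "continuous_on UNIV k" using k by (meson DERIV_isCont continuous_at_imp_continuous_on)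
  have kf: "continuous_on UNIV (\<lambda>x::real\<times>real. k (fst x))" "continuous_on UNIV (\<lambda>x::real\<times>real. k' (fst x))"
    by (intro continuous_on_compose2[OF kcc] continuous_on_compose2[OF kc]; auto intro: continuous_intros)+
  have li: "set_integrable lborel (cbox (-R,-R) (R,R)) f" "f \<in> borel_measurable borel" if "continuous_on UNIV f" for f :: "real \<times> real \<Rightarrow> real"
    using borel_integrable_compact[OF compact_cbox continuous_on_subset[OF that subset_UNIV], of "(-R,-R)" "(R,R)"]
      borel_measurable_continuous_onI[OF that] by (auto simp: set_integrable_def)
  show i: "integrable lborel (\<lambda>x. \<phi>1 x * k (fst x))" "integrable lborel (\<lambda>x. \<phi> x * k' (fst x))" "integrable lborel (\<lambda>x. \<phi>2 x * k (fst x))"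
    using R(2) T \<phi>c by (auto intro!: integrable_mult_compact_support[where a="(-R,-R)" and b="(R,R)"] li kf)
  have d1: "((\<lambda>x. \<phi> (x, y)) has_real_derivative \<phi>1 (x, y)) (at x)" for x y
  proof -
    have "((\<lambda>x. \<phi> (x, y)) has_derivative (\<lambda>h. fst (h, 0::real) * \<phi>1 (x, y) + snd (h, 0::real) * \<phi>2 (x, y))) (at x)"
      by (rule has_derivative_compose[where g=\<phi>, OF _ T(3)]) (auto intro!: derivative_eq_intros)
    then show ?thesis unfolding has_field_derivative_def by (rule has_derivative_eq_rhs) auto
  qed
  have d2: "((\<lambda>y. \<phi> (x, y)) has_real_derivative \<phi>2 (x, y)) (at y)" for x y
  proof -
    have "((\<lambda>y. \<phi> (x, y)) has_derivative (\<lambda>h. fst (0::real, h) * \<phi>1 (x, y) + snd (0::real, h) * \<phi>2 (x, y))) (at y)"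
      by (rule has_derivative_compose[where g=\<phi>, OF _ T(3)]) (auto intro!: derivative_eq_intros)
    then show ?thesis unfolding has_field_derivative_def by (rule has_derivative_eq_rhs) auto
  qed
  have "(\<integral>x. \<phi>1 x * k (fst x) + \<phi> x * k' (fst x) \<partial>lborel) = (\<integral>y. \<integral>x. \<phi>1 (x, y) * k x + \<phi> (x, y) * k' x \<partial>lborel \<partial>lborel)"
    using lborel_pair_integral(3)[of "\<lambda>x. \<phi>1 x * k (fst x) + \<phi> x * k' (fst x)"] i by simp
  also have "\<dots> = (\<integral>y. 0 \<partial>(lborel :: real measure))"
  proof (rule Bochner_Integration.integral_cong[OF refl])
    fix y :: real
    have c1: "continuous_on UNIV (\<lambda>x. \<phi>1 (x, y))" by (rule continuous_on_compose2[OF T(1)]) (auto intro: continuous_intros)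
    have a: "ac (\<lambda>x. \<phi> (x, y) * k x) (\<lambda>x. k x * \<phi>1 (x, y) + \<phi> (x, y) * k' x)"
      by (rule ac_mult[OF ac_if_C1[OF d1 c1] ac_if_C1[OF k kc]])
    have out: "\<phi> (x, y) = 0 \<and> \<phi>1 (x, y) = 0" if "R < \<bar>x\<bar>" for x
    proof -
      have "(x, y) \<notin> cbox (-R, -R) (R, R)" using that by (auto simp: cbox_Pair_eq)
      then show ?thesis using R(2) by blast
    qed
    have "\<phi>1 (x, y) * k x + \<phi> (x, y) * k' x = indicator {-(R+1)..R+1} x *\<^sub>R (k x * \<phi>1 (x, y) + \<phi> (x, y) * k' x)" for x
      using out[of x] by (cases "R < \<bar>x\<bar>") (auto simp: indicator_def mult.commute)
    then have "(\<integral>x. \<phi>1 (x, y) * k x + \<phi> (x, y) * k' x \<partial>lborel) = (LINT x:{-(R+1)..R+1}|lborel. k x * \<phi>1 (x, y) + \<phi> (x, y) * k' x)"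
      by (simp add: set_lebesgue_integral_def)
    also have "\<dots> = 0" using acD(2)[OF a, of "-(R+1)" "R+1"] out[of "R+1"] out[of "-(R+1)"] R(1) by simp
    finally show "(\<integral>x. \<phi>1 (x, y) * k x + \<phi> (x, y) * k' x \<partial>lborel) = 0" .
  qed
  finally show "(\<integral>x. \<phi>1 x * k (fst x) \<partial>lborel) = - (\<integral>x. \<phi> x * k' (fst x) \<partial>lborel)" using i by simp
  have "(\<lambda>x. \<phi>2 x * k (fst x)) \<in> borel_measurable borel" using i(3) by (simp add: borel_measurable_integrable)
  from lborel_swap[OF this] have "(\<integral>x. \<phi>2 x * k (fst x) \<partial>lborel) = (\<integral>x. \<phi>2 (snd x, fst x) * k (snd x) \<partial>lborel)" by simp
  also have "\<dots> = (\<integral>x. \<integral>y. \<phi>2 (x, y) * k x \<partial>lborel \<partial>lborel)"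
  proof -
    have "integrable (lborel \<Otimes>\<^sub>M lborel) (\<lambda>x. \<phi>2 x * k (fst x))" using i(3) by (simp add: lborel_prod)
    from lborel_pair.integrable_product_swap[OF this]
    have "integrable lborel (\<lambda>x. \<phi>2 (snd x, fst x) * k (snd x))" by (simp add: lborel_prod case_prod_beta')
    from lborel_pair_integral(3)[OF this] show ?thesis by simp
  qed
  also have "\<dots> = (\<integral>x. 0 \<partial>(lborel :: real measure))"
  proof (rule Bochner_Integration.integral_cong[OF refl])
    fix x :: real
    have c2: "continuous_on UNIV (\<lambda>y. \<phi>2 (x, y))" by (rule continuous_on_compose2[OF T(2)]) (auto intro: continuous_intros)
    note a = ac_if_C1[OF d2 c2]
    have out: "\<phi> (x, y) = 0 \<and> \<phi>2 (x, y) = 0" if "R < \<bar>y\<bar>" for y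
    proof -
      have "(x, y) \<notin> cbox (-R, -R) (R, R)" using that by (auto simp: cbox_Pair_eq)
      then show ?thesis using R(2) by blast
    qed
    have "\<phi>2 (x, y) * k x = k x * (indicator {-(R+1)..R+1} y *\<^sub>R \<phi>2 (x, y))" for y
      using out[of y] by (cases "R < \<bar>y\<bar>") (auto simp: indicator_def)
    then have "(\<integral>y. \<phi>2 (x, y) * k x \<partial>lborel) = (\<integral>y. k x * (indicator {-(R+1)..R+1} y *\<^sub>R \<phi>2 (x, y)) \<partial>lborel)"
      by (simp only:)
    also have "\<dots> = k x * (LINT y:{-(R+1)..R+1}|lborel. \<phi>2 (x, y))"
      unfolding set_lebesgue_integral_def by (rule integral_mult_right_zero)
    also have "\<dots> = 0" using acD(2)[OF a, of "-(R+1)" "R+1"] out[of "R+1"] out[of "-(R+1)"] R(1) by simp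
    finally show "(\<integral>y. \<phi>2 (x, y) * k x \<partial>lborel) = 0" .
  qed
  finally show "(\<integral>x. \<phi>2 x * k (fst x) \<partial>lborel) = 0" by simp
qed

lemma integral_Pair:
  fixes f g :: "'a \<Rightarrow> real"
  assumes f: "integrable M f" and g: "integrable M g"
  shows "(\<integral>x. (f x, g x) \<partial>M) = (\<integral>x. f x \<partial>M, \<integral>x. g x \<partial>M)"
proof -
  have b1: "bounded_linear (\<lambda>x::real. (x, 0::real))" "bounded_linear (\<lambda>x::real. (0::real, x))"
    by (auto intro!: bounded_linear_Pair bounded_linear_ident bounded_linear_zero)
  have i: "integrable M (\<lambda>x. (f x, 0::real))" "integrable M (\<lambda>x. (0::real, g x))"
    using integrable_bounded_linear[OF b1(1) f] integrable_bounded_linear[OF b1(2) g] by auto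
  have "(\<integral>x. (f x, g x) \<partial>M) = (\<integral>x. (f x, 0) + (0, g x) \<partial>M)" by simp
  also have "\<dots> = (\<integral>x. (f x, 0) \<partial>M) + (\<integral>x. (0, g x) \<partial>M)" using i by (rule Bochner_Integration.integral_add)
  also have "\<dots> = (\<integral>x. f x \<partial>M, 0) + (0, \<integral>x. g x \<partial>M)"
    using integral_bounded_linear[OF b1(1) f] integral_bounded_linear[OF b1(2) g] by simp
  finally show ?thesis by simp
qed

text \<open>Along a solution of \<open>g' = w (a, g)\<close> the energy density is
  \<open>(w (a, g))^2\<close>, which is the derivative of \<open>P (g)\<close>. The energy is
  therefore bounded by the flux, the value that the calibration gives as a lower bound.\<close>

lemma one_dimensional_competitor:
  fixes w W :: "real \<times> real \<Rightarrow> real"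
  assumes W: "\<And>z. W z = (w z)\<^sup>2 / 2" and wc: "continuous_on UNIV w"
    and P: "\<And>s. (P has_real_derivative w (a, s)) (at s)"
    and g: "\<And>t. (g has_real_derivative w (a, g t)) (at t)" "(g \<longlongrightarrow> up) at_top" "(g \<longlongrightarrow> um) at_bot"
  shows "\<exists>v V1 V2. admissible2 (a, um) (a, up) v V1 V2 \<and> energy2 W v V1 V2 \<le> ennreal (P up - P um)"
proof -
  define F where "F s = w (a, s)" for s
  have Fc: "continuous_on UNIV F" unfolding F_def by (intro continuous_on_compose2[OF wc]) (auto intro: continuous_intros)
  have gc: "continuous_on UNIV g" using g(1) by (meson DERIV_isCont continuous_at_imp_continuous_on)
  have Fgc: "continuous_on UNIV (\<lambda>t. F (g t))" by (rule continuous_on_compose2[OF Fc gc]) auto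
  have gd: "(g has_real_derivative F (g t)) (at t)" for t using g(1) by (simp add: F_def)
  have PF: "(P has_real_derivative F s) (at s)" for s using P by (simp add: F_def)
  have [measurable]: "g \<in> borel_measurable borel" "F \<in> borel_measurable borel" "w \<in> borel_measurable borel"
    using gc Fc wc by (auto intro: borel_measurable_continuous_onI)
  \<comment> \<open>The density is not known to be integrable beforehand; Fatou over growing
    intervals, on each of which the fundamental theorem applies, settles this together with the
    bound.\<close>
  have flux: "(\<integral>\<^sup>+t. ennreal ((F (g t))\<^sup>2) \<partial>lborel) \<le> ennreal (P up - P um)"
  proof -
    have "(\<integral>\<^sup>+t. ennreal ((F (g t))\<^sup>2) \<partial>lborel) \<le> (\<integral>\<^sup>+t. liminf (\<lambda>n. ennreal (indicator {-real n..real n} t *\<^sub>R (F (g t) * F (g t)))) \<partial>lborel)"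
    proof (rule nn_integral_mono)
      fix t
      obtain N :: nat where "\<bar>t\<bar> \<le> real N" using real_arch_simple by blast
      then have "\<forall>\<^sub>F n in sequentially. ennreal (indicator {-real n..real n} t *\<^sub>R (F (g t) * F (g t))) = ennreal ((F (g t))\<^sup>2)"
        by (intro eventually_sequentiallyI[of N]) (auto simp: indicator_def power2_eq_square)
      then have "(\<lambda>n. ennreal (indicator {-real n..real n} t *\<^sub>R (F (g t) * F (g t)))) \<longlonglongrightarrow> ennreal ((F (g t))\<^sup>2)" by (rule tendsto_eventually)
      from lim_imp_Liminf[OF sequentially_bot this]
      show "ennreal ((F (g t))\<^sup>2) \<le> liminf (\<lambda>n. ennreal (indicator {-real n..real n} t *\<^sub>R (F (g t) * F (g t))))" by (rule eq_refl[OF sym])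
    qed
    also have "\<dots> \<le> liminf (\<lambda>n. \<integral>\<^sup>+t. ennreal (indicator {-real n..real n} t *\<^sub>R (F (g t) * F (g t))) \<partial>lborel)" by (rule nn_integral_liminf) simp
    also have "(\<lambda>n::nat. \<integral>\<^sup>+t. ennreal (indicator {-real n..real n} t *\<^sub>R (F (g t) * F (g t))) \<partial>lborel) = (\<lambda>n. ennreal (P (g (real n)) - P (g (- real n))))"
    proof
      fix n :: nat
      note a = ac_compose[OF ac_if_C1[OF gd Fgc] PF Fc]
      have "integrable lborel (\<lambda>t. indicator {-real n..real n} t *\<^sub>R (F (g t) * F (g t)))" using acD(1)[OF a, of "- real n" "real n"] by (simp add: set_integrable_def)
      then have "(\<integral>\<^sup>+t. ennreal (indicator {-real n..real n} t *\<^sub>R (F (g t) * F (g t))) \<partial>lborel) = ennreal (\<integral>t. indicator {-real n..real n} t *\<^sub>R (F (g t) * F (g t)) \<partial>lborel)"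
        by (intro nn_integral_eq_integral) (auto simp: indicator_def)
      then show "(\<integral>\<^sup>+t. ennreal (indicator {-real n..real n} t *\<^sub>R (F (g t) * F (g t))) \<partial>lborel) = ennreal (P (g (real n)) - P (g (- real n)))"
        using acD(2)[OF a, of "- real n" "real n"] by (simp add: set_lebesgue_integral_def)
    qed
    also have "liminf (\<lambda>n. ennreal (P (g (real n)) - P (g (- real n)))) = ennreal (P up - P um)"
    proof (rule lim_imp_Liminf)
      show "(\<lambda>n. ennreal (P (g (real n)) - P (g (- real n)))) \<longlonglongrightarrow> ennreal (P up - P um)"
      proof (intro tendsto_ennrealI tendsto_diff)
        show "(\<lambda>n. P (g (real n))) \<longlonglongrightarrow> P up"
          by (rule isCont_tendsto_compose[OF DERIV_isCont[OF P]], rule filterlim_compose[OF g(2) filterlim_real_sequentially])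
        have "filterlim (\<lambda>n. - real n) at_bot sequentially"
          by (rule filterlim_compose[OF filterlim_uminus_at_bot_at_top filterlim_real_sequentially])
        then show "(\<lambda>n. P (g (- real n))) \<longlonglongrightarrow> P um"
          by (intro isCont_tendsto_compose[OF DERIV_isCont[OF P]], rule filterlim_compose[OF g(3)])
      qed
    qed simp
    finally show ?thesis .
  qed
  define v where "v x = (a, g (fst x))" for x :: "real \<times> real"
  define V1 where "V1 x = (0::real, F (g (fst x)))" for x :: "real \<times> real"
  define V2 where "V2 x = (0::real, 0::real)" for x :: "real \<times> real"
  have cg: "continuous_on UNIV (\<lambda>x::real\<times>real. g (fst x))" "continuous_on UNIV (\<lambda>x::real\<times>real. F (g (fst x)))"
    by (intro continuous_on_compose2[OF gc] continuous_on_compose2[OF Fgc]; auto intro: continuous_intros)+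
  have vc: "continuous_on UNIV v" "continuous_on UNIV V1" "continuous_on UNIV V2"
    unfolding v_def V1_def V2_def using cg by (auto intro!: continuous_on_Pair)
  have strip: "(\<integral>\<^sup>+x. indicator strip x * ennreal ((F (g (fst x)))\<^sup>2) \<partial>lborel) = (\<integral>\<^sup>+t. ennreal ((F (g t))\<^sup>2) \<partial>lborel)"
  proof -
    have "(\<integral>\<^sup>+x. indicator strip x * ennreal ((F (g (fst x)))\<^sup>2) \<partial>lborel) = (\<integral>\<^sup>+x. ennreal ((F (g (fst x)))\<^sup>2) \<partial>cyl)"
      by (rule nn_integral_cyl[symmetric]) simp
    also have "\<dots> = (\<integral>\<^sup>+x. \<integral>\<^sup>+y. ennreal ((F (g x))\<^sup>2) \<partial>T1 \<partial>lborel)" by (subst nn_integral_cyl_fst) auto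
    finally show ?thesis by simp
  qed
  have "weak_partials v V1 V2" unfolding weak_partials_def
  proof (intro conjI allI impI L2_loc_continuous vc)
    fix \<phi> \<phi>1 \<phi>2 assume t: "test_fun \<phi> \<phi>1 \<phi>2"
    note G = test_fun_line_parts[OF t gd Fgc] and A = test_fun_line_parts[OF t DERIV_const[of a] continuous_on_const]
    have "(\<integral>x. \<phi>1 x *\<^sub>R v x \<partial>lborel) = (\<integral>x. \<phi>1 x * a \<partial>lborel, \<integral>x. \<phi>1 x * g (fst x) \<partial>lborel)"
      unfolding v_def scaleR_Pair real_scaleR_def by (rule integral_Pair[OF A(1) G(1)])
    moreover have "(\<integral>x. \<phi> x *\<^sub>R V1 x \<partial>lborel) = (\<integral>x. \<phi> x * 0 \<partial>lborel, \<integral>x. \<phi> x * F (g (fst x)) \<partial>lborel)"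
      unfolding V1_def scaleR_Pair real_scaleR_def by (rule integral_Pair[OF A(2) G(2)])
    ultimately show "(\<integral>x. \<phi>1 x *\<^sub>R v x \<partial>lborel) = - (\<integral>x. \<phi> x *\<^sub>R V1 x \<partial>lborel)" using A(4) G(4) by simp
    have "(\<integral>x. \<phi>2 x *\<^sub>R v x \<partial>lborel) = (\<integral>x. \<phi>2 x * a \<partial>lborel, \<integral>x. \<phi>2 x * g (fst x) \<partial>lborel)"
      unfolding v_def scaleR_Pair real_scaleR_def by (rule integral_Pair[OF A(3) G(3)])
    then show "(\<integral>x. \<phi>2 x *\<^sub>R v x \<partial>lborel) = - (\<integral>x. \<phi> x *\<^sub>R V2 x \<partial>lborel)"
      using A(5) G(5) by (auto simp: V2_def zero_prod_def)
  qed
  moreover have "(\<integral>\<^sup>+ x. indicator strip x * ennreal ((norm (V1 x))\<^sup>2 + (norm (V2 x))\<^sup>2) \<partial>lborel) < \<infinity>"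
    using le_less_trans[OF flux] by (simp add: V1_def V2_def norm_Pair strip)
  ultimately have "H1div v V1 V2" unfolding H1div_def using L2_loc_continuous[OF vc(1)] by (auto simp: v_def V1_def V2_def)
  moreover have "bc2 (a, um) (a, up) v" unfolding bc2_def
  proof (intro exI[of _ "\<lambda>t. (a, g t)"] conjI)
    show "continuous_on UNIV (\<lambda>t. (a, g t))" using gc by (intro continuous_on_Pair continuous_on_const)
    show "AE x1 in lborel. (a, g x1) = ubar v x1"
      by (auto simp: ubar_def v_def integral_Pair intro!: AE_I2)
    show "((\<lambda>t. (a, g t)) \<longlongrightarrow> (a, up)) at_top" "((\<lambda>t. (a, g t)) \<longlongrightarrow> (a, um)) at_bot" using g by (auto intro!: tendsto_intros)
  qed
  moreover have "energy2 W v V1 V2 \<le> ennreal (P up - P um)"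
  proof -
    have "(norm (V1 x))\<^sup>2 / 2 + (norm (V2 x))\<^sup>2 / 2 + W (v x) = (F (g (fst x)))\<^sup>2" for x
      by (simp add: V1_def V2_def norm_Pair W v_def F_def)
    then show ?thesis unfolding energy2_def using strip flux by simp
  qed
  ultimately show ?thesis unfolding admissible2_def by blast
qed

section \<open>Potentials and their growth\<close>

lemma partial_derivatives:
  fixes f f1 f2 :: "real \<times> real \<Rightarrow> real"
  assumes "\<And>z. (f has_derivative (\<lambda>h. fst h * f1 z + snd h * f2 z)) (at z)"
  shows "((\<lambda>x. f (x, y)) has_real_derivative f1 (x, y)) (at x)" "((\<lambda>y. f (x, y)) has_real_derivative f2 (x, y)) (at y)"
proof -
  have "((\<lambda>x. f (x, y)) has_derivative (\<lambda>h. fst (h, 0::real) * f1 (x, y) + snd (h, 0::real) * f2 (x, y))) (at x)"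
    by (rule has_derivative_compose[where g=f, OF _ assms]) (auto intro!: derivative_eq_intros)
  then show "((\<lambda>x. f (x, y)) has_real_derivative f1 (x, y)) (at x)" unfolding has_field_derivative_def by (rule has_derivative_eq_rhs) auto
  have "((\<lambda>y. f (x, y)) has_derivative (\<lambda>h. fst (0::real, h) * f1 (x, y) + snd (0::real, h) * f2 (x, y))) (at y)"
    by (rule has_derivative_compose[where g=f, OF _ assms]) (auto intro!: derivative_eq_intros)
  then show "((\<lambda>y. f (x, y)) has_real_derivative f2 (x, y)) (at y)" unfolding has_field_derivative_def by (rule has_derivative_eq_rhs) auto
qed

text \<open>The Poincare lemma in the plane, \<open>R\<close> being the common mixed derivative. The
  potential integrates \<open>Q\<close> along the vertical axis and then \<open>P\<close>
  horizontally.\<close>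

lemma potential_exists:
  fixes P Q R :: "real \<times> real \<Rightarrow> real"
  assumes c: "continuous_on UNIV P" "continuous_on UNIV Q" "continuous_on UNIV R"
    and P: "\<And>x y. ((\<lambda>y. P (x, y)) has_real_derivative R (x, y)) (at y)"
    and Q: "\<And>x y. ((\<lambda>x. Q (x, y)) has_real_derivative R (x, y)) (at x)"
  shows "\<exists>\<phi>. \<forall>z. (\<phi> has_derivative (\<lambda>h. fst h * P z + snd h * Q z)) (at z)"
proof -
  have "continuous_on UNIV (\<lambda>y. Q (0, y))" by (rule continuous_on_compose2[OF c(2)]) (auto intro: continuous_intros)
  then obtain G where G: "\<And>y. (G has_real_derivative Q (0, y)) (at y)" using antiderivative_exists by blast
  have "((\<lambda>z. seg_int 0 P z + G (snd z)) has_derivative (\<lambda>h. fst h * P z + snd h * Q z)) (at z)" for z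
  proof -
    have g: "((\<lambda>z. G (snd z)) has_derivative (\<lambda>h. Q (0, snd z) * snd h)) (at z)"
      using has_derivative_compose[OF has_derivative_snd[OF has_derivative_ident] G[unfolded has_field_derivative_def], of z UNIV] by simp
    have e: "seg_int 0 R z = Q z - Q (0, snd z)"
      using integral_unique[OF seg_int_FTC[of "\<lambda>x. Q (x, snd z)" "\<lambda>x. R (x, snd z)" "fst z" 0, OF Q]] by (simp add: seg_int_def)
    show ?thesis
      by (rule has_derivative_eq_rhs[OF has_derivative_add[OF seg_int_has_derivative[OF c(1,3) P, of 0 z] g]]) (auto simp: e algebra_simps)
  qed
  then show ?thesis by blast
qed

lemma norm_pair_square: "(norm (z :: real \<times> real))\<^sup>2 = (fst z)\<^sup>2 + (snd z)\<^sup>2"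
  by (cases z) (simp add: norm_Pair)

text \<open>\<open>A + w\<close> and \<open>A - w\<close> are constant along the two families of characteristics.\<close>

lemma wave_conjugate_growth:
  fixes w A w1 w2 :: "real \<times> real \<Rightarrow> real"
  assumes wd: "\<And>z. (w has_derivative (\<lambda>h. fst h * w1 z + snd h * w2 z)) (at z)"
    and Ad: "\<And>z. (A has_derivative (\<lambda>h. fst h * w2 z + snd h * w1 z)) (at z)"
    and b: "b > 0" and g: "\<And>z. \<bar>w z\<bar> \<le> K * exp (b * (norm z)\<^sup>2)"
  shows "\<exists>C\<ge>0. \<forall>z. \<bar>A z\<bar> \<le> C * exp (b * (norm z)\<^sup>2)"
proof -
  have K0: "K \<ge> 0" using g[of "(0,0)"] by (simp add: norm_Pair)
  have 1: "A (c + t, c - t) + w (c + t, c - t) = A (c, c) + w (c, c)" for c t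
  proof -
    have d: "((\<lambda>t. A (c + t, c - t) + w (c + t, c - t)) has_real_derivative 0) (at t)" for t
    proof -
      have l: "((\<lambda>t::real. (c + t, c - t)) has_derivative (\<lambda>h. (h, - h))) (at t)" by (auto intro!: derivative_eq_intros)
      have "((\<lambda>t. A (c + t, c - t) + w (c + t, c - t)) has_derivative
        (\<lambda>h. (fst (h, - h) * w2 (c + t, c - t) + snd (h, - h) * w1 (c + t, c - t)) + (fst (h, - h) * w1 (c + t, c - t) + snd (h, - h) * w2 (c + t, c - t)))) (at t)"
        by (intro has_derivative_add has_derivative_compose[OF l Ad] has_derivative_compose[OF l wd])
      then show ?thesis unfolding has_field_derivative_def by (rule has_derivative_eq_rhs) (auto simp: algebra_simps)
    qed
    show ?thesis using DERIV_isconst_all[of "\<lambda>t. A (c + t, c - t) + w (c + t, c - t)", OF allI[OF d], of t 0] by simp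
  qed
  have 2: "A (t, t) - w (t, t) = A (0, 0) - w (0, 0)" for t
  proof -
    have d: "((\<lambda>t. A (t, t) - w (t, t)) has_real_derivative 0) (at t)" for t
    proof -
      have l: "((\<lambda>t::real. (t, t)) has_derivative (\<lambda>h. (h, h))) (at t)" by (auto intro!: derivative_eq_intros)
      have "((\<lambda>t. A (t, t) - w (t, t)) has_derivative
        (\<lambda>h. (fst (h, h) * w2 (t, t) + snd (h, h) * w1 (t, t)) - (fst (h, h) * w1 (t, t) + snd (h, h) * w2 (t, t)))) (at t)"
        by (intro has_derivative_diff has_derivative_compose[OF l Ad] has_derivative_compose[OF l wd])
      then show ?thesis unfolding has_field_derivative_def by (rule has_derivative_eq_rhs) (auto simp: algebra_simps)
    qed
    show ?thesis using DERIV_isconst_all[of "\<lambda>t. A (t, t) - w (t, t)", OF allI[OF d], of t 0] by simp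
  qed
  define k where "k = \<bar>A (0, 0) - w (0, 0)\<bar>"
  have "\<bar>A z\<bar> \<le> (3 * K + k) * exp (b * (norm z)\<^sup>2)" for z
  proof -
    obtain x y where z: "z = (x, y)" by (cases z)
    \<comment> \<open>The characteristic of direction \<open>(1, -1)\<close> through
      \<open>z\<close> meets the diagonal at \<open>(c, c)\<close>. This is the orthogonal
      projection of \<open>z\<close>, so its norm is no larger and the exponent \<open>b\<close> is
      kept.\<close>
    define c where "c = (x + y) / 2"
    have e: "z = (c + (x - y) / 2, c - (x - y) / 2)" by (simp add: z c_def field_simps)
    have "A z = A (c, c) + w (c, c) - w z" using 1[of c "(x - y) / 2"] unfolding e[symmetric] by simp
    then have Az: "A z = 2 * w (c, c) - w z + (A (0, 0) - w (0, 0))" using 2[of c] by simp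
    have "(norm (c, c))\<^sup>2 \<le> (norm z)\<^sup>2"
    proof -
      have "x\<^sup>2 + y\<^sup>2 - 2 * c\<^sup>2 = (x - y)\<^sup>2 / 2" by (simp add: c_def power2_eq_square field_simps)
      then have "2 * c\<^sup>2 \<le> x\<^sup>2 + y\<^sup>2" using zero_le_power2[of "x - y"] by linarith
      then show ?thesis by (simp add: norm_pair_square z)
    qed
    then have "K * exp (b * (norm (c, c))\<^sup>2) \<le> K * exp (b * (norm z)\<^sup>2)" using b K0 by (intro mult_left_mono) auto
    then have "\<bar>w (c, c)\<bar> \<le> K * exp (b * (norm z)\<^sup>2)" using g[of "(c, c)"] by linarith
    moreover have "k \<le> k * exp (b * (norm z)\<^sup>2)" using b by (simp add: k_def mult_le_cancel_left1)
    ultimately have "\<bar>A z\<bar> \<le> 3 * (K * exp (b * (norm z)\<^sup>2)) + k * exp (b * (norm z)\<^sup>2)"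
      unfolding Az using g[of z] unfolding k_def by linarith
    then show ?thesis by (simp add: algebra_simps)
  qed
  moreover have "3 * K + k \<ge> 0" using K0 by (simp add: k_def)
  ultimately show ?thesis by blast
qed

text \<open>Cauchy's estimate applied to \<open>exp (\<tau> G)\<close>, \<open>G = w + iA\<close>, needs a bound on the real part of \<open>G\<close> only.\<close>

lemma harmonic_gradient_bound:
  fixes w A w1 w2 :: "real \<times> real \<Rightarrow> real"
  assumes wd: "\<And>z. (w has_derivative (\<lambda>h. fst h * w1 z + snd h * w2 z)) (at z)"
    and Ad: "\<And>z. (A has_derivative (\<lambda>h. fst h * (- w2 z) + snd h * w1 z)) (at z)"
    and M: "M > 0" "\<And>z'. dist z' z \<le> 1 \<Longrightarrow> \<bar>w z'\<bar> \<le> M"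
  shows "\<bar>w1 z\<bar> \<le> exp 2 * M" "\<bar>w2 z\<bar> \<le> exp 2 * M"
proof -
  define G where "G \<zeta> = complex_of_real (w (Re \<zeta>, Im \<zeta>)) + \<i> * complex_of_real (A (Re \<zeta>, Im \<zeta>))" for \<zeta>
  define D where "D \<zeta> = complex_of_real (w1 (Re \<zeta>, Im \<zeta>)) - \<i> * complex_of_real (w2 (Re \<zeta>, Im \<zeta>))" for \<zeta>
  have Gd: "(G has_field_derivative D \<zeta>) (at \<zeta>)" for \<zeta>
  proof -
    have l: "((\<lambda>\<zeta>. (Re \<zeta>, Im \<zeta>)) has_derivative (\<lambda>h. (Re h, Im h))) (at \<zeta>)" by (auto intro!: derivative_eq_intros)
    have a: "((\<lambda>\<zeta>. w (Re \<zeta>, Im \<zeta>)) has_derivative (\<lambda>h. Re h * w1 (Re \<zeta>, Im \<zeta>) + Im h * w2 (Re \<zeta>, Im \<zeta>))) (at \<zeta>)"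
      using has_derivative_compose[OF l wd] by simp
    have b: "((\<lambda>\<zeta>. A (Re \<zeta>, Im \<zeta>)) has_derivative (\<lambda>h. Re h * (- w2 (Re \<zeta>, Im \<zeta>)) + Im h * w1 (Re \<zeta>, Im \<zeta>))) (at \<zeta>)"
      using has_derivative_compose[OF l Ad] by simp
    have "(G has_derivative (\<lambda>h. complex_of_real (Re h * w1 (Re \<zeta>, Im \<zeta>) + Im h * w2 (Re \<zeta>, Im \<zeta>)) +
       \<i> * complex_of_real (Re h * (- w2 (Re \<zeta>, Im \<zeta>)) + Im h * w1 (Re \<zeta>, Im \<zeta>)))) (at \<zeta>)"
      unfolding G_def by (intro has_derivative_add has_derivative_mult_right has_derivative_of_real a b)
    then show ?thesis unfolding has_field_derivative_def
      by (rule has_derivative_eq_rhs) (auto simp: D_def complex_eq_iff algebra_simps)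
  qed
  define \<zeta> where "\<zeta> = Complex (fst z) (snd z)"
  \<comment> \<open>Dividing by \<open>M\<close> makes the real part of \<open>\<tau> * G\<close> at
    most \<open>1\<close> in modulus on the unit disc, so \<open>norm (E \<xi>)\<close> lies between
    \<open>exp (-1)\<close> and \<open>exp 1\<close>. The upper bound on the circle and the lower
    one at the centre produce the factor \<open>exp 2\<close>.\<close>
  define \<tau> where "\<tau> = complex_of_real (1 / M)"
  define E where "E \<xi> = exp (\<tau> * G \<xi>)" for \<xi>
  have Ed: "(E has_field_derivative \<tau> * D \<xi> * E \<xi>) (at \<xi>)" for \<xi>
    unfolding E_def by (rule derivative_eq_intros Gd refl | simp)+
  have Eh: "E holomorphic_on S" for S using Ed by (meson field_differentiable_def field_differentiable_at_within holomorphic_on_def)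
  have nE: "norm (E \<xi>) = exp (w (Re \<xi>, Im \<xi>) / M)" for \<xi>
    by (simp add: E_def \<tau>_def G_def norm_exp_eq_Re field_simps)
  have "norm ((deriv ^^ 1) E \<zeta>) \<le> fact 1 * exp 1 / 1 ^ 1"
  proof (rule Cauchy_inequality)
    show "E holomorphic_on ball \<zeta> 1" "continuous_on (cball \<zeta> 1) E" using Eh by (auto intro: holomorphic_on_imp_continuous_on)
    fix \<xi> assume x: "norm (\<zeta> - \<xi>) = 1"
    have "dist (Re \<xi>, Im \<xi>) z = norm (\<zeta> - \<xi>)"
      by (cases z) (simp add: \<zeta>_def dist_prod_def dist_real_def cmod_def power2_commute)
    then have "\<bar>w (Re \<xi>, Im \<xi>)\<bar> \<le> M" using x by (intro M(2)) simp
    then have "w (Re \<xi>, Im \<xi>) / M \<le> 1" using M(1) by simp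
    then show "norm (E \<xi>) \<le> exp 1" unfolding nE by simp
  qed simp
  moreover have "deriv E \<zeta> = \<tau> * D \<zeta> * E \<zeta>" using Ed by (rule DERIV_imp_deriv)
  ultimately have "norm \<tau> * norm (D \<zeta>) * norm (E \<zeta>) \<le> exp 1" by (simp add: norm_mult)
  moreover have "exp (- 1) \<le> norm (E \<zeta>)"
  proof -
    have "\<bar>w z\<bar> \<le> M" using M(2)[of z] by simp
    then have "- 1 \<le> w z / M" using M(1) by (simp add: field_simps)
    then show ?thesis unfolding nE by (simp add: \<zeta>_def)
  qed
  ultimately have "(norm \<tau> * norm (D \<zeta>)) * exp (- 1) \<le> exp 1"
    using mult_left_mono[of "exp (- 1)" "norm (E \<zeta>)" "norm \<tau> * norm (D \<zeta>)"] by (simp add: mult.assoc)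
  then have "norm (D \<zeta>) / M \<le> exp 1 * exp 1"
    using M(1) by (simp add: \<tau>_def norm_divide exp_minus field_simps)
  then have "norm (D \<zeta>) \<le> exp 2 * M" using M(1) by (simp add: divide_le_eq exp_add[symmetric])
  moreover have "\<bar>w1 z\<bar> \<le> norm (D \<zeta>)" "\<bar>w2 z\<bar> \<le> norm (D \<zeta>)"
    using abs_Re_le_cmod[of "D \<zeta>"] abs_Im_le_cmod[of "D \<zeta>"] by (auto simp: D_def \<zeta>_def)
  ultimately show "\<bar>w1 z\<bar> \<le> exp 2 * M" "\<bar>w2 z\<bar> \<le> exp 2 * M" by linarith+
qed

text \<open>The gradient is estimated from the unit disc about \<open>z\<close>, where
  \<open>(norm z + 1)^2 \<le> 2 * (norm z)^2 + 2\<close> doubles the exponent; \<open>A\<close> then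
  follows from the mean value theorem starting at the origin.\<close>

lemma harmonic_growth:
  fixes w A w1 w2 :: "real \<times> real \<Rightarrow> real"
  assumes wd: "\<And>z. (w has_derivative (\<lambda>h. fst h * w1 z + snd h * w2 z)) (at z)"
    and Ad: "\<And>z. (A has_derivative (\<lambda>h. fst h * (- w2 z) + snd h * w1 z)) (at z)"
    and b: "b > 0" and g: "\<And>z. \<bar>w z\<bar> \<le> K * exp (b * (norm z)\<^sup>2)"
  shows "\<exists>C\<ge>0. \<exists>c>0. \<forall>z. \<bar>A z\<bar> \<le> C * exp (c * (norm z)\<^sup>2) \<and> \<bar>w2 z\<bar> \<le> C * exp (c * (norm z)\<^sup>2)"
proof -
  \<comment> \<open>Makes the bound \<open>M\<close> positive, as Cauchy's estimate above
    demands.\<close>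
  define K' where "K' = max K 1"
  define C1 where "C1 = exp 2 * (K' * exp (2 * b))"
  have K': "K' > 0" "K \<le> K'" by (auto simp: K'_def)
  have C1: "C1 > 0" using K' by (simp add: C1_def)
  have gb: "\<bar>w1 z\<bar> \<le> C1 * exp (2 * b * (norm z)\<^sup>2)" "\<bar>w2 z\<bar> \<le> C1 * exp (2 * b * (norm z)\<^sup>2)" for z
  proof -
    define M where "M = K' * exp (2 * b) * exp (2 * b * (norm z)\<^sup>2)"
    have M0: "M > 0" using K' by (simp add: M_def)
    have "\<bar>w z'\<bar> \<le> M" if "dist z' z \<le> 1" for z'
    proof -
      have n: "norm z' \<le> norm z + 1" using that norm_triangle_sub[of z' z] by (simp add: dist_norm)
      have "(norm z')\<^sup>2 \<le> (norm z + 1)\<^sup>2" using n by (intro power_mono) auto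
      also have "\<dots> \<le> 2 * (norm z)\<^sup>2 + 2" using zero_le_power2[of "norm z - 1"] by (simp add: power2_eq_square algebra_simps)
      finally have "b * (norm z')\<^sup>2 \<le> b * (2 * (norm z)\<^sup>2 + 2)" using b by (intro mult_left_mono) auto
      then have e: "b * (norm z')\<^sup>2 \<le> 2 * b + 2 * b * (norm z)\<^sup>2" by (simp add: algebra_simps)
      have "\<bar>w z'\<bar> \<le> K * exp (b * (norm z')\<^sup>2)" by (rule g)
      also have "\<dots> \<le> K' * exp (2 * b + 2 * b * (norm z)\<^sup>2)" using e K' by (intro mult_mono) auto
      finally show ?thesis by (simp add: M_def exp_add mult.assoc)
    qed
    from harmonic_gradient_bound[OF wd Ad M0 this]
    show "\<bar>w1 z\<bar> \<le> C1 * exp (2 * b * (norm z)\<^sup>2)" "\<bar>w2 z\<bar> \<le> C1 * exp (2 * b * (norm z)\<^sup>2)"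
      by (simp_all add: M_def C1_def mult.assoc)
  qed
  \<comment> \<open>The additional \<open>1\<close> absorbs the factor \<open>norm z\<close> that
    the mean value theorem produces.\<close>
  define c where "c = 2 * b + 1"
  have ce: "exp (2 * b * (norm z)\<^sup>2) \<le> exp (c * (norm z)\<^sup>2)" for z :: "real \<times> real" by (simp add: c_def mult_right_mono)
  define C where "C = \<bar>A (0, 0)\<bar> + 2 * C1"
  have "\<bar>A z\<bar> \<le> C * exp (c * (norm z)\<^sup>2)" for z
  proof -
    obtain \<xi> where \<xi>: "\<xi> \<in> closed_segment (0, 0) z" "A z - A (0, 0) = - w2 \<xi> * (fst z - fst (0::real, 0::real)) + w1 \<xi> * (snd z - snd (0::real, 0::real))"
      using has_derivative_segment_sum[OF Ad, of "(0,0)" z] by blast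
    have "norm \<xi> \<le> norm z"
    proof -
      obtain t where "0 \<le> t" "t \<le> 1" "\<xi> = t *\<^sub>R z" using \<xi>(1) by (auto simp: in_segment zero_prod_def[symmetric])
      then show ?thesis by (simp add: mult_left_le_one_le)
    qed
    then have "2 * b * (norm \<xi>)\<^sup>2 \<le> 2 * b * (norm z)\<^sup>2" using b by (intro mult_left_mono power_mono) auto
    then have "C1 * exp (2 * b * (norm \<xi>)\<^sup>2) \<le> C1 * exp (2 * b * (norm z)\<^sup>2)" using C1 by (intro mult_left_mono) auto
    then have w: "\<bar>w1 \<xi>\<bar> \<le> C1 * exp (2 * b * (norm z)\<^sup>2)" "\<bar>w2 \<xi>\<bar> \<le> C1 * exp (2 * b * (norm z)\<^sup>2)" using gb[of \<xi>] by linarith+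
    have fs: "\<bar>fst z\<bar> \<le> norm z" "\<bar>snd z\<bar> \<le> norm z" using norm_fst_le[of "fst z" "snd z"] norm_snd_le[of "snd z" "fst z"] by auto
    have "\<bar>A z\<bar> \<le> \<bar>A (0, 0)\<bar> + (\<bar>w2 \<xi>\<bar> * \<bar>fst z\<bar> + \<bar>w1 \<xi>\<bar> * \<bar>snd z\<bar>)"
    proof -
      have "A z - A (0, 0) = - (w2 \<xi> * fst z) + w1 \<xi> * snd z" using \<xi>(2) by simp
      then show ?thesis unfolding abs_mult[symmetric] by linarith
    qed
    also have "\<dots> \<le> \<bar>A (0, 0)\<bar> + (C1 * exp (2 * b * (norm z)\<^sup>2) * norm z + C1 * exp (2 * b * (norm z)\<^sup>2) * norm z)"
      using w fs C1 by (intro add_left_mono add_mono mult_mono) auto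
    also have "\<dots> = \<bar>A (0, 0)\<bar> + 2 * C1 * (exp (2 * b * (norm z)\<^sup>2) * norm z)" by simp
    also have "\<dots> \<le> \<bar>A (0, 0)\<bar> * exp (c * (norm z)\<^sup>2) + 2 * C1 * exp (c * (norm z)\<^sup>2)"
    proof (intro add_mono mult_left_mono)
      show "\<bar>A (0, 0)\<bar> \<le> \<bar>A (0, 0)\<bar> * exp (c * (norm z)\<^sup>2)" using b by (simp add: c_def mult_le_cancel_left1)
      have "norm z \<le> 1 + (norm z)\<^sup>2" using zero_le_power2[of "norm z - 1 / 2"] by (simp add: power2_eq_square field_simps)
      also have "\<dots> \<le> exp ((norm z)\<^sup>2)" by (rule exp_ge_add_one_self)
      finally have "exp (2 * b * (norm z)\<^sup>2) * norm z \<le> exp (2 * b * (norm z)\<^sup>2) * exp ((norm z)\<^sup>2)" by (intro mult_left_mono) auto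
      also have "\<dots> = exp (c * (norm z)\<^sup>2)" by (simp add: c_def exp_add[symmetric] algebra_simps)
      finally show "exp (2 * b * (norm z)\<^sup>2) * norm z \<le> exp (c * (norm z)\<^sup>2)" .
    qed (use C1 in auto)
    finally show ?thesis by (simp add: C_def algebra_simps)
  qed
  moreover have "\<bar>w2 z\<bar> \<le> C * exp (c * (norm z)\<^sup>2)" for z
  proof -
    have "\<bar>w2 z\<bar> \<le> C1 * exp (2 * b * (norm z)\<^sup>2)" by (rule gb)
    also have "\<dots> \<le> C * exp (c * (norm z)\<^sup>2)" using ce[of z] C1 by (intro mult_mono) (auto simp: C_def)
    finally show ?thesis .
  qed
  moreover have "C \<ge> 0" "c > 0" using C1 b by (auto simp: C_def c_def)
  ultimately show ?thesis by blast
qed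

lemma ac_zero_const: "ac \<gamma> (\<lambda>x. 0) \<Longrightarrow> \<gamma> t = \<gamma> s"
  using acD(2)[of \<gamma> "\<lambda>x. 0" s t] acD(2)[of \<gamma> "\<lambda>x. 0" t s] by (cases "s \<le> t") (auto simp: set_lebesgue_integral_def)

lemma continuous_limits_bounded:
  fixes v :: "real \<Rightarrow> real"
  assumes c: "continuous_on UNIV v" and l: "(v \<longlongrightarrow> l1) at_top" "(v \<longlongrightarrow> l2) at_bot"
  shows "\<exists>B. \<forall>x. \<bar>v x\<bar> \<le> B"
proof -
  have "eventually (\<lambda>x. dist (v x) l1 < 1) at_top" using l(1) by (rule tendstoD) simp
  then obtain R1 where R1: "\<And>x. x \<ge> R1 \<Longrightarrow> \<bar>v x\<bar> \<le> \<bar>l1\<bar> + 1" unfolding eventually_at_top_linorder dist_real_def by fastforce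
  have "eventually (\<lambda>x. dist (v x) l2 < 1) at_bot" using l(2) by (rule tendstoD) simp
  then obtain R2 where R2: "\<And>x. x \<le> R2 \<Longrightarrow> \<bar>v x\<bar> \<le> \<bar>l2\<bar> + 1" unfolding eventually_at_bot_linorder dist_real_def by fastforce
  obtain B where B: "\<And>x. x \<in> {R2..R1} \<Longrightarrow> norm (v x) \<le> B"
    using continuous_on_compact_bound[OF compact_Icc continuous_on_subset[OF c subset_UNIV]] by blast
  have "\<bar>v x\<bar> \<le> max B (max (\<bar>l1\<bar> + 1) (\<bar>l2\<bar> + 1))" for x
    using R1[of x] R2[of x] B[of x] by (cases "x \<ge> R1"; cases "x \<le> R2") (auto simp: le_max_iff_disj)
  then show ?thesis by blast
qed

lemma box_emeasure_finite: "emeasure cyl ({c..d} \<times> UNIV) < \<infinity>"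
proof -
  have "emeasure cyl ({c..d} \<times> UNIV) = emeasure lborel {c..d} * emeasure T1 UNIV"
    unfolding cyl_def by (rule T1.emeasure_pair_measure_Times) auto
  then show ?thesis by (simp add: emeasure_lborel_Icc_eq)
qed

section \<open>Integrability of functions of \<open>u\<close> and constancy of its first
  component\<close>

context cyl_field
begin

text \<open>The inequality \<open>exp (x + y) \<le> exp (2 * x) + exp (2 * y)\<close> separates the
  components at the price of doubling the exponent, which is harmless because every exponent is
  integrable.\<close>

lemma exp_norm_square_integrable:
  assumes b: "b > 0" and S[measurable]: "S \<in> sets borel" "emeasure cyl S < \<infinity>"
  shows "integrable cyl (\<lambda>x. indicator S x * exp (b * (norm (u1 x, u2 x))\<^sup>2))"
proof (rule Bochner_Integration.integrable_bound)
  have b2: "2 * b > 0" using b by simp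
  obtain v where v: "continuous_on UNIV v" "AE x in lborel. (\<integral>y. u2 (x, y) \<partial>T1) = v x" "(v \<longlongrightarrow> up) at_top" "(v \<longlongrightarrow> um) at_bot"
    using mean2 by blast
  obtain B where B: "\<And>x. \<bar>v x\<bar> \<le> B" using continuous_limits_bounded[OF v(1,3,4)] by blast
  have m2: "AE x in lborel. \<bar>\<integral>y. u2 (x, y) \<partial>T1\<bar> \<le> B" using v(2) by eventually_elim (simp add: B)
  have m1: "AE x in lborel. \<bar>\<integral>y. u1 (x, y) \<partial>T1\<bar> \<le> \<bar>a\<bar>" using mean1 by eventually_elim simp
  have i: "integrable cyl (\<lambda>x. indicator S x * exp (2 * b * (v x)\<^sup>2))"
    if "(\<integral>\<^sup>+x. indicator S x * ennreal (exp (2 * b * (v x)\<^sup>2)) \<partial>cyl) < \<infinity>" "v \<in> borel_measurable borel" for v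
    using that by (intro integrableI_bounded) (auto simp: abs_mult ennreal_mult ennreal_indicator)
  show "integrable cyl (\<lambda>x. indicator S x * exp (2 * b * (u1 x)\<^sup>2) + indicator S x * exp (2 * b * (u2 x)\<^sup>2))"
    by (intro Bochner_Integration.integrable_add i exp_square_integrable_finite_measure[OF acl1 L2(1,3) m1 b2 S]
        exp_square_integrable_finite_measure[OF acl2 L2(2,4) m2 b2 S] meas)
  have "exp (x + y) \<le> exp (2 * x) + exp (2 * y)" for x y :: real
  proof -
    have "exp (x + y) \<le> exp (2 * max x y)" by (simp add: max_def)
    also have "\<dots> \<le> exp (2 * x) + exp (2 * y)" by (simp add: max_def)
    finally show ?thesis .
  qed
  from this[of "b * _" "b * _"] show "AE x in cyl. norm (indicator S x * exp (b * (norm (u1 x, u2 x))\<^sup>2))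
    \<le> norm (indicator S x * exp (2 * b * (u1 x)\<^sup>2) + indicator S x * exp (2 * b * (u2 x)\<^sup>2))"
    by (intro AE_I2) (simp add: norm_pair_square distrib_left indicator_def mult.assoc)
qed measurable

lemma growth_integrable:
  fixes f :: "real \<times> real \<Rightarrow> real"
  assumes f: "continuous_on UNIV f"
    and g: "(AE x in cyl. norm (u1 x, u2 x) \<le> M) \<or> (c > 0 \<and> (\<forall>z. \<bar>f z\<bar> \<le> C * exp (c * (norm z)\<^sup>2)))"
    and S[measurable]: "S \<in> sets borel" "emeasure cyl S < \<infinity>"
  shows "integrable cyl (\<lambda>x. indicator S x * (f (u1 x, u2 x)) ^ n)"
proof -
  have [measurable]: "f \<in> borel_measurable borel" by (rule borel_measurable_continuous_onI[OF f])
  show ?thesis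
    using g
  proof
    assume M: "AE x in cyl. norm (u1 x, u2 x) \<le> M"
    obtain B where "\<And>z. z \<in> cball 0 M \<Longrightarrow> norm (f z) \<le> B"
      using continuous_on_compact_bound[OF compact_cball continuous_on_subset[OF f subset_UNIV]] by blast
    then have B: "\<bar>f z\<bar> \<le> B" if "norm z \<le> M" for z using that by simp
    show ?thesis
    proof (rule Bochner_Integration.integrable_bound)
      show "integrable cyl (\<lambda>x. B ^ n * indicator S x)" using S by simp
      show "AE x in cyl. norm (indicator S x * f (u1 x, u2 x) ^ n) \<le> norm (B ^ n * indicator S x)"
        using M
      proof eventually_elim
        case (elim x)
        have "\<bar>f (u1 x, u2 x)\<bar> ^ n \<le> \<bar>B\<bar> ^ n" using B[OF elim] by (intro power_mono) auto
        then show ?case by (simp add: indicator_def power_abs)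
      qed
    qed measurable
  next
    assume g: "c > 0 \<and> (\<forall>z. \<bar>f z\<bar> \<le> C * exp (c * (norm z)\<^sup>2))"
    \<comment> \<open>The \<open>1\<close> keeps the exponent positive for \<open>n = 0\<close> as
      well.\<close>
    define b where "b = real n * c + 1"
    have b: "b > 0" using g by (auto simp: b_def intro: add_nonneg_pos)
    show ?thesis
    proof (rule Bochner_Integration.integrable_bound)
      show "integrable cyl (\<lambda>x. C ^ n * (indicator S x * exp (b * (norm (u1 x, u2 x))\<^sup>2)))"
        by (intro integrable_mult_right exp_norm_square_integrable b S)
      have C: "C \<ge> 0" using g[THEN conjunct2, rule_format, of 0] by simp
      have "\<bar>f z\<bar> ^ n \<le> C ^ n * exp (b * (norm z)\<^sup>2)" for z
      proof -
        have "\<bar>f z\<bar> ^ n \<le> (C * exp (c * (norm z)\<^sup>2)) ^ n" using g by (intro power_mono abs_ge_zero) blast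
        also have "\<dots> = C ^ n * exp (real n * c * (norm z)\<^sup>2)" by (simp add: power_mult_distrib exp_of_nat_mult[symmetric] mult.assoc)
        also have "\<dots> \<le> C ^ n * exp (b * (norm z)\<^sup>2)" using C by (intro mult_left_mono) (auto simp: b_def mult_right_mono)
        finally show ?thesis .
      qed
      then show "AE x in cyl. norm (indicator S x * f (u1 x, u2 x) ^ n) \<le> norm (C ^ n * (indicator S x * exp (b * (norm (u1 x, u2 x))\<^sup>2)))"
        using C by (intro AE_I2) (simp add: indicator_def power_abs)
    qed measurable
  qed
qed

text \<open>On almost every axial line \<open>u1\<close> is constant, and on such a line the
  integral of \<open>(u1 - a)^2\<close> over an infinite length is finite, so the constant is
  \<open>a\<close>.\<close>

lemma constant_if_p_zero:
  assumes p: "AE x in cyl. p x = 0"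
  shows "AE x in cyl. u1 x = a"
proof (subst AE_cyl_swap(2))
  have "AE y in T1. AE x in lborel. p (x, y) = 0" using p by (subst (asm) AE_cyl_swap(2)) auto
  with aclD(5)[OF acl1] integral_cyl(4)[OF u1_L2] show "AE y in T1. AE x in lborel. u1 (x, y) = a"
  proof eventually_elim
    case (elim y)
    then obtain \<gamma> where g: "ac \<gamma> (\<lambda>x. p (x, y))" "AE x in lborel. u1 (x, y) = \<gamma> x" by (auto simp: wac_def)
    have "ac \<gamma> (\<lambda>x. 0)" by (rule ac_cong_AE[OF g(1) elim(3)]) simp
    then have z: "\<gamma> t = \<gamma> 0" for t by (rule ac_zero_const)
    have k: "AE x in lborel. u1 (x, y) = \<gamma> 0" using g(2) by eventually_elim (use z in metis)
    have "\<gamma> 0 = a"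
    proof (rule ccontr)
      assume "\<gamma> 0 \<noteq> a"
      then have "(\<gamma> 0 - a)\<^sup>2 > 0" by simp
      from integrable_small_values(1)[OF elim(2) k this] obtain x where "u1 (x, y) = \<gamma> 0" "\<bar>(u1 (x, y) - a)\<^sup>2\<bar> < (\<gamma> 0 - a)\<^sup>2" by blast
      then show False by simp
    qed
    with k show ?case by simp
  qed
qed measurable

text \<open>The sign \<epsilon> lets both equations share potentials and calibration. Only the end
  differs: \<open>p = 0\<close> for \<epsilon> = 1, the maximum principle for \<epsilon> =
  -1.\<close>

lemma first_component_constant:
  fixes w w1 w2 w11 w12 w21 w22 :: "real \<times> real \<Rightarrow> real"
  assumes C2: "C2_partials w w1 w2 w11 w12 w21 w22"
    and \<epsilon>: "\<epsilon> = 1 \<or> \<epsilon> = -1" and pde: "\<And>z. w11 z = \<epsilon> * w22 z"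
    and g: "(AE x in cyl. norm (u1 x, u2 x) \<le> M) \<or> (b > 0 \<and> (\<forall>z. \<bar>w z\<bar> \<le> K * exp (b * (norm z)\<^sup>2)))"
    and wi: "integrable cyl (\<lambda>x. (w (u1 x, u2 x))\<^sup>2)"
    and P: "\<And>t. (P has_real_derivative w (a, t)) (at t)"
    and E: "(\<integral>x. 2 * (p x)\<^sup>2 + (q x)\<^sup>2 + (r x)\<^sup>2 + (w (u1 x, u2 x))\<^sup>2 \<partial>cyl) \<le> 2 * (P up - P um)"
  shows "AE x in cyl. u1 x = a"
proof -
  have wd: "(w has_derivative (\<lambda>h. fst h * w1 z + snd h * w2 z)) (at z)"
    and w1d: "(w1 has_derivative (\<lambda>h. fst h * w11 z + snd h * w12 z)) (at z)"
    and w2d: "(w2 has_derivative (\<lambda>h. fst h * w21 z + snd h * w22 z)) (at z)"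
    and c22: "continuous_on UNIV w22" for z
    using C2 unfolding C2_partials_def by blast+
  have c: "continuous_on UNIV w" "continuous_on UNIV w1" "continuous_on UNIV w2"
    using has_derivative_pair_continuous[OF wd] has_derivative_pair_continuous[OF w1d] has_derivative_pair_continuous[OF w2d] by auto
  \<comment> \<open>\<open>w11 = \<epsilon> * w22\<close> is exactly closedness of the form with
    entries \<open>\<epsilon> * w2\<close> and \<open>w1\<close>. The forms built below from
    \<open>A\<close> and \<open>w\<close> are closed because these entries are the partial
    derivatives of \<open>A\<close>.\<close>
  have "\<exists>A. \<forall>z. (A has_derivative (\<lambda>h. fst h * (\<epsilon> * w2 z) + snd h * w1 z)) (at z)"
  proof (rule potential_exists[where R="\<lambda>z. \<epsilon> * w22 z"])
    show "((\<lambda>y. \<epsilon> * w2 (x, y)) has_real_derivative \<epsilon> * w22 (x, y)) (at y)" for x y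
      by (intro DERIV_cmult partial_derivatives(2)[OF w2d])
    show "((\<lambda>x. w1 (x, y)) has_real_derivative \<epsilon> * w22 (x, y)) (at x)" for x y
      using partial_derivatives(1)[OF w1d] pde by simp
  qed (use c c22 in \<open>auto intro!: continuous_intros\<close>)
  then obtain A where Ad: "\<And>z. (A has_derivative (\<lambda>h. fst h * (\<epsilon> * w2 z) + snd h * w1 z)) (at z)" by blast
  have cA: "continuous_on UNIV A" by (rule has_derivative_pair_continuous[OF Ad])
  have "\<exists>\<phi>. \<forall>z. (\<phi> has_derivative (\<lambda>h. fst h * A z + snd h * w z)) (at z)"
    by (rule potential_exists[where R=w1]) (use c cA partial_derivatives[OF Ad] partial_derivatives[OF wd] in auto)
  then obtain \<Phi>1 where d1: "\<And>z. (\<Phi>1 has_derivative (\<lambda>h. fst h * A z + snd h * w z)) (at z)" by blast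
  have "\<exists>\<phi>. \<forall>z. (\<phi> has_derivative (\<lambda>h. fst h * (\<epsilon> * w z) + snd h * A z)) (at z)"
    by (rule potential_exists[where R="\<lambda>z. \<epsilon> * w2 z"])
      (use c cA partial_derivatives[OF Ad] partial_derivatives[OF wd] in \<open>auto intro!: continuous_intros DERIV_cmult\<close>)
  then obtain \<Phi>2 where d2: "\<And>z. (\<Phi>2 has_derivative (\<lambda>h. fst h * (\<epsilon> * w z) + snd h * A z)) (at z)" by blast
  have \<Phi>P: "\<Phi>1 (a, up) - \<Phi>1 (a, um) = P up - P um"
  proof -
    have "((\<lambda>t. \<Phi>1 (a, t) - P t) has_real_derivative w (a, t) - w (a, t)) (at t)" for t
      by (intro DERIV_diff partial_derivatives(2)[OF d1] P)
    then have "\<forall>t. ((\<lambda>t. \<Phi>1 (a, t) - P t) has_real_derivative 0) (at t)" by simp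
    from DERIV_isconst_all[OF this, of up um] show ?thesis by simp
  qed
  \<comment> \<open>For bounded \<open>u\<close> continuity of \<open>A\<close> and
    \<open>w2\<close> is enough; otherwise the growth of \<open>w\<close> is passed on to them. The
    bound on \<open>w2\<close> serves the maximum principle and is asked for \<epsilon> = -1 only,
    where Cauchy's estimate supplies it.\<close>
  have "\<exists>C c. (AE x in cyl. norm (u1 x, u2 x) \<le> M) \<or> c > 0 \<and> (\<forall>z. \<bar>A z\<bar> \<le> C * exp (c * (norm z)\<^sup>2)) \<and> (\<epsilon> = -1 \<longrightarrow> (\<forall>z. \<bar>w2 z\<bar> \<le> C * exp (c * (norm z)\<^sup>2)))"
  proof (cases "AE x in cyl. norm (u1 x, u2 x) \<le> M")
    case False
    then have g: "b > 0" "\<And>z. \<bar>w z\<bar> \<le> K * exp (b * (norm z)\<^sup>2)" using g by auto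
    show ?thesis
    proof (cases "\<epsilon> = 1")
      case True
      have "\<exists>C\<ge>0. \<forall>z. \<bar>A z\<bar> \<le> C * exp (b * (norm z)\<^sup>2)"
        using Ad by (intro wave_conjugate_growth[OF wd _ g]) (simp add: True)
      with g(1) True show ?thesis by auto
    next
      case False
      then have e: "\<epsilon> = -1" using \<epsilon> by simp
      have "\<exists>C\<ge>0. \<exists>c>0. \<forall>z. \<bar>A z\<bar> \<le> C * exp (c * (norm z)\<^sup>2) \<and> \<bar>w2 z\<bar> \<le> C * exp (c * (norm z)\<^sup>2)"
        using Ad by (intro harmonic_growth[OF wd _ g]) (simp add: e)
      then show ?thesis by blast
    qed
  qed auto
  then obtain C k where Ck: "(AE x in cyl. norm (u1 x, u2 x) \<le> M) \<or> k > 0 \<and> (\<forall>z. \<bar>A z\<bar> \<le> C * exp (k * (norm z)\<^sup>2)) \<and> (\<epsilon> = -1 \<longrightarrow> (\<forall>z. \<bar>w2 z\<bar> \<le> C * exp (k * (norm z)\<^sup>2)))"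
    by blast
  have A2: "integrable cyl (\<lambda>x. indicator {-real n..real n} (fst x) * (A (u1 x, u2 x))\<^sup>2)" for n
  proof -
    have "integrable cyl (\<lambda>x. indicator ({-real n..real n} \<times> UNIV) x * (A (u1 x, u2 x))\<^sup>2)"
      by (rule growth_integrable[OF cA, where M=M and c=k and C=C]) (use Ck box_emeasure_finite in \<open>auto intro!: borel_Times\<close>)
    then show ?thesis by (simp add: indicator_times)
  qed
  have mw: "w \<in> borel_measurable borel" by (rule borel_measurable_continuous_onI[OF c(1)])
  note eq = energy_equality[OF mw wi \<epsilon> calibration(2)[OF d1 d2 cA c(1) A2 wi, unfolded \<Phi>P] E]
  show ?thesis
  proof (cases "\<epsilon> = 1")
    case True
    from constant_if_p_zero[OF eq(2)[OF this]] show ?thesis .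
  next
    case False
    then have e: "\<epsilon> = -1" using \<epsilon> by simp
    \<comment> \<open>A bound for \<open>w2\<close> along the whole segment from \<open>a\<close> to
      \<open>u1 x\<close>, written as a continuous function of \<open>u x\<close> so that
      \<open>growth_integrable\<close> gives its fourth power. In the unbounded case,
      \<open>s^2 \<le> a^2 + (u1 x)^2\<close> on the segment accounts for the factor
      \<open>exp (k * a^2)\<close>.\<close>
    have "\<exists>f C' k'. continuous_on UNIV f \<and> ((AE x in cyl. norm (u1 x, u2 x) \<le> M) \<or> (k' > 0 \<and> (\<forall>z. \<bar>f z\<bar> \<le> C' * exp (k' * (norm z)\<^sup>2))))
      \<and> (AE x in cyl. \<forall>s\<in>closed_segment a (u1 x). \<bar>w2 (s, u2 x)\<bar> \<le> f (u1 x, u2 x))"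
    proof (cases "AE x in cyl. norm (u1 x, u2 x) \<le> M")
      case True
      obtain B where "\<And>z. z \<in> cball 0 (\<bar>a\<bar> + 2 * M) \<Longrightarrow> norm (w2 z) \<le> B"
        using continuous_on_compact_bound[OF compact_cball continuous_on_subset[OF c(3) subset_UNIV]] by blast
      then have B: "\<bar>w2 z\<bar> \<le> B" if "norm z \<le> \<bar>a\<bar> + 2 * M" for z using that by simp
      have "AE x in cyl. \<forall>s\<in>closed_segment a (u1 x). \<bar>w2 (s, u2 x)\<bar> \<le> B"
        using True
      proof eventually_elim
        case (elim x)
        show ?case
        proof
          fix s assume "s \<in> closed_segment a (u1 x)"
          then have "\<bar>s\<bar> \<le> \<bar>a\<bar> + \<bar>u1 x\<bar>" by (auto simp: closed_segment_eq_real_ivl split: if_splits)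
          moreover have "\<bar>u1 x\<bar> \<le> M" "\<bar>u2 x\<bar> \<le> M"
            using elim norm_fst_le[of "u1 x" "u2 x"] norm_snd_le[of "u2 x" "u1 x"] by auto
          moreover have "norm (s, u2 x) \<le> \<bar>s\<bar> + \<bar>u2 x\<bar>" using norm_Pair_le[of s "u2 x"] by simp
          ultimately show "\<bar>w2 (s, u2 x)\<bar> \<le> B" by (intro B) linarith
        qed
      qed
      with True show ?thesis by (intro exI[of _ "\<lambda>_. B"]) auto
    next
      case False
      then have k: "k > 0" "\<And>z. \<bar>w2 z\<bar> \<le> C * exp (k * (norm z)\<^sup>2)" using Ck e by auto
      then have C: "C \<ge> 0" using k(2)[of 0] by simp
      let ?C = "C * exp (k * a\<^sup>2)" and ?f = "\<lambda>z::real \<times> real. C * exp (k * a\<^sup>2) * exp (k * (norm z)\<^sup>2)"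
      have "\<bar>w2 (s, u2 x)\<bar> \<le> ?f (u1 x, u2 x)" if "s \<in> closed_segment a (u1 x)" for x s
      proof -
        have "\<bar>s\<bar> \<le> max \<bar>a\<bar> \<bar>u1 x\<bar>" using that by (auto simp: closed_segment_eq_real_ivl split: if_splits)
        then have "s\<^sup>2 \<le> (max \<bar>a\<bar> \<bar>u1 x\<bar>)\<^sup>2" by (metis abs_ge_zero power2_abs power_mono)
        also have "\<dots> \<le> a\<^sup>2 + (u1 x)\<^sup>2" by (simp add: max_def)
        finally have "(norm (s, u2 x))\<^sup>2 \<le> a\<^sup>2 + (norm (u1 x, u2 x))\<^sup>2" by (simp add: norm_pair_square)
        then have "k * (norm (s, u2 x))\<^sup>2 \<le> k * a\<^sup>2 + k * (norm (u1 x, u2 x))\<^sup>2" using k(1) by (simp add: distrib_left[symmetric])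
        then have "C * exp (k * (norm (s, u2 x))\<^sup>2) \<le> C * exp (k * a\<^sup>2 + k * (norm (u1 x, u2 x))\<^sup>2)" using C by (intro mult_left_mono) auto
        then show ?thesis using k(2)[of "(s, u2 x)"] by (simp add: exp_add mult.assoc)
      qed
      moreover have "\<forall>z. \<bar>?f z\<bar> \<le> ?C * exp (k * (norm z)\<^sup>2)" using C by (simp add: abs_mult)
      moreover have "continuous_on UNIV ?f" by (intro continuous_intros)
      ultimately show ?thesis using k(1) by (intro exI[of _ ?f] exI[of _ ?C] exI[of _ k]) auto
    qed
    then obtain f C' k' where f: "continuous_on UNIV f" "(AE x in cyl. norm (u1 x, u2 x) \<le> M) \<or> (k' > 0 \<and> (\<forall>z. \<bar>f z\<bar> \<le> C' * exp (k' * (norm z)\<^sup>2)))"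
      "AE x in cyl. \<forall>s\<in>closed_segment a (u1 x). \<bar>w2 (s, u2 x)\<bar> \<le> f (u1 x, u2 x)" by blast
    have [measurable]: "f \<in> borel_measurable borel" by (rule borel_measurable_continuous_onI[OF f(1)])
    show ?thesis
    proof (rule maximum_principle[where w=w and ?w2.0=w2 and lam="\<lambda>x. f (u1 x, u2 x)"])
      show "continuous_on UNIV w" "continuous_on UNIV w2" by (fact c)+
      show "((\<lambda>t. w (s, t)) has_real_derivative w2 (s, t)) (at t)" for s t by (rule partial_derivatives(2)[OF wd])
      show "(\<lambda>x. f (u1 x, u2 x)) \<in> borel_measurable borel" by measurable
      show "AE x in cyl. q x - r x = w (u1 x, u2 x)" using eq(1) by (simp add: e)
      show "integrable cyl (\<lambda>x. indicator S x * f (u1 x, u2 x) ^ 4)" if "S \<in> sets borel" "emeasure cyl S < \<infinity>" for S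
        by (rule growth_integrable[OF f(1,2) that])
    qed (fact wi f(3))+
  qed
qed

end

section \<open>Reduction to one dimension\<close>

text \<open>Translation by minus the floor brings every \<open>y\<close> into the unit interval, and
  countably many integer translates of a null set form a null set.\<close>

lemma AE_cyl_periodic:
  assumes m: "{x. P x} \<in> sets borel" and per: "\<And>x y. P (x, y + 1) \<longleftrightarrow> P (x, y)" and P: "AE x in cyl. P x"
  shows "AE x in lborel. P x"
proof -
  have pn: "P (x, y + real n) \<longleftrightarrow> P (x, y)" for x y n
  proof (induction n)
    case (Suc n)
    then show ?case using per[of x "y + real n"] by (simp add: add_ac)
  qed simp
  have pk: "P (x, y + real_of_int k) \<longleftrightarrow> P (x, y)" for x y k
  proof (cases "k \<ge> 0")
    case True
    then show ?thesis using pn[of x y "nat k"] by simp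
  next
    case False
    then show ?thesis using pn[of x "y + real_of_int k" "nat (- k)"] by simp
  qed
  have "AE y in T1. AE x in lborel. P (x, y)" using P m by (subst (asm) AE_cyl_swap(2)) auto
  then have "AE y in lborel. 0 \<le> y \<and> y \<le> 1 \<longrightarrow> (AE x in lborel. P (x, y))" by (simp add: AE_T1)
  then have "AE y in lborel. \<forall>k::int. 0 \<le> y + real_of_int k \<and> y + real_of_int k \<le> 1 \<longrightarrow> (AE x in lborel. P (x, y + real_of_int k))"
    unfolding AE_all_countable by (intro allI AE_lborel_shift)
  then have "AE y in lborel. AE x in lborel. P (x, y)"
  proof eventually_elim
    case (elim y)
    have "0 \<le> y + real_of_int (- \<lfloor>y\<rfloor>) \<and> y + real_of_int (- \<lfloor>y\<rfloor>) \<le> 1" by simp linarith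
    with elim have "AE x in lborel. P (x, y + real_of_int (- \<lfloor>y\<rfloor>))" by blast
    then show ?case unfolding pk .
  qed
  moreover have s: "{x\<in>space (lborel \<Otimes>\<^sub>M lborel). P x} \<in> sets (lborel \<Otimes>\<^sub>M lborel)" unfolding lborel_prod using m by simp
  ultimately have "AE x in lborel. AE y in lborel. P (x, y)"
    using lborel_pair.AE_commute[of "\<lambda>x y. P (x, y)"] by simp
  from lborel_pair.AE_pair_measure[OF s this] show ?thesis unfolding lborel_prod .
qed

lemma ubar_components:
  assumes a: "acl (\<lambda>x. fst (u x)) p r" "acl (\<lambda>x. snd (u x)) q s"
  shows "AE x in lborel. ubar u x = (\<integral>y. fst (u (x, y)) \<partial>T1, \<integral>y. snd (u (x, y)) \<partial>T1)"
  using aclD(6)[OF a(1)] aclD(6)[OF a(2)]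
proof eventually_elim
  case (elim x)
  have m: "(\<lambda>y. fst (u (x, y))) \<in> borel_measurable borel" "(\<lambda>y. snd (u (x, y))) \<in> borel_measurable borel"
    using elim by (auto simp: wac_def)
  have i: "integrable lborel (\<lambda>y. indicator {0..1} y *\<^sub>R fst (u (x, y)))" "integrable lborel (\<lambda>y. indicator {0..1} y *\<^sub>R snd (u (x, y)))"
    using wac_integrable_T1(1)[OF elim(1)] wac_integrable_T1(1)[OF elim(2)] m by (simp_all add: integrable_T1 set_integrable_def)
  have "ubar u x = (\<integral>y. (indicator {0..1} y *\<^sub>R fst (u (x, y)), indicator {0..1} y *\<^sub>R snd (u (x, y))) \<partial>lborel)"
    unfolding ubar_def by (intro Bochner_Integration.integral_cong) (auto simp: scaleR_prod_def)
  also have "\<dots> = (\<integral>y. fst (u (x, y)) \<partial>T1, \<integral>y. snd (u (x, y)) \<partial>T1)"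
    unfolding integral_Pair[OF i] using m by (simp add: integrable_T1 set_lebesgue_integral_def)
  finally show ?case .
qed

lemma wac_mean_L2:
  assumes a: "acl v d1 d2" and L2: "integrable cyl (\<lambda>x. (d1 x)\<^sup>2)"
  shows "wac (\<lambda>x. \<integral>y. v (x, y) \<partial>T1) (\<lambda>x. \<integral>y. d1 (x, y) \<partial>T1)"
proof -
  note [measurable] = aclD(1-3)[OF a]
  show ?thesis
  proof (rule wac_mean[OF aclD(1,2,5)[OF a]])
    show "integrable cyl (\<lambda>x. indicator {-real n..real n} (fst x) * d1 x)" for n
      using L2 box_cyl_integrable by (intro L2_mult_integrable) auto
    show "AE x in lborel. integrable T1 (\<lambda>y. v (x, y))"
      using aclD(6)[OF a] by eventually_elim (rule wac_integrable_T1(1))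
  qed
qed

text \<open>The field with content is \<open>mean1\<close>. The circle mean of \<open>u1\<close> has
  as derivative the mean of \<open>p = - s\<close>, and \<open>s\<close>, being the circle
  derivative of the periodic \<open>u2\<close>, has mean zero. So the mean is constant, and the
  boundary condition makes it \<open>a\<close>.\<close>

lemma admissible_cyl_field:
  assumes adm: "admissible2 (a, um) (a, up) u D1 D2"
  shows "cyl_field (\<lambda>x. fst (u x)) (\<lambda>x. snd (u x)) (\<lambda>x. fst (D1 x)) (\<lambda>x. snd (D1 x)) (\<lambda>x. fst (D2 x)) (\<lambda>x. snd (D2 x)) a um up"
proof -
  have per: "\<And>x1 x2. u (x1, x2 + 1) = u (x1, x2)" and uL: "L2_loc u" and wp: "weak_partials u D1 D2"
    and fin: "(\<integral>\<^sup>+ x. indicator strip x * ennreal ((norm (D1 x))\<^sup>2 + (norm (D2 x))\<^sup>2) \<partial>lborel) < \<infinity>"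
    and div: "AE x in lborel. fst (D1 x) + snd (D2 x) = 0" and bc: "bc2 (a, um) (a, up) u"
    using adm by (auto simp: admissible2_def H1div_def)
  have acl1: "acl (\<lambda>x. fst (u x)) (\<lambda>x. fst (D1 x)) (\<lambda>x. fst (D2 x))"
    and acl2: "acl (\<lambda>x. snd (u x)) (\<lambda>x. snd (D1 x)) (\<lambda>x. snd (D2 x))"
    using weak_partials_acl[OF uL wp per] by auto
  note [measurable] = aclD(1-3)[OF acl1] aclD(1-3)[OF acl2]
  let ?G = "\<lambda>x. (norm (D1 x))\<^sup>2 + (norm (D2 x))\<^sup>2"
  have [measurable]: "?G \<in> borel_measurable borel" unfolding norm_pair_square by measurable
  have "(\<integral>\<^sup>+x. ennreal (?G x) \<partial>cyl) < \<infinity>" using fin by (subst nn_integral_cyl) (auto simp del: ennreal_plus)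
  then have G: "integrable cyl ?G" by (intro integrableI_bounded) auto
  have sq: "integrable cyl (\<lambda>x. (f x)\<^sup>2)" if "f \<in> borel_measurable borel" "\<And>x. (f x)\<^sup>2 \<le> ?G x" for f
    by (rule Bochner_Integration.integrable_bound[OF G]) (use that in auto)
  have L2: "integrable cyl (\<lambda>x. (fst (D1 x))\<^sup>2)" "integrable cyl (\<lambda>x. (snd (D1 x))\<^sup>2)" "integrable cyl (\<lambda>x. (fst (D2 x))\<^sup>2)" "integrable cyl (\<lambda>x. (snd (D2 x))\<^sup>2)"
    by (rule sq[OF aclD(2)[OF acl1]] sq[OF aclD(2)[OF acl2]] sq[OF aclD(3)[OF acl1]] sq[OF aclD(3)[OF acl2]]; simp add: norm_pair_square)+
  have divc: "AE x in cyl. fst (D1 x) + snd (D2 x) = 0" by (rule AE_cyl_I[OF div])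
  obtain v where v: "continuous_on UNIV v" "AE x1 in lborel. v x1 = ubar u x1" "(v \<longlongrightarrow> (a, up)) at_top" "(v \<longlongrightarrow> (a, um)) at_bot"
    using bc by (auto simp: bc2_def)
  have vm: "AE x in lborel. fst (v x) = (\<integral>y. fst (u (x, y)) \<partial>T1) \<and> snd (v x) = (\<integral>y. snd (u (x, y)) \<partial>T1)"
    using v(2) ubar_components[OF acl1 acl2] by eventually_elim simp
  have cv: "continuous_on UNIV (\<lambda>x. fst (v x))" "continuous_on UNIV (\<lambda>x. snd (v x))" using v(1) by (auto intro: continuous_intros)
  obtain \<gamma> where g: "ac \<gamma> (\<lambda>x. \<integral>y. fst (D1 (x, y)) \<partial>T1)" "AE x in lborel. (\<integral>y. fst (u (x, y)) \<partial>T1) = \<gamma> x"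
    using wac_mean_L2[OF acl1 L2(1)] by (auto simp: wac_def)
  have "AE x in lborel. (\<integral>y. fst (D1 (x, y)) \<partial>T1) = 0"
    using aclD(6)[OF acl2] AE_cyl_fst[OF divc]
  proof eventually_elim
    case (elim x)
    have "(\<integral>y. fst (D1 (x, y)) \<partial>T1) = (\<integral>y. - snd (D2 (x, y)) \<partial>T1)"
      by (rule integral_cong_AE) (use elim(2) in \<open>auto elim!: eventually_mono\<close>)
    then show ?case using wac_periodic_integral(2)[OF elim(1)] per by simp
  qed
  then have "ac \<gamma> (\<lambda>x. 0)" by (rule ac_cong_AE[OF g(1)]) simp
  then have k: "\<gamma> x = \<gamma> 0" for x by (rule ac_zero_const)
  have "AE x in lborel. fst (v x) = \<gamma> 0" using vm g(2)
  proof eventually_elim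
    case (elim x)
    then show ?case using k[of x] by simp
  qed
  then have fv: "fst (v x) = \<gamma> 0" for x by (rule continuous_AE_eq[OF cv(1) continuous_on_const])
  have "((\<lambda>x. fst (v x)) \<longlongrightarrow> a) at_top" using tendsto_fst[OF v(3)] by simp
  then have "\<gamma> 0 = a" unfolding fv by (simp add: tendsto_const_iff)
  show ?thesis
  proof
    show "AE x in lborel. (\<integral>y. fst (u (x, y)) \<partial>T1) = a" using vm by eventually_elim (simp add: fv \<open>\<gamma> 0 = a\<close>)
    show "\<exists>v. continuous_on UNIV v \<and> (AE x in lborel. (\<integral>y. snd (u (x, y)) \<partial>T1) = v x) \<and> (v \<longlongrightarrow> up) at_top \<and> (v \<longlongrightarrow> um) at_bot"
    proof (intro exI conjI)
      show "continuous_on UNIV (\<lambda>x. snd (v x))" by (rule cv)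
      show "AE x in lborel. (\<integral>y. snd (u (x, y)) \<partial>T1) = snd (v x)" using vm by eventually_elim simp
    qed (use tendsto_snd[OF v(3)] tendsto_snd[OF v(4)] in auto)
  qed (fact acl1 acl2 divc L2)+
qed

text \<open>From \<open>u1 = a\<close> follows \<open>p = 0\<close>, hence \<open>s = 0\<close> by
  \<open>div\<close>, and the Poincare inequality on circles identifies \<open>u2\<close> with its
  slice mean. The profile is the continuous representative of that mean.\<close>

lemma (in cyl_field) second_component_profile:
  assumes u1: "AE x in cyl. u1 x = a"
  shows "\<exists>y. ac y (\<lambda>x. \<integral>y. q (x, y) \<partial>T1) \<and> (y \<longlongrightarrow> up) at_top \<and> (y \<longlongrightarrow> um) at_bot \<and> (AE x in cyl. u2 x = y (fst x))"
proof -
  have "AE y in T1. AE x in lborel. u1 (x, y) = a" using u1 by (subst (asm) AE_cyl_swap(2)) auto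
  with aclD(5)[OF acl1] have "AE y in T1. AE x in lborel. p (x, y) = 0"
  proof eventually_elim
    case (elim y)
    have "wac (\<lambda>x. a) (\<lambda>x. 0)" unfolding wac_def by (auto simp: ac_def set_integrable_def set_lebesgue_integral_def intro!: exI[of _ "\<lambda>x. a"])
    from wac_unique[OF elim(1) this elim(2)] show ?case .
  qed
  then have "AE x in cyl. p x = 0" by (subst AE_cyl_swap(2)) auto
  with div have "AE x in cyl. s x = 0" by eventually_elim simp
  then have "(\<integral>\<^sup>+x. ennreal ((s x)\<^sup>2) \<partial>cyl) = 0" by (subst nn_integral_0_iff_AE) (auto elim: eventually_mono)
  with acl_Poincare_mean(1)[OF acl2] have z: "(\<integral>\<^sup>+x. ennreal ((u2 x - (\<integral>y. u2 (fst x, y) \<partial>T1))\<^sup>2) \<partial>cyl) = 0" by simp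
  have [measurable]: "(\<lambda>x. \<integral>y. u2 (x, y) \<partial>T1) \<in> borel_measurable borel" by (rule T1_integral_measurable) simp
  have u2: "AE x in cyl. u2 x = (\<integral>y. u2 (fst x, y) \<partial>T1)"
    using z by (subst (asm) nn_integral_0_iff_AE) (auto elim!: eventually_mono simp: ennreal_eq_0_iff)
  obtain y where y: "ac y (\<lambda>x. \<integral>y. q (x, y) \<partial>T1)" "AE x in lborel. (\<integral>y. u2 (x, y) \<partial>T1) = y x"
    using wac_mean_L2[OF acl2 L2(2)] by (auto simp: wac_def)
  have cy: "continuous_on UNIV y" by (rule ac_continuous[OF y(1)])
  have [measurable]: "y \<in> borel_measurable borel" by (rule borel_measurable_continuous_onI[OF cy])
  have "AE x in cyl. (\<integral>y. u2 (fst x, y) \<partial>T1) = y (fst x)" by (subst AE_cyl_swap(1)) (use y(2) in auto)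
  with u2 have uy: "AE x in cyl. u2 x = y (fst x)" by eventually_elim simp
  obtain v where v: "continuous_on UNIV v" "AE x in lborel. (\<integral>y. u2 (x, y) \<partial>T1) = v x" "(v \<longlongrightarrow> up) at_top" "(v \<longlongrightarrow> um) at_bot"
    using mean2 by blast
  have "AE x in lborel. v x = y x" using v(2) y(2) by eventually_elim simp
  then have "v = y" using continuous_AE_eq[OF v(1) cy] by blast
  with v(3,4) y(1) uy show ?thesis by blast
qed

lemma H1_line_I:
  assumes y: "ac y d" and [measurable]: "d \<in> borel_measurable borel" and d2: "(\<integral>\<^sup>+t. ennreal ((d t)\<^sup>2) \<partial>lborel) < \<infinity>"
  shows "H1_line a (\<lambda>t. (a, y t)) (\<lambda>t. (0, d t))"
  unfolding H1_line_def
proof (intro conjI allI impI)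
  show "(\<lambda>t. (0::real, d t)) \<in> borel_measurable lborel" by (simp add: borel_measurable_Pair)
  show "(\<integral>\<^sup>+t. ennreal ((norm (0::real, d t))\<^sup>2) \<partial>lborel) < \<infinity>" using d2 by (simp add: norm_pair_square)
  fix s t :: real assume st: "s \<le> t"
  have e: "(\<lambda>x. indicator {s..t} x *\<^sub>R (0::real, d x)) = (\<lambda>x. (0, indicator {s..t} x *\<^sub>R d x))" by (auto simp: scaleR_prod_def)
  have i: "integrable lborel (\<lambda>x. indicator {s..t} x *\<^sub>R d x)" using acD(1)[OF y st] by (simp add: set_integrable_def)
  have "integrable lborel (\<lambda>x. (0::real, indicator {s..t} x *\<^sub>R d x))"
    by (rule Bochner_Integration.integrable_bound[OF i]) (auto simp: norm_Pair borel_measurable_Pair)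
  then show "set_integrable lborel {s..t} (\<lambda>t. (0::real, d t))" unfolding set_integrable_def e .
  show "(a, y t) - (a, y s) = set_lebesgue_integral lborel {s..t} (\<lambda>t. (0, d t))"
    unfolding set_lebesgue_integral_def e using acD(2)[OF y st] by (subst integral_Pair[OF _ i]) (auto simp: set_lebesgue_integral_def)
qed simp

text \<open>The derivative of the profile enters as the circle mean of \<open>q\<close>, so Jensen's
  inequality on the circle suffices; the potential term is unchanged because \<open>u\<close> is
  constant on almost every slice.\<close>

lemma (in cyl_field) energy1_le_energy2:
  fixes W :: "real \<times> real \<Rightarrow> real"
  assumes [measurable]: "W \<in> borel_measurable borel" and W0: "\<And>z. W z \<ge> 0"
    and u1: "AE x in cyl. u1 x = a" and u2: "AE x in cyl. u2 x = y (fst x)"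
  shows "energy1 W (\<lambda>t. (a, y t)) (\<lambda>t. (0, \<integral>y. q (t, y) \<partial>T1)) \<le>
    (\<integral>\<^sup>+x. ennreal ((q x)\<^sup>2 / 2 + W (u1 x, u2 x)) \<partial>cyl)"
proof -
  define k where "k = ennreal (1 / 2)"
  have k: "ennreal (x / 2 + c) = k * ennreal x + ennreal c" if "x \<ge> 0" "c \<ge> 0" for x c
    using that unfolding k_def by (subst ennreal_mult[symmetric]) (auto simp: ennreal_plus[symmetric] simp del: ennreal_plus)
  have "AE x in cyl. (u1 x, u2 x) = (a, y (fst x))" using u1 u2 by eventually_elim simp
  note uw = AE_cyl_fst[OF this]
  have "energy1 W (\<lambda>t. (a, y t)) (\<lambda>t. (0, \<integral>y. q (t, y) \<partial>T1)) \<le> (\<integral>\<^sup>+t. \<integral>\<^sup>+z. ennreal ((q (t, z))\<^sup>2 / 2 + W (u1 (t, z), u2 (t, z))) \<partial>T1 \<partial>lborel)"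
    unfolding energy1_def
  proof (rule nn_integral_mono_AE, use uw in eventually_elim)
    case (elim t)
    have "(\<integral>\<^sup>+z. ennreal ((q (t, z))\<^sup>2 / 2 + W (u1 (t, z), u2 (t, z))) \<partial>T1) = (\<integral>\<^sup>+z. k * ennreal ((q (t, z))\<^sup>2) + ennreal (W (a, y t)) \<partial>T1)"
      by (rule nn_integral_cong_AE, use elim in eventually_elim) (simp add: W0 k del: ennreal_plus)
    also have "\<dots> = k * (\<integral>\<^sup>+z. ennreal ((q (t, z))\<^sup>2) \<partial>T1) + ennreal (W (a, y t))"
      by (subst nn_integral_add) (auto simp: nn_integral_cmult)
    finally have e: "(\<integral>\<^sup>+z. ennreal ((q (t, z))\<^sup>2 / 2 + W (u1 (t, z), u2 (t, z))) \<partial>T1) = k * (\<integral>\<^sup>+z. ennreal ((q (t, z))\<^sup>2) \<partial>T1) + ennreal (W (a, y t))" .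
    have "ennreal ((norm (0::real, \<integral>y. q (t, y) \<partial>T1))\<^sup>2 / 2 + W (a, y t)) = k * ennreal ((\<integral>y. q (t, y) \<partial>T1)\<^sup>2) + ennreal (W (a, y t))"
      by (simp add: norm_pair_square W0 k del: ennreal_plus)
    also have "\<dots> \<le> k * (\<integral>\<^sup>+z. ennreal ((q (t, z))\<^sup>2) \<partial>T1) + ennreal (W (a, y t))"
      by (intro add_right_mono mult_left_mono nn_integral_T1_square_le) auto
    finally show ?case unfolding e .
  qed
  also have "\<dots> = (\<integral>\<^sup>+x. ennreal ((q x)\<^sup>2 / 2 + W (u1 x, u2 x)) \<partial>cyl)" by (subst nn_integral_cyl_fst) auto
  finally show ?thesis .
qed

lemma limits_IVT:
  fixes y :: "real \<Rightarrow> real"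
  assumes c: "continuous_on UNIV y" and l: "(y \<longlongrightarrow> up) at_top" "(y \<longlongrightarrow> um) at_bot" and m: "m \<in> open_segment um up"
  shows "\<exists>t. y t = m"
proof (cases "um < up")
  case True
  then have m: "um < m" "m < up" using m by (auto simp: open_segment_eq_real_ivl split: if_splits)
  obtain t1 where "y t1 > m" using order_tendstoD(1)[OF l(1) m(2)] eventually_happens'[OF trivial_limit_at_top_linorder] by blast
  moreover obtain t2 where "y t2 < m" using order_tendstoD(2)[OF l(2) m(1)] eventually_happens'[OF trivial_limit_at_bot_linorder] by blast
  ultimately show ?thesis using connected_continuous_image[OF c connected_UNIV] connectedD_interval[of "range y" "y t2" "y t1" m] by (auto simp: image_iff)
next
  case False
  then have m: "m < um" "up < m" using m by (auto simp: open_segment_eq_real_ivl split: if_splits)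
  obtain t1 where "y t1 < m" using order_tendstoD(2)[OF l(1) m(2)] eventually_happens'[OF trivial_limit_at_top_linorder] by blast
  moreover obtain t2 where "y t2 > m" using order_tendstoD(1)[OF l(2) m(1)] eventually_happens'[OF trivial_limit_at_bot_linorder] by blast
  ultimately show ?thesis using connected_continuous_image[OF c connected_UNIV] connectedD_interval[of "range y" "y t1" "y t2" m] by (auto simp: image_iff)
qed

text \<open>Both solutions take the midpoint of the limits; shifting time so that they do so
  simultaneously reduces the claim to \<open>ode_unique\<close>.\<close>

lemma heteroclinic_unique:
  fixes F F' y z :: "real \<Rightarrow> real"
  assumes F: "\<And>s. (F has_real_derivative F' s) (at s)" "continuous_on UNIV F'" and ne: "um \<noteq> up"
    and y: "\<And>t. (y has_real_derivative F (y t)) (at t)" "(y \<longlongrightarrow> up) at_top" "(y \<longlongrightarrow> um) at_bot"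
    and z: "\<And>t. (z has_real_derivative F (z t)) (at t)" "(z \<longlongrightarrow> up) at_top" "(z \<longlongrightarrow> um) at_bot"
  shows "\<exists>\<tau>. \<forall>t. z t = y (t + \<tau>)"
proof -
  have c: "continuous_on UNIV y" "continuous_on UNIV z" using y(1) z(1) by (auto intro!: DERIV_isCont continuous_at_imp_continuous_on)
  have m: "(um + up) / 2 \<in> open_segment um up" using ne by (auto simp: open_segment_eq_real_ivl)
  obtain t0 t1 where t: "y t0 = (um + up) / 2" "z t1 = (um + up) / 2" using limits_IVT[OF c(1) y(2,3) m] limits_IVT[OF c(2) z(2,3) m] by blast
  obtain B1 B2 where B: "\<And>t. \<bar>y t\<bar> \<le> B1" "\<And>t. \<bar>z t\<bar> \<le> B2" using continuous_limits_bounded[OF c(1) y(2,3)] continuous_limits_bounded[OF c(2) z(2,3)] by blast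
  have "z t = y (t + (t0 - t1))" for t
  proof (rule ode_unique[OF F z(1), where B="max B1 B2" and ?t0.0=t1])
    show "((\<lambda>t. y (t + (t0 - t1))) has_real_derivative F (y (t + (t0 - t1)))) (at t)" for t
      using DERIV_shift[of y "F (y (t + (t0 - t1)))" t "t0 - t1"] y(1) by simp
  qed (use t B in \<open>auto simp: le_max_iff_disj\<close>)
  then show ?thesis by blast
qed

lemma signed_heteroclinic_flux_nonneg:
  fixes P F :: "real \<Rightarrow> real"
  assumes P: "\<And>s. (P has_real_derivative F s) (at s)" and pos: "\<And>s. s \<in> open_segment um up \<Longrightarrow> F s * (up - um) > 0"
  shows "0 \<le> P up - P um"
proof -
  consider "um = up" | "um < up" | "up < um" by linarith
  then show ?thesis
  proof cases
    case 2
    then obtain z where "um < z" "z < up" "P up - P um = (up - um) * F z" using MVT2[of um up P F] P by blast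
    then show ?thesis using pos[of z] 2 by (simp add: open_segment_eq_real_ivl mult.commute)
  next
    case 3
    then obtain z where "up < z" "z < um" "P um - P up = (um - up) * F z" using MVT2[of up um P F] P by blast
    then show ?thesis using pos[of z] 3 by (simp add: open_segment_eq_real_ivl algebra_simps)
  qed simp
qed

lemma C2_partials_cmult:
  assumes "C2_partials w w1 w2 w11 w12 w21 w22"
  shows "C2_partials (\<lambda>z. c * w z) (\<lambda>z. c * w1 z) (\<lambda>z. c * w2 z) (\<lambda>z. c * w11 z) (\<lambda>z. c * w12 z) (\<lambda>z. c * w21 z) (\<lambda>z. c * w22 z)"
proof -
  have "((\<lambda>z. c * f z) has_derivative (\<lambda>h. fst h * (c * f1 x) + snd h * (c * f2 x))) (at x)"
    if "(f has_derivative (\<lambda>h. fst h * f1 x + snd h * f2 x)) (at x)" for f f1 f2 and x :: "real \<times> real"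
    by (rule has_derivative_eq_rhs[OF has_derivative_mult_right[OF that]]) (auto simp: algebra_simps)
  with assms show ?thesis unfolding C2_partials_def by (intro conjI allI continuous_on_mult_left) blast+
qed

text \<open>Divergence zero gives \<open>s^2 = p^2\<close>, which brings the gradient into the form
  \<open>2 * p^2 + q^2 + r^2\<close> of \<open>energy_equality\<close>. The last bound keeps only
  \<open>q\<close>, for the comparison with the profile.\<close>

lemma admissible_energy_bound:
  fixes w W :: "real \<times> real \<Rightarrow> real"
  assumes adm: "admissible2 (a, um) (a, up) u D1 D2" and W: "\<And>z. W z = (w z)\<^sup>2 / 2" and wc: "continuous_on UNIV w"
    and c: "c \<ge> 0" and E: "energy2 W u D1 D2 \<le> ennreal c"
  shows "integrable cyl (\<lambda>x. (w (u x))\<^sup>2)"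
    "(\<integral>x. 2 * (fst (D1 x))\<^sup>2 + (snd (D1 x))\<^sup>2 + (fst (D2 x))\<^sup>2 + (w (u x))\<^sup>2 \<partial>cyl) \<le> 2 * c"
    "(\<integral>\<^sup>+x. ennreal ((snd (D1 x))\<^sup>2 / 2 + W (u x)) \<partial>cyl) \<le> ennreal c"
proof -
  interpret cyl_field "\<lambda>x. fst (u x)" "\<lambda>x. snd (u x)" "\<lambda>x. fst (D1 x)" "\<lambda>x. snd (D1 x)" "\<lambda>x. fst (D2 x)" "\<lambda>x. snd (D2 x)" a um up
    by (rule admissible_cyl_field[OF adm])
  have [measurable]: "w \<in> borel_measurable borel" by (rule borel_measurable_continuous_onI[OF wc])
  have "(\<lambda>x. w (fst (u x), snd (u x))) \<in> borel_measurable borel" by measurable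
  then have [measurable]: "(\<lambda>x. w (u x)) \<in> borel_measurable borel" by simp
  let ?f = "\<lambda>x. (norm (D1 x))\<^sup>2 / 2 + (norm (D2 x))\<^sup>2 / 2 + W (u x)"
  have [measurable]: "?f \<in> borel_measurable borel" unfolding norm_pair_square W by measurable
  have f0: "?f x \<ge> 0" for x by (simp add: W)
  have fE: "(\<integral>\<^sup>+x. ennreal (?f x) \<partial>cyl) \<le> ennreal c" using E unfolding energy2_def by (subst nn_integral_cyl) auto
  then have fi: "integrable cyl ?f" using f0 by (intro integrableI_bounded) (auto simp: le_less_trans)
  have fc: "(\<integral>x. ?f x \<partial>cyl) \<le> c" using fE c f0 unfolding nn_integral_eq_integral[OF fi AE_I2[OF f0]] by simp
  show "integrable cyl (\<lambda>x. (w (u x))\<^sup>2)"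
    by (rule Bochner_Integration.integrable_bound[OF integrable_mult_right[OF fi, of 2]]) (auto simp: W)
  have "(\<integral>x. 2 * (fst (D1 x))\<^sup>2 + (snd (D1 x))\<^sup>2 + (fst (D2 x))\<^sup>2 + (w (u x))\<^sup>2 \<partial>cyl) = (\<integral>x. 2 * ?f x \<partial>cyl)"
  proof (rule integral_cong_AE)
    show "AE x in cyl. 2 * (fst (D1 x))\<^sup>2 + (snd (D1 x))\<^sup>2 + (fst (D2 x))\<^sup>2 + (w (u x))\<^sup>2 = 2 * ?f x"
      using div
    proof eventually_elim
      case (elim x)
      then have "snd (D2 x) = - fst (D1 x)" by simp
      then show ?case by (simp add: norm_pair_square W field_simps)
    qed
  qed measurable
  also have "\<dots> = 2 * (\<integral>x. ?f x \<partial>cyl)" by (rule integral_mult_right_zero)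
  finally show "(\<integral>x. 2 * (fst (D1 x))\<^sup>2 + (snd (D1 x))\<^sup>2 + (fst (D2 x))\<^sup>2 + (w (u x))\<^sup>2 \<partial>cyl) \<le> 2 * c" using fc by linarith
  have "(\<integral>\<^sup>+x. ennreal ((snd (D1 x))\<^sup>2 / 2 + W (u x)) \<partial>cyl) \<le> (\<integral>\<^sup>+x. ennreal (?f x) \<partial>cyl)"
    by (intro nn_integral_mono ennreal_leI) (simp add: norm_pair_square add_divide_distrib)
  with fE show "(\<integral>\<^sup>+x. ennreal ((snd (D1 x))\<^sup>2 / 2 + W (u x)) \<partial>cyl) \<le> ennreal c" by (rule order_trans[rotated])
qed

text \<open>An energy not above the flux is the case of equality in \<open>energy1_bound\<close>. It
  gives the differential equation almost everywhere, continuity makes it classical, and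
  \<open>heteroclinic_unique\<close> compares the two solutions.\<close>

lemma heteroclinic_minimizer_unique:
  fixes w w2 W :: "real \<times> real \<Rightarrow> real"
  assumes W: "\<And>z. W z = (w z)\<^sup>2 / 2" and wc: "continuous_on UNIV w" "continuous_on UNIV w2"
    and wd: "\<And>s t. ((\<lambda>t. w (s, t)) has_real_derivative w2 (s, t)) (at t)"
    and P: "\<And>s. (P has_real_derivative w (a, s)) (at s)" and c: "0 \<le> P up - P um"
    and g: "admissible1 a (a, um) (a, up) g g'" "energy1 W g g' \<le> ennreal (P up - P um)"
    and h: "admissible1 a (a, um) (a, up) h h'" "energy1 W h h' \<le> ennreal (P up - P um)"
  shows "\<exists>\<tau>. \<forall>t. h t = g (t + \<tau>)"
proof -
  have fst: "fst (g t) = a" "fst (h t) = a" for t using g(1) h(1) by (auto simp: admissible1_def H1_line_def)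
  have lim: "((\<lambda>t. snd (k t)) \<longlongrightarrow> up) at_top" "((\<lambda>t. snd (k t)) \<longlongrightarrow> um) at_bot" if "admissible1 a (a, um) (a, up) k k'" for k k'
    using that tendsto_snd[of k "(a, up)" at_top] tendsto_snd[of k "(a, um)" at_bot] by (auto simp: admissible1_def)
  have ackk: "ac (\<lambda>t. snd (k t)) (\<lambda>t. snd (k' t))" if "admissible1 a (a, um) (a, up) k k'" for k k'
    using that H1_line_ac by (auto simp: admissible1_def)
  have "\<exists>\<tau>. \<forall>t. snd (h t) = snd (g (t + \<tau>))"
  proof (cases "um = up")
    \<comment> \<open>With equal end points there is no intermediate value at which to match two
      solutions. The flux is zero instead, and zero energy makes each curve constant.\<close>
    case True
    have *: "snd (k t) = um" if k: "admissible1 a (a, um) (a, up) k k'" "energy1 W k k' \<le> ennreal (P up - P um)" for k k' t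
    proof -
      have [measurable]: "k' \<in> borel_measurable borel" "(\<lambda>t. snd (k t)) \<in> borel_measurable borel"
        using k(1) ac_borel_measurable[OF ackk[OF k(1)]] by (auto simp: admissible1_def H1_line_def)
      have "(\<integral>\<^sup>+t. ennreal ((norm (k' t))\<^sup>2 / 2) \<partial>lborel) \<le> energy1 W k k'"
        unfolding energy1_def by (intro nn_integral_mono ennreal_leI) (simp add: W)
      then have "(\<integral>\<^sup>+t. ennreal ((norm (k' t))\<^sup>2 / 2) \<partial>lborel) = 0" using k(2) True by simp
      then have "AE t in lborel. ennreal ((norm (k' t))\<^sup>2 / 2) = 0" by (subst (asm) nn_integral_0_iff_AE) auto
      then have "AE t in lborel. snd (k' t) = 0" by eventually_elim (auto simp: ennreal_eq_0_iff)
      then have "ac (\<lambda>t. snd (k t)) (\<lambda>t. 0)" by (rule ac_cong_AE[OF ackk[OF k(1)]]) simp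
      then have "(\<lambda>s. snd (k s)) = (\<lambda>s. snd (k t))" by (intro ext ac_zero_const)
      with lim(2)[OF k(1)] have "((\<lambda>s. snd (k t)) \<longlongrightarrow> um) (at_bot :: real filter)" by (rule subst[rotated])
      then show ?thesis by (simp add: tendsto_const_iff)
    qed
    show ?thesis using *[OF g] *[OF h] by simp
  next
    case False
    have ode: "((\<lambda>t. snd (k t)) has_real_derivative w (a, snd (k t))) (at t)"
      if k: "admissible1 a (a, um) (a, up) k k'" "energy1 W k k' \<le> ennreal (P up - P um)" for k k' t
    proof -
      have "fst (k t) = a" for t using k(1) by (auto simp: admissible1_def H1_line_def)
      then have kt: "k t = (a, snd (k t))" for t by (metis prod.collapse)
      have e: "AE t in lborel. snd (k' t) = w (k t)" by (rule energy1_bound(2)[OF W wc(1) P k c])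
      have "continuous_on UNIV (\<lambda>t. w (a, snd (k t)))"
        by (rule continuous_on_compose2[OF wc(1)]) (auto intro: continuous_intros ac_continuous[OF ackk[OF k(1)]])
      then have cw: "continuous_on UNIV (\<lambda>t. w (k t))" using kt by simp
      have "((\<lambda>t. snd (k t)) has_real_derivative w (k t)) (at t)"
        by (rule ac_continuous_imp_C1[OF ac_cong_AE[OF ackk[OF k(1)] e] cw]) (rule borel_measurable_continuous_onI[OF cw])
      then show ?thesis using kt[of t] by simp
    qed
    have "continuous_on UNIV (\<lambda>s. w2 (a, s))" by (rule continuous_on_compose2[OF wc(2)]) (auto intro: continuous_intros)
    from heteroclinic_unique[of "\<lambda>s. w (a, s)" "\<lambda>s. w2 (a, s)", OF wd this False ode[OF g] lim[OF g(1)] ode[OF h] lim[OF h(1)]]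
    show ?thesis .
  qed
  then show ?thesis using fst by (auto simp: prod_eq_iff)
qed

theorem theorem2p6:
  fixes w w1 w2 w11 w12 w21 w22 :: "real \<times> real \<Rightarrow> real"
    and W :: "real \<times> real \<Rightarrow> real"
    and a um2 up2 :: real
    and u :: "real \<times> real \<Rightarrow> real \<times> real"
  assumes W_def: "\<And>z. W z = (w z)\<^sup>2 / 2"
    and w_C2: "C2_partials w w1 w2 w11 w12 w21 w22"
    and w_pde: "(\<forall>x. w11 x + w22 x = 0) \<or> (\<forall>x. w11 x - w22 x = 0)"
    and Wm: "W (a, um2) = 0" and Wp: "W (a, up2) = 0"
    and w_pos: "\<forall>z\<in>open_segment (a, um2) (a, up2). w z > 0"
    and u_min: "global_minimizer W (a, um2) (a, up2) u"
    and growth: "(\<exists>M. AE x in lborel. norm (u x) \<le> M) \<or>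
                 (\<exists>C \<beta>. C > 0 \<and> \<beta> > 0 \<and> (\<forall>z. W z \<le> C * exp (\<beta> * (norm z)\<^sup>2)))"
  shows "\<exists>g. minimizer1 W a (a, um2) (a, up2) g \<and>
             (\<forall>h. minimizer1 W a (a, um2) (a, up2) h \<longrightarrow> (\<exists>\<tau>. \<forall>t. h t = g (t + \<tau>))) \<and>
             (AE x in lborel. u x = g (fst x))"
proof -
  \<comment> \<open>If \<open>up2 < um2\<close>, replacing \<open>w\<close> by \<open>- w\<close> makes the flux \<open>P up2 - P um2\<close> nonnegative.\<close>
  define \<sigma> :: real where "\<sigma> = (if um2 \<le> up2 then 1 else -1)"
  define v where "v z = \<sigma> * w z" for z
  have \<sigma>2: "\<sigma>\<^sup>2 = 1" by (simp add: \<sigma>_def)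
  have Wv: "W z = (v z)\<^sup>2 / 2" for z by (simp add: W_def v_def power_mult_distrib \<sigma>2)
  have C2: "C2_partials v (\<lambda>z. \<sigma> * w1 z) (\<lambda>z. \<sigma> * w2 z) (\<lambda>z. \<sigma> * w11 z) (\<lambda>z. \<sigma> * w12 z) (\<lambda>z. \<sigma> * w21 z) (\<lambda>z. \<sigma> * w22 z)"
    unfolding v_def by (rule C2_partials_cmult[OF w_C2])
  then have vd: "(v has_derivative (\<lambda>h. fst h * (\<sigma> * w1 z) + snd h * (\<sigma> * w2 z))) (at z)"
    and v2d: "((\<lambda>z. \<sigma> * w2 z) has_derivative (\<lambda>h. fst h * (\<sigma> * w21 z) + snd h * (\<sigma> * w22 z))) (at z)" for z
    unfolding C2_partials_def by blast+
  have vc: "continuous_on UNIV v" "continuous_on UNIV (\<lambda>z. \<sigma> * w2 z)"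
    by (rule has_derivative_pair_continuous[OF vd], rule has_derivative_pair_continuous[OF v2d])
  have va: "continuous_on UNIV (\<lambda>s. v (a, s))" "continuous_on UNIV (\<lambda>s. \<sigma> * w2 (a, s))"
    by (rule continuous_on_compose2[OF vc(1)] continuous_on_compose2[OF vc(2)]; auto intro: continuous_intros)+
  note vda = partial_derivatives(2)[OF vd]
  have v0: "v (a, um2) = 0" "v (a, up2) = 0" using Wm Wp by (auto simp: Wv)
  have pos: "v (a, s) * (up2 - um2) > 0" if "s \<in> open_segment um2 up2" for s
  proof -
    have "(a, s) \<in> open_segment (a, um2) (a, up2)" using that by (auto simp: in_segment algebra_simps scaleR_prod_def)
    then have "w (a, s) > 0" using w_pos by blast
    moreover have "um2 \<noteq> up2" using that by auto
    ultimately show ?thesis by (auto simp: v_def \<sigma>_def mult_pos_neg)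
  qed
  obtain P where P: "\<And>s. (P has_real_derivative v (a, s)) (at s)" using antiderivative_exists[OF va(1)] by blast
  have c0: "0 \<le> P up2 - P um2" by (rule signed_heteroclinic_flux_nonneg[OF P pos])
  \<comment> \<open>This orbit serves only to bound the energy of \<open>u\<close> from above; the
    curve \<open>g\<close> of the conclusion is built from \<open>u\<close> itself.\<close>
  obtain k where k: "\<And>t. (k has_real_derivative v (a, k t)) (at t)" "(k \<longlongrightarrow> up2) at_top" "(k \<longlongrightarrow> um2) at_bot"
    using heteroclinic_exists[of "\<lambda>s. v (a, s)" "\<lambda>s. \<sigma> * w2 (a, s)" um2 up2, OF vda va(2) v0 pos] by blast
  obtain D1 D2 where adm: "admissible2 (a, um2) (a, up2) u D1 D2"
    and min: "\<And>v V1 V2. admissible2 (a, um2) (a, up2) v V1 V2 \<Longrightarrow> energy2 W u D1 D2 \<le> energy2 W v V1 V2"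
    using u_min unfolding global_minimizer_def by blast
  have E: "energy2 W u D1 D2 \<le> ennreal (P up2 - P um2)"
    using one_dimensional_competitor[OF Wv vc(1) P k] min by (meson order_trans)
  note EB = admissible_energy_bound[OF adm Wv vc(1) c0 E]
  interpret cyl_field "\<lambda>x. fst (u x)" "\<lambda>x. snd (u x)" "\<lambda>x. fst (D1 x)" "\<lambda>x. snd (D1 x)" "\<lambda>x. fst (D2 x)" "\<lambda>x. snd (D2 x)" a um2 up2
    by (rule admissible_cyl_field[OF adm])
  obtain \<epsilon> :: real where \<epsilon>: "\<epsilon> = 1 \<or> \<epsilon> = -1" "\<And>z. \<sigma> * w11 z = \<epsilon> * (\<sigma> * w22 z)"
  proof (cases "\<forall>x. w11 x + w22 x = 0")
    case True
    then have "w11 z = - w22 z" for z by (metis add_eq_0_iff2)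
    then show ?thesis using that[of "-1"] by simp
  next
    case False
    then have "w11 z = w22 z" for z using w_pde by (metis eq_iff_diff_eq_0)
    then show ?thesis using that[of 1] by simp
  qed
  obtain M b K where g: "(AE x in cyl. norm (fst (u x), snd (u x)) \<le> M) \<or> (b > 0 \<and> (\<forall>z. \<bar>v z\<bar> \<le> K * exp (b * (norm z)\<^sup>2)))"
    using growth
  proof (elim disjE exE conjE)
    fix M assume "AE x in lborel. norm (u x) \<le> M"
    then show ?thesis using that[of M] by (auto dest: AE_cyl_I)
  next
    fix C \<beta> assume C: "C > 0" "\<beta> > 0" "\<forall>z. W z \<le> C * exp (\<beta> * (norm z)\<^sup>2)"
    \<comment> \<open>From \<open>\<bar>v z\<bar> = sqrt (2 * W z)\<close>: the root halves the
      exponent.\<close>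
    have "\<bar>v z\<bar> \<le> sqrt (2 * C) * exp (\<beta> / 2 * (norm z)\<^sup>2)" for z
    proof (rule power2_le_imp_le)
      have "(exp (\<beta> / 2 * (norm z)\<^sup>2))\<^sup>2 = exp (\<beta> * (norm z)\<^sup>2)" by (simp add: exp_double[symmetric])
      then show "\<bar>v z\<bar>\<^sup>2 \<le> (sqrt (2 * C) * exp (\<beta> / 2 * (norm z)\<^sup>2))\<^sup>2"
        using C(1) C(3)[rule_format, of z] by (simp add: power_mult_distrib Wv)
    qed (use C(1) in simp)
    then show ?thesis using that[of 0 "\<beta> / 2"] C(2) by auto
  qed
  have u1: "AE x in cyl. fst (u x) = a"
    by (rule first_component_constant[OF C2 \<epsilon> g _ P]) (use EB(1,2) in simp_all)
  obtain y where y: "ac y (\<lambda>x. \<integral>y. snd (D1 (x, y)) \<partial>T1)" "(y \<longlongrightarrow> up2) at_top" "(y \<longlongrightarrow> um2) at_bot"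
    "AE x in cyl. snd (u x) = y (fst x)" using second_component_profile[OF u1] by blast
  define g where "g t = (a, y t)" for t
  \<comment> \<open>The derivative of the profile: the circle mean of the axial derivative of the
    second component.\<close>
  define g' where "g' t = (0::real, \<integral>y. snd (D1 (t, y)) \<partial>T1)" for t
  have mW: "W \<in> borel_measurable borel" using vc(1) unfolding Wv
    by (intro borel_measurable_continuous_onI continuous_intros) auto
  have E1: "energy1 W g g' \<le> ennreal (P up2 - P um2)"
    using energy1_le_energy2[OF mW _ u1 y(4)] EB(3) unfolding g_def g'_def by (auto simp: Wv intro: order_trans)
  have "(\<integral>\<^sup>+t. ennreal ((\<integral>y. snd (D1 (t, y)) \<partial>T1)\<^sup>2) \<partial>lborel) \<le> (\<integral>\<^sup>+t. \<integral>\<^sup>+y. ennreal ((snd (D1 (t, y)))\<^sup>2) \<partial>T1 \<partial>lborel)"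
    by (intro nn_integral_mono nn_integral_T1_square_le) simp
  also have "\<dots> = (\<integral>\<^sup>+x. ennreal ((snd (D1 x))\<^sup>2) \<partial>cyl)" by (subst nn_integral_cyl_fst) auto
  also have "\<dots> < \<infinity>" using L2(2) by (simp add: integrable_iff_bounded)
  finally have "H1_line a g g'" unfolding g_def g'_def by (intro H1_line_I y(1) T1_integral_measurable) auto
  then have gadm: "admissible1 a (a, um2) (a, up2) g g'"
    using y(2,3) unfolding admissible1_def g_def by (auto intro: tendsto_Pair)
  \<comment> \<open>The flux bounds the energy of \<open>g\<close> from above and that of every
    admissible curve from below.\<close>
  have "energy1 W g g' \<le> energy1 W \<gamma> \<gamma>'" if "admissible1 a (a, um2) (a, up2) \<gamma> \<gamma>'" for \<gamma> \<gamma>'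
    using E1 energy1_bound(1)[OF Wv vc(1) P that] by (rule order_trans)
  then have "minimizer1 W a (a, um2) (a, up2) g" using gadm unfolding minimizer1_def by blast
  moreover have "\<exists>\<tau>. \<forall>t. h t = g (t + \<tau>)" if hm: "minimizer1 W a (a, um2) (a, up2) h" for h
  proof -
    obtain h' where h: "admissible1 a (a, um2) (a, up2) h h'" "energy1 W h h' \<le> energy1 W g g'"
      using hm gadm unfolding minimizer1_def by blast
    show ?thesis
      by (rule heteroclinic_minimizer_unique[OF Wv vc vda P c0 gadm E1 h(1) order_trans[OF h(2) E1]])
  qed
  \<comment> \<open>So far the identity holds almost everywhere on the fundamental strip; both sides
    have period one in the second variable.\<close>
  moreover have "AE x in lborel. u x = g (fst x)"
  proof (rule AE_cyl_periodic)
    have [measurable]: "y \<in> borel_measurable borel" by (rule borel_measurable_continuous_onI[OF ac_continuous[OF y(1)]])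
    have "{x. u x = g (fst x)} = {x. fst (u x) = a \<and> snd (u x) = y (fst x)}" by (auto simp: g_def prod_eq_iff)
    also have "\<dots> \<in> sets borel" by measurable
    finally show "{x. u x = g (fst x)} \<in> sets borel" .
    show "AE x in cyl. u x = g (fst x)" using u1 y(4) by eventually_elim (simp add: g_def prod_eq_iff)
    show "u (x, z + 1) = g (fst (x, z + 1)) \<longleftrightarrow> u (x, z) = g (fst (x, z))" for x z
      using adm by (simp add: admissible2_def H1div_def)
  qed
  ultimately show ?thesis by blast
qed

end
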